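(* Let $p$ be an odd prime and let $G$ be a finite nested GVZ $p$-group. Write $\operatorname{cd}(G)=\{p^{\delta_i}: 0\le i\le n\}$ with $0=\delta_0<\delta_1<\cdots<\delta_n$, and for $0\le i\le n$ let $Z_{\delta_i}:=Z(\chi)$ for some $\chi\in\operatorname{Irr}_{p^{\delta_i}}(G)$ (this does not depend on the choice of $\chi$). For $1\le r\le n$ let $m_r$ and $m_r'$ be the exponents of $Z_{\delta_r}/[Z_{\delta_r},G]$ and $Z_{\delta_r}/[Z_{\delta_{r-1}},G]$ respectively. Then \[ \mathbb{Q}G\cong \mathbb{Q}(G/G')\;\bigoplus_{r=1}^n\bigoplus_{\substack{d_r\mid m_r\\ d_r\nmid m_r'}} a_{d_r}\,M_{p^{\delta_r}}\big(\mathbb{Q}(\zeta_{d_r})\big)\;\bigoplus_{r=1}^n\bigoplus_{\substack{d_r\mid m_r\\ d_r\mid m_r'}}\big(a_{d_r}-a'_{d_r}\big)\,M_{p^{\delta_r}}\big(\mathbb{Q}(\zeta_{d_r})\big), \] where $a_{d_r}$ and $a'_{d_r}$ denote the number of cyclic subgroups of order $d_r$ in $Z_{\delta_r}/[Z_{\delta_r},G]$ and in $Z_{\delta_r}/[Z_{\delta_{r-1}},G]$, respectively.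
   Context: All groups are finite. $\operatorname{Irr}(G)$ is the set of irreducible complex characters of $G$, $\operatorname{Irr}_m(G)=\{\chi\in\operatorname{Irr}(G):\chi(1)=m\}$, $\operatorname{cd}(G)=\{\chi(1):\chi\in\operatorname{Irr}(G)\}$. For $\chi\in\operatorname{Irr}(G)$, $Z(\chi)=\{g\in G:|\chi(g)|=\chi(1)\}$. $\chi$ is of central type if $\chi(g)=0$ for all $g\in G\setminus Z(\chi)$. $G$ is a GVZ-group if every $\chi\in\operatorname{Irr}(G)$ is of central type; $G$ is nested if for all $\chi,\psi\in\operatorname{Irr}(G)$ either $Z(\chi)\subseteq Z(\psi)$ or $Z(\psi)\subseteq Z(\chi)$; a nested GVZ-group is a GVZ-group that is nested. For $N\trianglelefteq G$, $[N,G]=\langle [n,g]:n\in N,g\in G\rangle$ with $[g,h]=g^{-1}h^{-1}gh$; $G'=[G,G]$. $\zeta_d$ is a primitive $d$-th root of unity, $M_k(K)$ is the $k\times k$ matrix algebra over $K$, and $a\,A$ denotes the direct sum of $a$ copies of $A$. *)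

theory Defs
  imports "HOL-Algebra.Algebra" "Jordan_Normal_Form.Matrix"
begin

definition mtrace :: "complex mat \<Rightarrow> complex" where
  "mtrace A = (\<Sum>i<dim_row A. A $$ (i, i))"

definition is_rep :: "'a monoid \<Rightarrow> nat \<Rightarrow> ('a \<Rightarrow> complex mat) \<Rightarrow> bool" where
  "is_rep G n \<rho> \<longleftrightarrow>
     (\<forall>g\<in>carrier G. \<rho> g \<in> carrier_mat n n) \<and>
     \<rho> \<one>\<^bsub>G\<^esub> = 1\<^sub>m n \<and>
     (\<forall>g\<in>carrier G. \<forall>h\<in>carrier G. \<rho> (g \<otimes>\<^bsub>G\<^esub> h) = \<rho> g * \<rho> h)"

definition invariant_subspace :: "'a monoid \<Rightarrow> nat \<Rightarrow> ('a \<Rightarrow> complex mat) \<Rightarrow> complex vec set \<Rightarrow> bool" where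
  "invariant_subspace G n \<rho> W \<longleftrightarrow>
     W \<subseteq> carrier_vec n \<and> 0\<^sub>v n \<in> W \<and>
     (\<forall>v\<in>W. \<forall>w\<in>W. v + w \<in> W) \<and>
     (\<forall>c::complex. \<forall>w\<in>W. c \<cdot>\<^sub>v w \<in> W) \<and>
     (\<forall>g\<in>carrier G. \<forall>w\<in>W. \<rho> g *\<^sub>v w \<in> W)"

definition irr_rep :: "'a monoid \<Rightarrow> nat \<Rightarrow> ('a \<Rightarrow> complex mat) \<Rightarrow> bool" where
  "irr_rep G n \<rho> \<longleftrightarrow> 0 < n \<and> is_rep G n \<rho> \<and>
     (\<forall>W. invariant_subspace G n \<rho> W \<longrightarrow> W = {0\<^sub>v n} \<or> W = carrier_vec n)"

definition character :: "'a monoid \<Rightarrow> ('a \<Rightarrow> complex mat) \<Rightarrow> 'a \<Rightarrow> complex" where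
  "character G \<rho> = (\<lambda>g. if g \<in> carrier G then mtrace (\<rho> g) else 0)"

definition Irr :: "'a monoid \<Rightarrow> ('a \<Rightarrow> complex) set" where
  "Irr G = {\<chi>. \<exists>n \<rho>. irr_rep G n \<rho> \<and> \<chi> = character G \<rho>}"

definition cd :: "'a monoid \<Rightarrow> nat set" where
  "cd G = {m. \<exists>\<chi>\<in>Irr G. \<chi> \<one>\<^bsub>G\<^esub> = of_nat m}"

definition Zchi :: "'a monoid \<Rightarrow> ('a \<Rightarrow> complex) \<Rightarrow> 'a set" where
  "Zchi G \<chi> = {g\<in>carrier G. cmod (\<chi> g) = cmod (\<chi> \<one>\<^bsub>G\<^esub>)}"

definition central_type :: "'a monoid \<Rightarrow> ('a \<Rightarrow> complex) \<Rightarrow> bool" where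
  "central_type G \<chi> \<longleftrightarrow> (\<forall>g\<in>carrier G - Zchi G \<chi>. \<chi> g = 0)"

definition GVZ :: "'a monoid \<Rightarrow> bool" where
  "GVZ G \<longleftrightarrow> (\<forall>\<chi>\<in>Irr G. central_type G \<chi>)"

definition nested :: "'a monoid \<Rightarrow> bool" where
  "nested G \<longleftrightarrow> (\<forall>\<chi>\<in>Irr G. \<forall>\<psi>\<in>Irr G. Zchi G \<chi> \<subseteq> Zchi G \<psi> \<or> Zchi G \<psi> \<subseteq> Zchi G \<chi>)"

definition nested_GVZ :: "'a monoid \<Rightarrow> bool" where
  "nested_GVZ G \<longleftrightarrow> GVZ G \<and> nested G"

definition commG :: "'a monoid \<Rightarrow> 'a set \<Rightarrow> 'a set" where
  "commG G N = generate G {inv\<^bsub>G\<^esub> x \<otimes>\<^bsub>G\<^esub> inv\<^bsub>G\<^esub> g \<otimes>\<^bsub>G\<^esub> x \<otimes>\<^bsub>G\<^esub> g | x g. x \<in> N \<and> g \<in> carrier G}"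

definition subquot :: "'a monoid \<Rightarrow> 'a set \<Rightarrow> 'a set \<Rightarrow> 'a set monoid" where
  "subquot G Z K = (G\<lparr>carrier := Z\<rparr>) Mod K"

definition grp_exponent :: "('b, 'c) monoid_scheme \<Rightarrow> nat" where
  "grp_exponent H = (LEAST e. 0 < e \<and> (\<forall>x\<in>carrier H. x [^]\<^bsub>H\<^esub> e = \<one>\<^bsub>H\<^esub>))"

definition num_cyclic :: "('b, 'c) monoid_scheme \<Rightarrow> nat \<Rightarrow> nat" where
  "num_cyclic H d = card {C. \<exists>x\<in>carrier H. C = generate H {x} \<and> card C = d}"

definition Zdelta :: "'a monoid \<Rightarrow> nat \<Rightarrow> (nat \<Rightarrow> nat) \<Rightarrow> nat \<Rightarrow> 'a set" where
  "Zdelta G p \<delta> i = Zchi G (SOME \<chi>. \<chi> \<in> Irr G \<and> \<chi> \<one>\<^bsub>G\<^esub> = of_nat (p ^ \<delta> i))"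

definition mexp :: "'a monoid \<Rightarrow> nat \<Rightarrow> (nat \<Rightarrow> nat) \<Rightarrow> nat \<Rightarrow> nat" where
  "mexp G p \<delta> r = grp_exponent (subquot G (Zdelta G p \<delta> r) (commG G (Zdelta G p \<delta> r)))"

definition mexp' :: "'a monoid \<Rightarrow> nat \<Rightarrow> (nat \<Rightarrow> nat) \<Rightarrow> nat \<Rightarrow> nat" where
  "mexp' G p \<delta> r = grp_exponent (subquot G (Zdelta G p \<delta> r) (commG G (Zdelta G p \<delta> (r - 1))))"

definition acyc :: "'a monoid \<Rightarrow> nat \<Rightarrow> (nat \<Rightarrow> nat) \<Rightarrow> nat \<Rightarrow> nat \<Rightarrow> nat" where
  "acyc G p \<delta> r d = num_cyclic (subquot G (Zdelta G p \<delta> r) (commG G (Zdelta G p \<delta> r))) d"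

definition acyc' :: "'a monoid \<Rightarrow> nat \<Rightarrow> (nat \<Rightarrow> nat) \<Rightarrow> nat \<Rightarrow> nat \<Rightarrow> nat" where
  "acyc' G p \<delta> r d = num_cyclic (subquot G (Zdelta G p \<delta> r) (commG G (Zdelta G p \<delta> (r - 1)))) d"

record 'c qalg =
  qcarrier :: "'c set"
  qadd :: "'c \<Rightarrow> 'c \<Rightarrow> 'c"
  qmul :: "'c \<Rightarrow> 'c \<Rightarrow> 'c"
  qsmul :: "rat \<Rightarrow> 'c \<Rightarrow> 'c"
  qzero :: "'c"
  qone :: "'c"

definition qalg_iso :: "'c qalg \<Rightarrow> 'd qalg \<Rightarrow> ('c \<Rightarrow> 'd) \<Rightarrow> bool" where
  "qalg_iso A B \<phi> \<longleftrightarrow> bij_betw \<phi> (qcarrier A) (qcarrier B) \<and>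
     (\<forall>x\<in>qcarrier A. \<forall>y\<in>qcarrier A. \<phi> (qadd A x y) = qadd B (\<phi> x) (\<phi> y)) \<and>
     (\<forall>x\<in>qcarrier A. \<forall>y\<in>qcarrier A. \<phi> (qmul A x y) = qmul B (\<phi> x) (\<phi> y)) \<and>
     (\<forall>q. \<forall>x\<in>qcarrier A. \<phi> (qsmul A q x) = qsmul B q (\<phi> x)) \<and>
     \<phi> (qone A) = qone B"

definition qalg_isomorphic :: "'c qalg \<Rightarrow> 'd qalg \<Rightarrow> bool" where
  "qalg_isomorphic A B \<longleftrightarrow> (\<exists>\<phi>. qalg_iso A B \<phi>)"

definition group_alg :: "('b, 'e) monoid_scheme \<Rightarrow> ('b \<Rightarrow> rat) qalg" where
  "group_alg H = \<lparr>
     qcarrier = {f. \<forall>x. x \<notin> carrier H \<longrightarrow> f x = 0},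
     qadd = (\<lambda>f h x. f x + h x),
     qmul = (\<lambda>f h x. if x \<in> carrier H then (\<Sum>y\<in>carrier H. f y * h (inv\<^bsub>H\<^esub> y \<otimes>\<^bsub>H\<^esub> x)) else 0),
     qsmul = (\<lambda>q f x. q * f x),
     qzero = (\<lambda>x. 0),
     qone = (\<lambda>x. if x = \<one>\<^bsub>H\<^esub> then 1 else 0) \<rparr>"

definition zeta :: "nat \<Rightarrow> complex" where
  "zeta d = cis (2 * pi / real d)"

definition is_subfield_C :: "complex set \<Rightarrow> bool" where
  "is_subfield_C K \<longleftrightarrow> 0 \<in> K \<and> 1 \<in> K \<and>
     (\<forall>x\<in>K. \<forall>y\<in>K. x + y \<in> K \<and> x * y \<in> K) \<and>
     (\<forall>x\<in>K. - x \<in> K) \<and> (\<forall>x\<in>K. x \<noteq> 0 \<longrightarrow> inverse x \<in> K)"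

definition cyclo_field :: "nat \<Rightarrow> complex set" where
  "cyclo_field d = \<Inter>{K. is_subfield_C K \<and> zeta d \<in> K}"

definition mat_alg :: "nat \<Rightarrow> nat \<Rightarrow> complex mat qalg" where
  "mat_alg k d = \<lparr>
     qcarrier = {A \<in> carrier_mat k k. \<forall>i<k. \<forall>j<k. A $$ (i, j) \<in> cyclo_field d},
     qadd = (+), qmul = (*),
     qsmul = (\<lambda>q A. of_rat q \<cdot>\<^sub>m A),
     qzero = 0\<^sub>m k k, qone = 1\<^sub>m k \<rparr>"

definition qalg_sum :: "'c qalg \<Rightarrow> 'd qalg \<Rightarrow> ('c \<times> 'd) qalg" where
  "qalg_sum A B = \<lparr>
     qcarrier = qcarrier A \<times> qcarrier B,
     qadd = (\<lambda>x y. (qadd A (fst x) (fst y), qadd B (snd x) (snd y))),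
     qmul = (\<lambda>x y. (qmul A (fst x) (fst y), qmul B (snd x) (snd y))),
     qsmul = (\<lambda>q x. (qsmul A q (fst x), qsmul B q (snd x))),
     qzero = (qzero A, qzero B), qone = (qone A, qone B) \<rparr>"

definition qalg_dsum :: "'i set \<Rightarrow> ('i \<Rightarrow> 'c qalg) \<Rightarrow> ('i \<Rightarrow> 'c) qalg" where
  "qalg_dsum I A = \<lparr>
     qcarrier = {f. (\<forall>i\<in>I. f i \<in> qcarrier (A i)) \<and> (\<forall>i. i \<notin> I \<longrightarrow> f i = undefined)},
     qadd = (\<lambda>f g i. if i \<in> I then qadd (A i) (f i) (g i) else undefined),
     qmul = (\<lambda>f g i. if i \<in> I then qmul (A i) (f i) (g i) else undefined),
     qsmul = (\<lambda>q f i. if i \<in> I then qsmul (A i) q (f i) else undefined),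
     qzero = (\<lambda>i. if i \<in> I then qzero (A i) else undefined),
     qone = (\<lambda>i. if i \<in> I then qone (A i) else undefined) \<rparr>"

end

theory Submission
  imports Defs "HOL-Library.Function_Algebras" "Jordan_Normal_Form.Schur_Decomposition"
    "Jordan_Normal_Form.Spectral_Radius" "HOL-Number_Theory.Number_Theory"
    "HOL-Computational_Algebra.Polynomial_Factorial" "HOL-Computational_Algebra.Field_as_Ring"
begin

text \<open>
  Call a linear character \<open>\<theta>\<close> of \<open>Z\<^sub>r\<close> relevant if it is trivial on \<open>[Z\<^sub>r, G]\<close> but not on
  \<open>[Z\<^sub>r\<^sub>-\<^sub>1, G]\<close>. The nested GVZ condition makes such a character fully ramified in \<open>G\<close>. Since \<open>p\<close> is
  odd, it therefore has a polarisation: it extends, with values in the same field \<open>\<rat>(\<zeta>\<^sub>d)\<close>, to a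
  subgroup of index \<open>p^\<delta>\<^sub>r\<close>. Inducing the extension gives a representation over \<open>\<rat>(\<zeta>\<^sub>d)\<close> whose
  character vanishes off \<open>Z\<^sub>r\<close>, and hence a homomorphism from the rational group algebra onto a full
  matrix algebra over \<open>\<rat>(\<zeta>\<^sub>d)\<close>. By duality, relevant characters of order \<open>d\<close> up to algebraic
  conjugation are counted by the difference of the numbers of cyclic subgroups of order \<open>d\<close> in
  \<open>Z\<^sub>r/[Z\<^sub>r, G]\<close> and \<open>Z\<^sub>r/[Z\<^sub>r\<^sub>-\<^sub>1, G]\<close>, where the second number is \<open>0\<close> if \<open>d\<close> does not divide \<open>m'\<^sub>r\<close>.

  The resulting homomorphism to the direct sum is onto because differences of averages over
  subgroups separate the blocks. It is one-to-one: if \<open>f\<close> is in the kernel, then column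
  orthogonality for the two quotients of \<open>Z\<^sub>r\<close> shows by induction on \<open>r\<close> that the sums of \<open>f\<close> over
  the cosets of \<open>[Z\<^sub>r, G]\<close> vanish, and \<open>[Z\<^sub>n, G] = 1\<close>.
\<close>

text \<open>The delicate point is that the polarisation must not enlarge the field. Extending
  \<theta> from Z to an element x means choosing a p-th root w of \<theta>(x^p), and w^(p^(m+1)) = 1
  only if \<theta>(x^p)^(p^m) = 1. Not every x qualifies; the search for a good one is an induction
  that passes through extensions with larger values and then corrects the element found by a power
  of an earlier one. The correction needs (xy)^p and x^p y^p to have the same \<theta>-value, at the
  cost of a commutator to the power p(p-1)/2: here p must be odd.

  Full ramification comes from a positivity argument. If some g outside Z_r paired trivially under
  \<theta>, its class sum times the idempotent of \<theta> would be nonzero, hence visible in an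
  irreducible character over \<theta>. Nestedness makes Z_r the centre of that character, so it
  vanishes at g and the class sum acts by zero.

  Algebraic conjugation is used only as a rule for rational relations between roots of unity, and it
  rests on the irreducibility of the prime-power cyclotomic polynomial.\<close>

section \<open>Convolution and the linear extension of a representation\<close>

definition conv :: "('a, 'e) monoid_scheme \<Rightarrow> ('a \<Rightarrow> 'c::comm_ring_1) \<Rightarrow> ('a \<Rightarrow> 'c) \<Rightarrow> 'a \<Rightarrow> 'c" where
  "conv G x y = (\<lambda>g. if g \<in> carrier G then \<Sum>h\<in>carrier G. x h * y (inv\<^bsub>G\<^esub> h \<otimes>\<^bsub>G\<^esub> g) else 0)"

text \<open>The extension of \<rho> to the complex group algebra, given entrywise so that sums of
  complex numbers suffice.\<close>

definition lift :: "'a monoid \<Rightarrow> nat \<Rightarrow> ('a \<Rightarrow> complex mat) \<Rightarrow> ('a \<Rightarrow> complex) \<Rightarrow> complex mat" where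
  "lift G n \<rho> x = mat n n (\<lambda>(i, j). \<Sum>g\<in>carrier G. x g * \<rho> g $$ (i, j))"

locale fin_group = group G for G :: "'a monoid" (structure) +
  assumes fin: "finite (carrier G)"

lemma lift_carrier [simp]: "lift G n \<rho> x \<in> carrier_mat n n"
  by (simp add: lift_def)

lemma lift_dim [simp]: "dim_row (lift G n \<rho> x) = n" "dim_col (lift G n \<rho> x) = n"
  by (simp_all add: lift_def)

lemma lift_index: "i < n \<Longrightarrow> j < n \<Longrightarrow> lift G n \<rho> x $$ (i, j) = (\<Sum>g\<in>carrier G. x g * \<rho> g $$ (i, j))"
  by (simp add: lift_def)

lemma sum_fun_apply: "(\<Sum>i\<in>I. f i) x = (\<Sum>i\<in>I. f i x)"
  by (induction I rule: infinite_finite_induct) auto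

lemma is_repD:
  assumes "is_rep G n \<rho>"
  shows "\<And>g. g \<in> carrier G \<Longrightarrow> \<rho> g \<in> carrier_mat n n" "\<rho> \<one>\<^bsub>G\<^esub> = 1\<^sub>m n"
    "\<And>g h. g \<in> carrier G \<Longrightarrow> h \<in> carrier G \<Longrightarrow> \<rho> (g \<otimes>\<^bsub>G\<^esub> h) = \<rho> g * \<rho> h"
  using assms by (auto simp: is_rep_def)

lemma index_mult_mat_sum:
  assumes "A \<in> carrier_mat n m" "B \<in> carrier_mat m k" "i < n" "j < k"
  shows "(A * B) $$ (i, j) = (\<Sum>l<m. A $$ (i, l) * B $$ (l, j))"
  using assms by (simp add: scalar_prod_def lessThan_atLeast0)

lemma index_mult_mat_vec_sum:
  assumes "A \<in> carrier_mat n m" "v \<in> carrier_vec m" "i < n"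
  shows "(A *\<^sub>v v) $ i = (\<Sum>l<m. A $$ (i, l) * v $ l)"
  using assms by (simp add: scalar_prod_def lessThan_atLeast0)

context fin_group
begin

lemma sum_translate:
  assumes "h \<in> carrier G"
  shows "(\<Sum>g\<in>carrier G. f (h \<otimes> g)) = (\<Sum>g\<in>carrier G. f g)"
  by (rule sum.reindex_bij_witness[of _ "\<lambda>g. inv h \<otimes> g" "\<lambda>g. h \<otimes> g"])
     (use assms in \<open>auto simp: m_assoc[symmetric]\<close>)

lemma sum_inverse: "(\<Sum>g\<in>carrier G. f (inv g)) = (\<Sum>g\<in>carrier G. f g)"
  by (rule sum.reindex_bij_witness[of _ "\<lambda>g. inv g" "\<lambda>g. inv g"]) auto

lemma lift_conv:
  assumes "is_rep G n \<rho>"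
  shows "lift G n \<rho> (conv G x y) = lift G n \<rho> x * lift G n \<rho> y"
proof (rule eq_matI)
  fix i j assume "i < dim_row (lift G n \<rho> x * lift G n \<rho> y)" "j < dim_col (lift G n \<rho> x * lift G n \<rho> y)"
  then have ij: "i < n" "j < n" by auto
  note \<rho> = is_repD[OF assms]
  have "lift G n \<rho> (conv G x y) $$ (i, j) = (\<Sum>g\<in>carrier G. \<Sum>h\<in>carrier G. x h * y (inv h \<otimes> g) * \<rho> g $$ (i, j))"
    using ij by (auto simp: lift_index conv_def sum_distrib_right intro!: sum.cong)
  also have "\<dots> = (\<Sum>h\<in>carrier G. \<Sum>g\<in>carrier G. x h * y (inv h \<otimes> g) * \<rho> g $$ (i, j))"
    by (rule sum.swap)
  also have "\<dots> = (\<Sum>h\<in>carrier G. \<Sum>k\<in>carrier G. x h * y k * \<rho> (h \<otimes> k) $$ (i, j))"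
  proof (rule sum.cong[OF refl])
    fix h assume h: "h \<in> carrier G"
    have "(\<Sum>g\<in>carrier G. x h * y (inv h \<otimes> g) * \<rho> g $$ (i, j))
        = (\<Sum>k\<in>carrier G. x h * y (inv h \<otimes> (h \<otimes> k)) * \<rho> (h \<otimes> k) $$ (i, j))"
      using sum_translate[OF h, of "\<lambda>g. x h * y (inv h \<otimes> g) * \<rho> g $$ (i, j)"] by simp
    then show "(\<Sum>g\<in>carrier G. x h * y (inv h \<otimes> g) * \<rho> g $$ (i, j)) = (\<Sum>k\<in>carrier G. x h * y k * \<rho> (h \<otimes> k) $$ (i, j))"
      using h by (simp add: m_assoc[symmetric])
  qed
  also have "\<dots> = (\<Sum>h\<in>carrier G. \<Sum>k\<in>carrier G. \<Sum>l<n. (x h * \<rho> h $$ (i, l)) * (y k * \<rho> k $$ (l, j)))"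
    by (intro sum.cong refl)
       (simp add: \<rho> index_mult_mat_sum[OF \<rho>(1) \<rho>(1) ij] sum_distrib_left mult_ac)
  also have "\<dots> = (\<Sum>l<n. (\<Sum>h\<in>carrier G. x h * \<rho> h $$ (i, l)) * (\<Sum>k\<in>carrier G. y k * \<rho> k $$ (l, j)))"
    unfolding sum_product by (simp only: sum.swap[of _ "carrier G" "{..<n}"])
  also have "\<dots> = (lift G n \<rho> x * lift G n \<rho> y) $$ (i, j)"
    using ij by (subst index_mult_mat_sum[of _ n n _ n]) (auto simp: lift_index)
  finally show "lift G n \<rho> (conv G x y) $$ (i, j) = (lift G n \<rho> x * lift G n \<rho> y) $$ (i, j)" .
qed auto

lemma lift_delta:
  assumes "is_rep G n \<rho>" "g \<in> carrier G"
  shows "lift G n \<rho> (\<lambda>h. if h = g then 1 else 0) = \<rho> g"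
  using is_repD(1)[OF assms] assms(2) fin
  by (intro eq_matI) (auto simp: lift_index if_distrib[of "\<lambda>x. x * _"] cong: if_cong)

end

subsection \<open>Detecting group algebra elements by irreducible representations\<close>

text \<open>The ambient space of the regular representation; the interpretation makes the spans and
  independence of the library available for its subspaces.\<close>

interpretation fs: vector_space "\<lambda>(c::complex) (f::'a \<Rightarrow> complex) x. c * f x"
  by unfold_locales (auto simp: algebra_simps)

context fin_group
begin

text \<open>The left regular representation, with functions cut off outside the carrier.\<close>

definition translate :: "'a \<Rightarrow> ('a \<Rightarrow> complex) \<Rightarrow> 'a \<Rightarrow> complex" where
  "translate g f = (\<lambda>h. if h \<in> carrier G then f (inv g \<otimes> h) else 0)"

definition supp_fun :: "('a \<Rightarrow> complex) set" where
  "supp_fun = {f. \<forall>x. x \<notin> carrier G \<longrightarrow> f x = 0}"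

definition translate_inv :: "('a \<Rightarrow> complex) set \<Rightarrow> bool" where
  "translate_inv W \<longleftrightarrow> fs.subspace W \<and> W \<subseteq> supp_fun \<and> (\<forall>g\<in>carrier G. \<forall>w\<in>W. translate g w \<in> W)"

lemma translate_sum: "translate g (\<lambda>x. \<Sum>i\<in>I. c i * b i x) = (\<lambda>x. \<Sum>i\<in>I. c i * translate g (b i) x)"
  by (auto simp: translate_def)

lemma translate_mult:
  assumes "g \<in> carrier G" "h \<in> carrier G"
  shows "translate (g \<otimes> h) f = translate g (translate h f)"
  using assms by (auto simp: translate_def inv_mult_group m_assoc)

lemma translate_one: "f \<in> supp_fun \<Longrightarrow> translate \<one> f = f"
  by (auto simp: translate_def supp_fun_def)

text \<open>The finitely many delta functions span, so independent sets are finite and their sizes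
  can be compared.\<close>

lemma supp_fun_span: "supp_fun \<subseteq> fs.span ((\<lambda>g x. if x = g then 1 else 0) ` carrier G)"
proof
  fix f :: "'a \<Rightarrow> complex" assume f: "f \<in> supp_fun"
  have "f = (\<Sum>g\<in>carrier G. (\<lambda>x. f g * (if x = g then 1 else 0)))"
    using f fin by (auto simp: fun_eq_iff supp_fun_def sum_fun_apply if_distrib cong: if_cong)
  also have "\<dots> \<in> fs.span ((\<lambda>g x. if x = g then 1 else 0) ` carrier G)"
    by (intro fs.span_sum fs.span_scale fs.span_base) auto
  finally show "f \<in> fs.span ((\<lambda>g x. if x = g then 1 else 0) ` carrier G)" .
qed

lemma finite_independent:
  assumes "fs.independent B" "B \<subseteq> supp_fun"
  shows "finite B"
  using fs.independent_span_bound[OF _ assms(1)] assms(2) supp_fun_span fin by blast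

text \<open>Bases are indexed by an initial segment of the naturals because the coordinates become
  matrix entries.\<close>

lemma basis_family:
  assumes "fs.subspace W" "W \<subseteq> supp_fun"
  obtains n b where "fs.independent (b ` {..<n::nat})" "inj_on b {..<n}" "fs.span (b ` {..<n}) = W" "b ` {..<n} \<subseteq> W"
proof -
  obtain B where B: "B \<subseteq> W" "fs.independent B" "W \<subseteq> fs.span B"
    using fs.maximal_independent_subset by blast
  then have "finite B" using assms finite_independent by blast
  then obtain b where "bij_betw b {..<card B} B"
    using ex_bij_betw_nat_finite atLeast0LessThan by metis
  then show thesis using that[of b "card B"] B assms(1)
    by (auto simp: bij_betw_def fs.span_subspace)
qed

lemma family_unique:
  assumes "fs.independent (b ` {..<n::nat})" "inj_on b {..<n}"
    "(\<lambda>x. \<Sum>i<n. c i * b i x) = (\<lambda>x. \<Sum>i<n. d i * b i x)" "i < n"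
  shows "c i = d i"
proof -
  have "(\<Sum>v\<in>b ` {..<n}. (\<lambda>x. (c (the_inv_into {..<n} b v) - d (the_inv_into {..<n} b v)) * v x))
      = (\<Sum>i<n. (\<lambda>x. (c i - d i) * b i x))"
    using assms(2) by (simp add: sum.reindex the_inv_into_f_f)
  also have "\<dots> = 0"
    using assms(3) by (auto simp: fun_eq_iff sum_fun_apply algebra_simps sum_subtractf)
  finally have "c (the_inv_into {..<n} b (b i)) - d (the_inv_into {..<n} b (b i)) = 0"
    using fs.independentD[OF assms(1) _ order_refl, of "\<lambda>v. c (the_inv_into {..<n} b v) - d (the_inv_into {..<n} b v)" "b i"] assms(4)
    by auto
  then show ?thesis using assms by (simp add: the_inv_into_f_f)
qed

lemma family_span:
  assumes "w \<in> fs.span (b ` {..<n::nat})" "inj_on b {..<n}"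
  obtains c where "w = (\<lambda>x. \<Sum>i<n. c i * b i x)"
proof -
  obtain u where "(\<Sum>v\<in>b ` {..<n}. (\<lambda>x. u v * v x)) = w"
    using assms(1) fs.span_finite[of "b ` {..<n}"] by auto
  then have "w = (\<lambda>x. \<Sum>i<n. u (b i) * b i x)"
    using assms(2) by (auto simp: sum.reindex fun_eq_iff sum_fun_apply)
  then show thesis by (rule that)
qed

lemma span_family_mem: "(\<lambda>x. \<Sum>i<n. c i * b i x) \<in> fs.span (b ` {..<n::nat})"
proof -
  have "(\<lambda>x. \<Sum>i<n. c i * b i x) = (\<Sum>i<n. (\<lambda>x. c i * b i x))"
    by (auto simp: fun_eq_iff sum_fun_apply)
  also have "\<dots> \<in> fs.span (b ` {..<n})"
    by (intro fs.span_sum fs.span_scale fs.span_base) auto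
  finally show ?thesis .
qed

text \<open>A nonzero invariant subspace of least dimension contains no smaller one. An indexed
  basis is carried along, since the irreducible representation is read off from it as
  matrices.\<close>

lemma exists_minimal_translate_inv:
  assumes "translate_inv W0" "W0 \<noteq> {0}"
  obtains b n where "translate_inv (fs.span (b ` {..<n::nat}))" "fs.span (b ` {..<n}) \<subseteq> W0" "0 < n"
    "fs.independent (b ` {..<n})" "inj_on b {..<n}"
    "\<forall>T. translate_inv T \<longrightarrow> T \<subseteq> fs.span (b ` {..<n}) \<longrightarrow> T \<noteq> {0} \<longrightarrow> T = fs.span (b ` {..<n})"
proof -
  define P where "P n = (\<exists>b. translate_inv (fs.span (b ` {..<n::nat})) \<and> fs.span (b ` {..<n}) \<subseteq> W0 \<and> 0 < n \<and>
    fs.independent (b ` {..<n}) \<and> inj_on b {..<n})" for n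
  have basis_P: "\<exists>n. P n \<and> (\<exists>b. inj_on b {..<n} \<and> fs.independent (b ` {..<n}) \<and> T = fs.span (b ` {..<n}))"
    if T: "translate_inv T" "T \<subseteq> W0" "T \<noteq> {0}" for T
  proof -
    obtain n b where b: "fs.independent (b ` {..<n::nat})" "inj_on b {..<n}" "fs.span (b ` {..<n}) = T" "b ` {..<n} \<subseteq> T"
      using basis_family T(1) unfolding translate_inv_def by metis
    have "n \<noteq> 0" using b(3) T(3) by (intro notI) simp
    then show ?thesis unfolding P_def using b T by (intro exI[of _ n] conjI exI[of _ b]) auto
  qed
  define n where "n = (LEAST n. P n)"
  have "\<exists>n. P n" using basis_P assms by blast
  then have n: "P n" unfolding n_def by (rule LeastI_ex)
  have min: "n \<le> m" if "P m" for m using that unfolding n_def by (rule Least_le)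
  obtain b where b: "translate_inv (fs.span (b ` {..<n}))" "fs.span (b ` {..<n}) \<subseteq> W0" "0 < n"
    "fs.independent (b ` {..<n})" "inj_on b {..<n}" using n unfolding P_def by blast
  have "T = fs.span (b ` {..<n})"
    if T: "translate_inv T" "T \<subseteq> fs.span (b ` {..<n})" "T \<noteq> {0}" for T
  proof -
    obtain m c where m: "P m" and c: "inj_on c {..<m}" "fs.independent (c ` {..<m})" "T = fs.span (c ` {..<m})"
      using basis_P[OF T(1) _ T(3)] T(2) b(2) by blast
    \<comment> \<open>Otherwise \<open>b i\<close> together with the basis of T would give m + 1
      independent vectors in a space of dimension n, although n \<le> m by minimality.\<close>
    have "b i \<in> T" if "i < n" for i
    proof (rule ccontr)
      assume "b i \<notin> T"
      then have "fs.independent (insert (b i) (c ` {..<m}))"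
        using c by (simp add: fs.independent_insertI)
      moreover have "insert (b i) (c ` {..<m}) \<subseteq> fs.span (b ` {..<n})"
        using T(2) c(3) that by (auto intro: fs.span_base)
      ultimately have "card (insert (b i) (c ` {..<m})) \<le> card (b ` {..<n})"
        using fs.independent_span_bound[of "b ` {..<n}"] by simp
      moreover have "b i \<notin> c ` {..<m}" using \<open>b i \<notin> T\<close> fs.span_base[of "b i" "c ` {..<m}"] unfolding c(3) by meson
      ultimately show False using min[OF m] b(5) c(1) by (simp add: card_image)
    qed
    then have "fs.span (b ` {..<n}) \<subseteq> T"
      by (intro fs.span_minimal) (use T(1) in \<open>auto simp: translate_inv_def\<close>)
    then show ?thesis using T(2) by simp
  qed
  then have "\<forall>T. translate_inv T \<longrightarrow> T \<subseteq> fs.span (b ` {..<n}) \<longrightarrow> T \<noteq> {0} \<longrightarrow> T = fs.span (b ` {..<n})"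
    by blast
  then show thesis by (rule that[OF b])
qed

text \<open>Complete reducibility in the form needed. U is the largest invariant subspace on which x
  acts as zero; its orthogonal complement W0 is invariant because translations are unitary, and
  nonzero because x is. On a minimal invariant W inside W0 the element x cannot act as zero, since W
  would then lie in U as well and every vector of W would be orthogonal to itself.\<close>

theorem irr_rep_detects:
  assumes "g0 \<in> carrier G" "x g0 \<noteq> 0"
  obtains n \<rho> where "irr_rep G n \<rho>" "lift G n \<rho> x \<noteq> 0\<^sub>m n n"
proof -
  define Xop where "Xop f = (\<lambda>h. \<Sum>g\<in>carrier G. x g * translate g f h)" for f
  define ip where "ip u v = (\<Sum>h\<in>carrier G. u h * cnj (v h))" for u v :: "'a \<Rightarrow> complex"
  have ip_trans: "ip (translate g u) (translate g v) = ip u v" if g: "g \<in> carrier G" for g u v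
  proof -
    have "ip (translate g u) (translate g v) = (\<Sum>h\<in>carrier G. u (inv g \<otimes> h) * cnj (v (inv g \<otimes> h)))"
      unfolding ip_def by (rule sum.cong) (auto simp: translate_def)
    also have "\<dots> = ip u v" unfolding ip_def
      by (rule sum_translate[of "inv g" "\<lambda>h. u h * cnj (v h)"]) (use g in auto)
    finally show ?thesis .
  qed
  have trans_supp: "translate g f \<in> supp_fun" for g f by (auto simp: translate_def supp_fun_def)
  \<comment> \<open>All translates are required to be killed, because x need not be central and its
    kernel alone need not be invariant.\<close>
  define U where "U = {u \<in> supp_fun. \<forall>k\<in>carrier G. Xop (translate k u) = 0}"
  have U_inv: "translate g u \<in> U" if "g \<in> carrier G" "u \<in> U" for g u
    using that trans_supp translate_mult[symmetric] by (auto simp: U_def)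
  define W0 where "W0 = {w \<in> supp_fun. \<forall>u\<in>U. ip u w = 0}"
  have "fs.subspace W0"
    unfolding fs.subspace_def W0_def supp_fun_def ip_def
    by (auto simp: distrib_left sum.distrib mult.left_commute[of _ "cnj _"] simp flip: sum_distrib_left)
  moreover have "translate g w \<in> W0" if g: "g \<in> carrier G" and w: "w \<in> W0" for g w
  proof -
    have "ip u (translate g w) = 0" if u: "u \<in> U" for u
    proof -
      have "u = translate g (translate (inv g) u)"
        using g u by (simp add: translate_mult[symmetric] translate_one U_def)
      then have "ip u (translate g w) = ip (translate (inv g) u) w" using ip_trans[OF g] by metis
      also have "\<dots> = 0" using w U_inv[of "inv g" u] g u by (auto simp: W0_def)
      finally show ?thesis .
    qed
    then show ?thesis using trans_supp by (auto simp: W0_def)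
  qed
  ultimately have W0: "translate_inv W0" unfolding translate_inv_def by (auto simp: W0_def)
  \<comment> \<open>Chosen so that the inner product of u with \<open>f0\<close> is the value of
    \<open>Xop u\<close> at the identity; hence \<open>f0\<close> is orthogonal to U.\<close>
  define f0 where "f0 h = (if h \<in> carrier G then cnj (x (inv h)) else 0)" for h
  have "ip u f0 = 0" if "u \<in> U" for u
  proof -
    have "ip u f0 = (\<Sum>h\<in>carrier G. u h * x (inv h))"
      unfolding ip_def f0_def by (rule sum.cong) auto
    also have "\<dots> = (\<Sum>h\<in>carrier G. u (inv h) * x (inv (inv h)))"
      by (rule sum_inverse[symmetric])
    also have "\<dots> = Xop u \<one>"
      unfolding Xop_def by (rule sum.cong) (auto simp: translate_def)
    also have "Xop u = 0" using that translate_one[of u] by (force simp: U_def)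
    finally show ?thesis by simp
  qed
  then have "f0 \<in> W0" by (auto simp: W0_def f0_def supp_fun_def)
  moreover have "f0 (inv g0) \<noteq> 0" using assms by (simp add: f0_def)
  ultimately have "W0 \<noteq> {0}" by auto
  then obtain b n where inv_W: "translate_inv (fs.span (b ` {..<n::nat}))" and sub: "fs.span (b ` {..<n}) \<subseteq> W0" and n: "0 < n"
    and ind: "fs.independent (b ` {..<n})" and inj: "inj_on b {..<n}"
    and min: "\<forall>T. translate_inv T \<longrightarrow> T \<subseteq> fs.span (b ` {..<n}) \<longrightarrow> T \<noteq> {0} \<longrightarrow> T = fs.span (b ` {..<n})"
    by (rule exists_minimal_translate_inv[OF W0])
  have b_mem: "b j \<in> fs.span (b ` {..<n})" if "j < n" for j using that by (intro fs.span_base) simp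
  then have b_supp: "b j \<in> supp_fun" if "j < n" for j using that inv_W unfolding translate_inv_def by auto
  have "\<exists>c. translate g (b j) = (\<lambda>x. \<Sum>i<n. c i * b i x)" if "g \<in> carrier G" "j < n" for g j
  proof -
    have "translate g (b j) \<in> fs.span (b ` {..<n})" using inv_W that b_mem unfolding translate_inv_def by simp
    then obtain d where "translate g (b j) = (\<lambda>x. \<Sum>i<n. d i * b i x)" by (rule family_span[OF _ inj])
    then show ?thesis by (intro exI[of _ d])
  qed
  then obtain c where c: "\<And>g j. g \<in> carrier G \<Longrightarrow> j < n \<Longrightarrow> translate g (b j) = (\<lambda>x. \<Sum>i<n. c g j i * b i x)"
    by metis
  define \<rho> where "\<rho> g = mat n n (\<lambda>(i, j). c g j i)" for g
  have act: "translate g (\<lambda>x. \<Sum>i<n. v i * b i x) = (\<lambda>x. \<Sum>i<n. (\<Sum>j<n. c g j i * v j) * b i x)"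
    if g: "g \<in> carrier G" for g v
  proof -
    have "translate g (\<lambda>x. \<Sum>i<n. v i * b i x) = (\<lambda>x. \<Sum>j<n. v j * (\<Sum>i<n. c g j i * b i x))"
      unfolding translate_sum using c[OF g] by (intro ext sum.cong) auto
    also have "\<dots> = (\<lambda>x. \<Sum>i<n. (\<Sum>j<n. c g j i * v j) * b i x)"
      by (rule ext, simp add: sum_distrib_left sum_distrib_right mult_ac, rule sum.swap)
    finally show ?thesis .
  qed
  have rep: "is_rep G n \<rho>"
    unfolding is_rep_def
  proof (intro conjI ballI)
    show "\<rho> \<one> = 1\<^sub>m n"
    proof (rule eq_matI)
      fix i j assume "i < dim_row (1\<^sub>m n :: complex mat)" "j < dim_col (1\<^sub>m n :: complex mat)"
      then have ij: "i < n" "j < n" by auto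
      then have "b j \<in> supp_fun" by (intro b_supp)
      then have "(\<lambda>x. \<Sum>i<n. c \<one> j i * b i x) = b j"
        using c[of \<one> j] ij by (simp only: translate_one one_closed)
      also have "b j = (\<lambda>x. \<Sum>i<n. (if i = j then 1 else 0) * b i x)"
        using ij by (intro ext) (simp add: if_distrib[of "\<lambda>y. y * _"] cong: if_cong)
      finally have "c \<one> j i = (if i = j then 1 else 0)" by (rule family_unique[OF ind inj _ ij(1)])
      then show "\<rho> \<one> $$ (i, j) = 1\<^sub>m n $$ (i, j)"
        using ij by (simp add: \<rho>_def)
    qed (auto simp: \<rho>_def)
    fix g h assume gh: "g \<in> carrier G" "h \<in> carrier G"
    show "\<rho> (g \<otimes> h) = \<rho> g * \<rho> h"
    proof (rule eq_matI)
      fix i j assume "i < dim_row (\<rho> g * \<rho> h)" "j < dim_col (\<rho> g * \<rho> h)"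
      then have ij: "i < n" "j < n" by (auto simp: \<rho>_def)
      have "(\<lambda>x. \<Sum>i<n. c (g \<otimes> h) j i * b i x) = translate g (translate h (b j))"
        using gh c[of "g \<otimes> h" j] ij by (simp add: translate_mult)
      also have "\<dots> = (\<lambda>x. \<Sum>i<n. (\<Sum>l<n. c g l i * c h j l) * b i x)"
        using gh ij by (simp add: c[of h] act)
      finally have "c (g \<otimes> h) j i = (\<Sum>l<n. c g l i * c h j l)" by (rule family_unique[OF ind inj _ ij(1)])
      then show "\<rho> (g \<otimes> h) $$ (i, j) = (\<rho> g * \<rho> h) $$ (i, j)"
        using ij by (subst index_mult_mat_sum[of _ n n _ n]) (auto simp: \<rho>_def)
    qed (auto simp: \<rho>_def)
  qed (simp add: \<rho>_def)
  have irr: "irr_rep G n \<rho>"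
    unfolding irr_rep_def
  proof (intro conjI allI impI n rep)
    fix W' assume W': "invariant_subspace G n \<rho> W'"
    define emb where "emb v = (\<lambda>x. \<Sum>i<n. v $ i * b i x)" for v :: "complex vec"
    have emb_eq: "v = w" if "emb v = emb w" "v \<in> carrier_vec n" "w \<in> carrier_vec n" for v w
    proof (rule eq_vecI)
      fix i assume "i < dim_vec w"
      then have "i < n" using that(3) by simp
      with that(1)[unfolded emb_def] show "v $ i = w $ i" by (rule family_unique[OF ind inj])
    qed (use that in auto)
    have emb_span: "emb v \<in> fs.span (b ` {..<n})" for v unfolding emb_def by (rule span_family_mem)
    have W'c: "W' \<subseteq> carrier_vec n" and W'0: "0\<^sub>v n \<in> W'" using W' by (auto simp: invariant_subspace_def)
    have T: "translate_inv (emb ` W')"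
      unfolding translate_inv_def fs.subspace_def
    proof (intro conjI ballI allI)
      show "0 \<in> emb ` W'"
        by (rule image_eqI[OF _ W'0]) (simp add: emb_def fun_eq_iff)
    next
      fix x y assume "x \<in> emb ` W'" "y \<in> emb ` W'"
      then obtain v w where vw: "v \<in> W'" "w \<in> W'" "x = emb v" "y = emb w" by (elim imageE) simp
      have "v \<in> carrier_vec n" "w \<in> carrier_vec n" using subsetD[OF W'c] vw(1,2) by simp_all
      then have "emb (v + w) = (\<lambda>x. \<Sum>i<n. v $ i * b i x + w $ i * b i x)" unfolding emb_def
        by (intro ext sum.cong refl) (simp add: distrib_right)
      then have "x + y = emb (v + w)" unfolding vw(3,4)
        by (simp add: emb_def plus_fun_def sum.distrib)
      moreover have "v + w \<in> W'" using vw(1,2) W' by (simp add: invariant_subspace_def)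
      ultimately show "x + y \<in> emb ` W'" by simp
    next
      fix a x assume "x \<in> emb ` W'"
      then obtain v where v: "v \<in> W'" "x = emb v" by (elim imageE) simp
      have "v \<in> carrier_vec n" using subsetD[OF W'c] v(1) by simp
      then have "(\<lambda>y. a * x y) = emb (a \<cdot>\<^sub>v v)" unfolding v(2) emb_def sum_distrib_left
        by (intro ext sum.cong refl) (simp add: mult.assoc)
      moreover have "a \<cdot>\<^sub>v v \<in> W'" using v(1) W' by (simp add: invariant_subspace_def)
      ultimately show "(\<lambda>y. a * x y) \<in> emb ` W'" by simp
    next
      show "emb ` W' \<subseteq> supp_fun"
      proof (rule image_subsetI)
        fix v
        have "fs.span (b ` {..<n}) \<subseteq> supp_fun" using inv_W by (simp add: translate_inv_def)
        then show "emb v \<in> supp_fun" using emb_span[of v] by (rule subsetD)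
      qed
    next
      fix g x assume g: "g \<in> carrier G" and "x \<in> emb ` W'"
      then obtain v where v: "v \<in> W'" "x = emb v" by (elim imageE) simp
      have "translate g x = (\<lambda>x. \<Sum>i<n. (\<Sum>j<n. c g j i * v $ j) * b i x)"
        using v(2) act[OF g] by (simp add: emb_def)
      also have "\<dots> = emb (\<rho> g *\<^sub>v v)"
        unfolding emb_def using v(1) W'c
        by (intro ext sum.cong refl, subst index_mult_mat_vec_sum[of _ n n]) (auto simp: \<rho>_def)
      finally show "translate g x \<in> emb ` W'" using v(1) W' g by (simp add: invariant_subspace_def)
    qed
    show "W' = {0\<^sub>v n} \<or> W' = carrier_vec n"
    proof (cases "emb ` W' = {0}")
      case True
      have "v = 0\<^sub>v n" if "v \<in> W'" for v
      proof (rule emb_eq)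
        have "emb v \<in> emb ` W'" "emb (0\<^sub>v n) \<in> emb ` W'" using that W'0 by (auto simp only: imageI)
        then show "emb v = emb (0\<^sub>v n)" using True by simp
      qed (use that W'c in auto)
      then have "W' \<subseteq> {0\<^sub>v n}" by (intro subsetI) simp
      with W'0 show ?thesis by blast
    next
      case False
      then have eq: "emb ` W' = fs.span (b ` {..<n})"
        using min T emb_span by (simp add: image_subset_iff)
      have "v \<in> W'" if v: "v \<in> carrier_vec n" for v
      proof -
        have "emb v \<in> emb ` W'" unfolding eq by (rule emb_span)
        then obtain w where w: "w \<in> W'" "emb v = emb w" by (elim imageE) simp
        then have "v = w" using emb_eq[OF _ v, of w] subsetD[OF W'c w(1)] by simp
        then show ?thesis using w(1) by simp
      qed
      then have "carrier_vec n \<subseteq> W'" by (rule subsetI)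
      with W'c show ?thesis by blast
    qed
  qed
  have "lift G n \<rho> x \<noteq> 0\<^sub>m n n"
  proof
    assume 0: "lift G n \<rho> x = 0\<^sub>m n n"
    have X0: "Xop w = 0" if w: "w \<in> fs.span (b ` {..<n})" for w
    proof -
      obtain v where v: "w = (\<lambda>x. \<Sum>i<n. v i * b i x)" by (rule family_span[OF w inj])
      have "Xop w h = 0" for h
      proof -
        have "Xop w h = (\<Sum>g\<in>carrier G. \<Sum>i<n. \<Sum>j<n. x g * c g j i * (v j * b i h))"
          unfolding Xop_def v
          by (intro sum.cong refl) (simp add: act sum_distrib_left sum_distrib_right mult_ac)
        also have "\<dots> = (\<Sum>i<n. \<Sum>j<n. (\<Sum>g\<in>carrier G. x g * c g j i) * (v j * b i h))"
          by (simp only: sum.swap[of _ "{..<n}" "carrier G"] sum_distrib_right)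
        also have "\<dots> = (\<Sum>i<n. \<Sum>j<n. lift G n \<rho> x $$ (i, j) * (v j * b i h))"
          by (intro sum.cong refl) (simp add: lift_index \<rho>_def)
        also have "\<dots> = 0" by (intro sum.neutral ballI) (simp add: 0)
        finally show ?thesis .
      qed
      then show ?thesis by (auto simp: fun_eq_iff)
    qed
    have "ip w w = 0" if "w \<in> fs.span (b ` {..<n})" for w
    proof -
      have "w \<in> U" using that inv_W X0 by (auto simp: U_def translate_inv_def)
      then show ?thesis using sub that by (auto simp: W0_def)
    qed
    then have "ip (b 0) (b 0) = 0" using b_mem[OF n] by simp
    then have "(\<Sum>h\<in>carrier G. (cmod (b 0 h))\<^sup>2) = 0"
      unfolding ip_def by (simp only: complex_norm_square[symmetric] of_real_sum[symmetric] of_real_eq_0_iff)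
    then have "\<forall>h\<in>carrier G. b 0 h = 0" using fin by (simp add: sum_nonneg_eq_0_iff)
    then have "b 0 = 0" using b_supp[OF n] by (auto simp: supp_fun_def fun_eq_iff)
    then show False using ind n fs.dependent_zero by (metis imageI lessThan_iff)
  qed
  with irr show thesis using that by blast
qed

end

subsection \<open>Scalar matrices\<close>

lemma mtrace_comm:
  assumes "A \<in> carrier_mat n m" "B \<in> carrier_mat m n"
  shows "mtrace (A * B) = mtrace (B * A)"
proof -
  have "mtrace (A * B) = (\<Sum>i<n. \<Sum>l<m. A $$ (i, l) * B $$ (l, i))"
    using assms by (simp add: mtrace_def scalar_prod_def lessThan_atLeast0)
  also have "\<dots> = (\<Sum>l<m. \<Sum>i<n. B $$ (l, i) * A $$ (i, l))"
    by (subst sum.swap) (simp add: mult.commute)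
  also have "\<dots> = mtrace (B * A)"
    using assms by (simp add: mtrace_def scalar_prod_def lessThan_atLeast0)
  finally show ?thesis .
qed

lemma mtrace_scalar: "mtrace (c \<cdot>\<^sub>m 1\<^sub>m n) = of_nat n * c"
  by (simp add: mtrace_def)

lemma scalar_mult_mat:
  fixes A :: "complex mat"
  shows "dim_row A = n \<Longrightarrow> (c \<cdot>\<^sub>m 1\<^sub>m n) * A = c \<cdot>\<^sub>m A" "dim_col A = m \<Longrightarrow> A * (c \<cdot>\<^sub>m 1\<^sub>m m) = c \<cdot>\<^sub>m A"
proof -
  show "(c \<cdot>\<^sub>m 1\<^sub>m n) * A = c \<cdot>\<^sub>m A" if "dim_row A = n"
    unfolding mult_smult_assoc_mat[OF one_carrier_mat carrier_matI[OF that refl]]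
      left_mult_one_mat[OF carrier_matI[OF that refl]] by (rule refl)
  show "A * (c \<cdot>\<^sub>m 1\<^sub>m m) = c \<cdot>\<^sub>m A" if "dim_col A = m"
    unfolding mult_smult_distrib[OF carrier_matI[OF refl that] one_carrier_mat]
      right_mult_one_mat[OF carrier_matI[OF refl that]] by (rule refl)
qed

lemma mtrace_similar:
  assumes "similar_mat_wit A B P Q" "A \<in> carrier_mat n n"
  shows "mtrace A = mtrace B"
proof -
  note w = similar_mat_witD2[OF assms(2,1)]
  have "mtrace A = mtrace (P * (B * Q))" using w by (metis assoc_mult_mat)
  also have "\<dots> = mtrace (B * Q * P)" using w mtrace_comm[of P n n "B * Q"] by simp
  also have "B * Q * P = B" using w by simp
  finally show ?thesis .
qed

lemma upper_triangular_mult: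
  fixes A B :: "complex mat"
  assumes "A \<in> carrier_mat n n" "B \<in> carrier_mat n n" "upper_triangular A" "upper_triangular B" "j \<le> i" "i < n"
  shows "(A * B) $$ (i, j) = (if i = j then A $$ (i, i) * B $$ (i, i) else 0)"
proof -
  have "A $$ (i, l) * B $$ (l, j) = (if l = i then if i = j then A $$ (i, i) * B $$ (i, i) else 0 else 0)" if "l < n" for l
  proof -
    consider "l < i" | "j < l" | "l = i" "i = j" using assms(5) by linarith
    then show ?thesis
    proof cases
      case 1
      then show ?thesis using upper_triangularD[OF assms(3), of l i] assms by auto
    next
      case 2
      then show ?thesis using upper_triangularD[OF assms(4), of j l] assms that by auto
    qed simp
  qed
  then show ?thesis
    using assms unfolding index_mult_mat_sum[OF assms(1,2,6) le_less_trans[OF assms(5,6)]] by simp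
qed

lemma upper_triangular_pow:
  fixes B :: "complex mat"
  assumes "B \<in> carrier_mat n n" "upper_triangular B"
  shows "upper_triangular (B ^\<^sub>m k) \<and> (\<forall>i<n. (B ^\<^sub>m k) $$ (i, i) = (B $$ (i, i)) ^ k)"
proof (induction k)
  case 0
  then show ?case using assms by simp
next
  case (Suc k)
  have c: "B ^\<^sub>m k \<in> carrier_mat n n" using assms by simp
  show ?case
    using Suc upper_triangular_mult[OF c assms(1) _ assms(2)] c assms(1)
    by (auto intro!: upper_triangularI)
qed

text \<open>Finite order forces diagonalisability in characteristic zero. By induction on the
  distance from the diagonal, once the entries nearer to it vanish, the (i, j) entry of B^k is k
  u^(k-1) times that of B. For k = m it must be 0, and m u^(m-1) is not.\<close>

lemma upper_triangular_root_of_unity_scalar: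
  fixes B :: "complex mat"
  assumes B: "B \<in> carrier_mat n n" "upper_triangular B" "B ^\<^sub>m m = 1\<^sub>m n" "0 < m"
    and diag: "\<And>i. i < n \<Longrightarrow> B $$ (i, i) = u"
  shows "B = u \<cdot>\<^sub>m 1\<^sub>m n"
proof (cases "n = 0")
  case True
  then show ?thesis using B(1) by (intro eq_matI) auto
next
  case False
  have um: "u ^ m = 1" using upper_triangular_pow[OF B(1,2), of m] B(3) diag False by auto
  then have u0: "u \<noteq> 0" using B(4) by (auto simp: power_0_left)
  have off: "B $$ (i, j) = 0" if "i < j" "j < n" for i j
    using that
  proof (induction "j - i" arbitrary: i j rule: less_induct)
    case less
    have small: "B $$ (i', j') = 0" if "i' < j'" "j' < n" "j' - i' < j - i" for i' j'
      using less.hyps that by blast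
    have pow: "(B ^\<^sub>m k) $$ (i, j) = of_nat k * u ^ (k - 1) * B $$ (i, j)" for k
    proof (induction k)
      case 0
      then show ?case using less.prems B(1) by simp
    next
      case (Suc k)
      have c: "B ^\<^sub>m k \<in> carrier_mat n n" using B(1) by simp
      note ut = upper_triangular_pow[OF B(1,2), of k]
      have "(B ^\<^sub>m k) $$ (i, l) * B $$ (l, j) = (if l = i then u ^ k * B $$ (i, j) else 0)
          + (if l = j then of_nat k * u ^ (k - 1) * B $$ (i, j) * u else 0)" if "l < n" for l
      proof -
        consider "l < i" | "l = i" | "i < l" "l < j" | "l = j" | "j < l" by linarith
        then show ?thesis
        proof cases
          case 1
          then show ?thesis using ut less.prems upper_triangularD[of "B ^\<^sub>m k" l i] c by auto
        next
          case 2
          then show ?thesis using ut less.prems diag by auto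
        next
          case 3
          then show ?thesis using small[of l j] less.prems by auto
        next
          case 4
          then show ?thesis using Suc less.prems diag by auto
        next
          case 5
          then show ?thesis using upper_triangularD[OF B(2) 5] that B(1) less.prems by auto
        qed
      qed
      then have "(B ^\<^sub>m Suc k) $$ (i, j) = u ^ k * B $$ (i, j) + of_nat k * u ^ (k - 1) * B $$ (i, j) * u"
        using less.prems B(1) c unfolding pow_mat.simps
        by (subst index_mult_mat_sum[of _ n n _ n]) (simp_all add: sum.distrib)
      then show ?case by (cases k) (auto simp: algebra_simps)
    qed
    have "of_nat m * u ^ (m - 1) * B $$ (i, j) = 0"
      using pow[of m] B(3) less.prems by simp
    then show ?case using u0 B(4) by simp
  qed
  show ?thesis
  proof (rule eq_matI)
    fix i j assume "i < dim_row (u \<cdot>\<^sub>m 1\<^sub>m n)" "j < dim_col (u \<cdot>\<^sub>m 1\<^sub>m n)"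
    then have ij: "i < n" "j < n" by auto
    then show "B $$ (i, j) = (u \<cdot>\<^sub>m 1\<^sub>m n) $$ (i, j)"
      using off diag upper_triangularD[OF B(2)] B(1) by (cases i j rule: linorder_cases) auto
  qed (use B(1) in auto)
qed

text \<open>The equality case of the triangle inequality: u is the mean, which has modulus 1, and
  the real parts of z_i times the conjugate of u are at most 1 but have mean 1.\<close>

lemma unit_sum_equal:
  fixes z :: "nat \<Rightarrow> complex"
  assumes "\<And>i. i < n \<Longrightarrow> cmod (z i) = 1" "cmod (\<Sum>i<n. z i) = real n"
  obtains u where "\<And>i. i < n \<Longrightarrow> z i = u"
proof (cases "n = 0")
  case True
  then show ?thesis using that by auto
next
  case False
  define u where "u = (\<Sum>i<n. z i) / of_nat n"
  have u: "cmod u = 1" using assms(2) False by (simp add: u_def norm_divide)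
  have uu: "u * cnj u = 1" using u by (metis complex_norm_square of_real_1 one_power2)
  have "(\<Sum>i<n. z i) = of_nat n * u" using False by (simp add: u_def)
  then have "(\<Sum>i<n. z i * cnj u) = of_nat n * (u * cnj u)"
    by (simp only: sum_distrib_right[symmetric] mult.assoc)
  then have "(\<Sum>i<n. Re (z i * cnj u)) = real n"
    unfolding uu by (metis Re_sum complex_Re_of_nat mult.right_neutral)
  then have s: "(\<Sum>i<n. 1 - Re (z i * cnj u)) = 0" by (simp add: sum_subtractf)
  have nrm: "cmod (z i * cnj u) = 1" if "i < n" for i
    using assms(1)[OF that] u by (simp add: norm_mult)
  have "1 - Re (z i * cnj u) \<ge> 0" if "i < n" for i
    using complex_Re_le_cmod[of "z i * cnj u"] nrm[OF that] by simp
  then have re: "Re (z i * cnj u) = 1" if "i < n" for i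
    using s that by (subst (asm) sum_nonneg_eq_0_iff) auto
  have "z i = u" if "i < n" for i
  proof -
    have "Im (z i * cnj u) = 0"
      using nrm[OF that] re[OF that] by (metis add_cancel_left_right cmod_power2 one_power2 power2_eq_iff_nonneg zero_eq_power2 power2_eq_square)
    then have "z i * cnj u = 1" using re[OF that] by (simp add: complex_eq_iff)
    then have "z i * (u * cnj u) = u" by (simp add: mult.left_commute)
    then show ?thesis using uu by simp
  qed
  then show ?thesis by (rule that)
qed

text \<open>Translates the modulus condition that defines \<open>Zchi\<close> into scalar action.
  Schur triangularisation puts the eigenvalues on the diagonal, and finite order makes them roots of
  unity.\<close>

lemma finite_order_scalar_iff:
  fixes A :: "complex mat"
  assumes A: "A \<in> carrier_mat n n" and pow: "A ^\<^sub>m m = 1\<^sub>m n" "0 < m"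
  shows "cmod (mtrace A) = real n \<longleftrightarrow> (\<exists>c. A = c \<cdot>\<^sub>m 1\<^sub>m n)"
proof (cases "n = 0")
  case True
  then show ?thesis using A by (auto simp: mtrace_def intro!: exI[of _ 0] eq_matI)
next
  case n: False
  obtain as where "char_poly A = (\<Prod>a\<leftarrow>as. [:- a, 1:])" using char_poly_factorized[OF A] by blast
  then obtain B where B: "B \<in> carrier_mat n n" "upper_triangular B" "similar_mat A B"
    using schur_decomposition_exists[OF A] by blast
  then obtain P Q where wit: "similar_mat_wit A B P Q" by (auto simp: similar_mat_def)
  note w = similar_mat_witD2[OF A wit]
  have Bm: "B ^\<^sub>m m = 1\<^sub>m n"
    using similar_mat_wit_pow_id[OF similar_mat_wit_sym[OF wit], of m] pow(1) w by simp
  have diag1: "(B $$ (i, i)) ^ m = 1" if "i < n" for i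
    using upper_triangular_pow[OF B(1,2), of m] Bm that by simp
  then have nrm: "cmod (B $$ (i, i)) = 1" if "i < n" for i
    using that pow(2) by (metis norm_ge_zero norm_one norm_power power_eq_1_iff less_not_refl2)
  have tr: "mtrace A = (\<Sum>i<n. B $$ (i, i))" using mtrace_similar[OF wit A] B(1) by (simp add: mtrace_def)
  show ?thesis
  proof
    assume "cmod (mtrace A) = real n"
    then obtain u where u: "\<And>i. i < n \<Longrightarrow> B $$ (i, i) = u"
      using unit_sum_equal[of n "\<lambda>i. B $$ (i, i)"] nrm tr by metis
    have "B = u \<cdot>\<^sub>m 1\<^sub>m n"
      by (rule upper_triangular_root_of_unity_scalar[OF B(1,2) Bm pow(2) u])
    then have "A = u \<cdot>\<^sub>m 1\<^sub>m n"
      using w by (metis mult_smult_assoc_mat mult_smult_distrib one_carrier_mat right_mult_one_mat)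
    then show "\<exists>c. A = c \<cdot>\<^sub>m 1\<^sub>m n" by blast
  next
    assume "\<exists>c. A = c \<cdot>\<^sub>m 1\<^sub>m n"
    then obtain c where c: "A = c \<cdot>\<^sub>m 1\<^sub>m n" by blast
    have "A ^\<^sub>m k = c ^ k \<cdot>\<^sub>m 1\<^sub>m n" for k
    proof (induction k)
      case 0
      then show ?case using A by (intro eq_matI) auto
    next
      case (Suc k)
      then have "A ^\<^sub>m Suc k = (c ^ k \<cdot>\<^sub>m 1\<^sub>m n) * (c \<cdot>\<^sub>m 1\<^sub>m n)" using c by simp
      also have "\<dots> = c ^ k \<cdot>\<^sub>m (c \<cdot>\<^sub>m 1\<^sub>m n)" by (rule scalar_mult_mat) simp
      also have "\<dots> = c ^ Suc k \<cdot>\<^sub>m 1\<^sub>m n" by (intro eq_matI) auto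
      finally show ?case .
    qed
    then have "(c ^ m \<cdot>\<^sub>m 1\<^sub>m n) $$ (0, 0) = (1\<^sub>m n :: complex mat) $$ (0, 0)" using pow(1) by simp
    then have "c ^ m = 1" using n by simp
    then have "cmod c = 1"
      using pow(2) by (metis norm_ge_zero norm_one norm_power power_eq_1_iff less_not_refl2)
    then show "cmod (mtrace A) = real n" by (simp add: c mtrace_scalar norm_mult)
  qed
qed

subsection \<open>Irreducible representations and their centres\<close>

lemma (in group) inv_cancel [simp]:
  assumes "x \<in> carrier G" "y \<in> carrier G"
  shows "inv x \<otimes> (x \<otimes> y) = y" "x \<otimes> (inv x \<otimes> y) = y"
  using assms by (metis inv_closed l_inv l_one m_assoc, metis inv_closed r_inv l_one m_assoc)

lemma (in fin_group) rep_nat_pow: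
  assumes "is_rep G n \<rho>" "g \<in> carrier G"
  shows "\<rho> (g [^] (k::nat)) = \<rho> g ^\<^sub>m k"
proof (induction k)
  case 0
  then show ?case using is_repD(2)[OF assms(1)] carrier_matD(1)[OF is_repD(1)[OF assms]] by simp
next
  case (Suc k)
  then show ?case using is_repD(3)[OF assms(1)] assms(2) by simp
qed

locale irrep = fin_group +
  fixes n \<rho>
  assumes irr: "irr_rep G n \<rho>"
begin

abbreviation "\<chi> \<equiv> character G \<rho>"

lemma rep: "is_rep G n \<rho>" and npos: "0 < n"
  using irr by (auto simp: irr_rep_def)

lemmas rho_carrier [simp] = is_repD(1)[OF rep]
lemmas rho_one = is_repD(2)[OF rep]
lemmas rho_mult = is_repD(3)[OF rep]

lemma rho_mult_index:
  assumes "g \<in> carrier G" "h \<in> carrier G" "a < n" "b < n"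
  shows "\<rho> (g \<otimes> h) $$ (a, b) = (\<Sum>c<n. \<rho> g $$ (a, c) * \<rho> h $$ (c, b))"
  using assms by (simp add: rho_mult index_mult_mat_sum[of _ n n _ n] del: index_mult_mat(1))

lemma rho_dim [simp]: "g \<in> carrier G \<Longrightarrow> dim_row (\<rho> g) = n" "g \<in> carrier G \<Longrightarrow> dim_col (\<rho> g) = n"
  by (rule carrier_matD[OF rho_carrier], assumption)+

lemma chi_Irr: "\<chi> \<in> Irr G"
  using irr by (auto simp: Irr_def)

lemma chi_one: "\<chi> \<one> = of_nat n"
  using mtrace_scalar[of 1 n] by (simp add: character_def rho_one mtrace_def)

lemma schur:
  assumes A: "A \<in> carrier_mat n n" and comm: "\<And>g. g \<in> carrier G \<Longrightarrow> \<rho> g * A = A * \<rho> g"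
  obtains c where "A = c \<cdot>\<^sub>m 1\<^sub>m n"
proof -
  obtain e where "eigenvalue A e" using spectrum_non_empty[OF A npos] by (auto simp: spectrum_def)
  then obtain v where v: "v \<in> carrier_vec n" "v \<noteq> 0\<^sub>v n" "A *\<^sub>v v = e \<cdot>\<^sub>v v"
    using carrier_matD[OF A] by (metis eigenvalue_def eigenvector_def)
  define W where "W = {w \<in> carrier_vec n. A *\<^sub>v w = e \<cdot>\<^sub>v w}"
  have "invariant_subspace G n \<rho> W"
    unfolding invariant_subspace_def
  proof (intro conjI ballI allI)
    show "W \<subseteq> carrier_vec n" by (simp add: W_def)
    have "A *\<^sub>v 0\<^sub>v n = 0\<^sub>v n" "e \<cdot>\<^sub>v 0\<^sub>v n = 0\<^sub>v n"
      by (rule eq_vecI, use A in simp, use A in simp) (rule eq_vecI, simp_all)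
    then show "0\<^sub>v n \<in> W" by (simp add: W_def)
  next
    fix u w assume "u \<in> W" "w \<in> W"
    then show "u + w \<in> W" using A
      by (simp add: W_def mult_add_distrib_mat_vec[OF A] smult_add_distrib_vec[of _ n])
  next
    fix c w assume "w \<in> W"
    then show "c \<cdot>\<^sub>v w \<in> W" using A
      by (simp add: W_def mult_mat_vec[OF A] smult_smult_assoc mult.commute)
  next
    fix g w assume g: "g \<in> carrier G" and w: "w \<in> W"
    have "A *\<^sub>v (\<rho> g *\<^sub>v w) = (A * \<rho> g) *\<^sub>v w"
      using g w A by (simp add: W_def assoc_mult_mat_vec[of _ n n _ n])
    also have "\<dots> = \<rho> g *\<^sub>v (A *\<^sub>v w)"
      unfolding comm[OF g, symmetric] using g w A by (simp add: W_def assoc_mult_mat_vec[of _ n n _ n])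
    finally have "A *\<^sub>v (\<rho> g *\<^sub>v w) = \<rho> g *\<^sub>v (A *\<^sub>v w)" .
    then show "\<rho> g *\<^sub>v w \<in> W"
      using g w mult_mat_vec[OF rho_carrier[OF g]] mult_mat_vec_carrier[OF rho_carrier[OF g]] by (simp add: W_def)
  qed
  moreover have "v \<in> W" using v by (simp add: W_def)
  then have "W \<noteq> {0\<^sub>v n}" using v(2) by (metis singletonD)
  ultimately have W: "W = carrier_vec n" using irr unfolding irr_rep_def by metis
  have "A = e \<cdot>\<^sub>m 1\<^sub>m n"
  proof (rule eq_matI)
    fix i j assume "i < dim_row (e \<cdot>\<^sub>m 1\<^sub>m n)" "j < dim_col (e \<cdot>\<^sub>m 1\<^sub>m n)"
    then have ij: "i < n" "j < n" by auto
    have "unit_vec n j \<in> W" unfolding W by simp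
    then have "(A *\<^sub>v unit_vec n j) $ i = (e \<cdot>\<^sub>v unit_vec n j) $ i" by (simp add: W_def)
    then show "A $$ (i, j) = (e \<cdot>\<^sub>m 1\<^sub>m n) $$ (i, j)"
      using ij A by (simp add: scalar_prod_right_unit)
  qed (use A in simp_all)
  then show thesis by (rule that)
qed

lemma Zchi_iff: "g \<in> Zchi G \<chi> \<longleftrightarrow> g \<in> carrier G \<and> (\<exists>c. \<rho> g = c \<cdot>\<^sub>m 1\<^sub>m n)"
proof (cases "g \<in> carrier G")
  case True
  have "\<rho> g ^\<^sub>m Coset.order G = 1\<^sub>m n"
    using rep_nat_pow[OF rep True, of "Coset.order G"] pow_order_eq_1[OF True] rho_one by simp
  moreover have "0 < Coset.order G" using fin order_gt_0_iff_finite by blast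
  ultimately have "cmod (mtrace (\<rho> g)) = real n \<longleftrightarrow> (\<exists>c. \<rho> g = c \<cdot>\<^sub>m 1\<^sub>m n)"
    using finite_order_scalar_iff[OF rho_carrier[OF True]] by blast
  then show ?thesis using True chi_one by (simp add: Zchi_def) (simp add: character_def)
qed (simp add: Zchi_def)

lemma Zchi_scalar:
  assumes "g \<in> Zchi G \<chi>"
  shows "\<rho> g = (\<chi> g / of_nat n) \<cdot>\<^sub>m 1\<^sub>m n"
proof -
  obtain c where c: "g \<in> carrier G" "\<rho> g = c \<cdot>\<^sub>m 1\<^sub>m n" using assms Zchi_iff by blast
  then have "\<chi> g = of_nat n * c" by (simp add: character_def mtrace_scalar)
  then show ?thesis using c npos by simp
qed

lemma Zchi_subgroup: "subgroup (Zchi G \<chi>) G"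
proof
  show "Zchi G \<chi> \<subseteq> carrier G" using Zchi_iff by blast
  show "\<one> \<in> Zchi G \<chi>" by (simp add: Zchi_def)
next
  fix x y assume "x \<in> Zchi G \<chi>" "y \<in> Zchi G \<chi>"
  then obtain c d where *: "x \<in> carrier G" "\<rho> x = c \<cdot>\<^sub>m 1\<^sub>m n" "y \<in> carrier G" "\<rho> y = d \<cdot>\<^sub>m 1\<^sub>m n"
    using Zchi_iff by blast
  have "\<rho> (x \<otimes> y) = c \<cdot>\<^sub>m (d \<cdot>\<^sub>m 1\<^sub>m n)" using * scalar_mult_mat(1)[of "d \<cdot>\<^sub>m 1\<^sub>m n" n c] by (simp add: rho_mult)
  also have "\<dots> = (c * d) \<cdot>\<^sub>m 1\<^sub>m n" by (intro eq_matI) auto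
  finally show "x \<otimes> y \<in> Zchi G \<chi>" using * Zchi_iff by blast
next
  fix x assume "x \<in> Zchi G \<chi>"
  then obtain c where *: "x \<in> carrier G" "\<rho> x = c \<cdot>\<^sub>m 1\<^sub>m n" using Zchi_iff by blast
  have "1\<^sub>m n = c \<cdot>\<^sub>m \<rho> (inv x)"
    using * rho_mult[of x "inv x"] rho_one by (simp add: scalar_mult_mat)
  then have e: "(1\<^sub>m n :: complex mat) $$ (i, j) = c * \<rho> (inv x) $$ (i, j)" if "i < n" "j < n" for i j
    using that *(1) by (metis index_smult_mat(1) inv_closed rho_dim)
  have c0: "c \<noteq> 0" using e[of 0 0] npos by auto
  have "\<rho> (inv x) = inverse c \<cdot>\<^sub>m 1\<^sub>m n"
  proof (rule eq_matI)
    fix i j assume "i < dim_row (inverse c \<cdot>\<^sub>m 1\<^sub>m n)" "j < dim_col (inverse c \<cdot>\<^sub>m 1\<^sub>m n)"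
    then have ij: "i < n" "j < n" by auto
    then have "(inverse c \<cdot>\<^sub>m 1\<^sub>m n) $$ (i, j) = inverse c * (c * \<rho> (inv x) $$ (i, j))"
      using e[OF ij] by simp
    then show "\<rho> (inv x) $$ (i, j) = (inverse c \<cdot>\<^sub>m 1\<^sub>m n) $$ (i, j)" using c0 by simp
  qed (use *(1) in simp_all)
  then show "inv x \<in> Zchi G \<chi>" using * Zchi_iff by blast
qed

lemma Zchi_conj:
  assumes "z \<in> Zchi G \<chi>" "g \<in> carrier G"
  shows "inv g \<otimes> z \<otimes> g \<in> Zchi G \<chi>" "\<rho> (inv g \<otimes> z \<otimes> g) = \<rho> z"
proof -
  obtain c where c: "z \<in> carrier G" "\<rho> z = c \<cdot>\<^sub>m 1\<^sub>m n" using assms Zchi_iff by blast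
  have "\<rho> (inv g \<otimes> z \<otimes> g) = c \<cdot>\<^sub>m (\<rho> (inv g) * \<rho> g)"
    using assms(2) c scalar_mult_mat(2)[of "\<rho> (inv g)" n c] mult_smult_assoc_mat[of "\<rho> (inv g)" n n "\<rho> g" n c]
    by (simp add: rho_mult)
  also have "\<rho> (inv g) * \<rho> g = 1\<^sub>m n" using assms(2) rho_mult[of "inv g" g] rho_one by simp
  finally show eq: "\<rho> (inv g \<otimes> z \<otimes> g) = \<rho> z" using c by simp
  then show "inv g \<otimes> z \<otimes> g \<in> Zchi G \<chi>" using c assms(2) Zchi_iff by auto
qed

lemma rho_inverse:
  assumes "g \<in> carrier G"
  shows "\<rho> g * \<rho> (inv g) = 1\<^sub>m n" "\<rho> (inv g) * \<rho> g = 1\<^sub>m n"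
  using assms rho_mult[of g "inv g"] rho_mult[of "inv g" g] rho_one by simp_all

text \<open>By Schur, g acts as a scalar as soon as it commutes with the whole image. This says that
  Z(\<chi>) is the centre modulo the kernel, and it is how the groups [Z, G] enter the
  argument.\<close>

lemma Zchi_iff_comm:
  "g \<in> Zchi G \<chi> \<longleftrightarrow> g \<in> carrier G \<and> (\<forall>h\<in>carrier G. \<rho> (inv g \<otimes> inv h \<otimes> g \<otimes> h) = 1\<^sub>m n)"
proof (intro iffI conjI ballI; (elim conjE)?)
  assume g: "g \<in> Zchi G \<chi>"
  then show gc: "g \<in> carrier G" by (simp add: Zchi_def)
  fix h assume h: "h \<in> carrier G"
  have "\<rho> (inv g \<otimes> inv h \<otimes> g \<otimes> h) = \<rho> (inv g) * \<rho> (inv h \<otimes> g \<otimes> h)"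
    using gc h by (simp add: m_assoc flip: rho_mult)
  then show "\<rho> (inv g \<otimes> inv h \<otimes> g \<otimes> h) = 1\<^sub>m n"
    using Zchi_conj(2)[OF g h] rho_inverse[OF gc] by simp
next
  assume g: "g \<in> carrier G" and c: "\<forall>h\<in>carrier G. \<rho> (inv g \<otimes> inv h \<otimes> g \<otimes> h) = 1\<^sub>m n"
  have "\<rho> h * \<rho> g = \<rho> g * \<rho> h" if h: "h \<in> carrier G" for h
  proof -
    have "\<rho> g * \<rho> h = \<rho> (h \<otimes> g \<otimes> (inv g \<otimes> inv h \<otimes> g \<otimes> h))"
      using g h by (simp add: m_assoc flip: rho_mult)
    also have "\<dots> = \<rho> (h \<otimes> g) * \<rho> (inv g \<otimes> inv h \<otimes> g \<otimes> h)" using g h by (intro rho_mult) auto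
    also have "\<dots> = \<rho> (h \<otimes> g)" using g h c by simp
    finally show ?thesis using g h by (simp add: rho_mult)
  qed
  then obtain d where "\<rho> g = d \<cdot>\<^sub>m 1\<^sub>m n" using schur[OF rho_carrier[OF g]] by metis
  then show "g \<in> Zchi G \<chi>" using g Zchi_iff by blast
qed

lemma chi_orthogonality: "(\<Sum>g\<in>carrier G. \<chi> g * \<chi> (inv g)) = of_nat (card (carrier G))"
proof -
  \<comment> \<open>The sum over g of \<rho>(g) E_ij \<rho>(g^-1) for the matrix unit E_ij, written
    out in entries. It intertwines, so it is scalar; its trace determines the scalar for i = j, and
    its (i, j) entry is 0 for i \<noteq> j.\<close>
  define M where "M i j = mat n n (\<lambda>(a, b). \<Sum>g\<in>carrier G. \<rho> g $$ (a, i) * \<rho> (inv g) $$ (j, b))" for i j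
  have Mc: "M i j \<in> carrier_mat n n" for i j by (simp add: M_def)
  have scal: "\<exists>c. M i j = c \<cdot>\<^sub>m 1\<^sub>m n" if ij: "i < n" "j < n" for i j
  proof -
    have "\<rho> h * M i j = M i j * \<rho> h" if h: "h \<in> carrier G" for h
    proof (rule eq_matI)
      fix a b assume "a < dim_row (M i j * \<rho> h)" "b < dim_col (M i j * \<rho> h)"
      then have ab: "a < n" "b < n" using h by (auto simp: M_def)
      have "(\<rho> h * M i j) $$ (a, b) = (\<Sum>c<n. \<Sum>g\<in>carrier G. \<rho> h $$ (a, c) * \<rho> g $$ (c, i) * \<rho> (inv g) $$ (j, b))"
        using ab h by (subst index_mult_mat_sum[OF _ Mc]) (auto simp: M_def sum_distrib_left mult.assoc)
      also have "\<dots> = (\<Sum>g\<in>carrier G. \<rho> (h \<otimes> g) $$ (a, i) * \<rho> (inv g) $$ (j, b))"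
        using ab h ij by (subst sum.swap) (simp add: rho_mult_index sum_distrib_right)
      also have "\<dots> = (\<Sum>g\<in>carrier G. \<rho> (h \<otimes> g) $$ (a, i) * \<rho> (inv (h \<otimes> g) \<otimes> h) $$ (j, b))"
        using h by (intro sum.cong) (auto simp: inv_mult_group m_assoc)
      also have "\<dots> = (\<Sum>g\<in>carrier G. \<rho> g $$ (a, i) * \<rho> (inv g \<otimes> h) $$ (j, b))"
        by (rule sum_translate[OF h, of "\<lambda>g. \<rho> g $$ (a, i) * \<rho> (inv g \<otimes> h) $$ (j, b)"])
      also have "\<dots> = (\<Sum>c<n. \<Sum>g\<in>carrier G. \<rho> g $$ (a, i) * \<rho> (inv g) $$ (j, c) * \<rho> h $$ (c, b))"
        using ab h ij by (subst sum.swap) (simp add: rho_mult_index sum_distrib_left mult.assoc)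
      also have "\<dots> = (M i j * \<rho> h) $$ (a, b)"
        using ab h by (subst index_mult_mat_sum[OF Mc]) (auto simp: M_def sum_distrib_right)
      finally show "(\<rho> h * M i j) $$ (a, b) = (M i j * \<rho> h) $$ (a, b)" .
    qed (use h in \<open>simp_all add: M_def\<close>)
    then show ?thesis using schur[OF Mc] by metis
  qed
  then obtain c where c: "\<And>i j. i < n \<Longrightarrow> j < n \<Longrightarrow> M i j = c i j \<cdot>\<^sub>m 1\<^sub>m n" by metis
  have cii: "of_nat n * c i i = of_nat (card (carrier G))" if i: "i < n" for i
  proof -
    have "of_nat n * c i i = mtrace (M i i)" using c[OF i i] by (simp add: mtrace_scalar)
    also have "\<dots> = (\<Sum>a<n. \<Sum>g\<in>carrier G. \<rho> (inv g) $$ (i, a) * \<rho> g $$ (a, i))"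
      by (simp add: mtrace_def M_def mult.commute)
    also have "\<dots> = (\<Sum>g\<in>carrier G. (\<rho> (inv g) * \<rho> g) $$ (i, i))"
      using i by (subst sum.swap) (simp add: index_mult_mat_sum[of _ n n _ n] del: index_mult_mat(1))
    also have "\<dots> = of_nat (card (carrier G))" using i by (simp add: rho_inverse)
    finally show ?thesis .
  qed
  have "(\<Sum>g\<in>carrier G. \<chi> g * \<chi> (inv g)) = (\<Sum>g\<in>carrier G. \<Sum>i<n. \<Sum>j<n. \<rho> g $$ (i, i) * \<rho> (inv g) $$ (j, j))"
    by (intro sum.cong refl) (simp add: character_def mtrace_def sum_product)
  also have "\<dots> = (\<Sum>i<n. \<Sum>j<n. \<Sum>g\<in>carrier G. \<rho> g $$ (i, i) * \<rho> (inv g) $$ (j, j))"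
    by (simp only: sum.swap[of _ "{..<n}" "carrier G"])
  also have "\<dots> = (\<Sum>i<n. \<Sum>j<n. M i j $$ (i, j))" by (simp add: M_def)
  also have "\<dots> = (\<Sum>i<n. \<Sum>j<n. if i = j then c i i else 0)"
    by (intro sum.cong refl) (auto simp: c)
  also have "\<dots> = (\<Sum>i<n. c i i)" by simp
  also have "\<dots> = (\<Sum>i<n. of_nat (card (carrier G)) / of_nat n)"
    using cii npos by (intro sum.cong refl) (simp add: field_simps)
  also have "\<dots> = of_nat (card (carrier G))" using npos by simp
  finally show ?thesis .
qed

text \<open>In the norm relation only the centre contributes, each of its elements with n^2. So the
  degree determines the order of the centre, which together with nestedness will determine the
  centre itself.\<close>

lemma central_type_card:
  assumes "central_type G \<chi>"
  shows "n\<^sup>2 * card (Zchi G \<chi>) = card (carrier G)"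
proof -
  interpret Z: subgroup "Zchi G \<chi>" G by (rule Zchi_subgroup)
  have "of_nat (card (carrier G)) = (\<Sum>g\<in>carrier G. \<chi> g * \<chi> (inv g))" using chi_orthogonality by simp
  also have "\<dots> = (\<Sum>g\<in>Zchi G \<chi>. \<chi> g * \<chi> (inv g))"
    using assms fin Z.subset by (intro sum.mono_neutral_right) (auto simp: central_type_def)
  also have "\<dots> = (\<Sum>g\<in>Zchi G \<chi>. (of_nat n)\<^sup>2)"
  proof (rule sum.cong[OF refl])
    fix g assume g: "g \<in> Zchi G \<chi>"
    then have gc: "g \<in> carrier G" and gi: "inv g \<in> Zchi G \<chi>" by auto
    have "1\<^sub>m n = (\<chi> g / of_nat n) \<cdot>\<^sub>m ((\<chi> (inv g) / of_nat n) \<cdot>\<^sub>m 1\<^sub>m n)"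
      using rho_inverse(1)[OF gc] Zchi_scalar[OF g] Zchi_scalar[OF gi]
        scalar_mult_mat(1)[of "(\<chi> (inv g) / of_nat n) \<cdot>\<^sub>m 1\<^sub>m n" n "\<chi> g / of_nat n"] by simp
    then have "(1\<^sub>m n :: complex mat) $$ (0, 0) = ((\<chi> g / of_nat n) \<cdot>\<^sub>m ((\<chi> (inv g) / of_nat n) \<cdot>\<^sub>m 1\<^sub>m n)) $$ (0, 0)"
      by simp
    then have "1 = (\<chi> g / of_nat n) * (\<chi> (inv g) / of_nat n)" using npos by simp
    then show "\<chi> g * \<chi> (inv g) = (of_nat n)\<^sup>2" using npos by (simp add: field_simps power2_eq_square)
  qed
  also have "\<dots> = of_nat (n\<^sup>2 * card (Zchi G \<chi>))" by simp
  finally show ?thesis unfolding of_nat_eq_iff by simp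
qed

end

section \<open>Linear characters of subgroups and the irreducible representations above them\<close>

definition cmt :: "('a, 'b) monoid_scheme \<Rightarrow> 'a \<Rightarrow> 'a \<Rightarrow> 'a" where
  "cmt G x g = inv\<^bsub>G\<^esub> x \<otimes>\<^bsub>G\<^esub> inv\<^bsub>G\<^esub> g \<otimes>\<^bsub>G\<^esub> x \<otimes>\<^bsub>G\<^esub> g"

text \<open>Only values on Z are constrained. That they are nonzero follows from \<theta>(1) = 1
  when Z is a subgroup.\<close>

definition lchar :: "('a, 'b) monoid_scheme \<Rightarrow> 'a set \<Rightarrow> ('a \<Rightarrow> complex) \<Rightarrow> bool" where
  "lchar G Z \<theta> \<longleftrightarrow> \<theta> \<one>\<^bsub>G\<^esub> = 1 \<and> (\<forall>x\<in>Z. \<forall>y\<in>Z. \<theta> (x \<otimes>\<^bsub>G\<^esub> y) = \<theta> x * \<theta> y)"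

text \<open>Combines two facts: T normalises Z, and T fixes \<theta> under conjugation.\<close>

definition conj_inv :: "('a, 'b) monoid_scheme \<Rightarrow> 'a set \<Rightarrow> 'a set \<Rightarrow> ('a \<Rightarrow> complex) \<Rightarrow> bool" where
  "conj_inv G T Z \<theta> \<longleftrightarrow>
     (\<forall>z\<in>Z. \<forall>t\<in>T. inv\<^bsub>G\<^esub> t \<otimes>\<^bsub>G\<^esub> z \<otimes>\<^bsub>G\<^esub> t \<in> Z \<and> \<theta> (inv\<^bsub>G\<^esub> t \<otimes>\<^bsub>G\<^esub> z \<otimes>\<^bsub>G\<^esub> t) = \<theta> z)"

lemma (in group) lchar_inv:
  assumes "subgroup Z G" "lchar G Z \<theta>" "x \<in> Z"
  shows "\<theta> (inv x) * \<theta> x = 1" "\<theta> x \<noteq> 0" "\<theta> (inv x) = inverse (\<theta> x)"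
proof -
  have "x \<in> carrier G" "inv x \<in> Z"
    by (rule subgroup.mem_carrier[OF assms(1,3)], rule subgroup.m_inv_closed[OF assms(1,3)])
  then show 1: "\<theta> (inv x) * \<theta> x = 1" using assms unfolding lchar_def by (metis l_inv)
  then show "\<theta> x \<noteq> 0" by auto
  then show "\<theta> (inv x) = inverse (\<theta> x)" using 1 by (simp add: field_simps)
qed

lemma (in group) cmt_closed: "x \<in> carrier G \<Longrightarrow> g \<in> carrier G \<Longrightarrow> cmt G x g \<in> carrier G"
  by (simp add: cmt_def)

context fin_group
begin

lemma conv_delta_left:
  assumes "g \<in> carrier G" "k \<in> carrier G"
  shows "conv G (\<lambda>h. if h = g then 1 else 0) y k = y (inv g \<otimes> k)"
  using assms fin by (simp add: conv_def if_distrib[of "\<lambda>x. x * _"] cong: if_cong)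

lemma conv_delta_right:
  assumes "g \<in> carrier G" "k \<in> carrier G"
  shows "conv G y (\<lambda>h. if h = g then 1 else 0) k = y (k \<otimes> inv g)"
proof -
  have "inv h \<otimes> k = g \<longleftrightarrow> h = k \<otimes> inv g" if "h \<in> carrier G" for h
    using assms that by (auto simp: m_assoc inv_mult_group)
  then show ?thesis
    using assms fin by (simp add: conv_def if_distrib[of "\<lambda>x. _ * x"] cong: if_cong sum.cong)
qed

lemma lift_cong:
  assumes "\<And>g. g \<in> carrier G \<Longrightarrow> x g = y g"
  shows "lift G n \<rho> x = lift G n \<rho> y"
  using assms by (simp add: lift_def)

lemma lift_scale: "lift G n \<rho> (\<lambda>g. c * x g) = c \<cdot>\<^sub>m lift G n \<rho> x"
  by (rule eq_matI) (simp_all add: lift_index sum_distrib_left mult.assoc)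

end

context irrep
begin

text \<open>A class function is central in the group algebra, so Schur applies to its image.\<close>

lemma lift_class_fun:
  assumes "\<And>g h. g \<in> carrier G \<Longrightarrow> h \<in> carrier G \<Longrightarrow> y (inv h \<otimes> g \<otimes> h) = y g"
  obtains c where "lift G n \<rho> y = c \<cdot>\<^sub>m 1\<^sub>m n"
proof -
  have "\<rho> g * lift G n \<rho> y = lift G n \<rho> y * \<rho> g" if g: "g \<in> carrier G" for g
  proof -
    have "\<rho> g * lift G n \<rho> y = lift G n \<rho> (conv G (\<lambda>h. if h = g then 1 else 0) y)"
      using g by (simp add: lift_conv[OF rep] lift_delta[OF rep])
    also have "\<dots> = lift G n \<rho> (conv G y (\<lambda>h. if h = g then 1 else 0))"
    proof (rule lift_cong)
      fix k assume k: "k \<in> carrier G"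
      have "y (inv (inv g) \<otimes> (inv g \<otimes> k) \<otimes> inv g) = y (inv g \<otimes> k)"
        using g k by (intro assms) auto
      then show "conv G (\<lambda>h. if h = g then 1 else 0) y k = conv G y (\<lambda>h. if h = g then 1 else 0) k"
        using g k by (simp add: conv_delta_left conv_delta_right m_assoc)
    qed
    also have "\<dots> = lift G n \<rho> y * \<rho> g"
      using g by (simp add: lift_conv[OF rep] lift_delta[OF rep])
    finally show ?thesis .
  qed
  then show thesis using schur[OF lift_carrier] that by metis
qed

end

context fin_group
begin

text \<open>The function \<open>e\<close> is card Z times the idempotent of \<theta>, central
  because \<theta> is invariant, and \<open>nz\<close> says that y times \<open>e\<close> has a
  nonzero coefficient at g0. In a representation that detects this product, \<open>e\<close> acts as
  a nonzero scalar, and z \<open>e\<close> = \<theta>(z) \<open>e\<close> forces \<rho>(z) to be the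
  scalar \<theta>(z).\<close>

lemma irr_over_detect:
  assumes Z: "subgroup Z G" and lam: "lchar G Z \<theta>" and ci: "conj_inv G (carrier G) Z \<theta>"
    and g0: "g0 \<in> carrier G"
    and nz: "(\<Sum>h\<in>carrier G. y h * (if inv h \<otimes> g0 \<in> Z then \<theta> (inv (inv h \<otimes> g0)) else 0)) \<noteq> 0"
  obtains n \<rho> where "irr_rep G n \<rho>" "\<And>z. z \<in> Z \<Longrightarrow> \<rho> z = \<theta> z \<cdot>\<^sub>m 1\<^sub>m n" "lift G n \<rho> y \<noteq> 0\<^sub>m n n"
proof -
  interpret Z: subgroup Z G by (rule Z)
  define e where "e u = (if u \<in> Z then \<theta> (inv u) else 0)" for u
  have "conv G y e g0 \<noteq> 0" using g0 nz by (simp add: conv_def e_def)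
  then obtain n \<rho> where irr: "irr_rep G n \<rho>" and ne: "lift G n \<rho> (conv G y e) \<noteq> 0\<^sub>m n n"
    using irr_rep_detects[OF g0] by metis
  interpret irrep G n \<rho> by unfold_locales (rule irr)
  have le: "lift G n \<rho> y * lift G n \<rho> e \<noteq> 0\<^sub>m n n" using ne by (simp add: lift_conv[OF rep])
  have "e (inv h \<otimes> g \<otimes> h) = e g" if "g \<in> carrier G" "h \<in> carrier G" for g h
  proof -
    have "inv h \<otimes> g \<otimes> h \<in> Z \<longleftrightarrow> g \<in> Z"
    proof
      assume *: "inv h \<otimes> g \<otimes> h \<in> Z"
      have "inv (inv h) \<otimes> (inv h \<otimes> g \<otimes> h) \<otimes> inv h \<in> Z"
        using ci * that inv_closed[of h] unfolding conj_inv_def by blast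
      then show "g \<in> Z" using that by (simp add: m_assoc)
    qed (use ci that in \<open>auto simp: conj_inv_def\<close>)
    moreover have "inv (inv h \<otimes> g \<otimes> h) = inv h \<otimes> inv g \<otimes> h"
      using that by (simp add: inv_mult_group m_assoc)
    ultimately show ?thesis using ci that by (auto simp: e_def conj_inv_def)
  qed
  then obtain c where c: "lift G n \<rho> e = c \<cdot>\<^sub>m 1\<^sub>m n" using lift_class_fun by metis
  have c0: "c \<noteq> 0"
  proof
    assume "c = 0"
    then have "lift G n \<rho> e = 0\<^sub>m n n" using c by (intro eq_matI) simp_all
    then show False using le by simp
  qed
  have y0: "lift G n \<rho> y \<noteq> 0\<^sub>m n n"
  proof
    assume "lift G n \<rho> y = 0\<^sub>m n n"
    then show False using le by simp
  qed
  have "\<rho> z = \<theta> z \<cdot>\<^sub>m 1\<^sub>m n" if z: "z \<in> Z" for z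
  proof -
    have "lift G n \<rho> (conv G (\<lambda>h. if h = z then 1 else 0) e) = lift G n \<rho> (\<lambda>k. \<theta> z * e k)"
    proof (rule lift_cong)
      fix k assume k: "k \<in> carrier G"
      have "inv z \<otimes> k \<in> Z \<longleftrightarrow> k \<in> Z"
      proof
        assume "inv z \<otimes> k \<in> Z"
        then have "z \<otimes> (inv z \<otimes> k) \<in> Z" using z by (rule Z.m_closed[rotated])
        then show "k \<in> Z" using z k by simp
      qed (use z in simp)
      moreover have "\<theta> (inv k \<otimes> z) = \<theta> z * \<theta> (inv k)" if "k \<in> Z"
        using that z lam by (simp add: lchar_def)
      ultimately show "conv G (\<lambda>h. if h = z then 1 else 0) e k = \<theta> z * e k"
        using z k by (simp add: conv_delta_left e_def inv_mult_group)
    qed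
    then have "\<rho> z * (c \<cdot>\<^sub>m 1\<^sub>m n) = \<theta> z \<cdot>\<^sub>m (c \<cdot>\<^sub>m 1\<^sub>m n)"
      using z by (simp add: lift_conv[OF rep] lift_delta[OF rep] lift_scale c)
    then have eq: "c \<cdot>\<^sub>m \<rho> z = \<theta> z \<cdot>\<^sub>m (c \<cdot>\<^sub>m 1\<^sub>m n)"
      using z scalar_mult_mat(2)[of "\<rho> z" n c] by simp
    show ?thesis
    proof (rule eq_matI)
      fix i j assume "i < dim_row (\<theta> z \<cdot>\<^sub>m 1\<^sub>m n)" "j < dim_col (\<theta> z \<cdot>\<^sub>m 1\<^sub>m n)"
      then have ij: "i < n" "j < n" by auto
      have "(c \<cdot>\<^sub>m \<rho> z) $$ (i, j) = (\<theta> z \<cdot>\<^sub>m (c \<cdot>\<^sub>m 1\<^sub>m n)) $$ (i, j)" by (simp add: eq)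
      then show "\<rho> z $$ (i, j) = (\<theta> z \<cdot>\<^sub>m 1\<^sub>m n) $$ (i, j)" using ij c0 z by (simp split: if_splits)
    qed (use z in simp_all)
  qed
  with irr y0 show thesis by (intro that)
qed

text \<open>Separates the points of G/N without forming the quotient: the trivial character of N
  takes the place of \<theta>, and y is the identity minus g, tested at the identity.\<close>

lemma exists_irr_kernel:
  assumes N: "subgroup N G" and normal: "\<And>x g. x \<in> N \<Longrightarrow> g \<in> carrier G \<Longrightarrow> inv g \<otimes> x \<otimes> g \<in> N"
    and g: "g \<in> carrier G" "g \<notin> N"
  obtains n \<rho> where "irr_rep G n \<rho>" "\<And>x. x \<in> N \<Longrightarrow> \<rho> x = 1\<^sub>m n" "\<rho> g \<noteq> 1\<^sub>m n"
proof -
  have 1: "lchar G N (\<lambda>_. 1)" "conj_inv G (carrier G) N (\<lambda>_. 1)"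
    using normal by (auto simp: lchar_def conj_inv_def)
  define y :: "'a \<Rightarrow> complex" where "y h = (if h = \<one> then 1 else 0) - (if h = g then 1 else 0)" for h
  have "inv g \<notin> N" using g subgroup.m_inv_closed[OF N, of "inv g"] by auto
  then have "(\<Sum>h\<in>carrier G. y h * (if inv h \<otimes> \<one> \<in> N then 1 else 0)) = 1"
    using fin g subgroup.one_closed[OF N]
    by (simp add: y_def left_diff_distrib sum_subtractf if_distrib[of "\<lambda>x. x * _"] cong: if_cong)
  then have "(\<Sum>h\<in>carrier G. y h * (if inv h \<otimes> \<one> \<in> N then 1 else 0)) \<noteq> 0" by simp
  from irr_over_detect[OF N 1 one_closed this]
  obtain n \<rho> where r: "irr_rep G n \<rho>" "\<And>z. z \<in> N \<Longrightarrow> \<rho> z = 1 \<cdot>\<^sub>m 1\<^sub>m n" "lift G n \<rho> y \<noteq> 0\<^sub>m n n"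
    by metis
  interpret irrep G n \<rho> by unfold_locales (rule r(1))
  have "\<rho> g \<noteq> 1\<^sub>m n"
  proof
    assume rg: "\<rho> g = 1\<^sub>m n"
    have "lift G n \<rho> y = 0\<^sub>m n n"
    proof (rule eq_matI)
      fix i j assume "i < dim_row (0\<^sub>m n n :: complex mat)" "j < dim_col (0\<^sub>m n n :: complex mat)"
      then have ij: "i < n" "j < n" by auto
      have "lift G n \<rho> y $$ (i, j) = \<rho> \<one> $$ (i, j) - \<rho> g $$ (i, j)"
        using fin g ij by (simp add: lift_index y_def left_diff_distrib sum_subtractf if_distrib[of "\<lambda>x. x * _"] cong: if_cong)
      then show "lift G n \<rho> y $$ (i, j) = 0\<^sub>m n n $$ (i, j)" using rg rho_one ij by simp
    qed simp_all
    then show False using r(3) by simp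
  qed
  moreover have "\<rho> x = 1\<^sub>m n" if "x \<in> N" for x
    using r(2)[OF that] by (intro eq_matI) simp_all
  ultimately show thesis using r(1) that by metis
qed

text \<open>A class sum times a central idempotent has a positive coefficient at an element that is
  good with respect to the linear character, so it is detected by some irreducible character.\<close>

lemma central_type_ramified:
  assumes gvz: "GVZ G" and Z: "subgroup Z G" and lam: "lchar G Z \<theta>" and ci: "conj_inv G (carrier G) Z \<theta>"
    and over: "\<And>n \<rho>. irr_rep G n \<rho> \<Longrightarrow> (\<And>z. z \<in> Z \<Longrightarrow> \<rho> z = \<theta> z \<cdot>\<^sub>m 1\<^sub>m n) \<Longrightarrow> Zchi G (character G \<rho>) = Z"
    and g: "g \<in> carrier G" "g \<notin> Z"
  shows "\<exists>h\<in>carrier G. cmt G g h \<in> Z \<and> \<theta> (cmt G g h) \<noteq> 1"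
proof (rule ccontr)
  assume "\<not> ?thesis"
  then have good: "\<theta> (cmt G g h) = 1" if "h \<in> carrier G" "cmt G g h \<in> Z" for h using that by blast
  \<comment> \<open>The class sum of g with every coefficient multiplied by the order of the
    centraliser; counting all h avoids choosing conjugating elements.\<close>
  define y :: "'a \<Rightarrow> complex" where "y k = of_nat (card {h \<in> carrier G. h \<otimes> g \<otimes> inv h = k})" for k
  have y_sum: "(\<Sum>k\<in>carrier G. y k * f k) = (\<Sum>h\<in>carrier G. f (h \<otimes> g \<otimes> inv h))" for f
  proof -
    have "(\<Sum>h\<in>carrier G. f (h \<otimes> g \<otimes> inv h)) = (\<Sum>k\<in>carrier G. \<Sum>h\<in>{h \<in> carrier G. h \<otimes> g \<otimes> inv h = k}. f (h \<otimes> g \<otimes> inv h))"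
      using g fin by (intro sum.group[symmetric]) auto
    also have "\<dots> = (\<Sum>k\<in>carrier G. y k * f k)"
      by (intro sum.cong refl) (simp add: y_def)
    finally show ?thesis by simp
  qed
  have inv_cmt: "inv (inv (h \<otimes> g \<otimes> inv h) \<otimes> g) = cmt G g (inv h)" if "h \<in> carrier G" for h
    using that g by (simp add: cmt_def inv_mult_group m_assoc)
  have memZ: "u \<in> Z \<longleftrightarrow> inv u \<in> Z" if "u \<in> carrier G" for u
    using that subgroup.m_inv_closed[OF Z] by (metis inv_inv)
  have "(\<Sum>k\<in>carrier G. y k * (if inv k \<otimes> g \<in> Z then \<theta> (inv (inv k \<otimes> g)) else 0))
      = (\<Sum>h\<in>carrier G. if inv (h \<otimes> g \<otimes> inv h) \<otimes> g \<in> Z then \<theta> (inv (inv (h \<otimes> g \<otimes> inv h) \<otimes> g)) else 0)"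
    by (rule y_sum)
  \<comment> \<open>Since g pairs trivially, each term is 0 or 1 and nothing can cancel; h = 1
    contributes 1.\<close>
  also have "\<dots> = (\<Sum>h\<in>carrier G. if cmt G g (inv h) \<in> Z then 1 else 0)"
  proof (rule sum.cong[OF refl])
    fix h assume h: "h \<in> carrier G"
    have "inv (h \<otimes> g \<otimes> inv h) \<otimes> g \<in> Z \<longleftrightarrow> cmt G g (inv h) \<in> Z"
      using memZ[of "inv (h \<otimes> g \<otimes> inv h) \<otimes> g"] inv_cmt[OF h] h g by simp
    then show "(if inv (h \<otimes> g \<otimes> inv h) \<otimes> g \<in> Z then \<theta> (inv (inv (h \<otimes> g \<otimes> inv h) \<otimes> g)) else 0)
        = (if cmt G g (inv h) \<in> Z then 1 else 0)"
      using good[of "inv h"] h inv_cmt[OF h] by simp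
  qed
  also have "\<dots> = of_nat (card {h \<in> carrier G. cmt G g (inv h) \<in> Z})"
    using fin by (simp add: sum.If_cases Int_def)
  also have "\<dots> \<noteq> 0"
  proof -
    have "\<one> \<in> {h \<in> carrier G. cmt G g (inv h) \<in> Z}"
      using g subgroup.one_closed[OF Z] by (simp add: cmt_def)
    then show ?thesis using fin by (auto simp: card_eq_0_iff)
  qed
  finally obtain n \<rho> where r: "irr_rep G n \<rho>" "\<And>z. z \<in> Z \<Longrightarrow> \<rho> z = \<theta> z \<cdot>\<^sub>m 1\<^sub>m n" "lift G n \<rho> y \<noteq> 0\<^sub>m n n"
    using irr_over_detect[OF Z lam ci g(1), of y] by metis
  interpret irrep G n \<rho> by unfold_locales (rule r(1))
  have "g \<notin> Zchi G \<chi>" using over[OF r(1,2)] g by simp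
  then have chi0: "\<chi> g = 0" using gvz chi_Irr g by (auto simp: GVZ_def central_type_def)
  have conj: "\<chi> (h \<otimes> g \<otimes> inv h) = \<chi> g" if h: "h \<in> carrier G" for h
  proof -
    have "\<chi> (h \<otimes> g \<otimes> inv h) = mtrace (\<rho> h * \<rho> (g \<otimes> inv h))"
      using h g by (simp add: character_def m_assoc flip: rho_mult)
    also have "\<dots> = mtrace (\<rho> (g \<otimes> inv h) * \<rho> h)" using h g by (intro mtrace_comm[of _ n n]) auto
    also have "\<dots> = \<chi> g" using h g by (simp add: character_def m_assoc flip: rho_mult)
    finally show ?thesis .
  qed
  have "y (inv h \<otimes> k \<otimes> h) = y k" if kh: "k \<in> carrier G" "h \<in> carrier G" for h k
  proof -
    have "card {l \<in> carrier G. l \<otimes> g \<otimes> inv l = inv h \<otimes> k \<otimes> h} = card {l \<in> carrier G. l \<otimes> g \<otimes> inv l = k}"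
    proof (rule bij_betw_same_card[of "\<lambda>l. h \<otimes> l"], rule bij_betw_byWitness[where f' = "\<lambda>l. inv h \<otimes> l"])
      show "(\<lambda>l. h \<otimes> l) ` {l \<in> carrier G. l \<otimes> g \<otimes> inv l = inv h \<otimes> k \<otimes> h} \<subseteq> {l \<in> carrier G. l \<otimes> g \<otimes> inv l = k}"
      proof clarify
        fix l assume l: "l \<in> carrier G" "l \<otimes> g \<otimes> inv l = inv h \<otimes> k \<otimes> h"
        have "h \<otimes> l \<otimes> g \<otimes> inv (h \<otimes> l) = h \<otimes> (l \<otimes> g \<otimes> inv l) \<otimes> inv h"
          using l(1) kh g by (simp add: inv_mult_group m_assoc)
        also have "\<dots> = k" unfolding l(2) using kh by (simp add: m_assoc)
        finally show "h \<otimes> l \<in> carrier G \<and> h \<otimes> l \<otimes> g \<otimes> inv (h \<otimes> l) = k" using l kh by simp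
      qed
      show "(\<lambda>l. inv h \<otimes> l) ` {l \<in> carrier G. l \<otimes> g \<otimes> inv l = k} \<subseteq> {l \<in> carrier G. l \<otimes> g \<otimes> inv l = inv h \<otimes> k \<otimes> h}"
        using kh g by (auto simp: inv_mult_group m_assoc)
    qed (use kh in auto)
    then show ?thesis by (simp add: y_def)
  qed
  then obtain c where c: "lift G n \<rho> y = c \<cdot>\<^sub>m 1\<^sub>m n" using lift_class_fun by metis
  \<comment> \<open>The scalar by which the class sum acts is a multiple of \<chi>(g), which is 0
    because \<chi> is of central type and g lies outside its centre.\<close>
  have "of_nat n * c = mtrace (lift G n \<rho> y)" by (simp add: c mtrace_scalar)
  also have "\<dots> = (\<Sum>i<n. \<Sum>k\<in>carrier G. y k * \<rho> k $$ (i, i))" by (simp add: mtrace_def lift_index)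
  also have "\<dots> = (\<Sum>k\<in>carrier G. y k * \<chi> k)"
    by (subst sum.swap) (simp add: character_def mtrace_def sum_distrib_left)
  also have "\<dots> = (\<Sum>h\<in>carrier G. \<chi> (h \<otimes> g \<otimes> inv h))" by (rule y_sum)
  also have "\<dots> = 0" using conj chi0 by simp
  finally have "c = 0" using npos by simp
  then have "lift G n \<rho> y = 0\<^sub>m n n" using c by (intro eq_matI) simp_all
  with r(3) show False by simp
qed

end

subsection \<open>Fixed points of p-groups\<close>

text \<open>Orbit lengths are powers of p. If x0 were the only fixed point, all other orbits would
  have length divisible by p and card E would be 1 modulo p.\<close>

lemma p_group_second_fixed_point:
  fixes T (structure)
  assumes "group T" and card_T: "card (carrier T) = p ^ a" "Factorial_Ring.prime (p::nat)" and fE: "finite E"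
    and cl: "\<And>t x. t \<in> carrier T \<Longrightarrow> x \<in> E \<Longrightarrow> f t x \<in> E"
    and one: "\<And>x. x \<in> E \<Longrightarrow> f \<one> x = x"
    and mult: "\<And>s t x. s \<in> carrier T \<Longrightarrow> t \<in> carrier T \<Longrightarrow> x \<in> E \<Longrightarrow> f (s \<otimes> t) x = f s (f t x)"
    and dvd: "p dvd card E" and x0: "x0 \<in> E" "\<And>t. t \<in> carrier T \<Longrightarrow> f t x0 = x0"
  shows "\<exists>x\<in>E. x \<noteq> x0 \<and> (\<forall>t\<in>carrier T. f t x = x)"
proof (rule ccontr)
  assume no: "\<not> ?thesis"
  interpret T: group T by fact
  define \<phi> where "\<phi> t = restrict (f t) E" for t
  have inv: "f (inv t) (f t x) = x" "f t (f (inv t) x) = x" if "t \<in> carrier T" "x \<in> E" for t x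
    using that mult[of "inv t" t x] mult[of t "inv t" x] one by simp_all
  have Bij: "\<phi> t \<in> Bij E" if "t \<in> carrier T" for t
    unfolding Bij_def \<phi>_def
    using that inv cl by (auto intro!: bij_betw_byWitness[where f' = "f (inv t)"])
  have "\<phi> \<in> hom T (BijGroup E)"
  proof (rule homI)
    show "\<phi> x \<in> carrier (BijGroup E)" if "x \<in> carrier T" for x
      using Bij[OF that] by (simp add: BijGroup_def)
    show "\<phi> (x \<otimes> y) = \<phi> x \<otimes>\<^bsub>BijGroup E\<^esub> \<phi> y" if "x \<in> carrier T" "y \<in> carrier T" for x y
      using Bij that mult cl by (auto simp: BijGroup_def compose_def \<phi>_def fun_eq_iff)
  qed
  then interpret group_action T E \<phi>
    by (intro group_action.intro group_hom.intro group_hom_axioms.intro T.is_group group_BijGroup)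
  have orb: "orbit T \<phi> x = (\<lambda>t. f t x) ` carrier T" if "x \<in> E" for x
    using that by (auto simp: orbit_def \<phi>_def)
  have orb0: "orbit T \<phi> x0 = {x0}" using x0 T.one_closed by (auto simp: orb)
  have in0: "{x0} \<in> orbits T E \<phi>" using orb0 x0 by (auto simp: orbits_def)
  have pd: "p dvd card b" if b: "b \<in> orbits T E \<phi>" "b \<noteq> {x0}" for b
  proof -
    obtain x where x: "x \<in> E" "b = orbit T \<phi> x" using b by (auto simp: orbits_def)
    have "x \<noteq> x0" using x b orb0 by auto
    then obtain t where t: "t \<in> carrier T" "f t x \<noteq> x" using no x by auto
    have sub: "{x, f t x} \<subseteq> b" using x(2) orb[OF x(1)] t(1) one[OF x(1)] T.one_closed
      by (metis empty_subsetI imageI insert_subset)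
    have "b \<subseteq> E" using x cl orb by auto
    then have "card {x, f t x} \<le> card b" using sub fE by (intro card_mono) (auto intro: finite_subset)
    then have "card b \<noteq> 1" using t(2) by auto
    moreover have "card b dvd p ^ a"
      using orbit_stabilizer_theorem[OF x(1)] card_T(1) x(2) unfolding Coset.order_def by (metis dvd_triv_left)
    ultimately show ?thesis using card_T(2) by (metis dvd_power_same divides_primepow_nat power_0 dvd_power gr0I)
  qed
  have "card E = (\<Sum>b\<in>orbits T E \<phi>. card b)" using disjoint_sum[OF fE, of "\<lambda>_. 1::nat"] by simp
  also have "\<dots> = card {x0} + (\<Sum>b\<in>orbits T E \<phi> - {{x0}}. card b)"
    using in0 fE by (intro sum.remove) (auto simp: orbits_def)
  finally have e: "card E = 1 + (\<Sum>b\<in>orbits T E \<phi> - {{x0}}. card b)" by simp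
  have "p dvd (\<Sum>b\<in>orbits T E \<phi> - {{x0}}. card b)" using pd by (intro dvd_sum) auto
  then have "p dvd 1" using e dvd dvd_add_left_iff by metis
  then show False using card_T(2) by simp
qed

section \<open>Commutator subgroups [N, G]\<close>

lemma (in group) generate_conj:
  assumes "S \<subseteq> carrier G" "g \<in> carrier G" "\<And>s. s \<in> S \<Longrightarrow> inv g \<otimes> s \<otimes> g \<in> generate G S" "x \<in> generate G S"
  shows "inv g \<otimes> x \<otimes> g \<in> generate G S"
  using assms(4)
proof (induction rule: generate.induct)
  case one
  then show ?case using assms(2) generate.one by simp
next
  case (incl h)
  then show ?case by (rule assms(3))
next
  case (inv h)
  then have "inv (inv g \<otimes> h \<otimes> g) \<in> generate G S" using assms(1,3) generate_m_inv_closed by blast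
  then show ?case using inv assms(1,2) by (auto simp: inv_mult_group m_assoc subset_iff)
next
  case (eng h k)
  have hk: "h \<in> carrier G" "k \<in> carrier G" using eng(1,2) generate_in_carrier[OF assms(1)] by auto
  have "(inv g \<otimes> h \<otimes> g) \<otimes> (inv g \<otimes> k \<otimes> g) \<in> generate G S" using eng(3,4) by (rule generate.eng)
  then show ?case using hk assms(2) by (simp add: m_assoc)
qed

lemma commG_eq: "commG G N = generate G {cmt G x g | x g. x \<in> N \<and> g \<in> carrier G}"
  by (simp add: commG_def cmt_def)

context fin_group
begin

lemma cmt_set_subset: "N \<subseteq> carrier G \<Longrightarrow> {cmt G x g | x g. x \<in> N \<and> g \<in> carrier G} \<subseteq> carrier G"
  using cmt_closed by auto

lemma commG_subgroup: "N \<subseteq> carrier G \<Longrightarrow> subgroup (commG G N) G"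
  unfolding commG_eq by (rule generate_is_subgroup[OF cmt_set_subset])

lemma cmt_in_commG: "x \<in> N \<Longrightarrow> g \<in> carrier G \<Longrightarrow> cmt G x g \<in> commG G N"
  unfolding commG_eq by (rule generate.incl) auto

lemma commG_least: "subgroup H G \<Longrightarrow> (\<And>x g. x \<in> N \<Longrightarrow> g \<in> carrier G \<Longrightarrow> cmt G x g \<in> H) \<Longrightarrow> commG G N \<subseteq> H"
  unfolding commG_eq by (rule generate_subgroup_incl) auto

lemma commG_mono: "M \<subseteq> N \<Longrightarrow> commG G M \<subseteq> commG G N"
  unfolding commG_eq by (rule mono_generate) auto

lemma commG_conj:
  assumes "N \<subseteq> carrier G" "x \<in> commG G N" "h \<in> carrier G"
  shows "inv h \<otimes> x \<otimes> h \<in> commG G N"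
  unfolding commG_eq
proof (rule generate_conj[OF cmt_set_subset[OF assms(1)] assms(3)])
  fix s assume "s \<in> {cmt G x g | x g. x \<in> N \<and> g \<in> carrier G}"
  then obtain y g where s: "s = cmt G y g" "y \<in> N" "g \<in> carrier G" by auto
  then have y: "y \<in> carrier G" using assms(1) by auto
  \<comment> \<open>The identity [y, g]^h = [y, h]^-1 [y, gh] keeps the first entry y, which lies in
    N.\<close>
  have "inv h \<otimes> s \<otimes> h = inv (cmt G y h) \<otimes> cmt G y (g \<otimes> h)"
    using s(3) y assms(3) by (simp add: s(1) cmt_def inv_mult_group m_assoc)
  also have "\<dots> \<in> commG G N"
    using commG_subgroup[OF assms(1)] cmt_in_commG[OF s(2)] s(3) assms(3)
    by (intro subgroup.m_closed[of "commG G N"] subgroup.m_inv_closed[of "commG G N"]) auto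
  finally show "inv h \<otimes> s \<otimes> h \<in> generate G {cmt G x g | x g. x \<in> N \<and> g \<in> carrier G}"
    by (simp add: commG_eq)
qed (use assms(2) in \<open>simp add: commG_eq\<close>)

end

context fin_group
begin

lemma card_subgroup_pos: "subgroup H G \<Longrightarrow> 0 < card H"
  using fin subgroup.finite_imp_card_positive by blast

lemma card_subgroup_dvd: "subgroup H G \<Longrightarrow> card H dvd card (carrier G)"
  using lagrange[of H] by (metis Coset.order_def dvd_triv_right)

text \<open>T acts by conjugation on the cosets of N in M, whose number is a nontrivial power of p.
  It fixes N, hence a second coset, and being fixed means that the commutators with T fall into
  N.\<close>

lemma p_group_fixed_coset:
  assumes G: "card (carrier G) = p ^ a" "Factorial_Ring.prime p"
    and T: "subgroup T G" and M: "subgroup M G" and N: "subgroup N G"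
    and sub: "N \<subseteq> M" "M \<subseteq> T" "N \<noteq> M"
    and invM: "\<And>m t. m \<in> M \<Longrightarrow> t \<in> T \<Longrightarrow> inv t \<otimes> m \<otimes> t \<in> M"
    and invN: "\<And>m t. m \<in> N \<Longrightarrow> t \<in> T \<Longrightarrow> inv t \<otimes> m \<otimes> t \<in> N"
  shows "\<exists>g\<in>M - N. \<forall>t\<in>T. cmt G g t \<in> N"
proof -
  interpret T: subgroup T G by (rule T)
  interpret M: subgroup M G by (rule M)
  interpret N: subgroup N G by (rule N)
  interpret GT: group "G\<lparr>carrier := T\<rparr>" by (rule T.subgroup_is_group) unfold_locales
  interpret GM: group "G\<lparr>carrier := M\<rparr>" by (rule M.subgroup_is_group) unfold_locales
  define E where "E = (\<lambda>m. N #> m) ` M"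
  define f where "f t S = (\<lambda>x. t \<otimes> x \<otimes> inv t) ` S" for t S
  have invM': "t \<otimes> m \<otimes> inv t \<in> M" if "m \<in> M" "t \<in> T" for m t
    using invM[of m "inv t"] that by simp
  have invN': "t \<otimes> m \<otimes> inv t \<in> N" if "m \<in> N" "t \<in> T" for m t
    using invN[of m "inv t"] that by simp
  have fN: "f t (N #> m) = N #> (t \<otimes> m \<otimes> inv t)" if "t \<in> T" "m \<in> M" for t m
  proof
    show "f t (N #> m) \<subseteq> N #> (t \<otimes> m \<otimes> inv t)"
    proof
      fix y assume "y \<in> f t (N #> m)"
      then obtain x where x: "x \<in> N" "y = t \<otimes> (x \<otimes> m) \<otimes> inv t" by (auto simp: f_def r_coset_def)
      then have "y = (t \<otimes> x \<otimes> inv t) \<otimes> (t \<otimes> m \<otimes> inv t)" using that by (simp add: m_assoc)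
      then show "y \<in> N #> (t \<otimes> m \<otimes> inv t)" using invN'[OF x(1) that(1)] by (auto simp: r_coset_def)
    qed
    show "N #> (t \<otimes> m \<otimes> inv t) \<subseteq> f t (N #> m)"
    proof
      fix y assume "y \<in> N #> (t \<otimes> m \<otimes> inv t)"
      then obtain x where x: "x \<in> N" "y = x \<otimes> (t \<otimes> m \<otimes> inv t)" by (auto simp: r_coset_def)
      then have "y = t \<otimes> ((inv t \<otimes> x \<otimes> t) \<otimes> m) \<otimes> inv t" using that by (simp add: m_assoc)
      then show "y \<in> f t (N #> m)" using invN[OF x(1) that(1)] by (auto simp: r_coset_def f_def)
    qed
  qed
  obtain i where i: "card T = p ^ i"
    using card_subgroup_dvd[OF T] G by (metis divides_primepow_nat)
  have "\<exists>S\<in>E. S \<noteq> N \<and> (\<forall>t\<in>carrier (G\<lparr>carrier := T\<rparr>). f t S = S)"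
  proof (rule p_group_second_fixed_point[OF GT.is_group])
    show "card (carrier (G\<lparr>carrier := T\<rparr>)) = p ^ i" using i by simp
    show "Factorial_Ring.prime p" by (rule G(2))
    show fE: "finite E" unfolding E_def using M.subset fin finite_subset by auto
    show "f t S \<in> E" if "t \<in> carrier (G\<lparr>carrier := T\<rparr>)" "S \<in> E" for t S
      using that fN invM' by (auto simp: E_def)
    show "f \<one>\<^bsub>G\<lparr>carrier := T\<rparr>\<^esub> S = S" if "S \<in> E" for S
      using that fN[OF T.one_closed] by (auto simp: E_def)
    show "f (s \<otimes>\<^bsub>G\<lparr>carrier := T\<rparr>\<^esub> t) S = f s (f t S)"
      if st: "s \<in> carrier (G\<lparr>carrier := T\<rparr>)" "t \<in> carrier (G\<lparr>carrier := T\<rparr>)" "S \<in> E" for s t S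
    proof -
      obtain m where m: "m \<in> M" "S = N #> m" using st(3) by (auto simp: E_def)
      show ?thesis using st m invM'[of m t] by (simp add: fN inv_mult_group m_assoc)
    qed
    show "N \<in> E" unfolding E_def using coset_mult_one[OF N.subset] M.one_closed by (metis imageI)
    show "f t N = N" if "t \<in> carrier (G\<lparr>carrier := T\<rparr>)" for t
      using that fN[of t \<one>] coset_mult_one[OF N.subset] by simp
    have "rcosets\<^bsub>G\<lparr>carrier := M\<rparr>\<^esub> N = E" by (auto simp: RCOSETS_def r_coset_def E_def)
    moreover have "subgroup N (G\<lparr>carrier := M\<rparr>)" by (rule subgroup_incl[OF N M sub(1)])
    ultimately have c: "card E * card N = card M"
      using GM.lagrange[of N] by (simp add: Coset.order_def)
    have "card N < card M" using sub M.subset fin by (intro psubset_card_mono) (auto intro: finite_subset)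
    then have "card E \<noteq> 1" using c by auto
    moreover have "card E dvd p ^ a" using c card_subgroup_dvd[OF M] G(1) by (metis dvd_mult_left)
    ultimately show "p dvd card E" using G(2) by (metis divides_primepow_nat dvd_power gr0I power_0)
  qed
  then obtain m where m: "m \<in> M" "N #> m \<noteq> N" "\<And>t. t \<in> T \<Longrightarrow> f t (N #> m) = N #> m" by (auto simp: E_def)
  have "m \<notin> N" using m(2) coset_join2[OF _ N] M.subset m(1) by auto
  moreover have "cmt G m t \<in> N" if t: "t \<in> T" for t
  proof -
    have "inv t \<otimes> m \<otimes> t \<in> N #> m"
      using fN[of "inv t" m] m(3)[of "inv t"] rcos_self[OF _ N, of "inv t \<otimes> m \<otimes> t"] t m(1) by simp
    then obtain x where x: "x \<in> N" "inv t \<otimes> m \<otimes> t = x \<otimes> m" by (auto simp: r_coset_def)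
    have "cmt G m t = inv m \<otimes> (inv t \<otimes> m \<otimes> t)" using t m(1) by (simp add: cmt_def m_assoc)
    also have "\<dots> = inv m \<otimes> x \<otimes> m" unfolding x(2) using x(1) m(1) by (simp add: m_assoc)
    finally show ?thesis using invN[OF x(1), of m] m(1) sub(2) by auto
  qed
  ultimately show ?thesis using m(1) by blast
qed

end


subsection \<open>The chain of centres\<close>

locale nested_gvz = fin_group +
  fixes p n :: nat and \<delta> :: "nat \<Rightarrow> nat"
  assumes prime_p: "Factorial_Ring.prime p" and p_group: "\<exists>k. card (carrier G) = p ^ k"
    and ngvz: "nested_GVZ G" and \<delta>0: "\<delta> 0 = 0" and \<delta>_less: "\<forall>i<n. \<delta> i < \<delta> (Suc i)"
    and cd_eq: "cd G = {p ^ \<delta> i | i. i \<le> n}"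
begin

abbreviation ZZ :: "nat \<Rightarrow> 'a set" where "ZZ r \<equiv> Zdelta G p \<delta> r"
abbreviation KK :: "nat \<Rightarrow> 'a set" where "KK r \<equiv> commG G (ZZ r)"

lemma \<delta>_strict: "i < j \<Longrightarrow> j \<le> n \<Longrightarrow> \<delta> i < \<delta> j"
proof (induction j)
  case (Suc j)
  then show ?case using \<delta>_less by (cases "i = j") (auto intro: less_trans[of "\<delta> i" "\<delta> j"])
qed simp

lemma ZZ_irrep:
  assumes "i \<le> n"
  obtains \<rho> where "irr_rep G (p ^ \<delta> i) \<rho>" "ZZ i = Zchi G (character G \<rho>)"
proof -
  define c where "c = (SOME \<chi>. \<chi> \<in> Irr G \<and> \<chi> \<one> = of_nat (p ^ \<delta> i))"
  have "p ^ \<delta> i \<in> cd G" using cd_eq assms by auto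
  then have "\<exists>\<chi>. \<chi> \<in> Irr G \<and> \<chi> \<one> = of_nat (p ^ \<delta> i)" by (auto simp: cd_def)
  then have c: "c \<in> Irr G \<and> c \<one> = of_nat (p ^ \<delta> i)" unfolding c_def by (rule someI_ex)
  then obtain m \<rho> where r: "irr_rep G m \<rho>" "c = character G \<rho>" by (auto simp: Irr_def)
  interpret irrep G m \<rho> by unfold_locales (rule r(1))
  have "m = p ^ \<delta> i" using chi_one c r(2) by (metis of_nat_eq_iff)
  then show thesis using that[of \<rho>] r by (simp add: Zdelta_def c_def)
qed

lemma ZZ_card:
  assumes "i \<le> n"
  shows "(p ^ \<delta> i)\<^sup>2 * card (ZZ i) = card (carrier G)"
proof -
  obtain \<rho> where r: "irr_rep G (p ^ \<delta> i) \<rho>" "ZZ i = Zchi G (character G \<rho>)" using ZZ_irrep[OF assms] .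
  interpret irrep G "p ^ \<delta> i" \<rho> by unfold_locales (rule r(1))
  show ?thesis using central_type_card ngvz chi_Irr r(2) by (auto simp: nested_GVZ_def GVZ_def)
qed

lemma ZZ_subgroup:
  assumes "i \<le> n"
  shows "subgroup (ZZ i) G"
proof -
  obtain \<rho> where r: "irr_rep G (p ^ \<delta> i) \<rho>" "ZZ i = Zchi G (character G \<rho>)" using ZZ_irrep[OF assms] .
  interpret irrep G "p ^ \<delta> i" \<rho> by unfold_locales (rule r(1))
  show ?thesis using Zchi_subgroup r(2) by simp
qed

lemma ZZ_carrier: "i \<le> n \<Longrightarrow> ZZ i \<subseteq> carrier G"
  using ZZ_subgroup subgroup.subset by blast

lemma ZZ_conj:
  assumes "i \<le> n" "z \<in> ZZ i" "g \<in> carrier G"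
  shows "inv g \<otimes> z \<otimes> g \<in> ZZ i"
proof -
  obtain \<rho> where r: "irr_rep G (p ^ \<delta> i) \<rho>" "ZZ i = Zchi G (character G \<rho>)" using ZZ_irrep[OF assms(1)] .
  interpret irrep G "p ^ \<delta> i" \<rho> by unfold_locales (rule r(1))
  show ?thesis using Zchi_conj(1) assms r(2) by simp
qed

text \<open>Shows that \<open>ZZ i\<close> is independent of the choice made in
  \<open>Zdelta\<close>: equal degrees give centres of equal order by
  \<open>central_type_card\<close>, and nestedness makes one contain the other.\<close>

lemma irrep_ZZ:
  assumes "irr_rep G m \<rho>"
  obtains i where "i \<le> n" "m = p ^ \<delta> i" "Zchi G (character G \<rho>) = ZZ i"
proof -
  interpret irrep G m \<rho> by unfold_locales (rule assms)
  have "m \<in> cd G" using chi_Irr chi_one by (auto simp: cd_def)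
  then obtain i where i: "i \<le> n" "m = p ^ \<delta> i" using cd_eq by auto
  obtain \<sigma> where s: "irr_rep G (p ^ \<delta> i) \<sigma>" "ZZ i = Zchi G (character G \<sigma>)" using ZZ_irrep[OF i(1)] .
  interpret s: irrep G "p ^ \<delta> i" \<sigma> by unfold_locales (rule s(1))
  have "m\<^sup>2 * card (Zchi G \<chi>) = card (carrier G)"
    using central_type_card ngvz chi_Irr by (auto simp: nested_GVZ_def GVZ_def)
  then have "card (Zchi G \<chi>) = card (ZZ i)"
    using ZZ_card[OF i(1)] i(2) npos by (metis mult_left_cancel power_not_zero less_not_refl2)
  moreover have "Zchi G \<chi> \<subseteq> ZZ i \<or> ZZ i \<subseteq> Zchi G \<chi>"
    using ngvz chi_Irr s.chi_Irr s(2) by (auto simp: nested_GVZ_def nested_def)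
  moreover have "finite (ZZ i)" "finite (Zchi G \<chi>)"
    using finite_subset[OF _ fin] ZZ_carrier[OF i(1)] Zchi_subgroup subgroup.subset by blast+
  ultimately have "Zchi G \<chi> = ZZ i" using card_subset_eq by metis
  then show thesis using that i by blast
qed

text \<open>Nestedness makes the two centres comparable; a larger degree means a smaller centre by
  \<open>ZZ_card\<close>, which decides the direction.\<close>

lemma ZZ_strict:
  assumes "i < j" "j \<le> n"
  shows "ZZ j \<subset> ZZ i"
proof -
  have i: "i \<le> n" using assms by simp
  obtain \<rho> where r: "irr_rep G (p ^ \<delta> i) \<rho>" "ZZ i = Zchi G (character G \<rho>)" using ZZ_irrep[OF i] .
  obtain \<sigma> where s: "irr_rep G (p ^ \<delta> j) \<sigma>" "ZZ j = Zchi G (character G \<sigma>)" using ZZ_irrep[OF assms(2)] .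
  have "character G \<rho> \<in> Irr G" "character G \<sigma> \<in> Irr G" using r(1) s(1) by (auto simp: Irr_def)
  then have n: "ZZ i \<subseteq> ZZ j \<or> ZZ j \<subseteq> ZZ i"
    using ngvz r(2) s(2) by (auto simp: nested_GVZ_def nested_def)
  have fin': "finite (ZZ i)" "finite (ZZ j)"
    using finite_subset[OF _ fin] ZZ_carrier i assms(2) by blast+
  have "(p ^ \<delta> i)\<^sup>2 < (p ^ \<delta> j)\<^sup>2"
    using \<delta>_strict[OF assms] prime_gt_1_nat[OF prime_p] by (intro power_strict_mono power_strict_increasing) auto
  moreover have "(p ^ \<delta> i)\<^sup>2 * card (ZZ i) = (p ^ \<delta> j)\<^sup>2 * card (ZZ j)"
    using ZZ_card i assms(2) by simp
  moreover have "0 < card (ZZ i)" using card_subgroup_pos ZZ_subgroup[OF i] by simp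
  ultimately have lt: "card (ZZ j) < card (ZZ i)"
    using mult_less_le_imp_less[of "(p ^ \<delta> i)\<^sup>2" "(p ^ \<delta> j)\<^sup>2" "card (ZZ i)" "card (ZZ j)"]
    by (intro notI[THEN not_le_imp_less]) simp_all
  have "\<not> ZZ i \<subseteq> ZZ j" using card_mono[OF fin'(2), of "ZZ i"] lt by auto
  then show ?thesis using n by blast
qed

lemma ZZ_antimono: "i \<le> j \<Longrightarrow> j \<le> n \<Longrightarrow> ZZ j \<subseteq> ZZ i"
  using ZZ_strict[of i j] by (cases "i = j") auto

lemma ZZ_0: "ZZ 0 = carrier G"
proof -
  have "card (ZZ 0) = card (carrier G)" using ZZ_card[of 0] by (simp add: \<delta>0)
  then show ?thesis using card_subset_eq[OF fin ZZ_carrier[of 0]] by simp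
qed

lemma KK_subgroup: "i \<le> n \<Longrightarrow> subgroup (KK i) G"
  using commG_subgroup ZZ_carrier by blast

lemma KK_mono: "i \<le> j \<Longrightarrow> j \<le> n \<Longrightarrow> KK j \<subseteq> KK i"
  using commG_mono ZZ_antimono by blast

text \<open>Z_n lies in every Z(\<chi>), so its commutators with G lie in the kernel of every
  irreducible representation, and these kernels meet trivially.\<close>

lemma KK_n: "KK n = {\<one>}"
proof -
  have sg: "subgroup {\<one>} G" by (rule triv_subgroup)
  have "cmt G x g \<in> {\<one>}" if xg: "x \<in> ZZ n" "g \<in> carrier G" for x g
  proof (rule ccontr)
    assume c1: "cmt G x g \<notin> {\<one>}"
    have x: "x \<in> carrier G" using xg ZZ_carrier by blast
    obtain m \<rho> where r: "irr_rep G m \<rho>" "\<rho> (cmt G x g) \<noteq> 1\<^sub>m m"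
    proof (rule exists_irr_kernel[OF sg _ cmt_closed[OF x xg(2)] c1])
      show "inv h \<otimes> y \<otimes> h \<in> {\<one>}" if "y \<in> {\<one>}" "h \<in> carrier G" for y h using that by simp
    qed (rule that)
    interpret irrep G m \<rho> by unfold_locales (rule r(1))
    obtain i where i: "i \<le> n" "Zchi G \<chi> = ZZ i" using irrep_ZZ[OF r(1)] by metis
    then have "x \<in> Zchi G \<chi>" using xg ZZ_antimono by blast
    then show False using Zchi_iff_comm r(2) xg(2) by (simp add: cmt_def)
  qed
  then have "KK n \<subseteq> {\<one>}" by (rule commG_least[OF sg])
  then show ?thesis using subgroup.one_closed[OF KK_subgroup] by blast
qed

text \<open>Take g in Z_(r-1), outside Z_r, and central modulo Z_r; then N = [g, G] lies in Z_r. An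
  irreducible representation trivial on N has g in its centre, so its centre is some Z_i with i < r.
  It contains Z_(r-1), and the representation kills [Z_(r-1), G]. As such representations separate
  the elements of G/N, [Z_(r-1), G] lies in N.\<close>

lemma KK_le_ZZ:
  assumes "1 \<le> r" "r \<le> n"
  shows "KK (r - 1) \<subseteq> ZZ r"
proof -
  have r1: "r - 1 \<le> n" using assms by simp
  obtain k where k: "card (carrier G) = p ^ k" using p_group by blast
  have "ZZ r \<subset> ZZ (r - 1)" using ZZ_strict[of "r - 1" r] assms by simp
  then have "\<exists>g\<in>ZZ (r - 1) - ZZ r. \<forall>t\<in>carrier G. cmt G g t \<in> ZZ r"
    using assms r1 ZZ_subgroup ZZ_conj ZZ_carrier
    by (intro p_group_fixed_coset[OF k prime_p subgroup_self]) auto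
  then obtain g where g: "g \<in> ZZ (r - 1)" "g \<notin> ZZ r" "\<And>t. t \<in> carrier G \<Longrightarrow> cmt G g t \<in> ZZ r" by blast
  have gc: "g \<in> carrier G" using g(1) ZZ_carrier[OF r1] by blast
  define N where "N = commG G {g}"
  have N: "subgroup N G" unfolding N_def using gc by (intro commG_subgroup) simp
  have Nc: "inv h \<otimes> x \<otimes> h \<in> N" if "x \<in> N" "h \<in> carrier G" for x h
    using commG_conj[of "{g}"] gc that by (simp add: N_def)
  have "N \<subseteq> ZZ r" unfolding N_def using g(3) by (intro commG_least[OF ZZ_subgroup[OF assms(2)]]) auto
  moreover have "cmt G x t \<in> N" if xt: "x \<in> ZZ (r - 1)" "t \<in> carrier G" for x t
  proof (rule ccontr)
    assume c: "cmt G x t \<notin> N"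
    have x: "x \<in> carrier G" using xt ZZ_carrier[OF r1] by blast
    obtain m \<rho> where r: "irr_rep G m \<rho>" "\<And>y. y \<in> N \<Longrightarrow> \<rho> y = 1\<^sub>m m" "\<rho> (cmt G x t) \<noteq> 1\<^sub>m m"
      using exists_irr_kernel[OF N Nc cmt_closed[OF x xt(2)] c] by metis
    interpret irrep G m \<rho> by unfold_locales (rule r(1))
    have "\<rho> (cmt G g h) = 1\<^sub>m m" if "h \<in> carrier G" for h
      using that by (intro r(2)) (auto simp: N_def intro: cmt_in_commG)
    then have "g \<in> Zchi G \<chi>" using gc Zchi_iff_comm by (simp add: cmt_def)
    moreover obtain i where i: "i \<le> n" "Zchi G \<chi> = ZZ i" using irrep_ZZ[OF r(1)] by metis
    ultimately have "\<not> r \<le> i" using g(2) ZZ_antimono[of r i] by blast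
    then have "i \<le> r - 1" by simp
    then have "x \<in> Zchi G \<chi>" using xt(1) ZZ_antimono[of i "r - 1"] r1 i(2) by auto
    then show False using Zchi_iff_comm r(3) xt(2) by (simp add: cmt_def)
  qed
  then have "KK (r - 1) \<subseteq> N" by (rule commG_least[OF N])
  ultimately show ?thesis by blast
qed

text \<open>An irreducible representation over \<theta> has a centre Z_i containing Z_r. If it were
  larger it would contain Z_(r-1), and the kernel would contain [Z_(r-1), G] and hence k, against
  \<theta>(k) \<noteq> 1. So the centre is Z_r and \<open>central_type_ramified\<close>
  applies.\<close>

lemma ZZ_ramified:
  assumes r: "1 \<le> r" "r \<le> n" and th: "lchar G (ZZ r) \<theta>" "conj_inv G (carrier G) (ZZ r) \<theta>"
    and k: "k \<in> KK (r - 1)" "\<theta> k \<noteq> 1" and g: "g \<in> carrier G" "g \<notin> ZZ r"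
  shows "\<exists>h\<in>carrier G. cmt G g h \<in> ZZ r \<and> \<theta> (cmt G g h) \<noteq> 1"
proof (rule central_type_ramified[OF _ ZZ_subgroup[OF r(2)] th _ g])
  show "GVZ G" using ngvz by (simp add: nested_GVZ_def)
  fix m \<rho> assume irr: "irr_rep G m \<rho>" and over: "\<And>z. z \<in> ZZ r \<Longrightarrow> \<rho> z = \<theta> z \<cdot>\<^sub>m 1\<^sub>m m"
  interpret irrep G m \<rho> by unfold_locales (rule irr)
  obtain i where i: "i \<le> n" "Zchi G \<chi> = ZZ i" using irrep_ZZ[OF irr] by metis
  have sub: "ZZ r \<subseteq> ZZ i"
  proof
    fix z assume z: "z \<in> ZZ r"
    then have "z \<in> carrier G" using ZZ_carrier[OF r(2)] by blast
    then show "z \<in> ZZ i" using over[OF z] Zchi_iff i(2) by metis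
  qed
  have "i \<le> r" using ZZ_strict[of r i] sub i(1) by (metis leI psubsetE)
  moreover have "i \<noteq> r - 1" "\<not> i < r - 1"
  proof -
    have "\<not> ZZ (r - 1) \<subseteq> ZZ i"
    proof
      assume s: "ZZ (r - 1) \<subseteq> ZZ i"
      define H where "H = {x \<in> carrier G. \<rho> x = 1\<^sub>m m}"
      have "subgroup H G"
      proof
        show "inv x \<in> H" if "x \<in> H" for x
          using that rho_inverse(1)[of x] by (simp add: H_def)
      qed (auto simp: H_def rho_one rho_mult)
      moreover have "cmt G x t \<in> H" if "x \<in> ZZ (r - 1)" "t \<in> carrier G" for x t
      proof -
        have "x \<in> Zchi G \<chi>" using that s i(2) by blast
        then show ?thesis using Zchi_iff_comm that(2) by (auto simp: H_def cmt_def)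
      qed
      ultimately have "KK (r - 1) \<subseteq> H" by (rule commG_least)
      then have "k \<in> H" using k(1) by (rule subsetD)
      moreover have "k \<in> ZZ r" using KK_le_ZZ[OF r] k(1) by (rule subsetD)
      ultimately have "\<theta> k \<cdot>\<^sub>m 1\<^sub>m m = (1\<^sub>m m :: complex mat)" using over[of k] by (simp add: H_def)
      then have "(\<theta> k \<cdot>\<^sub>m 1\<^sub>m m) $$ (0, 0) = (1\<^sub>m m :: complex mat) $$ (0, 0)" by simp
      then show False using npos k(2) by simp
    qed
    then show "i \<noteq> r - 1" "\<not> i < r - 1" using ZZ_antimono[of i "r - 1"] diff_le_self[of r 1] r(2)
      by (meson le_trans order_refl, meson le_trans less_imp_le)
  qed
  ultimately have "i = r" by linarith
  then show "Zchi G \<chi> = ZZ r" using i(2) by simp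
qed

end

subsection \<open>Polarisations of fully ramified characters\<close>

lemma power_gcd_eq_1:
  fixes v :: "'a :: field"
  assumes "v ^ a = 1" "v ^ b = 1"
  shows "v ^ gcd a b = 1"
proof (cases "a = 0")
  case False
  then obtain x y where "a * x = b * y + gcd a b" using bezout_nat by blast
  then have "v ^ (a * x) = v ^ (b * y) * v ^ gcd a b" by (simp add: power_add)
  then show ?thesis using assms by (simp add: power_mult)
qed (use assms in simp)

text \<open>The exact order of v is p^(m+1), since the gcd of p^(m+1) with a smaller exponent
  divides p^m. Its powers are therefore distinct and exhaust the p^(m+1)-th roots of unity.\<close>

lemma primitive_prime_power_root:
  fixes v :: complex
  assumes p: "Factorial_Ring.prime p" and v: "v ^ p ^ Suc m = 1" "v ^ p ^ m \<noteq> 1" and u: "u ^ p ^ Suc m = 1"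
  obtains j where "u = v ^ j"
proof -
  have p0: "0 < p ^ Suc m" using prime_gt_0_nat[OF p] by simp
  have ord: "v ^ k \<noteq> 1" if k: "0 < k" "k < p ^ Suc m" for k
  proof
    assume "v ^ k = 1"
    then have g: "v ^ gcd k (p ^ Suc m) = 1" using power_gcd_eq_1 v(1) by blast
    obtain e where e: "e \<le> Suc m" "gcd k (p ^ Suc m) = p ^ e"
      using divides_primepow_nat[OF p] gcd_dvd2 by blast
    have "e \<noteq> Suc m" using e k gcd_le1_nat[of k "p ^ Suc m"] by auto
    then have "p ^ e dvd p ^ m" using e(1) by (intro le_imp_power_dvd) simp
    then have "v ^ p ^ m = 1" using g e(2) by (auto simp: power_mult elim!: dvdE)
    then show False using v(2) by simp
  qed
  have v0: "v \<noteq> 0" using v(1) p0 by (auto simp: power_0_left)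
  have inj: "inj_on (\<lambda>j. v ^ j) {..<p ^ Suc m}"
  proof (rule linorder_inj_onI)
    fix i j assume ij: "i < j" "i \<in> {..<p ^ Suc m}" "j \<in> {..<p ^ Suc m}"
    show "v ^ i \<noteq> v ^ j"
    proof
      assume "v ^ i = v ^ j"
      also have "v ^ j = v ^ i * v ^ (j - i)" using ij by (simp flip: power_add)
      finally have "v ^ (j - i) = 1" using v0 by simp
      then show False using ord[of "j - i"] less_imp_diff_less[of j "p ^ Suc m" i] ij by (simp del: power_Suc)
    qed
  qed auto
  have "(\<lambda>j. v ^ j) ` {..<p ^ Suc m} = {z. z ^ p ^ Suc m = 1}"
  proof (rule card_subset_eq)
    show "finite {z::complex. z ^ p ^ Suc m = 1}" using finite_roots_unity[of "p ^ Suc m"] p0 by simp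
    show "(\<lambda>j. v ^ j) ` {..<p ^ Suc m} \<subseteq> {z. z ^ p ^ Suc m = 1}"
    proof clarify
      fix j :: nat
      have "(v ^ j) ^ p ^ Suc m = (v ^ p ^ Suc m) ^ j" by (simp only: power_mult[symmetric] mult.commute)
      then show "(v ^ j) ^ p ^ Suc m = 1" using v(1) by simp
    qed
    show "card ((\<lambda>j. v ^ j) ` {..<p ^ Suc m}) = card {z::complex. z ^ p ^ Suc m = 1}"
      using inj card_roots_unity_eq[OF p0] by (simp add: card_image)
  qed
  then show thesis using u that by blast
qed

context fin_group
begin

lemma mult_closed_subgroup:
  assumes "S \<subseteq> carrier G" "\<one> \<in> S" "\<And>x y. x \<in> S \<Longrightarrow> y \<in> S \<Longrightarrow> x \<otimes> y \<in> S"
  shows "subgroup S G"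
proof
  fix x assume x: "x \<in> S"
  then have xc: "x \<in> carrier G" using assms(1) by blast
  have pow: "x [^] (k::nat) \<in> S" for k using assms x by (induction k) auto
  have "0 < Coset.order G" using fin order_gt_0_iff_finite by blast
  then have "x [^] (Coset.order G - 1) \<otimes> x = \<one>"
    using pow_order_eq_1[OF xc] nat_pow_Suc[of x "Coset.order G - 1"] by simp
  then have "inv x = x [^] (Coset.order G - 1)" using xc by (intro inv_equality) auto
  then show "inv x \<in> S" using pow by simp
qed (use assms in auto)

lemma subgroup_pow_closed: "subgroup S G \<Longrightarrow> x \<in> S \<Longrightarrow> x [^] (k::nat) \<in> S"
  by (induction k) (auto simp: subgroup.one_closed subgroup.m_closed)

lemma prime_pow_mem_iff:
  assumes Y: "subgroup Y G" and p: "Factorial_Ring.prime p" and x: "x \<in> carrier G" "x \<notin> Y" "x [^] p \<in> Y"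
  shows "x [^] (i::nat) \<in> Y \<longleftrightarrow> p dvd i"
proof
  assume i: "x [^] i \<in> Y"
  show "p dvd i"
  proof (rule ccontr)
    assume "\<not> p dvd i"
    then have "coprime p i" using p prime_imp_coprime by blast
    moreover have "i \<noteq> 0" using \<open>\<not> p dvd i\<close> by (intro notI) simp
    ultimately obtain a b where ab: "i * a = p * b + 1" using bezout_nat[of i p] by (metis coprime_iff_gcd_eq_1 gcd.commute)
    have "(x [^] i) [^] a = (x [^] p) [^] b \<otimes> x"
      using x(1) ab by (simp add: nat_pow_pow nat_pow_mult[of x _ 1, simplified])
    then have "x = inv ((x [^] p) [^] b) \<otimes> (x [^] i) [^] a"
      using x(1) by simp
    also have "\<dots> \<in> Y"
      by (rule subgroup.m_closed[OF Y subgroup.m_inv_closed[OF Y subgroup_pow_closed[OF Y x(3)]] subgroup_pow_closed[OF Y i]])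
    finally show False using x(2) by simp
  qed
next
  assume "p dvd i"
  then obtain k where "i = p * k" by (rule dvdE)
  then show "x [^] i \<in> Y" using subgroup_pow_closed[OF Y x(3), of k] x(1) by (simp add: nat_pow_pow)
qed

lemma card_prime_extension:
  assumes Y: "subgroup Y G" and p: "Factorial_Ring.prime p" and x: "x \<in> carrier G" "x \<notin> Y" "x [^] p \<in> Y"
    and S: "S = {y \<otimes> x [^] i | y i. y \<in> Y \<and> i < p}"
  shows "card S = p * card Y"
proof -
  interpret Y: subgroup Y G by (rule Y)
  have aux: "i = j" if "y \<otimes> x [^] i = y' \<otimes> x [^] j" "y \<in> Y" "y' \<in> Y" "i < p" "j < p" "i \<le> j" for y y' and i j :: nat
  proof -
    have "y \<otimes> x [^] i = y' \<otimes> x [^] (j - i) \<otimes> x [^] i"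
      using that x(1) by (simp add: m_assoc nat_pow_mult)
    then have "y = y' \<otimes> x [^] (j - i)" using x(1) that by simp
    then have "x [^] (j - i) = inv y' \<otimes> y" using that x(1) by simp
    then have "x [^] (j - i) \<in> Y" using that by simp
    then have "p dvd j - i" using prime_pow_mem_iff[OF Y p x] by simp
    then show ?thesis using that by (auto dest: dvd_imp_le)
  qed
  have "bij_betw (\<lambda>(y, i). y \<otimes> x [^] i) (Y \<times> {..<p}) S"
    unfolding bij_betw_def
  proof
    show "inj_on (\<lambda>(y, i). y \<otimes> x [^] i) (Y \<times> {..<p})"
    proof (rule inj_onI)
      fix b c assume "b \<in> Y \<times> {..<p}" "c \<in> Y \<times> {..<p}" "(\<lambda>(y, i). y \<otimes> x [^] i) b = (\<lambda>(y, i). y \<otimes> x [^] i) c"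
      then obtain y i y' j where bc: "b = (y, i)" "c = (y', j)"
        and a: "y \<in> Y" "y' \<in> Y" "i < p" "j < p" "y \<otimes> x [^] i = y' \<otimes> x [^] j"
        by (cases b; cases c) simp
      have "i = j" using aux[of y i y' j] aux[of y' j y i] a by (cases "i \<le> j") simp_all
      then show "b = c" using a x(1) bc by simp
    qed
    show "(\<lambda>(y, i). y \<otimes> x [^] i) ` (Y \<times> {..<p}) = S" by (auto simp: S)
  qed
  from bij_betw_same_card[OF this] show ?thesis by (simp add: card_cartesian_product mult.commute)
qed

end

section \<open>Invariant linear characters and their commutator pairing\<close>

locale inv_char = fin_group +
  fixes T Z :: "'a set" and \<theta> :: "'a \<Rightarrow> complex"
  assumes T: "subgroup T G" and Z: "subgroup Z G" and ZT: "Z \<subseteq> T"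
    and lchar: "lchar G Z \<theta>" and conj_inv: "conj_inv G T Z \<theta>"
begin

sublocale T: subgroup T G by (rule T)
sublocale Z: subgroup Z G by (rule Z)

lemma Z_T [simp]: "z \<in> Z \<Longrightarrow> z \<in> T" using ZT by blast

lemma T_pow [simp]: "t \<in> T \<Longrightarrow> t [^] (k::nat) \<in> T"
  by (rule subgroup_pow_closed[OF T])

lemma Z_pow [simp]: "t \<in> Z \<Longrightarrow> t [^] (k::nat) \<in> Z"
  by (rule subgroup_pow_closed[OF Z])

lemma th_one [simp]: "\<theta> \<one> = 1" using lchar by (simp add: lchar_def)

lemma th_mult [simp]: "x \<in> Z \<Longrightarrow> y \<in> Z \<Longrightarrow> \<theta> (x \<otimes> y) = \<theta> x * \<theta> y"
  using lchar by (simp add: lchar_def)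

lemma th_pow [simp]: "x \<in> Z \<Longrightarrow> \<theta> (x [^] (k::nat)) = \<theta> x ^ k"
  by (induction k) (simp_all add: mult.commute)

lemmas th_inv = lchar_inv[OF Z lchar]

lemma conj_mem: "z \<in> Z \<Longrightarrow> t \<in> T \<Longrightarrow> inv t \<otimes> z \<otimes> t \<in> Z" "z \<in> Z \<Longrightarrow> t \<in> T \<Longrightarrow> \<theta> (inv t \<otimes> z \<otimes> t) = \<theta> z"
  using conj_inv by (auto simp: conj_inv_def)

text \<open>Since [xy, t] = [x, t]^y [y, t] and \<theta> is invariant under T, the pairing
  \<theta>([x, t]) is multiplicative in x wherever the commutators lie in Z;
  \<open>cmt_right\<close> is the other side. All that follows is linear algebra with this partially
  defined form.\<close>

lemma cmt_left:
  assumes "x \<in> T" "y \<in> T" "t \<in> T" "cmt G x t \<in> Z" "cmt G y t \<in> Z"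
  shows "cmt G (x \<otimes> y) t \<in> Z" "\<theta> (cmt G (x \<otimes> y) t) = \<theta> (cmt G x t) * \<theta> (cmt G y t)"
proof -
  have "cmt G (x \<otimes> y) t = (inv y \<otimes> cmt G x t \<otimes> y) \<otimes> cmt G y t"
    using assms(1-3) by (simp add: cmt_def m_assoc inv_mult_group)
  then show "cmt G (x \<otimes> y) t \<in> Z" "\<theta> (cmt G (x \<otimes> y) t) = \<theta> (cmt G x t) * \<theta> (cmt G y t)"
    using conj_mem[OF assms(4,2)] assms(5) by simp_all
qed

lemma cmt_right:
  assumes "x \<in> T" "s \<in> T" "t \<in> T" "cmt G x s \<in> Z" "cmt G x t \<in> Z"
  shows "cmt G x (s \<otimes> t) \<in> Z" "\<theta> (cmt G x (s \<otimes> t)) = \<theta> (cmt G x s) * \<theta> (cmt G x t)"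
proof -
  have "cmt G x (s \<otimes> t) = cmt G x t \<otimes> (inv t \<otimes> cmt G x s \<otimes> t)"
    using assms(1-3) by (simp add: cmt_def m_assoc inv_mult_group)
  then show "cmt G x (s \<otimes> t) \<in> Z" "\<theta> (cmt G x (s \<otimes> t)) = \<theta> (cmt G x s) * \<theta> (cmt G x t)"
    using conj_mem[OF assms(4,3)] assms(5) by simp_all
qed

lemma cmt_Z: "z \<in> Z \<Longrightarrow> t \<in> T \<Longrightarrow> cmt G z t \<in> Z" "z \<in> Z \<Longrightarrow> t \<in> T \<Longrightarrow> \<theta> (cmt G z t) = 1"
proof -
  assume zt: "z \<in> Z" "t \<in> T"
  have "cmt G z t = inv z \<otimes> (inv t \<otimes> z \<otimes> t)" using zt by (simp add: cmt_def m_assoc)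
  then show "cmt G z t \<in> Z" "\<theta> (cmt G z t) = 1"
    using conj_mem[OF zt] th_inv[OF zt(1)] zt(1) by simp_all
qed

lemma cmt_flip: "x \<in> T \<Longrightarrow> t \<in> T \<Longrightarrow> cmt G t x = inv (cmt G x t)"
  by (simp add: cmt_def m_assoc inv_mult_group)

lemma cmt_same: "x \<in> T \<Longrightarrow> cmt G x x = \<one>"
  by (simp add: cmt_def m_assoc)

lemma cmt_one: "x \<in> T \<Longrightarrow> cmt G x \<one> = \<one>" "x \<in> T \<Longrightarrow> cmt G \<one> x = \<one>"
  by (simp_all add: cmt_def m_assoc)

lemma cmt_pow_left:
  assumes "x \<in> T" "t \<in> T" "cmt G x t \<in> Z"
  shows "cmt G (x [^] (k::nat)) t \<in> Z \<and> \<theta> (cmt G (x [^] k) t) = \<theta> (cmt G x t) ^ k"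
  using assms cmt_one by (induction k) (auto simp: cmt_left mult.commute)

lemma cmt_pow_right:
  assumes "x \<in> T" "t \<in> T" "cmt G x t \<in> Z"
  shows "cmt G x (t [^] (k::nat)) \<in> Z \<and> \<theta> (cmt G x (t [^] k)) = \<theta> (cmt G x t) ^ k"
  using assms cmt_one by (induction k) (auto simp: cmt_right mult.commute)

lemma cmt_root_of_unity:
  assumes "x \<in> T" "t \<in> T" "cmt G x t \<in> Z" "x [^] k \<in> Z"
  shows "\<theta> (cmt G x t) ^ k = 1"
  using cmt_pow_left[OF assms(1-3), of k] cmt_Z(2)[OF assms(4,2)] by simp

lemma cmt_right_subgroup: "g \<in> T \<Longrightarrow> subgroup {t \<in> T. cmt G g t \<in> Z} G"
  by (rule mult_closed_subgroup) (auto simp: cmt_one cmt_right)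

lemma cmt_left_subgroup: "g \<in> T \<Longrightarrow> subgroup {t \<in> T. cmt G t g \<in> Z} G"
  by (rule mult_closed_subgroup) (auto simp: cmt_one cmt_left)

text \<open>Commutator collection with the error recorded only through \<theta>. Moving x to the
  left past y^k costs [y^k, x], of value \<theta>([y, x])^k, so the exponents 0, 1, ..., k - 1 add
  up.\<close>

lemma power_mult_distrib_mod:
  assumes xy: "x \<in> T" "y \<in> T" "cmt G y x \<in> Z"
  shows "\<exists>u\<in>Z. (x \<otimes> y) [^] k = x [^] k \<otimes> y [^] k \<otimes> u \<and> \<theta> u = \<theta> (cmt G y x) ^ (\<Sum>i<k. i)"
proof (induction k)
  case 0
  show ?case by (rule bexI[of _ \<one>]) simp_all
next
  case (Suc k)
  then obtain u where u: "u \<in> Z" "(x \<otimes> y) [^] k = x [^] k \<otimes> y [^] k \<otimes> u" "\<theta> u = \<theta> (cmt G y x) ^ (\<Sum>i<k. i)"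
    by blast
  note c = cmt_pow_left[OF xy(2,1,3), of k]
  define u' where "u' = inv y \<otimes> (cmt G (y [^] k) x \<otimes> (inv x \<otimes> u \<otimes> x)) \<otimes> y"
  have "u' \<in> Z" unfolding u'_def using c conj_mem(1)[OF u(1) xy(1)] xy(2) by (intro conj_mem(1)) simp_all
  moreover have "\<theta> u' = \<theta> (cmt G y x) ^ (\<Sum>i<Suc k. i)"
    unfolding u'_def using c conj_mem[OF u(1) xy(1)] xy(2) u(3)
    by (subst conj_mem(2)) (simp_all add: power_add mult.commute)
  moreover have "(x \<otimes> y) [^] Suc k = x [^] Suc k \<otimes> y [^] Suc k \<otimes> u'"
    using xy u(1) by (simp add: u(2) u'_def cmt_def m_assoc inv_mult_group)
  ultimately show ?case by blast
qed

text \<open>This is where oddness of p enters: p divides p(p-1)/2, so the collected commutators have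
  value 1.\<close>

lemma prime_power_mult:
  assumes p: "Factorial_Ring.prime p" "odd p" and xy: "x \<in> T" "y \<in> T" "cmt G y x \<in> Z" "\<theta> (cmt G y x) ^ p = 1"
    and xp: "x [^] p \<in> Z" and yp: "y [^] p \<in> Z"
  shows "(x \<otimes> y) [^] p \<in> Z \<and> \<theta> ((x \<otimes> y) [^] p) = \<theta> (x [^] p) * \<theta> (y [^] p)"
proof -
  obtain u where u: "u \<in> Z" "(x \<otimes> y) [^] p = x [^] p \<otimes> y [^] p \<otimes> u" "\<theta> u = \<theta> (cmt G y x) ^ (\<Sum>i<p. i)"
    using power_mult_distrib_mod[OF xy(1-3)] by blast
  have "2 * (\<Sum>i<p. i) = p * (p - 1)" by (induction p) (auto simp: algebra_simps)
  then have "p dvd 2 * (\<Sum>i<p. i)" by simp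
  then have "p dvd (\<Sum>i<p. i)" using p by (simp add: coprime_dvd_mult_right_iff)
  then have "\<theta> u = 1" using u(3) xy(4) by (auto simp: power_mult elim!: dvdE)
  then show ?thesis using u xp yp by simp
qed

end

text \<open>Full ramification in elementary form: the pairing has no radical outside Z, where only
  commutators that fall into Z are tested.\<close>

locale ramified = inv_char +
  assumes ram: "\<And>g. g \<in> T \<Longrightarrow> g \<notin> Z \<Longrightarrow> \<exists>h\<in>T. cmt G g h \<in> Z \<and> \<theta> (cmt G g h) \<noteq> 1"

section \<open>Adjoining one element to the domain of the character\<close>

text \<open>x is central of order p in T modulo Z, and w is the value that the extended character is
  to take at x.\<close>

locale ramified_ext = ramified +
  fixes p :: nat and x and w :: complex
  assumes p: "Factorial_Ring.prime p" and xT: "x \<in> T" and xZ: "x \<notin> Z"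
    and cmt_x: "\<And>t. t \<in> T \<Longrightarrow> cmt G x t \<in> Z" and xp: "x [^] p \<in> Z" and w: "w ^ p = \<theta> (x [^] p)"
begin

text \<open>The orthogonal complement of x under the pairing, which is also the stabiliser in T of
  the extended character.\<close>

definition C :: "'a set" where "C = {t \<in> T. \<theta> (cmt G x t) = 1}"
definition Z1 :: "'a set" where "Z1 = {z \<otimes> x [^] i | z (i::nat). z \<in> Z}"
text \<open>\<open>LEAST\<close> only fixes one exponent i with y in Z x^i. By
  \<open>\<theta>1_eq\<close> every other exponent gives the same value, because w^p =
  \<theta>(x^p).\<close>

definition \<theta>1 :: "'a \<Rightarrow> complex" where
  "\<theta>1 y = (let i = (LEAST i::nat. y \<otimes> inv (x [^] i) \<in> Z) in \<theta> (y \<otimes> inv (x [^] i)) * w ^ i)"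

lemma x_carrier [simp]: "x \<in> carrier G" using xT by simp

lemma xpow_Z_iff: "x [^] (i::nat) \<in> Z \<longleftrightarrow> p dvd i"
  by (rule prime_pow_mem_iff[OF Z p x_carrier xZ xp])

lemma Z1I: "z \<in> Z \<Longrightarrow> z \<otimes> x [^] (i::nat) \<in> Z1"
  by (auto simp: Z1_def)

lemma Z1E:
  assumes "y \<in> Z1"
  obtains z i where "z \<in> Z" "y = z \<otimes> x [^] (i::nat)"
  using assms by (auto simp: Z1_def)

lemma \<theta>1_eq:
  assumes z: "z \<in> Z"
  shows "\<theta>1 (z \<otimes> x [^] (k::nat)) = \<theta> z * w ^ k"
proof -
  define i where "i = (LEAST i::nat. z \<otimes> x [^] k \<otimes> inv (x [^] i) \<in> Z)"
  have k: "z \<otimes> x [^] k \<otimes> inv (x [^] k) \<in> Z" using z by (simp add: m_assoc)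
  have i: "z \<otimes> x [^] k \<otimes> inv (x [^] i) \<in> Z" unfolding i_def by (rule LeastI[of _ k], rule k)
  have ik: "i \<le> k" unfolding i_def by (rule Least_le, rule k)
  have "x [^] k = x [^] (k - i) \<otimes> x [^] i" using ik by (simp add: nat_pow_mult)
  then have eq: "z \<otimes> x [^] k \<otimes> inv (x [^] i) = z \<otimes> x [^] (k - i)" using z by (simp add: m_assoc)
  have "x [^] (k - i) = inv z \<otimes> (z \<otimes> x [^] (k - i))" using z by simp
  then have "x [^] (k - i) \<in> Z" using i z unfolding eq by (metis Z.m_closed Z.m_inv_closed)
  then obtain q where q: "k - i = p * q" using xpow_Z_iff by (auto elim: dvdE)
  have "x [^] (k - i) = (x [^] p) [^] q" by (simp add: q nat_pow_pow)
  then have "\<theta> (z \<otimes> x [^] (k - i)) = \<theta> z * w ^ (k - i)"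
    using z xp by (simp add: power_mult w q)
  then have "\<theta>1 (z \<otimes> x [^] k) = \<theta> z * w ^ (k - i) * w ^ i"
    unfolding \<theta>1_def i_def[symmetric] Let_def eq by simp
  then show ?thesis using ik by (simp add: mult.assoc flip: power_add)
qed

lemma \<theta>1_Z: "z \<in> Z \<Longrightarrow> \<theta>1 z = \<theta> z"
  using \<theta>1_eq[of z 0] by simp

lemma Z_Z1: "z \<in> Z \<Longrightarrow> z \<in> Z1"
  using Z1I[of z 0] by simp

lemma x_Z1: "x \<in> Z1"
  using Z1I[of \<one> 1] by simp

lemma xpow_conj: "z \<in> Z \<Longrightarrow> x [^] (i::nat) \<otimes> z \<otimes> inv (x [^] i) \<in> Z"
  "z \<in> Z \<Longrightarrow> \<theta> (x [^] (i::nat) \<otimes> z \<otimes> inv (x [^] i)) = \<theta> z"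
  using conj_mem[of z "inv (x [^] i)"] xT by simp_all

lemma Z1_mult:
  assumes "z \<in> Z" "z' \<in> Z"
  shows "(z \<otimes> x [^] i) \<otimes> (z' \<otimes> x [^] j) = (z \<otimes> (x [^] i \<otimes> z' \<otimes> inv (x [^] i))) \<otimes> x [^] (i + j :: nat)"
  using assms by (simp add: m_assoc flip: nat_pow_mult)

lemma Z1_subset_T: "Z1 \<subseteq> T"
  using xT by (auto simp: Z1_def)

lemma Z1_subgroup: "subgroup Z1 G"
proof (rule mult_closed_subgroup)
  show "Z1 \<subseteq> carrier G" using Z1_subset_T T.subset by blast
  show "\<one> \<in> Z1" using Z_Z1 by simp
  fix y y' assume "y \<in> Z1" "y' \<in> Z1"
  then obtain z i z' j where *: "z \<in> Z" "y = z \<otimes> x [^] (i::nat)" "z' \<in> Z" "y' = z' \<otimes> x [^] (j::nat)"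
    by (metis Z1E)
  show "y \<otimes> y' \<in> Z1" unfolding *(2,4) Z1_mult[OF *(1,3)] using * xpow_conj by (intro Z1I) simp
qed

lemma lchar_\<theta>1: "lchar G Z1 \<theta>1"
  unfolding lchar_def
proof (intro conjI ballI)
  show "\<theta>1 \<one> = 1" by (simp add: \<theta>1_Z)
  fix y y' assume "y \<in> Z1" "y' \<in> Z1"
  then obtain z i z' j where *: "z \<in> Z" "y = z \<otimes> x [^] (i::nat)" "z' \<in> Z" "y' = z' \<otimes> x [^] (j::nat)"
    by (metis Z1E)
  show "\<theta>1 (y \<otimes> y') = \<theta>1 y * \<theta>1 y'"
    unfolding *(2,4) Z1_mult[OF *(1,3)] using * xpow_conj by (simp add: \<theta>1_eq power_add)
qed

lemma xpow_conj_T: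
  assumes t: "t \<in> T"
  shows "\<exists>u\<in>Z. inv t \<otimes> x [^] (i::nat) \<otimes> t = u \<otimes> x [^] i \<and> \<theta> u = \<theta> (cmt G x t) ^ i"
proof -
  note c = cmt_pow_left[OF xT t cmt_x[OF t], of i]
  define u where "u = x [^] i \<otimes> cmt G (x [^] i) t \<otimes> inv (x [^] i)"
  have "u \<in> Z" "\<theta> u = \<theta> (cmt G x t) ^ i" unfolding u_def using c xpow_conj by simp_all
  moreover have "inv t \<otimes> x [^] i \<otimes> t = u \<otimes> x [^] i"
    using t by (simp add: u_def cmt_def m_assoc)
  ultimately show ?thesis by blast
qed

lemma Z1_conj:
  assumes "y \<in> Z1" "t \<in> T"
  shows "inv t \<otimes> y \<otimes> t \<in> Z1" "t \<in> C \<Longrightarrow> \<theta>1 (inv t \<otimes> y \<otimes> t) = \<theta>1 y"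
proof -
  obtain z i where y: "z \<in> Z" "y = z \<otimes> x [^] (i::nat)" using Z1E[OF assms(1)] by metis
  obtain u where u: "u \<in> Z" "inv t \<otimes> x [^] i \<otimes> t = u \<otimes> x [^] i" "\<theta> u = \<theta> (cmt G x t) ^ i"
    using xpow_conj_T[OF assms(2)] by blast
  have "inv t \<otimes> y \<otimes> t = (inv t \<otimes> z \<otimes> t) \<otimes> (inv t \<otimes> x [^] i \<otimes> t)"
    using y assms(2) by (simp add: m_assoc)
  also have "\<dots> = (inv t \<otimes> z \<otimes> t \<otimes> u) \<otimes> x [^] i"
    unfolding u(2) using y u(1) assms(2) by (simp add: m_assoc)
  finally have e: "inv t \<otimes> y \<otimes> t = (inv t \<otimes> z \<otimes> t \<otimes> u) \<otimes> x [^] i" .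
  have m: "inv t \<otimes> z \<otimes> t \<otimes> u \<in> Z" using conj_mem(1)[OF y(1) assms(2)] u(1) by simp
  then show "inv t \<otimes> y \<otimes> t \<in> Z1" unfolding e by (rule Z1I)
  show "\<theta>1 (inv t \<otimes> y \<otimes> t) = \<theta>1 y" if "t \<in> C"
    using that conj_mem[OF y(1) assms(2)] u(1,3) m unfolding e by (simp add: \<theta>1_eq y C_def)
qed

lemma C_T: "C \<subseteq> T" by (auto simp: C_def)

lemma C_subgroup: "subgroup C G"
  using T.subset xT by (intro mult_closed_subgroup) (auto simp: C_def cmt_one cmt_right cmt_x)

lemma Z1_C: "Z1 \<subseteq> C"
proof
  fix y assume "y \<in> Z1"
  then obtain z i where y: "z \<in> Z" "y = z \<otimes> x [^] (i::nat)" using Z1E by metis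
  have "\<theta> (cmt G x z) = 1" using y(1) xT cmt_Z[OF y(1) xT] th_inv(3)[OF cmt_Z(1)[OF y(1) xT]]
    by (simp add: cmt_flip[of z x])
  moreover have "\<theta> (cmt G x (x [^] i)) = 1"
    using cmt_pow_right[OF xT xT, of i] xT by (simp add: cmt_same)
  ultimately show "y \<in> C" using y xT by (simp add: C_def cmt_right cmt_x)
qed

sublocale ext: inv_char G C Z1 \<theta>1
proof (intro inv_char.intro inv_char_axioms.intro fin_group_axioms C_subgroup Z1_subgroup Z1_C lchar_\<theta>1)
  show "conj_inv G C Z1 \<theta>1"
    using Z1_conj C_T by (auto simp: conj_inv_def)
qed

lemma root_of_unity: "t \<in> T \<Longrightarrow> \<theta> (cmt G x t) ^ p = 1"
  using cmt_root_of_unity[OF xT _ cmt_x xp] by simp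

lemma outer_exists:
  obtains t0 where "t0 \<in> T" "\<theta> (cmt G x t0) \<noteq> 1"
  using ram[OF xT xZ] by blast

text \<open>The map from t to \<theta>([x, t]) is a homomorphism from T to the p-th roots of unity
  with kernel C, so any t0 outside C generates T modulo C.\<close>

lemma outer_factor:
  assumes t0: "t0 \<in> T" "\<theta> (cmt G x t0) \<noteq> 1" and t: "t \<in> T"
  obtains i where "t \<otimes> inv (t0 [^] i) \<in> C" "\<theta> (cmt G x t) = \<theta> (cmt G x t0) ^ i" "i < p"
proof -
  have "\<theta> (cmt G x t) ^ p ^ Suc 0 = 1" "\<theta> (cmt G x t0) ^ p ^ Suc 0 = 1" "\<theta> (cmt G x t0) ^ p ^ 0 \<noteq> 1"
    using root_of_unity t t0 by simp_all
  then obtain j where "\<theta> (cmt G x t) = \<theta> (cmt G x t0) ^ j"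
    using primitive_prime_power_root[OF p] by metis
  also have "\<dots> = \<theta> (cmt G x t0) ^ (p * (j div p) + j mod p)" by simp
  also have "\<dots> = \<theta> (cmt G x t0) ^ (j mod p)"
    unfolding power_add power_mult root_of_unity[OF t0(1)] by simp
  finally have i: "\<theta> (cmt G x t) = \<theta> (cmt G x t0) ^ (j mod p)" .
  define i where "i = j mod p"
  have c: "t \<otimes> inv (t0 [^] i) \<in> T" using t t0 by simp
  have "t = t \<otimes> inv (t0 [^] i) \<otimes> t0 [^] i" using t t0 by (simp add: m_assoc)
  then have "\<theta> (cmt G x t) = \<theta> (cmt G x (t \<otimes> inv (t0 [^] i))) * \<theta> (cmt G x (t0 [^] i))"
    using cmt_right(2)[OF xT c T_pow[OF t0(1)] cmt_x[OF c] cmt_x[OF T_pow[OF t0(1)]]] by metis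
  also have "\<theta> (cmt G x (t0 [^] i)) = \<theta> (cmt G x t)"
    using cmt_pow_right[OF xT t0(1) cmt_x[OF t0(1)], of i] i by (simp add: i_def)
  finally have "\<theta> (cmt G x (t \<otimes> inv (t0 [^] i))) = 1"
    using th_inv(2)[OF cmt_x[OF t]] by simp
  then have "t \<otimes> inv (t0 [^] i) \<in> C" using c by (simp add: C_def)
  moreover have "i < p" using prime_gt_0_nat[OF p] by (simp add: i_def)
  ultimately show thesis using that i by (simp add: i_def)
qed

lemma outer_pow_C:
  assumes t0: "t0 \<in> T" "\<theta> (cmt G x t0) \<noteq> 1"
  shows "t0 \<notin> C" "t0 [^] p \<in> C"
  using t0 cmt_pow_right[OF xT t0(1) cmt_x[OF t0(1)], of p] root_of_unity[OF t0(1)] by (simp_all add: C_def)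

text \<open>Together with \<open>card_Z1\<close> this leaves the product of card T and card Z
  unchanged when (T, Z) becomes (C, Z1); the order of the polarising subgroup rests on it.\<close>

lemma card_T: "card T = p * card C"
proof -
  obtain t0 where t0: "t0 \<in> T" "\<theta> (cmt G x t0) \<noteq> 1" by (rule outer_exists)
  have "T = {c \<otimes> t0 [^] i | c i. c \<in> C \<and> i < p}"
  proof safe
    fix t assume t: "t \<in> T"
    obtain i where i: "t \<otimes> inv (t0 [^] i) \<in> C" "i < p" using outer_factor[OF t0 t] by metis
    moreover have "t = t \<otimes> inv (t0 [^] i) \<otimes> t0 [^] i" using t t0 by (simp add: m_assoc)
    ultimately show "\<exists>c i. t = c \<otimes> t0 [^] i \<and> c \<in> C \<and> i < p" by blast
  qed (use t0 C_T in auto)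
  then show ?thesis
    using card_prime_extension[OF C_subgroup p _ outer_pow_C[OF t0]] t0(1) by simp
qed

lemma card_Z1: "card Z1 = p * card Z"
proof -
  have "Z1 = {z \<otimes> x [^] i | z i. z \<in> Z \<and> i < p}"
  proof safe
    fix y assume "y \<in> Z1"
    then obtain z i where y: "z \<in> Z" "y = z \<otimes> x [^] (i::nat)" using Z1E by metis
    have "x [^] i = (x [^] p) [^] (i div p) \<otimes> x [^] (i mod p)"
      by (simp add: nat_pow_pow nat_pow_mult)
    then have "y = z \<otimes> (x [^] p) [^] (i div p) \<otimes> x [^] (i mod p)" using y by (simp add: m_assoc)
    moreover have "z \<otimes> (x [^] p) [^] (i div p) \<in> Z" using y xp by simp
    moreover have "i mod p < p" using prime_gt_0_nat[OF p] by simp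
    ultimately show "\<exists>z i. y = z \<otimes> x [^] i \<and> z \<in> Z \<and> i < p" by blast
  qed (auto intro: Z1I)
  then show ?thesis using card_prime_extension[OF Z p x_carrier xZ xp] by simp
qed

text \<open>The k-th power of \<theta>1 is trivial on Z and takes at x the value w^k, a nontrivial
  p-th root of unity. Since Z1/Z has order p, its kernel is Z.\<close>

lemma Z1_kernel:
  assumes y: "y \<in> Z1" "\<theta>1 y ^ k = 1" and k: "\<And>z. z \<in> Z \<Longrightarrow> \<theta> z ^ k = 1" and wk: "w ^ k \<noteq> 1"
  shows "y \<in> Z"
proof -
  obtain z i where zi: "z \<in> Z" "y = z \<otimes> x [^] (i::nat)" using Z1E[OF y(1)] by metis
  have "(\<theta> z * w ^ i) ^ k = 1" using y(2) zi by (simp add: \<theta>1_eq)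
  then have 1: "(w ^ k) ^ i = 1" using k[OF zi(1)] by (simp add: power_mult_distrib flip: power_mult) (simp add: mult.commute)
  have 2: "(w ^ k) ^ p = 1" using k[OF xp] w by (metis power_mult mult.commute)
  have "p dvd i"
  proof (rule ccontr)
    assume "\<not> p dvd i"
    then have "coprime p i" using p prime_imp_coprime by blast
    then have "w ^ k = 1" using power_gcd_eq_1[OF 2 1] by simp
    then show False using wk by simp
  qed
  then show ?thesis using xpow_Z_iff zi by simp
qed

text \<open>If \<open>g\<close> were good for the extension, then its commutator character would be a power of that of
  \<open>x\<close>, and some \<open>g x\<^sup>j\<close> would be good for the original character.\<close>

lemma ext_ramified:
  assumes g: "g \<in> C" "g \<notin> Z1"
  shows "\<exists>h\<in>C. cmt G g h \<in> Z1 \<and> \<theta>1 (cmt G g h) \<noteq> 1"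
proof (rule ccontr)
  assume no: "\<not> ?thesis"
  have gT: "g \<in> T" using g C_T by blast
  have trivial: "\<theta> (cmt G g h) = 1" if "h \<in> C" "cmt G g h \<in> Z" for h
    using no that Z_Z1 \<theta>1_Z by metis
  obtain h0 where h0: "h0 \<in> T" "cmt G g h0 \<in> Z" "\<theta> (cmt G g h0) \<noteq> 1"
    using ram[OF gT] g(2) Z_Z1 by blast
  define \<omega> where "\<omega> = \<theta> (cmt G x h0)"
  have \<omega>1: "\<omega> \<noteq> 1" using trivial[of h0] h0 by (auto simp: \<omega>_def C_def)
  have \<omega>p: "\<omega> ^ p = 1" unfolding \<omega>_def by (rule root_of_unity[OF h0(1)])
  have h0p: "h0 [^] p \<in> C" using outer_pow_C(2)[OF h0(1)] \<omega>1 by (simp add: \<omega>_def)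
  have "\<theta> (cmt G g h0) ^ p = 1"
    using cmt_pow_right[OF gT h0(1,2), of p] trivial[OF h0p] by simp
  then obtain i where i: "\<theta> (cmt G g h0) = \<omega> ^ i"
    using primitive_prime_power_root[OF p, of \<omega> 0 "\<theta> (cmt G g h0)"] \<omega>1 \<omega>p by auto
  \<comment> \<open>Congruent to -i modulo p, but a natural number.\<close>
  define j where "j = (p - 1) * i"
  have "i + j = p * i" unfolding j_def using prime_gt_0_nat[OF p] by (cases p) simp_all
  then have ij: "\<omega> ^ i * \<omega> ^ j = 1" using \<omega>p by (simp add: power_mult flip: power_add)
  define g' where "g' = g \<otimes> x [^] j"
  have g'T: "g' \<in> T" using gT xT by (simp add: g'_def)
  have gg': "g = g' \<otimes> inv (x [^] j)" using gT by (simp add: g'_def m_assoc)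
  have "g' \<notin> Z"
  proof
    assume "g' \<in> Z"
    then have "g' \<otimes> inv (x [^] j) \<in> Z1"
      using Z_Z1 x_Z1 Z1_subgroup subgroup_pow_closed[OF Z1_subgroup x_Z1]
      by (intro subgroup.m_closed[OF Z1_subgroup] subgroup.m_inv_closed[OF Z1_subgroup]) auto
    then show False using g(2) gg' by simp
  qed
  \<comment> \<open>Splitting h as an element of C times h0^k will give the contradiction: on C the
    pairing with g is trivial by assumption, so \<theta>([g', h]) = (\<omega>^i \<omega>^j)^k =
    1.\<close>
  then obtain h where h: "h \<in> T" "cmt G g' h \<in> Z" "\<theta> (cmt G g' h) \<noteq> 1" using ram[OF g'T] by blast
  have "subgroup {t \<in> T. cmt G t h \<in> Z} G" by (rule cmt_left_subgroup[OF h(1)])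
  moreover have "g' \<in> {t \<in> T. cmt G t h \<in> Z}" "x [^] j \<in> {t \<in> T. cmt G t h \<in> Z}"
    using g'T h cmt_pow_left[OF xT h(1) cmt_x[OF h(1)]] xT by simp_all
  ultimately have "g' \<otimes> inv (x [^] j) \<in> {t \<in> T. cmt G t h \<in> Z}"
    by (intro subgroup.m_closed subgroup.m_inv_closed)
  then have gh: "cmt G g h \<in> Z" using gg' by simp
  have \<omega>1': "\<theta> (cmt G x h0) \<noteq> 1" using \<omega>1 by (simp add: \<omega>_def)
  obtain k where k: "h \<otimes> inv (h0 [^] k) \<in> C" "\<theta> (cmt G x h) = \<omega> ^ k"
    using outer_factor[OF h0(1) \<omega>1' h(1)] unfolding \<omega>_def by metis
  have hk: "cmt G g (h0 [^] k) \<in> Z" "\<theta> (cmt G g (h0 [^] k)) = (\<omega> ^ i) ^ k"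
    using cmt_pow_right[OF gT h0(1,2), of k] i by simp_all
  have "subgroup {t \<in> T. cmt G g t \<in> Z} G" by (rule cmt_right_subgroup[OF gT])
  moreover have "h \<in> {t \<in> T. cmt G g t \<in> Z}" "h0 [^] k \<in> {t \<in> T. cmt G g t \<in> Z}"
    using gh h(1) h0(1) hk by simp_all
  ultimately have c: "h \<otimes> inv (h0 [^] k) \<in> {t \<in> T. cmt G g t \<in> Z}"
    by (intro subgroup.m_closed subgroup.m_inv_closed)
  have "h = h \<otimes> inv (h0 [^] k) \<otimes> h0 [^] k" using h(1) h0(1) by (simp add: m_assoc)
  then have "\<theta> (cmt G g h) = \<theta> (cmt G g (h \<otimes> inv (h0 [^] k))) * \<theta> (cmt G g (h0 [^] k))"
    using cmt_right(2)[OF gT _ _ _ hk(1)] c h0(1) by (metis (no_types, lifting) T_pow mem_Collect_eq)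
  then have "\<theta> (cmt G g h) = (\<omega> ^ i) ^ k" using trivial[OF k(1)] c hk(2) by simp
  moreover have "\<theta> (cmt G g' h) = \<theta> (cmt G g h) * (\<omega> ^ k) ^ j"
    unfolding g'_def using cmt_left(2)[OF gT _ h(1) gh, of "x [^] j"] cmt_pow_left[OF xT h(1) cmt_x[OF h(1)], of j] xT k(2)
    by simp
  moreover have "(\<omega> ^ i) ^ k * (\<omega> ^ k) ^ j = (\<omega> ^ i * \<omega> ^ j) ^ k"
    by (simp add: power_mult_distrib mult.commute flip: power_mult)
  ultimately show False using h(3) ij by simp
qed

sublocale ext: ramified G C Z1 \<theta>1
  using ext_ramified by unfold_locales

lemma C_conj:
  assumes "c \<in> C" "t \<in> T"
  shows "inv t \<otimes> c \<otimes> t \<in> C"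
proof -
  have c: "c \<in> T" "\<theta> (cmt G x c) = 1" using assms(1) by (simp_all add: C_def)
  have "cmt G x t \<in> Z" "cmt G x (inv t) \<in> Z" using assms(2) cmt_x by simp_all
  then have "\<theta> (cmt G x (inv t \<otimes> t)) = \<theta> (cmt G x (inv t)) * \<theta> (cmt G x t)"
    using assms(2) xT by (intro cmt_right) simp_all
  then have 1: "\<theta> (cmt G x (inv t)) * \<theta> (cmt G x t) = 1" using assms(2) xT by (simp add: cmt_one)
  have "\<theta> (cmt G x (inv t \<otimes> c \<otimes> t)) = \<theta> (cmt G x (inv t)) * \<theta> (cmt G x c) * \<theta> (cmt G x t)"
    using assms(2) xT c(1) by (simp add: cmt_right cmt_x)
  then show ?thesis using 1 c assms(2) by (simp add: C_def)
qed

text \<open>The elements of order \<open>p\<close> modulo the kernel in the second centre of \<open>C\<close> over \<open>Z1\<close> form a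
  \<open>T\<close>-invariant subgroup; a \<open>T\<close>-fixed coset in it is central over the smaller group \<open>Z\<close>.\<close>

lemma good_element_inner:
  assumes G: "card (carrier G) = p ^ a" and podd: "odd p" and Zm: "\<And>z. z \<in> Z \<Longrightarrow> \<theta> z ^ p ^ Suc m = 1"
    and bad: "\<theta> (x [^] p) ^ p ^ m \<noteq> 1"
    and y0: "y0 \<in> C" "y0 \<notin> Z1" "\<And>c. c \<in> C \<Longrightarrow> cmt G y0 c \<in> Z1" "y0 [^] p \<in> Z1" "\<theta>1 (y0 [^] p) ^ p ^ Suc m = 1"
  shows "\<exists>y\<in>T. y \<notin> Z \<and> (\<forall>t\<in>T. cmt G y t \<in> Z) \<and> y [^] p \<in> Z \<and> \<theta> (y [^] p) = 1"
proof -
  \<comment> \<open>By \<open>bad\<close>, w is not a p^(m+1)-th root of unity, so the p^(m+1)-th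
    power of \<theta>1 detects membership in Z.\<close>
  have wm: "w ^ p ^ Suc m \<noteq> 1" using bad w by (metis power_Suc power_mult)
  have kern: "y \<in> Z" if "y \<in> Z1" "\<theta>1 y ^ p = 1" for y
  proof (rule Z1_kernel[OF that(1) _ Zm wm])
    have "\<theta>1 y ^ p ^ Suc m = (\<theta>1 y ^ p) ^ p ^ m" by (simp add: power_mult)
    then show "\<theta>1 y ^ p ^ Suc m = 1" using that(2) by simp
  qed
  define E2 where "E2 = {y \<in> C. (\<forall>c\<in>C. cmt G y c \<in> Z1) \<and> y [^] p \<in> Z1 \<and> \<theta>1 (y [^] p) = 1}"
  have E2_C: "E2 \<subseteq> C" by (auto simp: E2_def)
  have E2: "subgroup E2 G"
  proof (rule mult_closed_subgroup)
    show "E2 \<subseteq> carrier G" using E2_C C_T T.subset by blast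
    show "\<one> \<in> E2" by (auto simp: E2_def ext.cmt_one)
    fix y y' assume y: "y \<in> E2" "y' \<in> E2"
    then have c: "y \<in> C" "y' \<in> C" "cmt G y' y \<in> Z1" by (simp_all add: E2_def)
    have "\<theta>1 (cmt G y' y) ^ p = 1"
      using y c by (intro ext.cmt_root_of_unity) (simp_all add: E2_def)
    then have "(y \<otimes> y') [^] p \<in> Z1 \<and> \<theta>1 ((y \<otimes> y') [^] p) = \<theta>1 (y [^] p) * \<theta>1 (y' [^] p)"
      using y c by (intro ext.prime_power_mult[OF p podd]) (simp_all add: E2_def)
    then show "y \<otimes> y' \<in> E2" using y by (simp add: E2_def ext.cmt_left)
  qed
  have E2_conj: "inv t \<otimes> y \<otimes> t \<in> E2" if y: "y \<in> E2" and t: "t \<in> T" for y t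
  proof -
    have yC: "y \<in> C" and yp: "y [^] p \<in> Z1" "\<theta>1 (y [^] p) = 1" using y by (simp_all add: E2_def)
    \<comment> \<open>\<theta>1 is only invariant under C. Stability of \<open>E2\<close> under T
      holds because y^p lies in Z, where \<theta>1 agrees with the T-invariant \<theta>.\<close>
    have "\<theta>1 (y [^] p) ^ p = 1" unfolding yp(2) by (rule power_one)
    then have ypZ1: "y [^] p \<in> Z" by (rule kern[OF yp(1)])
    have "\<theta> (y [^] p) = 1" unfolding \<theta>1_Z[OF ypZ1, symmetric] by (rule yp(2))
    note ypZ = ypZ1 this
    have yT: "y \<in> T" using yC C_T by blast
    have pw: "(inv t \<otimes> y \<otimes> t) [^] (k::nat) = inv t \<otimes> y [^] k \<otimes> t" for k
      using t yT by (induction k) (simp_all add: m_assoc)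
    have "cmt G (inv t \<otimes> y \<otimes> t) c \<in> Z1" if c: "c \<in> C" for c
    proof -
      have cT: "c \<in> T" using c C_T by blast
      have "inv (inv t) \<otimes> c \<otimes> inv t \<in> C" using c t by (intro C_conj) simp_all
      then have "cmt G y (inv (inv t) \<otimes> c \<otimes> inv t) \<in> Z1" using y by (simp add: E2_def)
      then have "inv t \<otimes> cmt G y (inv (inv t) \<otimes> c \<otimes> inv t) \<otimes> t \<in> Z1" by (rule Z1_conj(1)[OF _ t])
      also have "inv t \<otimes> cmt G y (inv (inv t) \<otimes> c \<otimes> inv t) \<otimes> t = cmt G (inv t \<otimes> y \<otimes> t) c"
        using t yT cT by (simp add: cmt_def m_assoc inv_mult_group)
      finally show ?thesis .
    qed
    then show ?thesis
      using C_conj[OF yC t] conj_mem[OF ypZ(1) t] ypZ(2) pw[of p] by (simp add: E2_def Z_Z1 \<theta>1_Z)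
  qed
  \<comment> \<open>By \<open>bad\<close>, \<theta>(x^p) is a primitive p^(m+1)-th root of unity.
    Hence some power x^j cancels \<theta>1(y0^p), and y0 x^j still lies outside Z1.\<close>
  have "\<exists>y1\<in>E2. y1 \<notin> Z1"
  proof -
    have xpm: "\<theta> (x [^] p) ^ p ^ Suc m = 1" by (rule Zm[OF xp])
    have "inverse (\<theta>1 (y0 [^] p)) ^ p ^ Suc m = 1" using y0(5) by (simp only: power_inverse inverse_1)
    then obtain j where j: "inverse (\<theta>1 (y0 [^] p)) = \<theta> (x [^] p) ^ j"
      using primitive_prime_power_root[OF p xpm bad] by metis
    have xj: "x [^] j \<in> Z1" using x_Z1 by simp
    have xjp: "(x [^] j) [^] p \<in> Z1" "\<theta>1 ((x [^] j) [^] p) = \<theta> (x [^] p) ^ j"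
    proof -
      have "(x [^] j) [^] p = (x [^] p) [^] j" by (simp add: nat_pow_pow mult.commute)
      then show "(x [^] j) [^] p \<in> Z1" "\<theta>1 ((x [^] j) [^] p) = \<theta> (x [^] p) ^ j"
        using xp by (simp_all add: Z_Z1 \<theta>1_Z)
    qed
    have "(y0 \<otimes> x [^] j) [^] p \<in> Z1 \<and> \<theta>1 ((y0 \<otimes> x [^] j) [^] p) = \<theta>1 (y0 [^] p) * \<theta>1 ((x [^] j) [^] p)"
      using y0 xj xjp(1) ext.cmt_Z[OF xj y0(1)] by (intro ext.prime_power_mult[OF p podd]) simp_all
    moreover have "\<theta>1 (y0 [^] p) * \<theta>1 ((x [^] j) [^] p) = 1"
      unfolding xjp(2) j[symmetric] using ext.th_inv(2)[OF y0(4)] by simp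
    moreover have "cmt G (y0 \<otimes> x [^] j) c \<in> Z1" if "c \<in> C" for c
      using y0 xj that ext.cmt_Z(1)[OF xj that] by (simp add: ext.cmt_left)
    ultimately have "y0 \<otimes> x [^] j \<in> E2" using y0(1) xj by (simp add: E2_def)
    moreover have "y0 \<otimes> x [^] j \<notin> Z1"
    proof
      assume "y0 \<otimes> x [^] j \<in> Z1"
      then have "y0 \<otimes> x [^] j \<otimes> inv (x [^] j) \<in> Z1" using xj by simp
      then show False using y0(1,2) by (simp add: m_assoc)
    qed
    ultimately show ?thesis by blast
  qed
  then have "\<exists>g\<in>E2 - E2 \<inter> Z1. \<forall>t\<in>T. cmt G g t \<in> E2 \<inter> Z1"
    using E2_C C_T E2_conj Z1_conj(1)
    by (intro p_group_fixed_coset[OF G p T E2 subgroups_Inter_pair[OF E2 Z1_subgroup]]) auto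
  then obtain y where y: "y \<in> E2" "y \<notin> Z1" "\<And>t. t \<in> T \<Longrightarrow> cmt G y t \<in> E2 \<inter> Z1" by blast
  \<comment> \<open>By the definition of \<open>E2\<close>, \<theta>1 takes only p-th roots of unity
    as values on its intersection with Z1, so \<open>kern\<close> moves the commutators from Z1 down
    into Z.\<close>
  have "cmt G y t \<in> Z" if "t \<in> T" for t
  proof (rule kern)
    have c: "cmt G y t \<in> E2" "cmt G y t \<in> Z1" using y(3)[OF that] by simp_all
    then show "\<theta>1 (cmt G y t) ^ p = 1" using ext.th_pow[OF c(2), of p] by (simp add: E2_def)
    show "cmt G y t \<in> Z1" by (rule c(2))
  qed
  moreover have "y [^] p \<in> Z" "\<theta> (y [^] p) = 1"
    using y(1) kern[of "y [^] p"] \<theta>1_Z by (auto simp: E2_def)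
  moreover have "y \<in> T" "y \<notin> Z" using y E2_C C_T Z_Z1 by auto
  ultimately show ?thesis by blast
qed

text \<open>Here Z, x and any y outside C generate T, and y is again central of order p modulo Z.
  The p^m-th powers of \<theta>(x^p) and \<theta>(y^p) are p-th roots of unity, the first one
  nontrivial, so for some j the element y x^j makes them cancel.\<close>

lemma good_element_base:
  assumes podd: "odd p" and Zm: "\<And>z. z \<in> Z \<Longrightarrow> \<theta> z ^ p ^ Suc m = 1"
    and bad: "\<theta> (x [^] p) ^ p ^ m \<noteq> 1" and CZ: "C = Z1"
  shows "\<exists>y\<in>T. y \<notin> Z \<and> (\<forall>t\<in>T. cmt G y t \<in> Z) \<and> y [^] p \<in> Z \<and> \<theta> (y [^] p) ^ p ^ m = 1"
proof -
  obtain y where y: "y \<in> T" "\<theta> (cmt G x y) \<noteq> 1" by (rule outer_exists)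
  have D: "subgroup {t \<in> T. cmt G y t \<in> Z} G" by (rule cmt_right_subgroup[OF y(1)])
  have yx: "cmt G y x \<in> Z" "\<theta> (cmt G y x) = inverse (\<theta> (cmt G x y))"
    using cmt_x[OF y(1)] th_inv(3)[OF cmt_x[OF y(1)]] by (simp_all add: cmt_flip[OF xT y(1)])
  have yz: "cmt G y z \<in> Z" if "z \<in> Z" for z
    using cmt_Z(1)[OF that y(1)] by (simp add: cmt_flip[OF Z_T[OF that] y(1)])
  have yC: "cmt G y c \<in> Z" if "c \<in> C" for c
  proof -
    have "c \<in> Z1" using that CZ by simp
    then obtain z i where zi: "z \<in> Z" "c = z \<otimes> x [^] (i::nat)" by (rule Z1E)
    then show ?thesis using cmt_pow_right[OF y(1) xT yx(1), of i] yz xT y(1) by (simp add: cmt_right)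
  qed
  have yT: "cmt G y t \<in> Z" if t: "t \<in> T" for t
  proof -
    obtain i :: nat where i: "t \<otimes> inv (y [^] i) \<in> C" "\<theta> (cmt G x t) = \<theta> (cmt G x y) ^ i" "i < p"
      by (rule outer_factor[OF y t])
    have "t = t \<otimes> inv (y [^] i) \<otimes> y [^] i" using t y by (simp add: m_assoc)
    moreover have "cmt G y (t \<otimes> inv (y [^] i) \<otimes> y [^] i) \<in> Z"
      using yC[OF i(1)] y(1) t cmt_pow_right[OF y(1,1), of i] cmt_right(1)[of y "t \<otimes> inv (y [^] i)" "y [^] i"]
      by (simp add: cmt_same)
    ultimately show ?thesis by simp
  qed
  have "y [^] p \<in> Z"
  proof -
    have "y [^] p \<in> Z1" using outer_pow_C(2)[OF y] CZ by simp
    then obtain z i where zi: "z \<in> Z" "y [^] p = z \<otimes> x [^] (i::nat)" using Z1E by metis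
    have "\<theta> (cmt G (y [^] p) y) = 1" using cmt_pow_left[OF y(1,1), of p] y(1) by (simp add: cmt_same)
    then have "\<theta> (cmt G x y) ^ i = 1"
      unfolding zi(2) using zi(1) y(1) xT cmt_pow_left[OF xT y(1) cmt_x[OF y(1)], of i]
      by (simp add: cmt_left cmt_Z)
    then have "\<theta> (cmt G x y) ^ gcd i p = 1" using power_gcd_eq_1 root_of_unity[OF y(1)] by blast
    then have "\<not> coprime i p" using y(2) by (metis coprime_imp_gcd_eq_1 power_one_right)
    then have "p dvd i" using p prime_imp_coprime coprime_commute by blast
    then show ?thesis using zi xpow_Z_iff by simp
  qed
  define u where "u = \<theta> (y [^] p) ^ p ^ m"
  define v where "v = \<theta> (x [^] p) ^ p ^ m"
  have "u ^ p = \<theta> (y [^] p) ^ p ^ Suc m" "v ^ p = \<theta> (x [^] p) ^ p ^ Suc m"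
    by (simp_all add: u_def v_def mult.commute flip: power_mult)
  then have up: "u ^ p = 1" and vp: "v ^ p = 1" using Zm[OF \<open>y [^] p \<in> Z\<close>] Zm[OF xp] by simp_all
  have "inverse u ^ p = 1" using up by (simp only: power_inverse inverse_1)
  then obtain j where j: "inverse u = v ^ j"
    using primitive_prime_power_root[OF p, of v 0 "inverse u"] vp bad by (auto simp: v_def)
  have u0: "u \<noteq> 0" using up prime_gt_0_nat[OF p] by (auto simp: power_0_left)
  have cxj: "cmt G (x [^] j) t \<in> Z" if "t \<in> T" for t
    using cmt_pow_left[OF xT that cmt_x[OF that]] by simp
  have "(x [^] j) [^] p = (x [^] p) [^] j" by (simp add: nat_pow_pow mult.commute)
  then have xjp: "(x [^] j) [^] p \<in> Z" "\<theta> ((x [^] j) [^] p) = \<theta> (x [^] p) ^ j" using xp by simp_all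
  have "\<theta> (cmt G (x [^] j) y) ^ p = 1"
    using xT y(1) xjp(1) cxj by (intro cmt_root_of_unity) simp_all
  then have "(y \<otimes> x [^] j) [^] p \<in> Z \<and> \<theta> ((y \<otimes> x [^] j) [^] p) = \<theta> (y [^] p) * \<theta> ((x [^] j) [^] p)"
    using y(1) xT cxj xjp(1) \<open>y [^] p \<in> Z\<close> by (intro prime_power_mult[OF p podd]) simp_all
  moreover have "(\<theta> (y [^] p) * \<theta> (x [^] p) ^ j) ^ p ^ m = u * v ^ j"
    by (simp add: u_def v_def power_mult_distrib mult.commute flip: power_mult)
  then have "(\<theta> (y [^] p) * \<theta> ((x [^] j) [^] p)) ^ p ^ m = 1"
    unfolding xjp(2) using j[symmetric] u0 by simp
  moreover have "y \<otimes> x [^] j \<notin> Z"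
  proof
    assume "y \<otimes> x [^] j \<in> Z"
    then have "y \<otimes> x [^] j \<otimes> inv (x [^] j) \<in> Z1"
      using Z_Z1 subgroup_pow_closed[OF Z1_subgroup x_Z1] by simp
    then have "y \<in> C" using CZ y(1) by (simp add: m_assoc)
    then show False using y(2) by (simp add: C_def)
  qed
  moreover have "cmt G (y \<otimes> x [^] j) t \<in> Z" if "t \<in> T" for t
    using y(1) xT that yT cxj by (intro cmt_left) simp_all
  ultimately show ?thesis using y(1) xT by (intro bexI[of _ "y \<otimes> x [^] j"]) simp_all
qed

end


section \<open>Good elements and the polarisation\<close>

context ramified
begin

text \<open>A fixed coset gives g outside Z and central in T modulo Z. The last iterated p-th power
  of g outside Z then has its own p-th power in Z.\<close>

lemma good_element_candidate:
  assumes G: "card (carrier G) = p ^ a" and p: "Factorial_Ring.prime p" and TZ: "T \<noteq> Z"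
  obtains x where "x \<in> T" "x \<notin> Z" "\<forall>t\<in>T. cmt G x t \<in> Z" "x [^] p \<in> Z"
proof -
  have "\<exists>g\<in>T - Z. \<forall>t\<in>T. cmt G g t \<in> Z"
    using TZ ZT conj_mem(1) by (intro p_group_fixed_coset[OF G p T T Z]) auto
  then obtain g where g: "g \<in> T" "g \<notin> Z" "\<And>t. t \<in> T \<Longrightarrow> cmt G g t \<in> Z" by blast
  define e where "e = (LEAST e. g [^] (p ^ e) \<in> Z)"
  have "g [^] (p ^ a) \<in> Z" using pow_order_eq_1[of g] G g(1) by (simp add: Coset.order_def)
  then have e: "g [^] (p ^ e) \<in> Z" unfolding e_def by (rule LeastI)
  have "e \<noteq> 0" using e g(1,2) by (intro notI) simp
  then obtain d where d: "e = Suc d" using not0_implies_Suc by blast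
  have "g [^] (p ^ d) \<notin> Z" using not_less_Least[of d "\<lambda>e. g [^] (p ^ e) \<in> Z"] d by (simp add: e_def)
  moreover have "(g [^] (p ^ d)) [^] p \<in> Z" using e g(1) by (simp add: d nat_pow_pow mult.commute)
  moreover have "cmt G (g [^] (p ^ d)) t \<in> Z" if "t \<in> T" for t
    using cmt_pow_left[OF g(1) that g(3)[OF that]] by simp
  ultimately show thesis using that[of "g [^] (p ^ d)"] g(1) by simp
qed

end

lemma complex_root_exists:
  assumes "0 < k"
  obtains w :: complex where "w ^ k = z"
proof (cases "z = 0")
  case True
  then show ?thesis using that[of 0] assms by simp
next
  case False
  have "root k (cmod z) ^ k = cmod z" using assms by (intro real_root_pow_pos2) simp_all
  then have "complex_of_real (root k (cmod z)) ^ k = complex_of_real (cmod z)" by (metis of_real_power)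
  then have "(complex_of_real (root k (cmod z)) * cis (Arg z / real k)) ^ k = complex_of_real (cmod z) * cis (Arg z)"
    using assms by (simp add: power_mult_distrib DeMoivre)
  also have "\<dots> = z" using rcis_cmod_Arg[of z] by (simp add: rcis_def)
  finally show ?thesis by (rule that)
qed

lemma power_swap: "((w::complex) ^ i) ^ (k * l) = ((w ^ l) ^ k) ^ i"
  by (simp only: power_mult[symmetric] ac_simps)

context fin_group
begin

text \<open>The last condition ensures that the p-th root chosen at x is again a p^(m+1)-th root of
  unity. If a candidate x violates it, x is adjoined all the same; the character on Z1 then takes
  p^(m+2)-th roots of unity as values, which is why m varies in the induction. A good element of (C,
  Z1) for m + 1 is brought back to (T, Z) by \<open>good_element_inner\<close>; the case C = Z1 is
  treated directly.\<close>

lemma good_element: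
  assumes G: "card (carrier G) = p ^ a" and p: "Factorial_Ring.prime p" "odd p"
  shows "ramified G T Z \<theta> \<Longrightarrow> T \<noteq> Z \<Longrightarrow> (\<And>z. z \<in> Z \<Longrightarrow> \<theta> z ^ p ^ Suc m = 1) \<Longrightarrow>
    \<exists>x\<in>T. x \<notin> Z \<and> (\<forall>t\<in>T. cmt G x t \<in> Z) \<and> x [^] p \<in> Z \<and> \<theta> (x [^] p) ^ p ^ m = 1"
proof (induction "card T" arbitrary: T Z \<theta> m rule: less_induct)
  case less
  interpret ramified G T Z \<theta> by (rule less.prems(1))
  obtain x where x: "x \<in> T" "x \<notin> Z" "\<And>t. t \<in> T \<Longrightarrow> cmt G x t \<in> Z" "x [^] p \<in> Z"
    using good_element_candidate[OF G p(1) less.prems(2)] by metis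
  show ?case
  proof (cases "\<theta> (x [^] p) ^ p ^ m = 1")
    case True
    then show ?thesis using x by blast
  next
    case bad: False
    obtain w :: complex where w: "w ^ p = \<theta> (x [^] p)" by (rule complex_root_exists[OF prime_gt_0_nat[OF p(1)]])
    interpret e: ramified_ext G T Z \<theta> p x w
      by (intro ramified_ext.intro ramified_ext_axioms.intro ramified_axioms p(1) x w)
    show ?thesis
    proof (cases "e.C = e.Z1")
      case True
      then show ?thesis using e.good_element_base[OF p(2) less.prems(3) bad] by simp
    next
      case False
      have "card e.C < card T" using e.card_T card_subgroup_pos[OF e.C_subgroup] prime_gt_1_nat[OF p(1)] by simp
      moreover have "e.\<theta>1 z ^ p ^ Suc (Suc m) = 1" if z: "z \<in> e.Z1" for z
      proof -
        obtain y i where yi: "y \<in> Z" "z = y \<otimes> x [^] (i::nat)" using e.Z1E[OF z] by metis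
        have "e.\<theta>1 z ^ p ^ Suc (Suc m) = (\<theta> y ^ p ^ Suc m) ^ p * ((w ^ p) ^ p ^ Suc m) ^ i"
          unfolding yi(2) e.\<theta>1_eq[OF yi(1)] power_mult_distrib power_Suc2[of p "Suc m"] power_swap[of w]
          by (simp only: power_mult)
        then show ?thesis using less.prems(3)[OF yi(1)] less.prems(3)[OF x(4)] w by simp
      qed
      ultimately obtain y0 where "y0 \<in> e.C" "y0 \<notin> e.Z1" "\<And>c. c \<in> e.C \<Longrightarrow> cmt G y0 c \<in> e.Z1"
        "y0 [^] p \<in> e.Z1" "e.\<theta>1 (y0 [^] p) ^ p ^ Suc m = 1"
        using less.hyps[OF _ e.ext.ramified_axioms False, of "Suc m"] by blast
      then have "\<exists>y\<in>T. y \<notin> Z \<and> (\<forall>t\<in>T. cmt G y t \<in> Z) \<and> y [^] p \<in> Z \<and> \<theta> (y [^] p) = 1"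
        by (intro e.good_element_inner[OF G p(2) less.prems(3) bad])
      then show ?thesis by (metis power_one)
    qed
  qed
qed

text \<open>Each good element turns (T, Z) into (C, Z1) with the same product of orders, until both
  groups coincide with H; hence card T times card Z is the square of card H. The values stay
  p^(m+1)-th roots of unity because w^(p^(m+1)) = \<theta>(x^p)^(p^m) = 1.\<close>

theorem polarisation:
  assumes G: "card (carrier G) = p ^ a" and p: "Factorial_Ring.prime p" "odd p"
  shows "ramified G T Z \<theta> \<Longrightarrow> (\<And>z. z \<in> Z \<Longrightarrow> \<theta> z ^ p ^ Suc m = 1) \<Longrightarrow>
    \<exists>H \<mu>. subgroup H G \<and> Z \<subseteq> H \<and> H \<subseteq> T \<and> lchar G H \<mu> \<and> (\<forall>z\<in>Z. \<mu> z = \<theta> z) \<and>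
      (\<forall>h\<in>H. \<mu> h ^ p ^ Suc m = 1) \<and> card T * card Z = (card H)\<^sup>2"
proof (induction "card T" arbitrary: T Z \<theta> rule: less_induct)
  case less
  interpret ramified G T Z \<theta> by (rule less.prems(1))
  show ?case
  proof (cases "T = Z")
    case True
    then show ?thesis using Z lchar less.prems(2)
      by (intro exI[of _ Z] exI[of _ \<theta>]) (simp add: power2_eq_square)
  next
    case False
    obtain x where x: "x \<in> T" "x \<notin> Z" "\<And>t. t \<in> T \<Longrightarrow> cmt G x t \<in> Z" "x [^] p \<in> Z" "\<theta> (x [^] p) ^ p ^ m = 1"
      using good_element[OF G p less.prems(1) False less.prems(2)] by blast
    obtain w :: complex where w: "w ^ p = \<theta> (x [^] p)" by (rule complex_root_exists[OF prime_gt_0_nat[OF p(1)]])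
    interpret e: ramified_ext G T Z \<theta> p x w
      by (intro ramified_ext.intro ramified_ext_axioms.intro ramified_axioms p(1) x w)
    have "card e.C < card T" using e.card_T card_subgroup_pos[OF e.C_subgroup] prime_gt_1_nat[OF p(1)] by simp
    moreover have "e.\<theta>1 z ^ p ^ Suc m = 1" if z: "z \<in> e.Z1" for z
    proof -
      obtain y i where yi: "y \<in> Z" "z = y \<otimes> x [^] (i::nat)" using e.Z1E[OF z] by metis
      have "e.\<theta>1 z ^ p ^ Suc m = \<theta> y ^ p ^ Suc m * ((w ^ p) ^ p ^ m) ^ i"
        unfolding yi(2) e.\<theta>1_eq[OF yi(1)] power_mult_distrib power_Suc2[of p m] power_swap[of w] by (rule refl)
      then show ?thesis using less.prems(2)[OF yi(1)] x(5) w by simp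
    qed
    ultimately obtain H \<mu> where H: "subgroup H G" "e.Z1 \<subseteq> H" "H \<subseteq> e.C" "lchar G H \<mu>" "\<forall>z\<in>e.Z1. \<mu> z = e.\<theta>1 z"
      "\<forall>h\<in>H. \<mu> h ^ p ^ Suc m = 1" "card e.C * card e.Z1 = (card H)\<^sup>2"
      using less.hyps[OF _ e.ext.ramified_axioms] by metis
    have "card T * card Z = (card H)\<^sup>2" using H(7) e.card_T e.card_Z1 by (simp add: mult_ac)
    moreover have "Z \<subseteq> H" "H \<subseteq> T" using H(2,3) e.Z_Z1 e.C_T by auto
    moreover have "\<forall>z\<in>Z. \<mu> z = \<theta> z" using H(5) e.Z_Z1 e.\<theta>1_Z by simp
    ultimately show ?thesis using H(1,4,6) by blast
  qed
qed

end

subsection \<open>Cyclotomic fields of prime power conductor\<close>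

lemma dvd_diff_power:
  fixes a b c :: "'a :: comm_ring_1"
  assumes "c dvd a - b"
  shows "c dvd a ^ n - b ^ n"
  using assms by (metis dvd_mult2 power_diff_sumr2)

lemma dvd_add_prime_power:
  fixes a b :: "int poly"
  assumes p: "Factorial_Ring.prime (p::nat)"
  shows "[:int p:] dvd (a + b) ^ p - (a ^ p + b ^ p)"
proof -
  have p0: "0 < p" using prime_gt_0_nat[OF p] .
  have "(a + b) ^ p = (\<Sum>k\<le>p. of_nat (p choose k) * a ^ k * b ^ (p - k))" by (rule binomial_ring)
  also have "{..p} = insert 0 (insert p {0<..<p})" using p0 by auto
  also have "(\<Sum>k\<in>insert 0 (insert p {0<..<p}). of_nat (p choose k) * a ^ k * b ^ (p - k))
      = b ^ p + (a ^ p + (\<Sum>k\<in>{0<..<p}. of_nat (p choose k) * a ^ k * b ^ (p - k)))"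
    using p0 by (subst sum.insert) simp_all
  finally have "(a + b) ^ p - (a ^ p + b ^ p) = (\<Sum>k\<in>{0<..<p}. of_nat (p choose k) * a ^ k * b ^ (p - k))" by simp
  also have "[:int p:] dvd \<dots>"
  proof (rule dvd_sum)
    fix k assume "k \<in> {0<..<p}"
    then have "p dvd (p choose k)" using p by (intro dvd_choose_prime) auto
    then have "[:int p:] dvd of_nat (p choose k)"
      by (auto simp: of_nat_poly elim!: dvdE intro!: dvdI[of _ _ "[:int _:]"])
    then show "[:int p:] dvd of_nat (p choose k) * a ^ k * b ^ (p - k)" by (simp add: dvd_mult2)
  qed
  finally show ?thesis .
qed

text \<open>The Frobenius congruence modulo p, iterated.\<close>

lemma dvd_X_plus_1_power:
  assumes p: "Factorial_Ring.prime (p::nat)"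
  shows "[:int p:] dvd [:1, 1:] ^ p ^ m - (monom 1 (p ^ m) + 1)"
proof (induction m)
  case 0
  have "[:1, 1:] = (monom 1 1 + 1 :: int poly)" by (simp add: monom_Suc one_pCons)
  then show ?case by simp
next
  case (Suc m)
  have "[:int p:] dvd ([:1, 1:] ^ p ^ m) ^ p - (monom 1 (p ^ m) + 1) ^ p"
    using Suc by (rule dvd_diff_power)
  moreover have "[:int p:] dvd (monom 1 (p ^ m) + 1) ^ p - (monom 1 (p ^ m) ^ p + 1 ^ p)"
    by (rule dvd_add_prime_power[OF p])
  ultimately have "[:int p:] dvd (([:1, 1:] ^ p ^ m) ^ p - (monom 1 (p ^ m) + 1) ^ p) + ((monom 1 (p ^ m) + 1) ^ p - (monom 1 (p ^ m) ^ p + 1 ^ p))"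
    by (rule dvd_add)
  then have "[:int p:] dvd ([:1, 1:] ^ p ^ m) ^ p - (monom 1 (p ^ m) ^ p + 1 ^ p)"
    by (simp only: add_diff_eq diff_add_cancel)
  then show ?case by (simp add: monom_power mult.commute flip: power_mult)
qed

text \<open>For prime p, the cyclotomic polynomial of conductor p^(m+1), not p^m. With this shift
  the trivial conductor 1 never occurs.\<close>

definition cyclo_pp :: "nat \<Rightarrow> nat \<Rightarrow> int poly" where
  "cyclo_pp p m = (\<Sum>i<p. monom 1 (i * p ^ m))"

lemma cyclo_pp_mult: "(monom 1 (p ^ m) - 1) * cyclo_pp p m = monom 1 (p ^ Suc m) - 1"
proof -
  have "cyclo_pp p m = (\<Sum>i<p. monom 1 (p ^ m) ^ i)"
    by (simp add: cyclo_pp_def monom_power mult.commute)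
  then show ?thesis
    using power_diff_1_eq[of "monom 1 (p ^ m) :: int poly" p] by (simp add: monom_power mult.commute)
qed

lemma cyclo_pp_degree:
  assumes "Factorial_Ring.prime (p::nat)"
  shows "degree (cyclo_pp p m) = (p - 1) * p ^ m" "lead_coeff (cyclo_pp p m) = 1" "cyclo_pp p m \<noteq> 0"
proof -
  have p1: "1 < p" using prime_gt_1_nat[OF assms] .
  have pm: "0 < p ^ m" using p1 by simp
  have c: "coeff (cyclo_pp p m) j = (\<Sum>i<p. if i * p ^ m = j then 1 else 0)" for j
    by (simp add: cyclo_pp_def coeff_sum)
  have "coeff (cyclo_pp p m) ((p - 1) * p ^ m) = (\<Sum>i<p. if i = p - 1 then 1 else 0)"
    unfolding c using pm by (intro sum.cong) auto
  also have "\<dots> = 1" using p1 by simp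
  finally have 1: "coeff (cyclo_pp p m) ((p - 1) * p ^ m) = 1" .
  have "coeff (cyclo_pp p m) j = 0" if "j > (p - 1) * p ^ m" for j
    unfolding c
  proof (intro sum.neutral ballI)
    fix i assume "i \<in> {..<p}"
    then have "i * p ^ m \<le> (p - 1) * p ^ m" by (intro mult_right_mono) auto
    then show "(if i * p ^ m = j then 1 else 0 :: int) = 0" using that by auto
  qed
  then show "degree (cyclo_pp p m) = (p - 1) * p ^ m"
    using 1 by (intro antisym degree_le le_degree) auto
  then show "lead_coeff (cyclo_pp p m) = 1" "cyclo_pp p m \<noteq> 0" using 1 by auto
qed

text \<open>Let F be the shifted polynomial. Modulo p, the identity \<open>cyclo_pp_mult\<close> at
  X + 1 reads X^(p^m) F = X^(p^(m+1)) by Frobenius, and the monomial cancels because p is prime in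
  Z[X].\<close>

lemma cyclo_pp_shift:
  assumes p: "Factorial_Ring.prime (p::nat)"
  shows "[:int p:] dvd pcompose (cyclo_pp p m) [:1, 1:] - monom 1 ((p - 1) * p ^ m)"
proof -
  define F where "F = pcompose (cyclo_pp p m) [:1, 1:]"
  have pc: "pcompose (monom 1 k) [:1, 1:] = ([:1, 1:] :: int poly) ^ k" for k
    by (induction k) (simp_all add: pcompose_1 monom_Suc pcompose_pCons)
  have "([:1, 1:] ^ p ^ m - 1) * F = [:1, 1:] ^ p ^ Suc m - 1"
    using arg_cong[OF cyclo_pp_mult[of p m], of "\<lambda>q. pcompose q [:1, 1:]"]
    by (simp add: F_def pcompose_mult pcompose_diff pc pcompose_1)
  moreover have "[:int p:] dvd [:1, 1:] ^ p ^ m - (monom 1 (p ^ m) + 1)" by (rule dvd_X_plus_1_power[OF p])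
  then have "[:int p:] dvd ([:1, 1:] ^ p ^ m - (monom 1 (p ^ m) + 1)) * F" by (rule dvd_mult2)
  moreover have "[:int p:] dvd [:1, 1:] ^ p ^ Suc m - (monom 1 (p ^ Suc m) + 1)" by (rule dvd_X_plus_1_power[OF p])
  ultimately have "[:int p:] dvd (([:1, 1:] ^ p ^ m - (monom 1 (p ^ m) + 1)) * F) - ([:1, 1:] ^ p ^ Suc m - (monom 1 (p ^ Suc m) + 1))"
    and e: "([:1, 1:] ^ p ^ m - 1) * F = [:1, 1:] ^ p ^ Suc m - 1"
    by (auto intro: dvd_diff simp del: power_Suc)
  moreover have "(([:1, 1:] ^ p ^ m - (monom 1 (p ^ m) + 1)) * F) - ([:1, 1:] ^ p ^ Suc m - (monom 1 (p ^ Suc m) + 1))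
      = (([:1, 1:] ^ p ^ m - 1) * F - ([:1, 1:] ^ p ^ Suc m - 1)) + (monom 1 (p ^ Suc m) - monom 1 (p ^ m) * F)"
    by (simp only: algebra_simps)
  ultimately have "[:int p:] dvd monom 1 (p ^ Suc m) - monom 1 (p ^ m) * F" by (simp only: diff_self add_0)
  moreover have "p ^ Suc m = p ^ m + (p - 1) * p ^ m" using prime_gt_0_nat[OF p] by (cases p) simp_all
  then have "monom 1 (p ^ Suc m) - monom 1 (p ^ m) * F = monom 1 (p ^ m) * (monom 1 ((p - 1) * p ^ m) - F)"
    by (simp add: right_diff_distrib mult_monom del: power_Suc)
  ultimately have "[:int p:] dvd monom 1 (p ^ m) * (monom 1 ((p - 1) * p ^ m) - F)" by simp
  moreover have "prime_elem [:int p:]" using p by (simp add: prime_elem_const_poly_iff)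
  moreover have "\<not> [:int p:] dvd monom 1 (p ^ m)"
  proof
    assume "[:int p:] dvd monom 1 (p ^ m)"
    then have "int p dvd coeff (monom 1 (p ^ m)) (p ^ m)" unfolding const_poly_dvd_iff by (rule spec)
    then show False using prime_gt_1_nat[OF p] by simp
  qed
  ultimately have "[:int p:] dvd monom 1 ((p - 1) * p ^ m) - F" by (simp add: prime_elem_dvd_mult_iff)
  then show ?thesis unfolding F_def by (metis dvd_minus_iff minus_diff_eq)
qed

lemma cyclo_pp_poly_1: "poly (cyclo_pp p m) 1 = int p"
  by (simp add: cyclo_pp_def poly_sum poly_monom)

text \<open>Eisenstein's argument after the shift by 1. The value at 1 is p, so one factor, B, has a
  value at 1 prime to p. The lowest coefficient of the shifted other factor that p does not divide
  would yield such a coefficient of the product, in a degree below the top one.\<close>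

lemma cyclo_pp_irreducible:
  assumes p: "Factorial_Ring.prime (p::nat)"
  shows "Factorial_Ring.irreducible (cyclo_pp p m)"
proof (rule Factorial_Ring.irreducibleI)
  have deg: "degree (cyclo_pp p m) = (p - 1) * p ^ m" by (rule cyclo_pp_degree[OF p])
  have degpos: "0 < (p - 1) * p ^ m" using prime_gt_1_nat[OF p] by simp
  show "cyclo_pp p m \<noteq> 0" by (rule cyclo_pp_degree[OF p])
  show "\<not> cyclo_pp p m dvd 1" using deg degpos by (auto simp: is_unit_poly_iff)
  have key: False
    if AB: "cyclo_pp p m = A * B" "degree A \<noteq> 0" "degree B \<noteq> 0" "\<not> int p dvd poly B 1" for A B
  proof -
    define A' where "A' = pcompose A [:1, 1:]"
    define B' where "B' = pcompose B [:1, 1:]"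
    have F: "pcompose (cyclo_pp p m) [:1, 1:] = A' * B'"
      by (simp add: AB A'_def B'_def pcompose_mult)
    have dA: "degree A' = degree A" by (simp add: A'_def)
    have lA: "lead_coeff A' = lead_coeff A" unfolding A'_def by (subst lead_coeff_comp) simp_all
    have dsum: "degree A + degree B = (p - 1) * p ^ m"
      using deg AB cyclo_pp_degree(3)[OF p, of m] by (metis degree_mult_eq mult_eq_0_iff)
    have B0: "\<not> int p dvd coeff B' 0" using AB(4) by (simp add: B'_def poly_0_coeff_0[symmetric] poly_pcompose)
    have "lead_coeff A * lead_coeff B = 1" using cyclo_pp_degree(2)[OF p, of m] AB(1) by (simp add: lead_coeff_mult)
    then have "\<not> int p dvd lead_coeff A'" unfolding lA using prime_gt_1_nat[OF p]
      by (metis dvd_mult2 int_dvd_int_iff nat_dvd_1_iff_1 less_irrefl of_nat_1)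
    then have ex: "\<exists>i. \<not> int p dvd coeff A' i" by blast
    define i where "i = (LEAST i. \<not> int p dvd coeff A' i)"
    have i: "\<not> int p dvd coeff A' i" unfolding i_def using ex by (rule LeastI_ex)
    have small: "int p dvd coeff A' j" if "j < i" for j using not_less_Least[of j] that unfolding i_def by blast
    have "i \<le> degree A'" using i by (intro le_degree) auto
    then have ilt: "i < (p - 1) * p ^ m" using dA dsum AB(3) by linarith
    have "int p dvd coeff (A' * B' - monom 1 ((p - 1) * p ^ m)) i"
      using cyclo_pp_shift[OF p, of m] F by (simp add: const_poly_dvd_iff)
    then have "int p dvd coeff (A' * B') i" using ilt by simp
    also have "coeff (A' * B') i = (\<Sum>j<i. coeff A' j * coeff B' (i - j)) + coeff A' i * coeff B' 0"
      by (simp add: coeff_mult flip: lessThan_Suc_atMost)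
    finally have "int p dvd coeff A' i * coeff B' 0"
      using small by (subst (asm) dvd_add_right_iff) (auto intro!: dvd_sum)
    then show False using i B0 p by (simp add: prime_dvd_mult_iff)
  qed
  fix A B assume AB: "cyclo_pp p m = A * B"
  have lc: "lead_coeff A * lead_coeff B = 1" using cyclo_pp_degree(2)[OF p, of m] AB by (simp add: lead_coeff_mult)
  have unit: "C dvd 1" if C: "degree C = 0" "lead_coeff C dvd 1" for C :: "int poly"
    using C by (metis degree_0_id is_unit_const_poly_iff)
  show "A dvd 1 \<or> B dvd 1"
  proof (rule ccontr)
    assume n: "\<not> ?thesis"
    have dA: "degree A \<noteq> 0" using n unit[of A] lc by (metis dvd_triv_left)
    have dB: "degree B \<noteq> 0" using n unit[of B] lc by (metis dvd_triv_right)
    have "poly A 1 * poly B 1 = int p" using cyclo_pp_poly_1[of p m] AB by simp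
    moreover have "\<not> int p * int p dvd int p" using prime_gt_1_nat[OF p] by (auto dest: zdvd_imp_le)
    ultimately have "\<not> int p dvd poly A 1 \<or> \<not> int p dvd poly B 1" by (metis mult_dvd_mono)
    then show False using key[OF AB dA dB] key[of B A] AB dA dB by (auto simp: mult.commute)
  qed
qed

text \<open>The Euclidean algorithm over the integers: a pseudo-remainder has the same root and
  smaller degree, and primality of \<Phi> disposes of the constant a.\<close>

lemma prime_elem_dvd_if_common_root:
  fixes \<Phi> :: "int poly" and x :: complex
  assumes \<Phi>: "prime_elem \<Phi>" "0 < degree \<Phi>" "poly (of_int_poly \<Phi>) x = 0"
  shows "poly (of_int_poly P) x = 0 \<Longrightarrow> \<Phi> dvd P"
proof (induction "degree P" arbitrary: P rule: less_induct)
  case less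
  have const: "\<not> \<Phi> dvd [:a:]" if "a \<noteq> 0" for a
  proof
    assume "\<Phi> dvd [:a:]"
    then have "degree \<Phi> \<le> degree [:a:]" using that by (intro dvd_imp_degree_le) simp_all
    then show False using \<Phi>(2) by simp
  qed
  show ?case
  proof (cases "P = 0 \<or> degree \<Phi> \<le> degree P")
    case True
    show ?thesis
    proof (cases "P = 0")
      case False
      then have d: "degree \<Phi> \<le> degree P" using True by simp
      have "\<Phi> \<noteq> 0" using \<Phi>(2) by auto
      from pseudo_mod[OF this, of P] obtain a q where aq: "a \<noteq> 0" "smult a P = \<Phi> * q + pseudo_mod P \<Phi>"
        and r: "pseudo_mod P \<Phi> = 0 \<or> degree (pseudo_mod P \<Phi>) < degree \<Phi>" by blast
      have "poly (of_int_poly (smult a P)) x = poly (of_int_poly (\<Phi> * q + pseudo_mod P \<Phi>)) x" using aq(2) by simp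
      then have "poly (of_int_poly (pseudo_mod P \<Phi>)) x = 0"
        using less.prems \<Phi>(3) by (simp add: hom_distribs)
      then have "\<Phi> dvd pseudo_mod P \<Phi>" using r d less.hyps[of "pseudo_mod P \<Phi>"] by auto
      then have "\<Phi> dvd [:a:] * P" using aq(2) by simp
      then show ?thesis using \<Phi>(1) const[OF aq(1)] by (simp add: prime_elem_dvd_mult_iff del: mult_pCons_left)
    qed simp
  next
    case False
    \<comment> \<open>With the roles exchanged, \<Phi> divides a remainder of smaller degree, which
      is therefore 0. Then P divides a \<Phi>, and if \<Phi> divided the cofactor, P would divide
      the nonzero constant a and could not vanish at x.\<close>
    then have P0: "P \<noteq> 0" and d: "degree P < degree \<Phi>" by auto
    from pseudo_mod[OF P0, of \<Phi>] obtain a q where aq: "a \<noteq> 0" "smult a \<Phi> = P * q + pseudo_mod \<Phi> P"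
      and r: "pseudo_mod \<Phi> P = 0 \<or> degree (pseudo_mod \<Phi> P) < degree P" by blast
    have "poly (of_int_poly (smult a \<Phi>)) x = poly (of_int_poly (P * q + pseudo_mod \<Phi> P)) x" using aq(2) by simp
    then have "poly (of_int_poly (pseudo_mod \<Phi> P)) x = 0"
      using less.prems \<Phi>(3) by (simp add: hom_distribs)
    then have dv: "\<Phi> dvd pseudo_mod \<Phi> P" using r less.hyps[of "pseudo_mod \<Phi> P"] by auto
    have "pseudo_mod \<Phi> P = 0"
    proof (rule ccontr)
      assume "pseudo_mod \<Phi> P \<noteq> 0"
      then show False using dvd_imp_degree_le[OF dv] r d by simp
    qed
    then have Pq: "smult a \<Phi> = P * q" using aq(2) by simp
    then have "\<Phi> dvd P * q" by (metis dvd_smult dvd_refl)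
    then consider "\<Phi> dvd P" | "\<Phi> dvd q" using \<Phi>(1) by (auto simp: prime_elem_dvd_mult_iff)
    then show ?thesis
    proof cases
      case 2
      then obtain s where "q = \<Phi> * s" by (rule dvdE)
      then have "\<Phi> * [:a:] = \<Phi> * (P * s)" using Pq by (simp add: mult_ac)
      then have "[:a:] = P * s" using \<Phi>(2) by (subst (asm) mult_left_cancel) auto
      then have "poly (of_int_poly [:a:]) x = poly (of_int_poly (P * s)) x" by simp
      then have "of_int a = (0::complex)" using less.prems by (simp add: hom_distribs)
      then show ?thesis using aq(1) by simp
    qed
  qed
qed

section \<open>Roots of unity and the field they generate\<close>

lemma zeta_power: "zeta d ^ k = cis (2 * pi * real k / real d)"
  by (simp add: zeta_def DeMoivre mult_ac)

lemma zeta_root: "0 < d \<Longrightarrow> zeta d ^ d = 1"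
  by (simp add: zeta_power)

lemma zeta_primitive:
  assumes "0 < d" "zeta d ^ k = 1"
  shows "d dvd k"
proof -
  have "cis (2 * pi * real k / real d) = 1" using assms by (simp add: zeta_power)
  then have "cos (2 * pi * real k / real d) = 1" by (metis Re_complex_of_real cis.sel(1) of_real_1)
  then obtain l :: int where l: "2 * pi * real k / real d = of_int l * 2 * pi" using cos_one_2pi_int by blast
  then have "real k = of_int l * real d" using assms(1) by (simp add: field_simps)
  then have "of_int (int k) = (of_int (l * int d) :: real)" by simp
  then have "int k = l * int d" by (simp only: of_int_eq_iff)
  then have "int d dvd int k" by simp
  then show ?thesis by (simp only: int_dvd_int_iff)
qed

lemma cyclo_pp_root:
  assumes p: "Factorial_Ring.prime (p::nat)" and j: "\<not> p dvd j"
  shows "poly (of_int_poly (cyclo_pp p m)) (zeta (p ^ Suc m) ^ j) = 0"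
proof -
  define y where "y = (zeta (p ^ Suc m) ^ j) ^ p ^ m"
  have p0: "0 < p" using prime_gt_0_nat[OF p] .
  have "y \<noteq> 1"
  proof
    assume "y = 1"
    then have "p ^ Suc m dvd j * p ^ m" using p0 by (intro zeta_primitive) (simp_all add: y_def power_mult)
    then show False using j p0 by simp
  qed
  have "y ^ p = (zeta (p ^ Suc m) ^ p ^ Suc m) ^ j" by (simp add: y_def mult_ac flip: power_mult)
  then have "y ^ p = 1" using zeta_root[of "p ^ Suc m"] p0 by simp
  moreover have "(y - 1) * (\<Sum>i<p. y ^ i) = y ^ p - 1" by (rule power_diff_1_eq[symmetric])
  ultimately have "(\<Sum>i<p. y ^ i) = 0" using \<open>y \<noteq> 1\<close> by simp
  moreover have "poly (of_int_poly (cyclo_pp p m)) (zeta (p ^ Suc m) ^ j) = (\<Sum>i<p. y ^ i)"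
    by (simp add: cyclo_pp_def hom_distribs poly_sum poly_monom y_def mult_ac flip: power_mult)
  ultimately show ?thesis by simp
qed

lemma cyclo_pp_dvd:
  assumes p: "Factorial_Ring.prime (p::nat)" and "poly (of_int_poly P) (zeta (p ^ Suc m)) = 0"
  shows "cyclo_pp p m dvd P"
proof (rule prime_elem_dvd_if_common_root[OF _ _ _ assms(2)])
  show "prime_elem (cyclo_pp p m)" by (rule irreducible_imp_prime_poly[OF cyclo_pp_irreducible[OF p]])
  show "0 < degree (cyclo_pp p m)" using cyclo_pp_degree(1)[OF p, of m] prime_gt_1_nat[OF p] by simp
  show "poly (of_int_poly (cyclo_pp p m)) (zeta (p ^ Suc m)) = 0"
    using cyclo_pp_root[OF p, of 1 m] prime_gt_1_nat[OF p] by simp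
qed

lemma rat_common_denominator:
  fixes f :: "'b \<Rightarrow> rat"
  assumes "finite A"
  obtains N :: int and k where "N \<noteq> 0" "\<And>a. a \<in> A \<Longrightarrow> of_int N * f a = of_int (k a)"
proof -
  have "\<exists>N::int. N \<noteq> 0 \<and> (\<forall>a\<in>A. \<exists>l::int. of_int N * f a = of_int l)"
    using assms
  proof (induction A)
    case empty
    show ?case by (rule exI[of _ 1]) simp
  next
    case (insert a A)
    then obtain N :: int where N: "N \<noteq> 0" "\<forall>a\<in>A. \<exists>l::int. of_int N * f a = of_int l" by blast
    obtain n d :: int where nd: "d \<noteq> 0" "f a = of_int n / of_int d"
      by (metis Fract_of_int_quotient Rat_cases less_irrefl)
    have "\<exists>l::int. of_int (N * d) * f b = of_int l" if b: "b \<in> insert a A" for b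
    proof (cases "b = a")
      case True
      then show ?thesis using nd by (intro exI[of _ "N * n"]) simp
    next
      case False
      then obtain l :: int where "of_int N * f b = of_int l" using N b by blast
      then have "of_int (N * d) * f b = of_int (l * d)" by (simp add: mult_ac)
      then show ?thesis by blast
    qed
    then show ?case using N nd by (intro exI[of _ "N * d"]) simp
  qed
  then show thesis using that by metis
qed

text \<open>Galois conjugation without automorphisms. After clearing denominators the relation is an
  integer polynomial vanishing at \<zeta>; it is divisible by the cyclotomic polynomial, which
  vanishes at \<zeta>^j too.\<close>

lemma zeta_relation_conjugate:
  fixes f :: "'b \<Rightarrow> rat" and a :: "'b \<Rightarrow> nat"
  assumes p: "Factorial_Ring.prime (p::nat)" and A: "finite A" and j: "\<not> p dvd j"
    and rel: "(\<Sum>z\<in>A. of_rat (f z) * zeta (p ^ Suc m) ^ a z) = 0"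
  shows "(\<Sum>z\<in>A. of_rat (f z) * zeta (p ^ Suc m) ^ (j * a z)) = 0"
proof -
  obtain N :: int and k where N: "N \<noteq> 0" "\<And>z. z \<in> A \<Longrightarrow> of_int N * f z = of_int (k z)"
    using rat_common_denominator[OF A] by metis
  define P where "P = (\<Sum>z\<in>A. monom (k z) (a z))"
  have ev: "poly (of_int_poly P) y = of_int N * (\<Sum>z\<in>A. of_rat (f z) * y ^ a z)" for y :: complex
  proof -
    have "poly (of_int_poly P) y = (\<Sum>z\<in>A. of_int (k z) * y ^ a z)"
      by (simp add: P_def hom_distribs poly_sum poly_monom)
    also have "\<dots> = (\<Sum>z\<in>A. of_int N * (of_rat (f z) * y ^ a z))"
    proof (rule sum.cong[OF refl])
      fix z assume "z \<in> A"
      then have "(of_rat (of_int N * f z) :: complex) = of_rat (of_int (k z))" using N by simp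
      then show "of_int (k z) * y ^ a z = of_int N * (of_rat (f z) * y ^ a z)"
        by (simp add: of_rat_mult mult.assoc)
    qed
    finally show ?thesis by (simp add: sum_distrib_left)
  qed
  have "cyclo_pp p m dvd P" using rel by (intro cyclo_pp_dvd[OF p]) (simp add: ev)
  then obtain Q where "P = cyclo_pp p m * Q" by (rule dvdE)
  then have "poly (of_int_poly P) (zeta (p ^ Suc m) ^ j) = 0"
    using cyclo_pp_root[OF p j, of m] by (simp add: hom_distribs)
  then show ?thesis using N(1) by (simp add: ev power_mult)
qed

text \<open>The point is that the values of rational polynomials at \<zeta> are closed under
  inverses. If P does not vanish at \<zeta>, neither does its gcd g with the cyclotomic polynomial,
  so the cofactor h does. With denominators cleared h is divisible by the cyclotomic polynomial,
  hence g is constant and Bezout gives the inverse.\<close>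

lemma cyclo_field_repr:
  assumes p: "Factorial_Ring.prime (p::nat)" and x: "x \<in> cyclo_field (p ^ Suc m)"
  obtains n and c :: "nat \<Rightarrow> rat" where "x = (\<Sum>i\<le>n. of_rat (c i) * zeta (p ^ Suc m) ^ i)"
proof -
  define \<zeta> where "\<zeta> = zeta (p ^ Suc m)"
  define ev :: "rat poly \<Rightarrow> complex" where "ev P = poly (map_poly of_rat P) \<zeta>" for P
  interpret h: map_poly_comm_ring_hom "of_rat :: rat \<Rightarrow> complex" ..
  have ev_add: "ev (P + Q) = ev P + ev Q" and ev_mult: "ev (P * Q) = ev P * ev Q"
    and ev_minus: "ev (- P) = - ev P" for P Q
    by (simp_all add: ev_def h.hom_add h.hom_mult h.hom_uminus)
  have ev_int: "ev (of_int_poly P) = poly (of_int_poly P) \<zeta>" for P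
    by (simp add: ev_def map_poly_map_poly o_def)
  have ev_const: "ev [:a:] = of_rat a" for a by (cases "a = 0") (simp_all add: ev_def map_poly_pCons)
  define \<Phi> where "\<Phi> = (of_int_poly (cyclo_pp p m) :: rat poly)"
  have \<Phi>0: "ev \<Phi> = 0" using cyclo_pp_root[OF p, of 1 m] prime_gt_1_nat[OF p] by (simp add: \<Phi>_def ev_int \<zeta>_def)
  have \<Phi>n: "\<Phi> \<noteq> 0" using cyclo_pp_degree(3)[OF p] by (simp add: \<Phi>_def)
  have inv: "\<exists>Q. ev Q = inverse (ev P)" if P: "ev P \<noteq> 0" for P
  proof -
    define g where "g = gcd P \<Phi>"
    obtain u v where uv: "u * P + v * \<Phi> = g"
      unfolding g_def using bezout_coefficients_fst_snd[of P \<Phi>] by blast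
    have g: "ev g = ev u * ev P" using uv \<Phi>0 by (metis ev_add ev_mult mult_zero_right add.right_neutral)
    obtain h where h: "\<Phi> = g * h" unfolding g_def by (meson dvdE gcd_dvd2)
    obtain k where "P = g * k" unfolding g_def by (meson dvdE gcd_dvd1)
    then have g0: "ev g \<noteq> 0" using P by (auto simp: ev_mult)
    then have h0: "ev h = 0" using h \<Phi>0 ev_mult by (metis mult_eq_0_iff)
    have hn: "h \<noteq> 0" "g \<noteq> 0" using h \<Phi>n by auto
    obtain N :: int and l where N: "N \<noteq> 0" "\<And>i. i \<in> {..degree h} \<Longrightarrow> of_int N * coeff h i = of_int (l i)"
      using rat_common_denominator[of "{..degree h}" "coeff h"] by auto
    define H where "H = (\<Sum>i\<le>degree h. monom (l i) i)"
    have "(of_int_poly H :: rat poly) = (\<Sum>i\<le>degree h. monom (of_int N * coeff h i) i)"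
      using N(2) by (simp add: H_def hom_distribs)
    also have "\<dots> = smult (of_int N) (\<Sum>i\<le>degree h. monom (coeff h i) i)"
      by (simp add: smult_sum2 smult_monom)
    also have "\<dots> = smult (of_int N) h" by (simp only: poly_as_sum_of_monoms)
    finally have H: "(of_int_poly H :: rat poly) = smult (of_int N) h" .
    have "ev (of_int_poly H) = 0" unfolding H using h0 ev_mult[of "[:of_int N:]" h] by simp
    then have "cyclo_pp p m dvd H" by (intro cyclo_pp_dvd[OF p]) (simp add: ev_int \<zeta>_def)
    moreover have "(of_int_poly H :: rat poly) \<noteq> 0" unfolding H using N(1) hn by simp
    then have "H \<noteq> 0" by auto
    ultimately have "degree (cyclo_pp p m) \<le> degree H" by (rule dvd_imp_degree_le)
    moreover have "degree (of_int_poly H :: rat poly) = degree H" by simp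
    then have "degree H = degree h" unfolding H using N(1) by simp
    moreover have "degree \<Phi> = degree g + degree h" using h hn by (simp add: degree_mult_eq)
    ultimately have "degree g = 0" by (simp add: \<Phi>_def)
    then obtain a where a: "g = [:a:]" by (rule degree_eq_zeroE)
    have a0: "a \<noteq> 0" using a hn by auto
    have "ev ([:inverse a:] * u) = inverse (of_rat a) * ev u" by (simp only: ev_mult ev_const of_rat_inverse)
    moreover have "of_rat a = ev u * ev P" using g a ev_const by simp
    ultimately have "ev ([:inverse a:] * u) = inverse (ev P)" using a0 g0 g
      by (simp add: field_simps)
    then show ?thesis by blast
  qed
  have "is_subfield_C (range ev)"
    unfolding is_subfield_C_def
  proof (intro conjI ballI impI)
    show "0 \<in> range ev" using ev_const[of 0] by (metis of_rat_0 rangeI)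
    show "1 \<in> range ev" using ev_const[of 1] by (metis of_rat_1 rangeI)
    show "inverse y \<in> range ev" if "y \<in> range ev" "y \<noteq> 0" for y using that inv by (metis imageE rangeI)
  qed (auto simp flip: ev_add ev_mult ev_minus)
  moreover have "\<zeta> = ev (monom 1 1)" by (simp add: ev_def map_poly_monom poly_monom)
  then have "\<zeta> \<in> range ev" by simp
  ultimately have "x \<in> range ev" using x by (auto simp: cyclo_field_def \<zeta>_def)
  then obtain P where "x = ev P" by blast
  also have "ev P = (\<Sum>i\<le>degree P. of_rat (coeff P i) * \<zeta> ^ i)"
    by (simp add: ev_def poly_altdef coeff_map_poly)
  finally show thesis using that by (simp add: \<zeta>_def)
qed

lemma cyclo_field_closed:
  shows "zeta d \<in> cyclo_field d" "0 \<in> cyclo_field d" "1 \<in> cyclo_field d"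
    "x \<in> cyclo_field d \<Longrightarrow> y \<in> cyclo_field d \<Longrightarrow> x + y \<in> cyclo_field d"
    "x \<in> cyclo_field d \<Longrightarrow> y \<in> cyclo_field d \<Longrightarrow> x * y \<in> cyclo_field d"
    "x \<in> cyclo_field d \<Longrightarrow> - x \<in> cyclo_field d"
    "x \<in> cyclo_field d \<Longrightarrow> inverse x \<in> cyclo_field d"
proof -
  show "inverse x \<in> cyclo_field d" if "x \<in> cyclo_field d"
    using that by (cases "x = 0") (auto simp: cyclo_field_def is_subfield_C_def)
qed (auto simp: cyclo_field_def is_subfield_C_def)

lemma cyclo_field_power: "x \<in> cyclo_field d \<Longrightarrow> x ^ k \<in> cyclo_field d"
  by (induction k) (auto simp: cyclo_field_closed)

lemma cyclo_field_sum: "(\<And>i. i \<in> A \<Longrightarrow> f i \<in> cyclo_field d) \<Longrightarrow> sum f A \<in> cyclo_field d"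
  by (induction A rule: infinite_finite_induct) (auto simp: cyclo_field_closed)

lemma cyclo_field_of_rat: "of_rat q \<in> cyclo_field d"
proof -
  have nat: "of_nat k \<in> cyclo_field d" for k by (induction k) (auto simp: cyclo_field_closed)
  have int: "of_int k \<in> cyclo_field d" for k
    using nat[of "nat k"] cyclo_field_closed(6)[OF nat[of "nat (- k)"]] by (cases "k \<ge> 0") auto
  obtain n e :: int where "q = of_int n / of_int e" by (metis Fract_of_int_quotient Rat_cases)
  then have "of_rat q = (of_int n * inverse (of_int e) :: complex)" by (simp add: of_rat_divide field_simps)
  then show ?thesis using int cyclo_field_closed by simp
qed

subsection \<open>Monomial representations over cyclotomic fields\<close>

context fin_group
begin

lemma left_transversal:
  assumes H: "subgroup H G" and card: "card (carrier G) = k * card H"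
  obtains t where "\<And>i. i < k \<Longrightarrow> t i \<in> carrier G"
    "\<And>g. g \<in> carrier G \<Longrightarrow> \<exists>!i. i < k \<and> inv (t i) \<otimes> g \<in> H"
proof -
  interpret H: subgroup H G by (rule H)
  have "card (rcosets H) * card H = k * card H" using lagrange[OF H] card by (simp add: Coset.order_def)
  then have c: "card (rcosets H) = k" using card_subgroup_pos[OF H] by simp
  have "finite (rcosets H)" using fin by (simp add: RCOSETS_def)
  then obtain b where b: "bij_betw b {..<k} (rcosets H)"
    using ex_bij_betw_nat_finite c atLeast0LessThan by metis
  have "\<exists>r. r \<in> carrier G \<and> b i = H #> r" if "i < k" for i
  proof -
    have "b i \<in> rcosets H" using bij_betwE[OF b] that by simp
    then show ?thesis by (auto simp: RCOSETS_def)
  qed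
  then obtain r where r: "\<And>i. i < k \<Longrightarrow> r i \<in> carrier G" "\<And>i. i < k \<Longrightarrow> b i = H #> r i" by metis
  \<comment> \<open>Inverses of right coset representatives represent the left cosets.\<close>
  have mem: "inv (inv (r i)) \<otimes> g \<in> H \<longleftrightarrow> b i = H #> inv g" if "i < k" "g \<in> carrier G" for i g
  proof -
    have "r i \<otimes> g \<in> H \<longleftrightarrow> r i \<in> H #> inv g"
    proof
      assume "r i \<otimes> g \<in> H"
      then have "r i \<otimes> g \<otimes> inv g \<in> H #> inv g" by (auto simp: r_coset_def)
      then show "r i \<in> H #> inv g" using r(1) that by (simp add: m_assoc)
    next
      assume "r i \<in> H #> inv g"
      then obtain h where "h \<in> H" "r i = h \<otimes> inv g" by (auto simp: r_coset_def)
      then show "r i \<otimes> g \<in> H" using that by (simp add: m_assoc)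
    qed
    also have "\<dots> \<longleftrightarrow> H #> r i = H #> inv g"
      using that r(1) repr_independence[OF _ _ H, of "r i" "inv g"] rcos_self[OF _ H, of "r i"] by auto
    finally show ?thesis using r that by simp
  qed
  show thesis
  proof (rule that[of "\<lambda>i. inv (r i)"])
    fix g assume g: "g \<in> carrier G"
    then have "H #> inv g \<in> rcosets H" by (auto simp: RCOSETS_def)
    then obtain i where i: "i < k" "b i = H #> inv g"
      using bij_betw_imp_surj_on[OF b] by (metis imageE lessThan_iff)
    have "\<exists>!i. i < k \<and> b i = H #> inv g"
    proof (rule ex1I[of _ i])
      fix j assume "j < k \<and> b j = H #> inv g"
      then show "j = i" using inj_onD[OF bij_betw_imp_inj_on[OF b], of j i] i by simp
    qed (use i in simp)
    then show "\<exists>!i. i < k \<and> inv (inv (r i)) \<otimes> g \<in> H" using mem[OF _ g] by (simp cong: conj_cong)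
  qed (use r in simp)
qed

end

locale monomial = fin_group +
  fixes Z :: "'a set" and \<theta> :: "'a \<Rightarrow> complex" and H :: "'a set" and \<mu> :: "'a \<Rightarrow> complex" and k :: nat and t :: "nat \<Rightarrow> 'a"
  assumes Z: "subgroup Z G" and th: "lchar G Z \<theta>" and ci: "conj_inv G (carrier G) Z \<theta>"
    and ram: "\<And>g. g \<in> carrier G \<Longrightarrow> g \<notin> Z \<Longrightarrow> \<exists>h\<in>carrier G. cmt G g h \<in> Z \<and> \<theta> (cmt G g h) \<noteq> 1"
    and H: "subgroup H G" and ZH: "Z \<subseteq> H" and mu: "lchar G H \<mu>" and mu_th: "\<And>z. z \<in> Z \<Longrightarrow> \<mu> z = \<theta> z"
    and t: "\<And>i. i < k \<Longrightarrow> t i \<in> carrier G"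
    and trans: "\<And>g. g \<in> carrier G \<Longrightarrow> \<exists>!i. i < k \<and> inv (t i) \<otimes> g \<in> H"
    and card_Z: "card (carrier G) = k\<^sup>2 * card Z"
begin

sublocale H: subgroup H G by (rule H)
sublocale Z: subgroup Z G by (rule Z)

lemma conj_mem:
  assumes "z \<in> Z" "g \<in> carrier G"
  shows "inv g \<otimes> z \<otimes> g \<in> Z" "\<theta> (inv g \<otimes> z \<otimes> g) = \<theta> z"
  using ci assms by (simp_all add: conj_inv_def)

lemma th_one: "\<theta> \<one> = 1"
  using th by (simp add: lchar_def)

definition mu0 :: "'a \<Rightarrow> complex" where "mu0 u = (if u \<in> H then \<mu> u else 0)"

text \<open>The matrix of the representation induced from \<mu>, in the basis given by the left
  transversal t.\<close>

definition rho :: "'a \<Rightarrow> complex mat" where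
  "rho g = mat k k (\<lambda>(i, j). mu0 (inv (t i) \<otimes> g \<otimes> t j))"

lemma rho_carrier [simp]: "rho g \<in> carrier_mat k k"
  by (simp add: rho_def)

lemma rho_dim [simp]: "dim_row (rho g) = k" "dim_col (rho g) = k"
  by (simp_all add: rho_def)

lemma rho_index: "i < k \<Longrightarrow> j < k \<Longrightarrow> rho g $$ (i, j) = mu0 (inv (t i) \<otimes> g \<otimes> t j)"
  by (simp add: rho_def)

lemma H_mult_iff:
  assumes "u \<in> carrier G" "v \<in> H"
  shows "u \<otimes> v \<in> H \<longleftrightarrow> u \<in> H"
proof
  assume "u \<otimes> v \<in> H"
  then have "u \<otimes> v \<otimes> inv v \<in> H" using assms(2) by simp
  then show "u \<in> H" using assms by (simp add: m_assoc)
qed (use assms in simp)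

lemma trans_same: "i < k \<Longrightarrow> j < k \<Longrightarrow> inv (t i) \<otimes> t j \<in> H \<longleftrightarrow> i = j"
  using trans[OF t[of j]] t[of j] by (metis H.one_closed l_inv)

text \<open>For a fixed column l, only one j satisfies t_j^-1 h t_l \<in> H, so the matrix product
  has a single surviving term.\<close>

lemma rho_mult:
  assumes gh: "g \<in> carrier G" "h \<in> carrier G"
  shows "rho (g \<otimes> h) = rho g * rho h"
proof (rule eq_matI)
  fix i l assume "i < dim_row (rho g * rho h)" "l < dim_col (rho g * rho h)"
  then have il: "i < k" "l < k" by simp_all
  have ht: "h \<otimes> t l \<in> carrier G" using gh t il by simp
  from trans[OF ht] obtain j0 where "j0 < k \<and> inv (t j0) \<otimes> (h \<otimes> t l) \<in> H"
    "\<forall>j. j < k \<and> inv (t j) \<otimes> (h \<otimes> t l) \<in> H \<longrightarrow> j = j0" by (rule ex1E)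
  then have j0: "j0 < k" "inv (t j0) \<otimes> (h \<otimes> t l) \<in> H"
    "\<And>j. j < k \<Longrightarrow> inv (t j) \<otimes> (h \<otimes> t l) \<in> H \<Longrightarrow> j = j0" by blast+
  define v where "v = inv (t j0) \<otimes> h \<otimes> t l"
  have v: "v \<in> H" using j0(1,2) t il gh by (simp add: v_def m_assoc)
  define u where "u = inv (t i) \<otimes> g \<otimes> t j0"
  have u: "u \<in> carrier G" using t il gh j0(1) by (simp add: u_def)
  have uv: "inv (t i) \<otimes> (g \<otimes> h) \<otimes> t l = u \<otimes> v" using t il gh j0(1) by (simp add: u_def v_def m_assoc)
  have "(rho g * rho h) $$ (i, l) = (\<Sum>j<k. mu0 (inv (t i) \<otimes> g \<otimes> t j) * mu0 (inv (t j) \<otimes> h \<otimes> t l))"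
    using il by (subst index_mult_mat_sum[of _ k k _ k]) (simp_all add: rho_index)
  also have "\<dots> = (\<Sum>j<k. if j = j0 then mu0 u * mu0 v else 0)"
  proof (rule sum.cong[OF refl])
    fix j assume "j \<in> {..<k}"
    then have j: "j < k" by simp
    have "inv (t j) \<otimes> h \<otimes> t l \<notin> H" if "j \<noteq> j0"
    proof
      assume "inv (t j) \<otimes> h \<otimes> t l \<in> H"
      then have "inv (t j) \<otimes> (h \<otimes> t l) \<in> H" using t j il gh by (simp add: m_assoc)
      from j0(3)[OF j this] that show False by simp
    qed
    then show "mu0 (inv (t i) \<otimes> g \<otimes> t j) * mu0 (inv (t j) \<otimes> h \<otimes> t l) = (if j = j0 then mu0 u * mu0 v else 0)"
      by (simp add: u_def v_def mu0_def)
  qed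
  also have "\<dots> = mu0 u * mu0 v" using j0(1) by simp
  also have "\<dots> = mu0 (u \<otimes> v)"
    using H_mult_iff[OF u v] v mu by (simp add: mu0_def lchar_def)
  finally show "rho (g \<otimes> h) $$ (i, l) = (rho g * rho h) $$ (i, l)"
    using il uv by (simp add: rho_index)
qed simp_all

lemma rho_Z:
  assumes z: "z \<in> Z"
  shows "rho z = \<theta> z \<cdot>\<^sub>m 1\<^sub>m k"
proof (rule eq_matI)
  fix i j assume "i < dim_row (\<theta> z \<cdot>\<^sub>m 1\<^sub>m k)" "j < dim_col (\<theta> z \<cdot>\<^sub>m 1\<^sub>m k)"
  then have ij: "i < k" "j < k" by simp_all
  define y where "y = inv (t j) \<otimes> z \<otimes> t j"
  have y: "y \<in> Z" "\<theta> y = \<theta> z" using conj_mem[OF z t[OF ij(2)]] by (simp_all add: y_def)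
  have e: "inv (t i) \<otimes> z \<otimes> t j = (inv (t i) \<otimes> t j) \<otimes> y" using z t ij by (simp add: y_def m_assoc)
  have c: "inv (t i) \<otimes> t j \<in> carrier G" using t ij by simp
  have "y \<in> H" using y ZH by blast
  then have "inv (t i) \<otimes> z \<otimes> t j \<in> H \<longleftrightarrow> i = j" unfolding e using H_mult_iff[OF c] trans_same[OF ij] by simp
  moreover have "inv (t i) \<otimes> z \<otimes> t j = y" if "i = j" using that by (simp add: y_def)
  ultimately have "mu0 (inv (t i) \<otimes> z \<otimes> t j) = (if i = j then \<theta> z else 0)"
    using y mu_th by (simp add: mu0_def)
  then show "rho z $$ (i, j) = (\<theta> z \<cdot>\<^sub>m 1\<^sub>m k) $$ (i, j)" using ij by (simp add: rho_index)
qed simp_all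

lemma rho_one: "rho \<one> = 1\<^sub>m k"
  using rho_Z[of \<one>] by (intro eq_matI) (simp_all add: th_one)

lemma rho_rep: "is_rep G k rho"
  by (simp add: is_rep_def rho_mult rho_one)

text \<open>Conjugation by h preserves the trace but multiplies \<rho>(g) by \<theta>([g, h]), which
  ramification allows to be different from 1.\<close>

lemma rho_trace:
  assumes g: "g \<in> carrier G" "g \<notin> Z"
  shows "mtrace (rho g) = 0"
proof -
  obtain h where h: "h \<in> carrier G" "cmt G g h \<in> Z" "\<theta> (cmt G g h) \<noteq> 1" using ram[OF g] by blast
  have "mtrace (rho g) = mtrace (rho (g \<otimes> h) * rho (inv h))"
    using g h by (simp add: m_assoc flip: rho_mult)
  also have "\<dots> = mtrace (rho (inv h) * rho (g \<otimes> h))" by (rule mtrace_comm[of _ k k]) simp_all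
  also have "\<dots> = mtrace (rho (g \<otimes> cmt G g h))"
    using g h by (simp add: cmt_def m_assoc flip: rho_mult)
  also have "\<dots> = mtrace (rho g * (\<theta> (cmt G g h) \<cdot>\<^sub>m 1\<^sub>m k))"
    using g h rho_Z cmt_closed by (simp add: rho_mult)
  also have "\<dots> = \<theta> (cmt G g h) * mtrace (rho g)"
    by (simp add: scalar_mult_mat(2)[of "rho g" k] mtrace_def sum_distrib_left)
  finally show ?thesis using h(3) by simp
qed

text \<open>The matrices \<open>rho (s a)\<close>, for \<open>s\<close> a transversal of \<open>Z\<close>, are orthogonal for the trace form
  and there are \<open>k\<^sup>2\<close> of them, so every matrix is recovered from its traces against them.\<close>

lemma matrix_from_traces:
  assumes k: "0 < k" and s: "\<And>a. a < k\<^sup>2 \<Longrightarrow> s a \<in> carrier G"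
    and s_trans: "\<And>g. g \<in> carrier G \<Longrightarrow> \<exists>!a. a < k\<^sup>2 \<and> inv (s a) \<otimes> g \<in> Z"
    and A: "A \<in> carrier_mat k k" and ij: "i < k" "j < k"
  shows "A $$ (i, j) = (\<Sum>a<k\<^sup>2. (mtrace (A * rho (inv (s a))) / of_nat k) * rho (s a) $$ (i, j))"
proof -
  let ?N = "k\<^sup>2"
  \<comment> \<open>The matrices \<open>rho (s a)\<close> are flattened into rows, with b standing
    for the position (b div k, b mod k); the columns of V are the dual family for the trace
    form.\<close>
  define U where "U = mat ?N ?N (\<lambda>(a, b). rho (s a) $$ (b div k, b mod k))"
  define V where "V = mat ?N ?N (\<lambda>(b, a). rho (inv (s a)) $$ (b mod k, b div k) / of_nat k)"
  have bk: "b div k < k" "b mod k < k" if "b < ?N" for b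
    using that k by (simp_all add: power2_eq_square less_mult_imp_div_less)
  have sum_pairs: "(\<Sum>b<?N. f (b div k) (b mod k)) = (\<Sum>x<k. \<Sum>y<k. f x y)" for f :: "nat \<Rightarrow> nat \<Rightarrow> complex"
  proof -
    have "(\<Sum>x<k. \<Sum>y<k. f x y) = (\<Sum>(x, y)\<in>{..<k} \<times> {..<k}. f x y)" by (simp add: sum.cartesian_product)
    also have "\<dots> = (\<Sum>b<?N. f (b div k) (b mod k))"
    proof (rule sum.reindex_bij_witness[of _ "\<lambda>b. (b div k, b mod k)" "\<lambda>(x, y). x * k + y"])
      fix c assume "c \<in> {..<k} \<times> {..<k}"
      then obtain x y where c: "c = (x, y)" "x < k" "y < k" by auto
      have "x * k + y < (x + 1) * k" using c by simp
      also have "\<dots> \<le> k * k" using c by (intro mult_right_mono) simp_all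
      finally show "(case c of (x, y) \<Rightarrow> x * k + y) \<in> {..<?N}" by (simp add: c power2_eq_square)
    qed (use bk in \<open>auto split: prod.splits\<close>)
    finally show ?thesis by simp
  qed
  have Uc: "U \<in> carrier_mat ?N ?N" and Vc: "V \<in> carrier_mat ?N ?N" by (simp_all add: U_def V_def)
  have tr: "mtrace (rho g * rho h) = (\<Sum>x<k. \<Sum>y<k. rho g $$ (x, y) * rho h $$ (y, x))" for g h
    by (simp add: mtrace_def index_mult_mat_sum[of _ k k _ k] del: index_mult_mat(1))
  have "U * V = 1\<^sub>m ?N"
  proof (rule eq_matI)
    fix a c assume "a < dim_row (1\<^sub>m ?N :: complex mat)" "c < dim_col (1\<^sub>m ?N :: complex mat)"
    then have ac: "a < ?N" "c < ?N" by simp_all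
    have "(U * V) $$ (a, c) = (\<Sum>b<?N. rho (s a) $$ (b div k, b mod k) * rho (inv (s c)) $$ (b mod k, b div k) / of_nat k)"
      using ac by (subst index_mult_mat_sum[OF Uc Vc]) (simp_all add: U_def V_def)
    also have "\<dots> = mtrace (rho (s a) * rho (inv (s c))) / of_nat k"
      by (simp add: tr sum_pairs[of "\<lambda>x y. rho (s a) $$ (x, y) * rho (inv (s c)) $$ (y, x) / of_nat k"] sum_divide_distrib)
    also have "\<dots> = mtrace (rho (s a \<otimes> inv (s c))) / of_nat k" using s ac by (simp add: rho_mult)
    also have "\<dots> = (if a = c then 1 else 0)"
    proof (cases "a = c")
      case True
      then show ?thesis using s ac k mtrace_scalar[of 1 k] by (simp add: rho_one mtrace_def)
    next
      case False
      have "s a \<otimes> inv (s c) \<notin> Z"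
      proof
        assume "s a \<otimes> inv (s c) \<in> Z"
        then have "inv (s c) \<otimes> (s a \<otimes> inv (s c)) \<otimes> s c \<in> Z" using s ac by (intro conj_mem(1))
        then have "inv (s c) \<otimes> s a \<in> Z" using s ac by (simp add: m_assoc)
        moreover have "inv (s a) \<otimes> s a \<in> Z" using s ac by simp
        ultimately show False using s_trans[OF s[OF ac(1)]] ac False by metis
      qed
      then show ?thesis using False s ac by (simp add: rho_trace)
    qed
    finally show "(U * V) $$ (a, c) = 1\<^sub>m ?N $$ (a, c)" using ac by simp
  qed (simp_all add: U_def V_def)
  \<comment> \<open>Both matrices are square of size k^2, so orthogonality (U V = 1) turns into
    completeness (V U = 1), which is the reconstruction formula.\<close>
  then have VU: "V * U = 1\<^sub>m ?N" by (rule mat_mult_left_right_inverse[OF Uc Vc])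
  define c where "c = i * k + j"
  have "i * k + j < (i + 1) * k" using ij by simp
  also have "\<dots> \<le> k * k" using ij by (intro mult_right_mono) simp_all
  finally have c: "c < ?N" "c div k = i" "c mod k = j" using ij by (simp_all add: c_def power2_eq_square)
  have VUe: "(\<Sum>a<?N. V $$ (b, a) * U $$ (a, c)) = (if b = c then 1 else 0)" if "b < ?N" for b
    using arg_cong[OF VU, of "\<lambda>M. M $$ (b, c)"] that c(1) index_mult_mat_sum[OF Vc Uc that c(1)] by simp
  have trA: "mtrace (A * rho h) / of_nat k = (\<Sum>b<?N. A $$ (b div k, b mod k) * (rho h $$ (b mod k, b div k) / of_nat k))" for h
    using A by (simp add: mtrace_def index_mult_mat_sum[of _ k k _ k] sum_divide_distrib
        sum_pairs[of "\<lambda>x y. A $$ (x, y) * rho h $$ (y, x) / of_nat k"] del: index_mult_mat(1))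
  have "(\<Sum>a<?N. (mtrace (A * rho (inv (s a))) / of_nat k) * rho (s a) $$ (i, j))
      = (\<Sum>a<?N. \<Sum>b<?N. A $$ (b div k, b mod k) * (V $$ (b, a) * U $$ (a, c)))"
    unfolding trA sum_distrib_right by (intro sum.cong refl) (use c in \<open>simp add: U_def V_def mult.assoc\<close>)
  also have "\<dots> = (\<Sum>b<?N. A $$ (b div k, b mod k) * (\<Sum>a<?N. V $$ (b, a) * U $$ (a, c)))"
    by (subst sum.swap) (simp add: sum_distrib_left)
  also have "\<dots> = (\<Sum>b<?N. A $$ (b div k, b mod k) * (if b = c then 1 else 0))"
    using VUe by (intro sum.cong refl) simp
  also have "\<dots> = A $$ (i, j)" using c by (simp add: if_distrib[of "\<lambda>x. _ * x"] cong: if_cong)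
  finally show ?thesis by simp
qed

text \<open>The coefficients of A in the trace formula lie in the field, since A and all
  \<open>rho g\<close> have entries there. By \<open>F\<close> each is a rational combination of
  values of \<theta>, and \<theta>(z) \<open>rho (s a)\<close> is
  \<open>rho (s a \<otimes> z)\<close>, so A is a rational combination of group elements.\<close>

lemma rat_span_surjective:
  assumes k: "0 < k" and F: "\<And>c. c \<in> cyclo_field d \<Longrightarrow> \<exists>\<beta>::'a \<Rightarrow> rat. c = (\<Sum>z\<in>Z. of_rat (\<beta> z) * \<theta> z)"
    and muF: "\<And>h. h \<in> H \<Longrightarrow> \<mu> h \<in> cyclo_field d"
    and A: "A \<in> carrier_mat k k" "\<And>i j. i < k \<Longrightarrow> j < k \<Longrightarrow> A $$ (i, j) \<in> cyclo_field d"
  shows "\<exists>f::'a \<Rightarrow> rat. (\<forall>x. x \<notin> carrier G \<longrightarrow> f x = 0) \<and> lift G k rho (\<lambda>g. of_rat (f g)) = A"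
proof -
  obtain s where s: "\<And>a. a < k\<^sup>2 \<Longrightarrow> s a \<in> carrier G"
    and s_trans: "\<And>g. g \<in> carrier G \<Longrightarrow> \<exists>!a. a < k\<^sup>2 \<and> inv (s a) \<otimes> g \<in> Z"
    using left_transversal[OF Z card_Z] by metis
  have rhoF: "rho g $$ (i, j) \<in> cyclo_field d" if "i < k" "j < k" for g i j
    using that muF by (simp add: rho_index mu0_def cyclo_field_closed)
  have "mtrace (A * rho g) / of_nat k \<in> cyclo_field d" for g
  proof -
    have "mtrace (A * rho g) \<in> cyclo_field d"
    proof -
      have "mtrace (A * rho g) = (\<Sum>i<k. \<Sum>j<k. A $$ (i, j) * rho g $$ (j, i))"
        using A(1) by (simp add: mtrace_def index_mult_mat_sum[of _ k k _ k] del: index_mult_mat(1))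
      also have "\<dots> \<in> cyclo_field d"
        using A(2) rhoF by (intro cyclo_field_sum cyclo_field_closed(5)) simp_all
      finally show ?thesis .
    qed
    moreover have "inverse (of_nat k) \<in> cyclo_field d"
      using cyclo_field_closed(7)[OF cyclo_field_of_rat[of "of_nat k" d]] by simp
    ultimately show ?thesis using cyclo_field_closed(5) by (simp add: divide_inverse)
  qed
  then have "\<forall>a. \<exists>\<beta>::'a \<Rightarrow> rat. mtrace (A * rho (inv (s a))) / of_nat k = (\<Sum>z\<in>Z. of_rat (\<beta> z) * \<theta> z)"
    using F by blast
  then obtain \<beta> :: "nat \<Rightarrow> 'a \<Rightarrow> rat"
    where \<beta>: "\<And>a. mtrace (A * rho (inv (s a))) / of_nat k = (\<Sum>z\<in>Z. of_rat (\<beta> a z) * \<theta> z)" by metis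
  define ix where "ix g = (THE a. a < k\<^sup>2 \<and> inv (s a) \<otimes> g \<in> Z)" for g
  have ix: "ix g < k\<^sup>2" "inv (s (ix g)) \<otimes> g \<in> Z" if "g \<in> carrier G" for g
    using theI'[OF s_trans[OF that]] by (simp_all add: ix_def)
  have ix_eq: "ix (s a \<otimes> z) = a" if "a < k\<^sup>2" "z \<in> Z" for a z
    unfolding ix_def using that s s_trans[of "s a \<otimes> z"] by (intro the1_equality) simp_all
  define f where "f g = (if g \<in> carrier G then \<beta> (ix g) (inv (s (ix g)) \<otimes> g) else 0)" for g
  have "lift G k rho (\<lambda>g. of_rat (f g)) = A"
  proof (rule eq_matI)
    fix i j assume "i < dim_row A" "j < dim_col A"
    then have ij: "i < k" "j < k" using A(1) by simp_all
    have "lift G k rho (\<lambda>g. of_rat (f g)) $$ (i, j) = (\<Sum>g\<in>carrier G. of_rat (f g) * rho g $$ (i, j))"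
      by (rule lift_index[OF ij])
    also have "\<dots> = (\<Sum>(a, z)\<in>{..<k\<^sup>2} \<times> Z. of_rat (f (s a \<otimes> z)) * rho (s a \<otimes> z) $$ (i, j))"
    proof (rule sum.reindex_bij_witness[of _ "\<lambda>(a, z). s a \<otimes> z" "\<lambda>g. (ix g, inv (s (ix g)) \<otimes> g)"])
      fix g assume g: "g \<in> carrier G"
      show "(case (ix g, inv (s (ix g)) \<otimes> g) of (a, z) \<Rightarrow> s a \<otimes> z) = g" using g s ix[OF g] by simp
      show "(ix g, inv (s (ix g)) \<otimes> g) \<in> {..<k\<^sup>2} \<times> Z" using ix[OF g] by simp
      show "(case (ix g, inv (s (ix g)) \<otimes> g) of (a, z) \<Rightarrow> of_rat (f (s a \<otimes> z)) * rho (s a \<otimes> z) $$ (i, j))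
          = of_rat (f g) * rho g $$ (i, j)" using g s ix[OF g] by simp
    next
      fix b assume "b \<in> {..<k\<^sup>2} \<times> Z"
      then obtain a z where b: "b = (a, z)" "a < k\<^sup>2" "z \<in> Z" by auto
      show "(ix (case b of (a, z) \<Rightarrow> s a \<otimes> z), inv (s (ix (case b of (a, z) \<Rightarrow> s a \<otimes> z))) \<otimes> (case b of (a, z) \<Rightarrow> s a \<otimes> z)) = b"
        using b ix_eq[OF b(2,3)] s by simp
      show "(case b of (a, z) \<Rightarrow> s a \<otimes> z) \<in> carrier G" using b s by simp
    qed
    also have "\<dots> = (\<Sum>a<k\<^sup>2. \<Sum>z\<in>Z. of_rat (f (s a \<otimes> z)) * rho (s a \<otimes> z) $$ (i, j))"
      by (simp add: sum.cartesian_product)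
    also have "\<dots> = (\<Sum>a<k\<^sup>2. \<Sum>z\<in>Z. of_rat (\<beta> a z) * \<theta> z * rho (s a) $$ (i, j))"
    proof (intro sum.cong refl)
      fix a z assume "a \<in> {..<k\<^sup>2}" and z: "z \<in> Z"
      then have a: "a < k\<^sup>2" by simp
      have "f (s a \<otimes> z) = \<beta> a z" using ix_eq[OF a z] s[OF a] z by (simp add: f_def)
      moreover have "rho (s a \<otimes> z) = \<theta> z \<cdot>\<^sub>m rho (s a)"
        using rho_mult[OF s[OF a], of z] z rho_Z[OF z] scalar_mult_mat(2)[of "rho (s a)" k] by simp
      ultimately show "of_rat (f (s a \<otimes> z)) * rho (s a \<otimes> z) $$ (i, j) = of_rat (\<beta> a z) * \<theta> z * rho (s a) $$ (i, j)"
        using ij by simp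
    qed
    also have "\<dots> = (\<Sum>a<k\<^sup>2. (mtrace (A * rho (inv (s a))) / of_nat k) * rho (s a) $$ (i, j))"
      by (simp add: \<beta> sum_distrib_right)
    also have "\<dots> = A $$ (i, j)" using matrix_from_traces[OF k s s_trans A(1) ij] by simp
    finally show "lift G k rho (\<lambda>g. of_rat (f g)) $$ (i, j) = A $$ (i, j)" .
  qed (use A(1) in simp_all)
  then show ?thesis by (intro exI[of _ f]) (simp add: f_def)
qed

end

context fin_group
begin

text \<open>Comparing the two formulas for card G gives card H = k card Z, so inducing from the
  polarisation gives degree k. The element z0 makes the rational span of the values of \<theta> the
  whole cyclotomic field.\<close>

theorem split_representation:
  assumes G: "card (carrier G) = p ^ a" and p: "Factorial_Ring.prime p" "odd p"
    and rm: "ramified G (carrier G) Z \<theta>" and root: "\<And>z. z \<in> Z \<Longrightarrow> \<theta> z ^ p ^ Suc m = 1"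
    and z0: "z0 \<in> Z" "\<theta> z0 = zeta (p ^ Suc m)" and k: "0 < k" "card (carrier G) = k\<^sup>2 * card Z"
  obtains \<rho> where "is_rep G k \<rho>" "\<And>z. z \<in> Z \<Longrightarrow> \<rho> z = \<theta> z \<cdot>\<^sub>m 1\<^sub>m k"
    "\<And>g. g \<in> carrier G \<Longrightarrow> g \<notin> Z \<Longrightarrow> mtrace (\<rho> g) = 0"
    "\<And>g i j. i < k \<Longrightarrow> j < k \<Longrightarrow> \<rho> g $$ (i, j) \<in> cyclo_field (p ^ Suc m)"
    "\<And>A. A \<in> qcarrier (mat_alg k (p ^ Suc m)) \<Longrightarrow>
      \<exists>f. (\<forall>x. x \<notin> carrier G \<longrightarrow> f x = 0) \<and> lift G k \<rho> (\<lambda>g. of_rat (f g)) = A"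
proof -
  have Z: "subgroup Z G" and th: "lchar G Z \<theta>" and ci: "conj_inv G (carrier G) Z \<theta>"
    using rm by (simp_all add: ramified_def inv_char_def inv_char_axioms_def)
  interpret Z: subgroup Z G by (rule Z)
  have th_pow: "\<theta> (z0 [^] (i::nat)) = \<theta> z0 ^ i" "z0 [^] i \<in> Z" for i
    using th z0(1) subgroup_pow_closed[OF Z z0(1)] by (induction i) (simp_all add: lchar_def mult.commute)
  obtain H \<mu> where H: "subgroup H G" "Z \<subseteq> H" "H \<subseteq> carrier G" "lchar G H \<mu>" "\<forall>z\<in>Z. \<mu> z = \<theta> z"
    "\<forall>h\<in>H. \<mu> h ^ p ^ Suc m = 1" "card (carrier G) * card Z = (card H)\<^sup>2"
    using polarisation[OF G p rm root] by metis
  have cz: "0 < card Z" by (rule card_subgroup_pos[OF Z])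
  have "(k * card Z)\<^sup>2 = (card H)\<^sup>2" using H(7) k(2) by (simp add: power2_eq_square mult_ac)
  then have "card H = k * card Z" by simp
  then have "card (carrier G) = k * card H" using k(2) by (simp add: power2_eq_square mult.assoc)
  then obtain t where t: "\<And>i. i < k \<Longrightarrow> t i \<in> carrier G" "\<And>g. g \<in> carrier G \<Longrightarrow> \<exists>!i. i < k \<and> inv (t i) \<otimes> g \<in> H"
    using left_transversal[OF H(1)] by metis
  interpret M: monomial G Z \<theta> H \<mu> k t
    by (intro monomial.intro monomial_axioms.intro fin_group_axioms Z th ci ramified.ram[OF rm] H(1,2,4) t k(2))
      (use H(5) in simp_all)
  have d: "0 < p ^ Suc m" using prime_gt_0_nat[OF p(1)] by simp
  have zp: "zeta (p ^ Suc m) ^ p ^ m \<noteq> 1"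
  proof
    assume "zeta (p ^ Suc m) ^ p ^ m = 1"
    then have "p ^ Suc m dvd p ^ m" by (rule zeta_primitive[OF d])
    then show False using prime_gt_1_nat[OF p(1)] by (auto dest: dvd_imp_le)
  qed
  have muF: "\<mu> h \<in> cyclo_field (p ^ Suc m)" if h: "h \<in> H" for h
  proof -
    have "\<mu> h ^ p ^ Suc m = 1" using H(6) h by blast
    then obtain j where "\<mu> h = zeta (p ^ Suc m) ^ j"
      by (rule primitive_prime_power_root[OF p(1) zeta_root[OF d] zp])
    then show ?thesis using cyclo_field_power[OF cyclo_field_closed(1)] by simp
  qed
  have F: "\<exists>\<beta>::'a \<Rightarrow> rat. c = (\<Sum>z\<in>Z. of_rat (\<beta> z) * \<theta> z)" if c: "c \<in> cyclo_field (p ^ Suc m)" for c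
  proof -
    obtain n and q :: "nat \<Rightarrow> rat" where q: "c = (\<Sum>i\<le>n. of_rat (q i) * zeta (p ^ Suc m) ^ i)"
      by (rule cyclo_field_repr[OF p(1) c])
    \<comment> \<open>Different exponents may give the same power of z0; their coefficients are
      collected.\<close>
    define \<beta> where "\<beta> z = (\<Sum>i\<in>{i \<in> {..n}. z0 [^] i = z}. q i)" for z
    have fZ: "finite Z" using fin Z.subset finite_subset by blast
    have "(\<Sum>z\<in>Z. of_rat (\<beta> z) * \<theta> z) = (\<Sum>z\<in>Z. \<Sum>i\<in>{i \<in> {..n}. z0 [^] i = z}. of_rat (q i) * \<theta> (z0 [^] i))"
      by (intro sum.cong refl) (simp add: \<beta>_def of_rat_sum sum_distrib_right)
    also have "\<dots> = (\<Sum>i\<le>n. of_rat (q i) * \<theta> (z0 [^] i))"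
      using fZ th_pow(2) by (intro sum.group) auto
    also have "\<dots> = c" using z0(2) th_pow(1) by (simp add: q)
    finally show ?thesis by (intro exI[of _ \<beta>]) simp
  qed
  show thesis
  proof (rule that[of M.rho])
    show "M.rho g $$ (i, j) \<in> cyclo_field (p ^ Suc m)" if "i < k" "j < k" for g i j
      using that muF by (simp add: M.rho_index M.mu0_def cyclo_field_closed)
    show "\<exists>f. (\<forall>x. x \<notin> carrier G \<longrightarrow> f x = 0) \<and> lift G k M.rho (\<lambda>g. of_rat (f g)) = A"
      if "A \<in> qcarrier (mat_alg k (p ^ Suc m))" for A
      using that by (intro M.rat_span_surjective[OF k(1) F muF]) (simp_all add: mat_alg_def)
  qed (simp_all add: M.rho_rep M.rho_Z M.rho_trace)
qed

end

subsection \<open>Counting cyclic subgroups and linear characters\<close>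

context group
begin

lemma nat_pow_eq_iff: "x \<in> carrier G \<Longrightarrow> x [^] (a::nat) = x [^] (b::nat) \<longleftrightarrow> [a = b] (mod ord x)"
  using int_pow_eq[of x "int a" "int b"] by (simp add: int_pow_int cong_iff_dvd_diff dvd_diff_commute flip: cong_int_iff)

lemma ord_prime_power_iff:
  assumes p: "Factorial_Ring.prime (p::nat)" and x: "x \<in> carrier G"
  shows "ord x = p ^ Suc m \<longleftrightarrow> x [^] (p ^ Suc m) = \<one> \<and> x [^] (p ^ m) \<noteq> \<one>"
proof -
  have "ord x = p ^ Suc m \<longleftrightarrow> ord x dvd p ^ Suc m \<and> \<not> ord x dvd p ^ m"
  proof
    assume "ord x = p ^ Suc m"
    then show "ord x dvd p ^ Suc m \<and> \<not> ord x dvd p ^ m"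
      using prime_gt_1_nat[OF p] by (auto dest: dvd_imp_le)
  next
    assume a: "ord x dvd p ^ Suc m \<and> \<not> ord x dvd p ^ m"
    then obtain e where e: "e \<le> Suc m" "ord x = p ^ e" using divides_primepow_nat[OF p] by blast
    have "\<not> e \<le> m" using a e(2) le_imp_power_dvd by metis
    then show "ord x = p ^ Suc m" using e by (simp add: le_Suc_eq)
  qed
  then show ?thesis using pow_eq_id[OF x] by simp
qed

lemma generate_eq_iff_power:
  assumes fin: "finite (carrier G)" and x: "x \<in> carrier G" "ord x = d" and y: "y \<in> carrier G"
  shows "generate G {y} = generate G {x} \<longleftrightarrow> (\<exists>j\<in>totatives d. y = x [^] j)"
proof -
  have gen: "generate G {z} = {z [^] k | k. k \<in> (UNIV::nat set)}" if "z \<in> carrier G" for z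
    using generate_pow_on_finite_carrier[OF fin that] .
  have d0: "0 < d" using ord_ge_1[OF fin x(1)] x(2) by simp
  show ?thesis
  proof
    assume eq: "generate G {y} = generate G {x}"
    have "y \<in> generate G {x}" using generate.incl[of y "{y}" G] eq by simp
    then obtain i :: nat where i: "y = x [^] i" using gen[OF x(1)] by auto
    have "x \<in> generate G {y}" using generate.incl[of x "{x}" G] eq by simp
    then obtain l :: nat where "x = y [^] l" using gen[OF y] by auto
    then have "x [^] (1::nat) = x [^] (i * l)" using i x(1) by (simp add: nat_pow_pow)
    then have "[i * l = Suc 0] (mod d)" using nat_pow_eq_iff[OF x(1), of 1 "i * l"] x(2) by (simp add: cong_sym)
    then have cop: "coprime i d" using coprime_iff_invertible_nat by blast
    \<comment> \<open>\<open>totatives d\<close> runs from 1 to d, so the residue 0 is represented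
      by d; this arises only for d = 1.\<close>
    define j where "j = (if i mod d = 0 then d else i mod d)"
    have "j \<in> totatives d"
    proof (cases "i mod d = 0")
      case True
      then have "d dvd i" by (rule mod_0_imp_dvd)
      then have "d dvd 1" using coprime_common_divisor[OF cop, of d] by simp
      then show ?thesis using True by (simp add: j_def totatives_def)
    next
      case False
      have "coprime (i mod d) d" using cop d0 by (simp add: coprime_mod_left_iff)
      then show ?thesis using False mod_less_divisor[OF d0, of i] by (simp add: j_def totatives_def)
    qed
    moreover have "x [^] j = x [^] i"
    proof -
      have "x [^] i = x [^] (d * (i div d)) \<otimes> x [^] (i mod d)" using x(1) by (simp add: nat_pow_mult)
      also have "x [^] (d * (i div d)) = \<one>" using x pow_ord_eq_1[OF x(1)] by (simp flip: nat_pow_pow)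
      finally have "x [^] i = x [^] (i mod d)" using x(1) by simp
      then show ?thesis using x pow_ord_eq_1[OF x(1)] by (simp add: j_def)
    qed
    ultimately show "\<exists>j\<in>totatives d. y = x [^] j" using i by metis
  next
    assume "\<exists>j\<in>totatives d. y = x [^] j"
    then obtain j where j: "j \<in> totatives d" "y = x [^] j" by blast
    then obtain l where "[j * l = Suc 0] (mod d)" using coprime_iff_invertible_nat[of j d] by (auto simp: totatives_def)
    then have "x [^] (j * l) = x [^] (1::nat)" using nat_pow_eq_iff[OF x(1), of "j * l" 1] x(2) by simp
    then have "x = y [^] l" using j(2) x(1) by (simp add: nat_pow_pow)
    then have "x \<in> generate G {y}" using gen[OF y] by auto
    moreover have "y \<in> generate G {x}" using gen[OF x(1)] j(2) by auto
    ultimately show "generate G {y} = generate G {x}"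
      using generate_subgroup_incl[of "{x}" "generate G {y}"] generate_subgroup_incl[of "{y}" "generate G {x}"]
        generate_is_subgroup x(1) y by auto
  qed
qed

text \<open>Each cyclic subgroup of order d has totient d generators, and S contains all of them or
  none. Stated for such an S because it is also applied to the relevant characters alone.\<close>

lemma card_cyclic_classes:
  assumes fin: "finite (carrier G)" and S: "S \<subseteq> {x \<in> carrier G. ord x = d}"
    and cl: "\<And>x y. x \<in> S \<Longrightarrow> y \<in> carrier G \<Longrightarrow> generate G {y} = generate G {x} \<Longrightarrow> y \<in> S"
  shows "card S = totient d * card ((\<lambda>x. generate G {x}) ` S)"
proof -
  have fS: "finite S" using S fin by (auto intro: finite_subset)
  have fib: "card {y \<in> S. generate G {y} = C} = totient d" if C: "C \<in> (\<lambda>x. generate G {x}) ` S" for C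
  proof -
    obtain x where x: "x \<in> S" "C = generate G {x}" using C by blast
    have xc: "x \<in> carrier G" "ord x = d" using S x by auto
    have "{y \<in> S. generate G {y} = C} = (\<lambda>j. x [^] j) ` totatives d"
    proof
      show "{y \<in> S. generate G {y} = C} \<subseteq> (\<lambda>j. x [^] j) ` totatives d"
        using generate_eq_iff_power[OF fin xc] S x(2) by blast
      show "(\<lambda>j. x [^] j) ` totatives d \<subseteq> {y \<in> S. generate G {y} = C}"
      proof clarify
        fix j assume j: "j \<in> totatives d"
        have "generate G {x [^] j} = generate G {x}"
          using generate_eq_iff_power[OF fin xc, of "x [^] j"] j xc(1) by blast
        then show "x [^] j \<in> S \<and> generate G {x [^] j} = C" using cl[OF x(1)] xc(1) x(2) by simp
      qed
    qed
    moreover have "inj_on (\<lambda>j. x [^] j) (totatives d)"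
    proof (rule inj_on_subset[OF ord_inj'[OF xc(1)]])
      show "totatives d \<subseteq> {1..ord x}" unfolding xc(2) by (auto simp: totatives_def)
    qed
    ultimately show ?thesis by (simp add: card_image totient_def)
  qed
  have "card S = (\<Sum>C\<in>(\<lambda>x. generate G {x}) ` S. card {y \<in> S. generate G {y} = C})"
    using sum.group[OF fS finite_imageI[OF fS, of "\<lambda>x. generate G {x}"] subset_refl, where h = "\<lambda>_. 1::nat"] by simp
  also have "\<dots> = totient d * card ((\<lambda>x. generate G {x}) ` S)" using fib by simp
  finally show ?thesis .
qed

lemma num_cyclic_totient:
  assumes fin: "finite (carrier G)"
  shows "card {x \<in> carrier G. ord x = d} = totient d * num_cyclic G d"
proof -
  have "{C. \<exists>x\<in>carrier G. C = generate G {x} \<and> card C = d} = (\<lambda>x. generate G {x}) ` {x \<in> carrier G. ord x = d}"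
    using generate_pow_card by auto
  moreover have "card {x \<in> carrier G. ord x = d} = totient d * card ((\<lambda>x. generate G {x}) ` {x \<in> carrier G. ord x = d})"
    using generate_pow_card by (intro card_cyclic_classes[OF fin]) auto
  ultimately show ?thesis by (simp add: num_cyclic_def)
qed

lemma num_cyclic_1: "num_cyclic G 1 = 1"
proof -
  have c: "card (generate G {x}) = 1 \<longleftrightarrow> x = \<one>" if "x \<in> carrier G" for x
    using generate_pow_card[OF that] ord_eq_1[OF that] by simp
  have "{C. \<exists>x\<in>carrier G. C = generate G {x} \<and> card C = 1} = {generate G {\<one>}}"
  proof (intro equalityI subsetI)
    fix C assume "C \<in> {C. \<exists>x\<in>carrier G. C = generate G {x} \<and> card C = 1}"
    then obtain x where "x \<in> carrier G" "C = generate G {x}" "card (generate G {x}) = 1" by blast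
    then show "C \<in> {generate G {\<one>}}" using c by simp
  next
    fix C assume "C \<in> {generate G {\<one>}}"
    then show "C \<in> {C. \<exists>x\<in>carrier G. C = generate G {x} \<and> card C = 1}" using c[OF one_closed] one_closed by blast
  qed
  then show ?thesis by (simp add: num_cyclic_def)
qed

lemma grp_exponent:
  assumes fin: "finite (carrier G)"
  shows "0 < grp_exponent G" "\<And>x. x \<in> carrier G \<Longrightarrow> x [^] grp_exponent G = \<one>" "grp_exponent G dvd Coset.order G"
    "num_cyclic G d \<noteq> 0 \<Longrightarrow> d dvd grp_exponent G"
proof -
  let ?P = "\<lambda>e::nat. 0 < e \<and> (\<forall>x\<in>carrier G. x [^] e = \<one>)"
  have o: "?P (Coset.order G)" using pow_order_eq_1 fin order_gt_0_iff_finite by blast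
  have e: "?P (grp_exponent G)" unfolding grp_exponent_def using o by (rule LeastI)
  then show "0 < grp_exponent G" and pow: "\<And>x. x \<in> carrier G \<Longrightarrow> x [^] grp_exponent G = \<one>" by auto
  show "grp_exponent G dvd Coset.order G"
  proof (rule ccontr)
    assume nd: "\<not> ?thesis"
    define r where "r = Coset.order G mod grp_exponent G"
    have "x [^] r = \<one>" if x: "x \<in> carrier G" for x
    proof -
      have "\<one> = x [^] (grp_exponent G * (Coset.order G div grp_exponent G)) \<otimes> x [^] r"
        using o x by (simp add: r_def nat_pow_mult)
      also have "x [^] (grp_exponent G * (Coset.order G div grp_exponent G)) = \<one>"
        using pow[OF x] x by (simp flip: nat_pow_pow)
      finally show ?thesis using x by simp
    qed
    moreover have "0 < r" using nd by (simp add: r_def mod_greater_zero_iff_not_dvd)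
    ultimately have "grp_exponent G \<le> r" unfolding grp_exponent_def by (intro Least_le) simp
    moreover have "r < grp_exponent G" unfolding r_def using e by (intro mod_less_divisor) simp
    ultimately show False by simp
  qed
  show "d dvd grp_exponent G" if "num_cyclic G d \<noteq> 0"
  proof -
    have "{C. \<exists>x\<in>carrier G. C = generate G {x} \<and> card C = d} \<noteq> {}"
      using that unfolding num_cyclic_def by (metis card.empty)
    then obtain x where "x \<in> carrier G" "card (generate G {x}) = d" by blast
    then show ?thesis using pow pow_eq_id generate_pow_card by metis
  qed
qed

end

section \<open>Linear characters of an abelian section Z/K\<close>

text \<open>The commutator condition makes K normal in Z with abelian quotient. Characters of Z/K
  are handled as functions on Z that are trivial on K.\<close>

locale abelian_section = fin_group +
  fixes Z K :: "'a set"
  assumes Z: "subgroup Z G" and K: "subgroup K G" and KZ: "K \<subseteq> Z"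
    and cmtK: "\<And>x y. x \<in> Z \<Longrightarrow> y \<in> Z \<Longrightarrow> cmt G x y \<in> K"
begin

sublocale Z: subgroup Z G by (rule Z)
sublocale K: subgroup K G by (rule K)

abbreviation GZ :: "'a monoid" where "GZ \<equiv> G\<lparr>carrier := Z\<rparr>"

lemma K_Z: "x \<in> K \<Longrightarrow> x \<in> Z" using KZ by blast

lemma finite_Z: "finite Z" using fin Z.subset finite_subset by blast

lemma K_conj: "x \<in> K \<Longrightarrow> y \<in> Z \<Longrightarrow> inv y \<otimes> x \<otimes> y \<in> K"
proof -
  assume xy: "x \<in> K" "y \<in> Z"
  have "inv y \<otimes> x \<otimes> y = x \<otimes> cmt G x y" using xy by (simp add: cmt_def m_assoc)
  then show ?thesis using cmtK[OF K_Z[OF xy(1)] xy(2)] xy(1) by simp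
qed

lemma GZ_fin_group: "fin_group GZ"
  using subgroup_imp_group[OF Z] finite_Z by (simp add: fin_group_def fin_group_axioms_def)

lemma K_normal: "K \<lhd> GZ"
proof -
  interpret GZ: fin_group GZ by (rule GZ_fin_group)
  have "subgroup K GZ" by (rule subgroup_incl[OF K Z KZ])
  then show ?thesis unfolding GZ.normal_inv_iff
  proof (intro conjI ballI)
    fix x h assume xh: "x \<in> carrier GZ" "h \<in> K"
    have "inv (inv x) \<otimes> h \<otimes> inv x \<in> K" using xh by (intro K_conj) simp_all
    then show "x \<otimes>\<^bsub>GZ\<^esub> h \<otimes>\<^bsub>GZ\<^esub> inv\<^bsub>GZ\<^esub> x \<in> K" using xh m_inv_consistent[OF Z, of x] by simp
  qed
qed

lemma subquot_group: "group (subquot G Z K)"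
  unfolding subquot_def by (rule normal.factorgroup_is_group[OF K_normal])

lemma subquot_carrier: "carrier (subquot G Z K) = (\<lambda>z. K #> z) ` Z"
  unfolding subquot_def carrier_FactGroup by (simp add: r_coset_def)

lemma subquot_finite: "finite (carrier (subquot G Z K))"
  unfolding subquot_carrier using finite_Z by simp

lemma subquot_one: "\<one>\<^bsub>subquot G Z K\<^esub> = K"
  by (simp add: subquot_def)

lemma subquot_pow: "z \<in> Z \<Longrightarrow> (K #> z) [^]\<^bsub>subquot G Z K\<^esub> (e::nat) = K #> (z [^] e)"
  using normal.FactGroup_pow[OF K_normal, of z e] nat_pow_consistent[of z e Z]
  by (simp add: subquot_def r_coset_def)

lemma coset_eq_K: "z \<in> Z \<Longrightarrow> K #> z = K \<longleftrightarrow> z \<in> K"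
  using coset_join2[of z K] rcos_self[OF _ K, of z] K by auto

lemma card_coset_preimage:
  assumes S: "S \<subseteq> carrier (subquot G Z K)"
  shows "card {z \<in> Z. K #> z \<in> S} = card K * card S"
proof -
  have fS: "finite S" using S subquot_finite finite_subset by blast
  have "card {z \<in> Z. K #> z \<in> S} = (\<Sum>c\<in>S. card {z \<in> {z \<in> Z. K #> z \<in> S}. K #> z = c})"
    using sum.group[OF _ fS, where S = "{z \<in> Z. K #> z \<in> S}" and g = "\<lambda>z. K #> z" and h = "\<lambda>_. 1::nat"] finite_Z
    by (simp add: image_subset_iff)
  also have "\<dots> = (\<Sum>c\<in>S. card K)"
  proof (rule sum.cong[OF refl])
    fix c assume c: "c \<in> S"
    then obtain w where w: "w \<in> Z" "c = K #> w" using S subquot_carrier by auto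
    have "{z \<in> {z \<in> Z. K #> z \<in> S}. K #> z = c} = c"
    proof (intro equalityI subsetI)
      fix z assume "z \<in> {z \<in> {z \<in> Z. K #> z \<in> S}. K #> z = c}"
      then show "z \<in> c" using rcos_self[OF _ K, of z] by auto
    next
      fix z assume z: "z \<in> c"
      then obtain k where k: "k \<in> K" "z = k \<otimes> w" using w by (auto simp: r_coset_def)
      then have zZ: "z \<in> Z" using w K_Z by simp
      have "K #> z = c" using repr_independence[of z K w] z w K by simp
      then show "z \<in> {z \<in> {z \<in> Z. K #> z \<in> S}. K #> z = c}" using c zZ by simp
    qed
    moreover have "c \<in> rcosets K" using w by (auto simp: RCOSETS_def)
    then have "card c = card K" using card_rcosets_equal[of c K] K.subset by simp
    ultimately show "card {z \<in> {z \<in> Z. K #> z \<in> S}. K #> z = c} = card K" by simp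
  qed
  finally show ?thesis by (simp add: mult.commute)
qed

lemma num_cyclic_subquot:
  assumes p: "Factorial_Ring.prime p"
  shows "card {z \<in> Z. z [^] (p ^ Suc m) \<in> K \<and> z [^] (p ^ m) \<notin> K}
    = card K * (totient (p ^ Suc m) * num_cyclic (subquot G Z K) (p ^ Suc m))"
proof -
  interpret A: group "subquot G Z K" by (rule subquot_group)
  let ?S = "{x \<in> carrier (subquot G Z K). A.ord x = p ^ Suc m}"
  have pow: "z [^] (e::nat) \<in> Z" if "z \<in> Z" for z e using subgroup_pow_closed[OF Z that] .
  have "{z \<in> Z. K #> z \<in> ?S} = {z \<in> Z. z [^] (p ^ Suc m) \<in> K \<and> z [^] (p ^ m) \<notin> K}"
  proof (intro Collect_cong conj_cong refl)
    fix z assume z: "z \<in> Z"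
    then have zc: "K #> z \<in> carrier (subquot G Z K)" by (auto simp: subquot_carrier)
    show "K #> z \<in> ?S \<longleftrightarrow> z [^] (p ^ Suc m) \<in> K \<and> z [^] (p ^ m) \<notin> K"
      using zc A.ord_prime_power_iff[OF p zc, of m] coset_eq_K[OF pow[OF z]] subquot_pow[OF z] by (simp add: subquot_one)
  qed
  then show ?thesis
    using card_coset_preimage[of ?S] A.num_cyclic_totient[OF subquot_finite] by simp
qed

text \<open>The value 0 off Z makes equal characters equal functions, so that they can be
  counted.\<close>

definition chars :: "('a \<Rightarrow> complex) set" where
  "chars = {\<theta>. (\<forall>g. g \<notin> Z \<longrightarrow> \<theta> g = 0) \<and> lchar G Z \<theta> \<and> (\<forall>k\<in>K. \<theta> k = 1)}"

lemma charsD: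
  assumes "\<theta> \<in> chars"
  shows "g \<notin> Z \<Longrightarrow> \<theta> g = 0" "lchar G Z \<theta>" "k \<in> K \<Longrightarrow> \<theta> k = 1" "\<theta> \<one> = 1"
    "x \<in> Z \<Longrightarrow> y \<in> Z \<Longrightarrow> \<theta> (x \<otimes> y) = \<theta> x * \<theta> y"
  using assms by (auto simp: chars_def lchar_def)

lemma chars_pow: "\<theta> \<in> chars \<Longrightarrow> z \<in> Z \<Longrightarrow> \<theta> (z [^] (e::nat)) = \<theta> z ^ e"
  by (induction e) (simp_all add: charsD subgroup_pow_closed[OF Z] mult.commute)

lemma chars_nz: "\<theta> \<in> chars \<Longrightarrow> z \<in> Z \<Longrightarrow> \<theta> z \<noteq> 0"
  using lchar_inv(2)[OF Z charsD(2)] .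

lemma chars_order:
  assumes "\<theta> \<in> chars" "z \<in> Z"
  shows "\<theta> z ^ card (carrier G) = 1"
  using chars_pow[OF assms, of "card (carrier G)"] pow_order_eq_1[of z] charsD(4)[OF assms(1)] assms(2)
  by (simp add: Coset.order_def)

lemma finite_chars: "finite chars"
proof -
  have n: "0 < card (carrier G)" using fin by (auto simp: card_gt_0_iff)
  have "finite {f. \<forall>x. (x \<in> Z \<longrightarrow> f x \<in> {z::complex. z ^ card (carrier G) = 1}) \<and> (x \<notin> Z \<longrightarrow> f x = 0)}"
    using finite_Z finite_roots_unity[of "card (carrier G)", where ?'a = complex] n
    by (intro finite_set_of_finite_funs) simp_all
  then show ?thesis by (rule finite_subset[rotated]) (auto simp: chars_order charsD(1))
qed

text \<open>An irreducible representation of Z that is trivial on K but not at z has commuting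
  matrices; by Schur they are scalar, and the scalars form the character.\<close>

lemma chars_separate:
  assumes z: "z \<in> Z" "z \<notin> K"
  obtains \<theta> where "\<theta> \<in> chars" "\<theta> z \<noteq> 1"
proof -
  interpret GZ: fin_group GZ by (rule GZ_fin_group)
  have invZ: "inv\<^bsub>GZ\<^esub> x = inv x" if "x \<in> Z" for x using m_inv_consistent[OF Z that] .
  have sub: "subgroup K GZ" by (rule subgroup_incl[OF K Z KZ])
  have nm: "inv\<^bsub>GZ\<^esub> g \<otimes>\<^bsub>GZ\<^esub> x \<otimes>\<^bsub>GZ\<^esub> g \<in> K" if "x \<in> K" "g \<in> carrier GZ" for x g
    using that K_conj by (simp add: invZ)
  obtain n \<rho> where r: "irr_rep GZ n \<rho>" "\<And>x. x \<in> K \<Longrightarrow> \<rho> x = 1\<^sub>m n" "\<rho> z \<noteq> 1\<^sub>m n"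
    using z by (rule_tac GZ.exists_irr_kernel[OF sub nm, of z]) simp_all
  interpret I: irrep GZ n \<rho> by unfold_locales (rule r(1))
  have "\<rho> x * \<rho> y = \<rho> y * \<rho> x" if xy: "x \<in> Z" "y \<in> Z" for x y
  proof -
    have "x \<otimes> y = y \<otimes> x \<otimes> cmt G x y" using xy by (simp add: cmt_def m_assoc)
    then have "\<rho> (x \<otimes> y) = \<rho> (y \<otimes> x) * \<rho> (cmt G x y)"
      using I.rho_mult[of "y \<otimes> x" "cmt G x y"] xy K_Z[OF cmtK[OF xy]] by simp
    also have "\<dots> = \<rho> (y \<otimes> x)" using r(2)[OF cmtK[OF xy]] xy I.rho_carrier[of "y \<otimes> x"] by simp
    finally show ?thesis using I.rho_mult[of x y] I.rho_mult[of y x] xy by simp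
  qed
  then have comm: "\<rho> g * \<rho> x = \<rho> x * \<rho> g" if "x \<in> Z" "g \<in> carrier GZ" for x g using that by simp
  have "\<exists>c. \<rho> x = c \<cdot>\<^sub>m 1\<^sub>m n" if "x \<in> Z" for x
    using that comm[OF that] I.rho_carrier[of x] by (rule_tac I.schur[of "\<rho> x"]) (simp, simp, rule exI)
  then obtain c where c: "\<And>x. x \<in> Z \<Longrightarrow> \<rho> x = c x \<cdot>\<^sub>m 1\<^sub>m n" by metis
  have c_eq: "c x = \<rho> x $$ (0, 0)" if "x \<in> Z" for x using c[OF that] I.npos by simp
  define \<theta> where "\<theta> x = (if x \<in> Z then c x else 0)" for x
  have "\<theta> \<in> chars"
    unfolding chars_def lchar_def
  proof (intro CollectI conjI allI impI ballI)
    show "\<theta> \<one> = 1" using c_eq[OF Z.one_closed] I.rho_one I.npos by (simp add: \<theta>_def)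
    show "\<theta> k = 1" if "k \<in> K" for k using c_eq[OF K_Z[OF that]] r(2)[OF that] I.npos K_Z[OF that] by (simp add: \<theta>_def)
    fix x y assume xy: "x \<in> Z" "y \<in> Z"
    have "\<rho> (x \<otimes> y) = (c x \<cdot>\<^sub>m 1\<^sub>m n) * (c y \<cdot>\<^sub>m 1\<^sub>m n)" using I.rho_mult[of x y] xy c by simp
    also have "\<dots> = c x \<cdot>\<^sub>m (c y \<cdot>\<^sub>m 1\<^sub>m n)" by (rule scalar_mult_mat) simp
    finally show "\<theta> (x \<otimes> y) = \<theta> x * \<theta> y" using c_eq[of "x \<otimes> y"] xy I.npos by (simp add: \<theta>_def)
  qed (simp add: \<theta>_def)
  moreover have "\<theta> z \<noteq> 1"
  proof
    assume "\<theta> z = 1"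
    then have "\<rho> z = 1 \<cdot>\<^sub>m 1\<^sub>m n" using c[OF z(1)] z(1) by (simp add: \<theta>_def)
    also have "\<dots> = 1\<^sub>m n" by (intro eq_matI) simp_all
    finally show False using r(3) by simp
  qed
  ultimately show thesis by (rule that)
qed

lemma row_orthogonality:
  assumes "lchar G Z \<theta>"
  shows "(\<Sum>z\<in>Z. \<theta> z) = (if \<forall>z\<in>Z. \<theta> z = 1 then of_nat (card Z) else 0)"
proof (cases "\<forall>z\<in>Z. \<theta> z = 1")
  case False
  then obtain w where w: "w \<in> Z" "\<theta> w \<noteq> 1" by blast
  have "\<theta> w * (\<Sum>z\<in>Z. \<theta> z) = (\<Sum>z\<in>Z. \<theta> (w \<otimes> z))"
    using w assms by (simp add: sum_distrib_left lchar_def)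
  also have "\<dots> = (\<Sum>z\<in>Z. \<theta> z)"
    by (rule sum.reindex_bij_witness[of _ "\<lambda>z. inv w \<otimes> z" "\<lambda>z. w \<otimes> z"]) (use w in auto)
  finally have "(\<Sum>z\<in>Z. \<theta> z) = 0" using w by simp
  then show ?thesis unfolding if_not_P[OF False] .
qed simp

lemma column_orthogonality:
  assumes z: "z \<in> Z"
  shows "(\<Sum>\<theta>\<in>chars. \<theta> z) = (if z \<in> K then of_nat (card chars) else 0)"
proof (cases "z \<in> K")
  case True
  then have "(\<Sum>\<theta>\<in>chars. \<theta> z) = (\<Sum>\<theta>\<in>chars. 1)" by (intro sum.cong refl charsD(3))
  then show ?thesis using True by simp
next
  case False
  obtain \<psi> where \<psi>: "\<psi> \<in> chars" "\<psi> z \<noteq> 1" using chars_separate[OF z False] .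
  have mult: "(\<lambda>x. \<psi> x * \<theta> x) \<in> chars" if "\<theta> \<in> chars" for \<theta>
    using that \<psi>(1) by (auto simp: chars_def lchar_def)
  have inv: "(\<lambda>x. if x \<in> Z then inverse (\<psi> x) * \<theta> x else 0) \<in> chars" if "\<theta> \<in> chars" for \<theta>
    using that \<psi>(1) K_Z by (auto simp: chars_def lchar_def)
  have "\<psi> z * (\<Sum>\<theta>\<in>chars. \<theta> z) = (\<Sum>\<theta>\<in>chars. (\<lambda>x. \<psi> x * \<theta> x) z)" by (simp add: sum_distrib_left)
  also have "\<dots> = (\<Sum>\<theta>\<in>chars. \<theta> z)"
    by (rule sum.reindex_bij_witness[of _ "\<lambda>\<theta> x. if x \<in> Z then inverse (\<psi> x) * \<theta> x else 0" "\<lambda>\<theta> x. \<psi> x * \<theta> x"])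
      (use mult inv chars_nz[OF \<psi>(1)] in \<open>auto simp: fun_eq_iff charsD(1)\<close>)
  finally have "(\<Sum>\<theta>\<in>chars. \<theta> z) = 0" using \<psi>(2) by simp
  then show ?thesis using False by simp
qed

text \<open>The sum of all \<theta>(z) is evaluated by rows and by columns.\<close>

lemma card_chars: "card chars * card K = card Z"
proof -
  have "(\<Sum>\<theta>\<in>chars. \<Sum>z\<in>Z. \<theta> z) = (\<Sum>\<theta>\<in>chars. if \<theta> = (\<lambda>z. if z \<in> Z then 1 else 0) then of_nat (card Z) else 0)"
  proof (rule sum.cong[OF refl])
    fix \<theta> assume "\<theta> \<in> chars"
    then show "(\<Sum>z\<in>Z. \<theta> z) = (if \<theta> = (\<lambda>z. if z \<in> Z then 1 else 0) then of_nat (card Z) else 0)"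
      using row_orthogonality[OF charsD(2)] charsD(1) by (auto simp: fun_eq_iff)
  qed
  also have "\<dots> = of_nat (card Z)"
  proof -
    have "(\<lambda>z. if z \<in> Z then 1 else 0) \<in> chars" using K_Z by (auto simp: chars_def lchar_def)
    then show ?thesis using finite_chars by simp
  qed
  finally have "of_nat (card Z) = (\<Sum>z\<in>Z. \<Sum>\<theta>\<in>chars. \<theta> z)" by (subst sum.swap) simp
  also have "\<dots> = (\<Sum>z\<in>Z. if z \<in> K then of_nat (card chars) else 0)"
    by (intro sum.cong refl column_orthogonality)
  also have "\<dots> = of_nat (card K * card chars)"
    using finite_Z KZ by (simp add: sum.If_cases Int_absorb1 Int_absorb2 inf.absorb2 Int_commute)
  finally show ?thesis unfolding of_nat_eq_iff by simp
qed

text \<open>The sum of all \<theta>(z)^e is evaluated twice: by rows for the character \<theta>^e,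
  and by columns at the element z^e. This gives the duality between Z/K and its characters without
  an isomorphism.\<close>

lemma card_chars_exponent:
  "card {\<theta> \<in> chars. \<forall>z\<in>Z. \<theta> z ^ e = 1} * card K = card {z \<in> Z. z [^] e \<in> K}"
proof -
  have "(\<Sum>\<theta>\<in>chars. \<Sum>z\<in>Z. \<theta> z ^ e) = (\<Sum>\<theta>\<in>chars. if \<forall>z\<in>Z. \<theta> z ^ e = 1 then of_nat (card Z) else 0)"
  proof (intro sum.cong refl)
    fix \<theta> assume "\<theta> \<in> chars"
    then have "lchar G Z (\<lambda>z. \<theta> z ^ e)" by (simp add: lchar_def charsD power_mult_distrib)
    then show "(\<Sum>z\<in>Z. \<theta> z ^ e) = (if \<forall>z\<in>Z. \<theta> z ^ e = 1 then of_nat (card Z) else 0)"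
      by (rule row_orthogonality)
  qed
  also have "\<dots> = of_nat (card {\<theta> \<in> chars. \<forall>z\<in>Z. \<theta> z ^ e = 1} * card Z)"
    using finite_chars by (simp add: sum.If_cases Int_def)
  finally have "of_nat (card {\<theta> \<in> chars. \<forall>z\<in>Z. \<theta> z ^ e = 1} * card Z) = (\<Sum>z\<in>Z. \<Sum>\<theta>\<in>chars. \<theta> z ^ e)"
    by (subst sum.swap) simp
  also have "\<dots> = (\<Sum>z\<in>Z. \<Sum>\<theta>\<in>chars. \<theta> (z [^] e))"
    by (intro sum.cong refl) (simp add: chars_pow)
  also have "\<dots> = (\<Sum>z\<in>Z. if z [^] e \<in> K then of_nat (card chars) else 0)"
    by (intro sum.cong refl column_orthogonality subgroup_pow_closed[OF Z])
  also have "\<dots> = of_nat (card {z \<in> Z. z [^] e \<in> K} * card chars)"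
    using finite_Z by (simp add: sum.If_cases Int_def)
  finally have "card {\<theta> \<in> chars. \<forall>z\<in>Z. \<theta> z ^ e = 1} * card Z = card {z \<in> Z. z [^] e \<in> K} * card chars"
    unfolding of_nat_eq_iff .
  then have "card {\<theta> \<in> chars. \<forall>z\<in>Z. \<theta> z ^ e = 1} * card K * card chars = card {z \<in> Z. z [^] e \<in> K} * card chars"
    by (simp only: card_chars[symmetric] mult_ac)
  moreover have "card chars \<noteq> 0" using card_chars card_subgroup_pos[OF Z] by (metis less_irrefl mult_0)
  ultimately show ?thesis by simp
qed

definition chars_of_order :: "nat \<Rightarrow> nat \<Rightarrow> ('a \<Rightarrow> complex) set" where
  "chars_of_order p m = {\<theta> \<in> chars. (\<forall>z\<in>Z. \<theta> z ^ p ^ Suc m = 1) \<and> (\<exists>z\<in>Z. \<theta> z ^ p ^ m \<noteq> 1)}"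

text \<open>Subtracting \<open>card_chars_exponent\<close> for p^m from that for p^(m+1) passes from
  exponents to exact orders, on the characters as on Z/K.\<close>

lemma card_chars_of_order:
  assumes p: "Factorial_Ring.prime p"
  shows "card (chars_of_order p m) = totient (p ^ Suc m) * num_cyclic (subquot G Z K) (p ^ Suc m)"
proof -
  let ?A = "\<lambda>e. {\<theta> \<in> chars. \<forall>z\<in>Z. \<theta> z ^ e = 1}" and ?B = "\<lambda>e. {z \<in> Z. z [^] e \<in> K}"
  have "?A (p ^ m) \<subseteq> ?A (p ^ Suc m)" by (auto simp: mult.commute[of p] power_mult)
  moreover have "chars_of_order p m = ?A (p ^ Suc m) - ?A (p ^ m)" by (auto simp: chars_of_order_def)
  ultimately have 1: "card (chars_of_order p m) = card (?A (p ^ Suc m)) - card (?A (p ^ m))"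
    using finite_chars by (simp add: card_Diff_subset)
  have "z [^] (p ^ Suc m) \<in> K" if "z \<in> Z" "z [^] (p ^ m) \<in> K" for z
    using subgroup_pow_closed[OF K that(2), of p] that(1) by (simp add: nat_pow_pow mult.commute)
  then have "?B (p ^ m) \<subseteq> ?B (p ^ Suc m)" by auto
  moreover have "{z \<in> Z. z [^] (p ^ Suc m) \<in> K \<and> z [^] (p ^ m) \<notin> K} = ?B (p ^ Suc m) - ?B (p ^ m)" by auto
  ultimately have "card {z \<in> Z. z [^] (p ^ Suc m) \<in> K \<and> z [^] (p ^ m) \<notin> K} = card (?B (p ^ Suc m)) - card (?B (p ^ m))"
    using finite_Z by (simp add: card_Diff_subset)
  then have "card K * (totient (p ^ Suc m) * num_cyclic (subquot G Z K) (p ^ Suc m)) = card (chars_of_order p m) * card K"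
    unfolding num_cyclic_subquot[OF p] 1 diff_mult_distrib card_chars_exponent by simp
  then show ?thesis using card_subgroup_pos[OF K] by (simp add: mult.commute)
qed

text \<open>The character group as a structure of its own, so that
  \<open>card_cyclic_classes\<close> can be applied to it.\<close>

definition dual :: "('a \<Rightarrow> complex) monoid" where
  "dual = \<lparr>carrier = chars, monoid.mult = (\<lambda>\<theta> \<psi> z. \<theta> z * \<psi> z), one = (\<lambda>z. if z \<in> Z then 1 else 0)\<rparr>"

lemma dual_group: "group dual"
proof (rule groupI)
  show "\<one>\<^bsub>dual\<^esub> \<in> carrier dual" using K_Z by (auto simp: dual_def chars_def lchar_def)
  show "\<And>\<theta> \<psi>. \<theta> \<in> carrier dual \<Longrightarrow> \<psi> \<in> carrier dual \<Longrightarrow> \<theta> \<otimes>\<^bsub>dual\<^esub> \<psi> \<in> carrier dual"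
    by (auto simp: dual_def chars_def lchar_def)
  show "\<And>\<theta>. \<theta> \<in> carrier dual \<Longrightarrow> \<one>\<^bsub>dual\<^esub> \<otimes>\<^bsub>dual\<^esub> \<theta> = \<theta>"
    by (auto simp: dual_def charsD(1) fun_eq_iff)
  show "\<exists>\<psi>\<in>carrier dual. \<psi> \<otimes>\<^bsub>dual\<^esub> \<theta> = \<one>\<^bsub>dual\<^esub>" if "\<theta> \<in> carrier dual" for \<theta>
  proof (rule bexI[of _ "\<lambda>z. if z \<in> Z then inverse (\<theta> z) else 0"])
    show "(\<lambda>z. if z \<in> Z then inverse (\<theta> z) else 0) \<in> carrier dual"
      using that K_Z by (auto simp: dual_def chars_def lchar_def)
    show "(\<lambda>z. if z \<in> Z then inverse (\<theta> z) else 0) \<otimes>\<^bsub>dual\<^esub> \<theta> = \<one>\<^bsub>dual\<^esub>"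
      using that chars_nz by (auto simp: dual_def fun_eq_iff)
  qed
qed (simp add: dual_def mult.assoc)

lemma dual_one: "z \<in> Z \<Longrightarrow> \<one>\<^bsub>dual\<^esub> z = 1"
  by (simp add: dual_def)

lemma dual_carrier: "carrier dual = chars"
  by (simp add: dual_def)

lemma dual_pow: "\<theta> \<in> chars \<Longrightarrow> z \<in> Z \<Longrightarrow> (\<theta> [^]\<^bsub>dual\<^esub> (k::nat)) z = \<theta> z ^ k"
proof -
  interpret D: group dual by (rule dual_group)
  show "\<theta> \<in> chars \<Longrightarrow> z \<in> Z \<Longrightarrow> (\<theta> [^]\<^bsub>dual\<^esub> (k::nat)) z = \<theta> z ^ k"
    by (induction k) (simp_all add: D.nat_pow_0 D.nat_pow_Suc, simp_all add: dual_def mult.commute)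
qed

lemma chars_eqI: "\<theta> \<in> chars \<Longrightarrow> \<psi> \<in> chars \<Longrightarrow> (\<And>z. z \<in> Z \<Longrightarrow> \<theta> z = \<psi> z) \<Longrightarrow> \<theta> = \<psi>"
  by (metis charsD(1) ext)

lemma chars_of_order_ord:
  assumes p: "Factorial_Ring.prime p"
  shows "chars_of_order p m = {\<theta> \<in> carrier dual. group.ord dual \<theta> = p ^ Suc m}"
proof -
  interpret D: group dual by (rule dual_group)
  have "\<theta> [^]\<^bsub>dual\<^esub> e = \<one>\<^bsub>dual\<^esub> \<longleftrightarrow> (\<forall>z\<in>Z. \<theta> z ^ e = 1)" if t: "\<theta> \<in> chars" for \<theta> and e :: nat
  proof
    assume "\<theta> [^]\<^bsub>dual\<^esub> e = \<one>\<^bsub>dual\<^esub>"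
    then show "\<forall>z\<in>Z. \<theta> z ^ e = 1" using dual_pow[OF t] dual_one by metis
  next
    assume a: "\<forall>z\<in>Z. \<theta> z ^ e = 1"
    have "\<theta> [^]\<^bsub>dual\<^esub> e \<in> chars" "\<one>\<^bsub>dual\<^esub> \<in> chars"
      using D.nat_pow_closed[of \<theta> e] D.one_closed t by (simp_all add: dual_carrier)
    then show "\<theta> [^]\<^bsub>dual\<^esub> e = \<one>\<^bsub>dual\<^esub>" using a dual_pow[OF t] dual_one by (intro chars_eqI) simp_all
  qed
  then show ?thesis using D.ord_prime_power_iff[OF p] by (auto simp: chars_of_order_def dual_carrier)
qed

end

lemma abelian_section_mono:
  assumes "abelian_section G Z K" "K \<subseteq> K'" "subgroup K' G" "K' \<subseteq> Z"
  shows "abelian_section G Z K'"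
  using assms by (auto simp: abelian_section_def abelian_section_axioms_def)

context abelian_section
begin

text \<open>V consists of the order-d characters for K minus those for K', so its size is totient d
  times N. It is a union of generator sets of cyclic subgroups of the dual, hence there are N
  classes; generators of one subgroup are powers of each other with exponents prime to p, that is,
  algebraic conjugates.\<close>

lemma class_representatives:
  fixes p m :: nat
  assumes S': "abelian_section G Z K'" and KK': "K \<subseteq> K'" and p: "Factorial_Ring.prime p"
  defines "V \<equiv> {\<theta> \<in> chars_of_order p m. \<exists>k\<in>K'. \<theta> k \<noteq> 1}"
    and "N \<equiv> num_cyclic (subquot G Z K) (p ^ Suc m) - num_cyclic (subquot G Z K') (p ^ Suc m)"
  obtains rep where "\<And>j. j < N \<Longrightarrow> rep j \<in> V"
    "\<And>\<theta>. \<theta> \<in> V \<Longrightarrow> \<exists>j<N. \<exists>i. \<not> p dvd i \<and> (\<forall>z\<in>Z. \<theta> z = rep j z ^ i)"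
    "\<And>j l i. j < N \<Longrightarrow> l < N \<Longrightarrow> (\<forall>z\<in>Z. rep l z = rep j z ^ i) \<Longrightarrow> j = l"
proof -
  interpret S': abelian_section G Z K' by (rule S')
  interpret D: group dual by (rule dual_group)
  let ?d = "p ^ Suc m"
  have fD: "finite (carrier dual)" using finite_chars by (simp add: dual_carrier)
  have ordV: "V \<subseteq> {\<theta> \<in> carrier dual. D.ord \<theta> = ?d}" unfolding V_def chars_of_order_ord[OF p] by blast
  have Vc: "\<theta> \<in> chars" if "\<theta> \<in> V" for \<theta> using that by (simp add: V_def chars_of_order_def)
  have K'Z: "k \<in> Z" if "k \<in> K'" for k using S'.K_Z[OF that] .
  have cl: "\<psi> \<in> V" if th: "\<theta> \<in> V" "\<psi> \<in> carrier dual" "generate dual {\<psi>} = generate dual {\<theta>}" for \<theta> \<psi>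
  proof -
    have tc: "\<theta> \<in> carrier dual" "D.ord \<theta> = ?d" using ordV th(1) by auto
    have o: "D.ord \<psi> = ?d" using D.generate_pow_card[OF th(2)] D.generate_pow_card[OF tc(1)] th(3) tc(2) by simp
    obtain j :: nat where j: "\<theta> = \<psi> [^]\<^bsub>dual\<^esub> j"
      using D.generate_eq_iff_power[OF fD th(2) o tc(1)] th(3) by auto
    obtain k where k: "k \<in> K'" "\<theta> k \<noteq> 1" using th(1) by (auto simp: V_def)
    \<comment> \<open>As \<theta> is a power of \<psi>, nontriviality of \<theta> on K' passes to
      \<psi>.\<close>
    have "\<theta> k = \<psi> k ^ j" unfolding j using dual_pow th(2) K'Z[OF k(1)] by (simp add: dual_carrier)
    then have "\<psi> k \<noteq> 1" using k(2) by auto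
    then show ?thesis using th(2) o k(1) unfolding V_def chars_of_order_ord[OF p] by blast
  qed
  have sub: "S'.chars_of_order p m \<subseteq> chars_of_order p m"
    using KK' by (auto simp: chars_of_order_def S'.chars_of_order_def chars_def S'.chars_def)
  have Veq: "V = chars_of_order p m - S'.chars_of_order p m"
    unfolding V_def by (auto simp: chars_of_order_def S'.chars_of_order_def chars_def S'.chars_def)
  have "finite (S'.chars_of_order p m)" using S'.finite_chars by (simp add: S'.chars_of_order_def)
  then have "card V = totient ?d * N"
    unfolding Veq N_def using sub card_chars_of_order[OF p, of m] S'.card_chars_of_order[OF p, of m]
    by (simp add: card_Diff_subset diff_mult_distrib2)
  moreover have "card V = totient ?d * card ((\<lambda>\<theta>. generate dual {\<theta>}) ` V)"
    by (rule D.card_cyclic_classes[OF fD ordV cl])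
  moreover have "0 < totient ?d" using prime_gt_0_nat[OF p] by simp
  ultimately have cN: "card ((\<lambda>\<theta>. generate dual {\<theta>}) ` V) = N" by simp
  have "finite ((\<lambda>\<theta>. generate dual {\<theta>}) ` V)"
    using finite_subset[OF ordV] fD by simp
  then obtain b where b: "bij_betw b {..<N} ((\<lambda>\<theta>. generate dual {\<theta>}) ` V)"
    using ex_bij_betw_nat_finite cN atLeast0LessThan by metis
  have "\<exists>\<theta>. \<theta> \<in> V \<and> b j = generate dual {\<theta>}" if "j < N" for j
    using bij_betwE[OF b] that by blast
  then obtain rep where rep: "\<And>j. j < N \<Longrightarrow> rep j \<in> V" "\<And>j. j < N \<Longrightarrow> b j = generate dual {rep j}" by metis
  have ro: "rep j \<in> carrier dual" "D.ord (rep j) = ?d" if "j < N" for j using rep(1)[OF that] ordV by auto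
  show thesis
  proof (rule that[of rep])
    show "rep j \<in> V" if "j < N" for j by (rule rep(1)[OF that])
    show "\<exists>j<N. \<exists>i. \<not> p dvd i \<and> (\<forall>z\<in>Z. \<theta> z = rep j z ^ i)" if th: "\<theta> \<in> V" for \<theta>
    proof -
      have "generate dual {\<theta>} \<in> b ` {..<N}" using bij_betw_imp_surj_on[OF b] th by blast
      then obtain j where j: "j < N" "generate dual {\<theta>} = generate dual {rep j}" using rep(2) by auto
      have "\<theta> \<in> carrier dual" using Vc[OF th] by (simp add: dual_carrier)
      then obtain i where i: "i \<in> totatives ?d" "\<theta> = rep j [^]\<^bsub>dual\<^esub> i"
        using D.generate_eq_iff_power[OF fD ro[OF j(1)]] j(2) by blast
      have "coprime i p" using i(1) by (simp add: totatives_def)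
      then have "\<not> p dvd i" using prime_gt_1_nat[OF p] by (metis coprime_absorb_right less_irrefl nat_dvd_1_iff_1)
      moreover have "\<theta> z = rep j z ^ i" if "z \<in> Z" for z
        unfolding i(2) using dual_pow[OF Vc[OF rep(1)[OF j(1)]] that] .
      ultimately show ?thesis using j(1) by blast
    qed
    show "j = l" if jl: "j < N" "l < N" "\<forall>z\<in>Z. rep l z = rep j z ^ i" for j l i
    proof -
      have "rep j [^]\<^bsub>dual\<^esub> i \<in> chars" using D.nat_pow_closed[OF ro(1)[OF jl(1)]] by (simp add: dual_carrier)
      then have e: "rep l = rep j [^]\<^bsub>dual\<^esub> i"
        using jl Vc rep(1) dual_pow by (intro chars_eqI) simp_all
      have "generate dual {rep l} \<subseteq> generate dual {rep j}"
      proof (rule D.generate_subgroup_incl)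
        have "generate dual {rep j} = {rep j [^]\<^bsub>dual\<^esub> k | k. k \<in> (UNIV::nat set)}"
          using D.generate_pow_on_finite_carrier[OF fD ro(1)[OF jl(1)]] .
        then show "{rep l} \<subseteq> generate dual {rep j}" unfolding e by blast
        show "subgroup (generate dual {rep j}) dual" using ro(1)[OF jl(1)] by (intro D.generate_is_subgroup) simp
      qed
      moreover have "card (generate dual {rep l}) = card (generate dual {rep j})"
        using D.generate_pow_card ro jl by metis
      moreover have "finite (generate dual {rep j})"
        using D.generate_incl[of "{rep j}"] ro(1)[OF jl(1)] fD finite_subset by auto
      ultimately have "generate dual {rep l} = generate dual {rep j}" by (simp add: card_subset_eq)
      then have "b l = b j" using rep(2) jl by simp
      then show ?thesis using inj_onD[OF bij_betw_imp_inj_on[OF b], of j l] jl by simp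
    qed
  qed
qed

end

subsection \<open>Decomposing a rational group algebra\<close>

definition rlift :: "'a monoid \<Rightarrow> nat \<Rightarrow> ('a \<Rightarrow> complex mat) \<Rightarrow> ('a \<Rightarrow> rat) \<Rightarrow> complex mat" where
  "rlift G k \<rho> f = lift G k \<rho> (\<lambda>g. of_rat (f g))"

text \<open>For a homomorphism q, the induced map of rational group algebras: coefficients are
  summed over the fibres of q.\<close>

definition push :: "'a monoid \<Rightarrow> ('a \<Rightarrow> 'b) \<Rightarrow> ('a \<Rightarrow> rat) \<Rightarrow> 'b \<Rightarrow> rat" where
  "push G q f Q = (\<Sum>x | x \<in> carrier G \<and> q x = Q. f x)"

lemma rlift_carrier [simp]: "rlift G k \<rho> f \<in> carrier_mat k k"
  by (simp add: rlift_def)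

lemma rlift_dim [simp]: "dim_row (rlift G k \<rho> f) = k" "dim_col (rlift G k \<rho> f) = k"
  by (simp_all add: rlift_def)

lemma rlift_index: "i < k \<Longrightarrow> j < k \<Longrightarrow> rlift G k \<rho> f $$ (i, j) = (\<Sum>g\<in>carrier G. of_rat (f g) * \<rho> g $$ (i, j))"
  by (simp add: rlift_def lift_index)

lemma rlift_add: "rlift G k \<rho> (\<lambda>x. f x + h x) = rlift G k \<rho> f + rlift G k \<rho> h"
  by (rule eq_matI) (simp_all add: rlift_index of_rat_add distrib_right sum.distrib)

lemma rlift_smult: "rlift G k \<rho> (\<lambda>x. c * f x) = of_rat c \<cdot>\<^sub>m rlift G k \<rho> f"
  by (rule eq_matI) (simp_all add: rlift_index of_rat_mult sum_distrib_left mult.assoc)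

lemma push_add: "push G q (\<lambda>x. f x + h x) Q = push G q f Q + push G q h Q"
  by (simp add: push_def sum.distrib)

lemma push_smult: "push G q (\<lambda>x. c * f x) Q = c * push G q f Q"
  by (simp add: push_def sum_distrib_left)

lemma push_sum: "push G q (\<lambda>x. \<Sum>i\<in>I. f i x) Q = (\<Sum>i\<in>I. push G q (f i) Q)"
  unfolding push_def by (rule sum.swap)

context fin_group
begin

lemma rlift_conv:
  assumes "is_rep G k \<rho>"
  shows "rlift G k \<rho> (conv G f h) = rlift G k \<rho> f * rlift G k \<rho> h"
proof -
  have "(\<lambda>g. of_rat (conv G f h g) :: complex) = conv G (\<lambda>g. of_rat (f g)) (\<lambda>g. of_rat (h g))"
    by (simp add: conv_def fun_eq_iff of_rat_sum of_rat_mult)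
  then show ?thesis by (simp only: rlift_def lift_conv[OF assms])
qed

lemma rlift_one:
  assumes "is_rep G k \<rho>"
  shows "rlift G k \<rho> (\<lambda>x. if x = \<one> then 1 else 0) = 1\<^sub>m k"
proof -
  have "rlift G k \<rho> (\<lambda>x. if x = \<one> then 1 else 0) = lift G k \<rho> (\<lambda>x. if x = \<one> then 1 else 0)"
    unfolding rlift_def by (rule lift_cong) simp
  then show ?thesis using lift_delta[OF assms one_closed] is_repD(2)[OF assms] by simp
qed

lemma push_conv:
  assumes "group_hom G H q" "Q \<in> carrier H" and that: "q ` carrier G = carrier H"
  shows "push G q (conv G f h) Q = (\<Sum>Y\<in>carrier H. push G q f Y * push G q h (inv\<^bsub>H\<^esub> Y \<otimes>\<^bsub>H\<^esub> Q))"
    (is "_ = ?R")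
proof -
  interpret q: group_hom G H q by (rule assms(1))
  have fH: "finite (carrier H)" using fin that by (metis finite_imageI)
  have "push G q (conv G f h) Q = (\<Sum>x | x \<in> carrier G \<and> q x = Q. \<Sum>y\<in>carrier G. f y * h (inv y \<otimes> x))"
    unfolding push_def by (intro sum.cong refl) (simp add: conv_def)
  also have "\<dots> = (\<Sum>y\<in>carrier G. \<Sum>x | x \<in> carrier G \<and> q x = Q. f y * h (inv y \<otimes> x))"
    by (rule sum.swap)
  also have "\<dots> = (\<Sum>y\<in>carrier G. f y * push G q h (inv\<^bsub>H\<^esub> (q y) \<otimes>\<^bsub>H\<^esub> Q))"
  proof (rule sum.cong[OF refl])
    fix y assume y: "y \<in> carrier G"
    have "(\<Sum>x | x \<in> carrier G \<and> q x = Q. h (inv y \<otimes> x)) = push G q h (inv\<^bsub>H\<^esub> (q y) \<otimes>\<^bsub>H\<^esub> Q)"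
      unfolding push_def
    proof (rule sum.reindex_bij_witness[of _ "\<lambda>x. y \<otimes> x" "\<lambda>x. inv y \<otimes> x"])
      fix x assume "x \<in> {x \<in> carrier G. q x = inv\<^bsub>H\<^esub> (q y) \<otimes>\<^bsub>H\<^esub> Q}"
      then have x: "x \<in> carrier G" "q x = inv\<^bsub>H\<^esub> (q y) \<otimes>\<^bsub>H\<^esub> Q" by simp_all
      have "q y \<otimes>\<^bsub>H\<^esub> q x = Q" unfolding x(2) using y assms(2) by (simp add: q.H.m_assoc[symmetric])
      then show "y \<otimes> x \<in> {x \<in> carrier G. q x = Q}" using x(1) y by simp
      show "inv y \<otimes> (y \<otimes> x) = x" using x(1) y by (simp add: m_assoc[symmetric])
    qed (use y in \<open>simp_all add: m_assoc[symmetric]\<close>)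
    then show "(\<Sum>x | x \<in> carrier G \<and> q x = Q. f y * h (inv y \<otimes> x)) = f y * push G q h (inv\<^bsub>H\<^esub> (q y) \<otimes>\<^bsub>H\<^esub> Q)"
      by (simp add: sum_distrib_left[symmetric])
  qed
  also have "\<dots> = (\<Sum>Y\<in>carrier H. \<Sum>y | y \<in> carrier G \<and> q y = Y. f y * push G q h (inv\<^bsub>H\<^esub> (q y) \<otimes>\<^bsub>H\<^esub> Q))"
    by (rule sum.group[symmetric]) (use fin fH that in auto)
  also have "\<dots> = ?R"
    unfolding push_def[of G q f] sum_distrib_right by (intro sum.cong refl) simp
  finally show ?thesis .
qed

lemma push_surj:
  assumes q: "q ` carrier G = C" and F: "\<And>Q. Q \<notin> C \<Longrightarrow> F Q = 0"
  shows "\<exists>f. (\<forall>x. x \<notin> carrier G \<longrightarrow> f x = 0) \<and> push G q f = F"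
proof -
  define s where "s Q = (SOME x. x \<in> carrier G \<and> q x = Q)" for Q
  have s: "s Q \<in> carrier G \<and> q (s Q) = Q" if "Q \<in> C" for Q
  proof -
    have "\<exists>x. x \<in> carrier G \<and> q x = Q" using q that by blast
    then show ?thesis unfolding s_def by (rule someI_ex)
  qed
  define f where "f x = (if x \<in> carrier G \<and> x = s (q x) then F (q x) else 0)" for x
  have "push G q f Q = F Q" for Q
  proof (cases "Q \<in> C")
    case True
    have "push G q f Q = (\<Sum>x | x \<in> carrier G \<and> q x = Q. if x = s Q then F Q else 0)"
      unfolding push_def by (intro sum.cong refl) (auto simp: f_def)
    also have "\<dots> = F Q" using s[OF True] fin by (simp add: sum.delta)
    finally show ?thesis .
  next
    case False
    then have "{x. x \<in> carrier G \<and> q x = Q} = {}" using q by blast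
    then show ?thesis using F[OF False] by (simp only: push_def sum.empty)
  qed
  then show ?thesis by (intro exI[of _ f]) (auto simp: f_def)
qed

text \<open>A Chinese remainder argument: the elements from \<open>sep\<close> turn surjectivity
  onto each block separately into joint surjectivity. I1 and I2 are kept apart to match the two
  direct sums of the theorem.\<close>

theorem block_decomposition:
  fixes I1 I2 :: "'i set" and \<kappa> d :: "'i \<Rightarrow> nat" and H :: "'b monoid"
  assumes hom: "group_hom G H q" and surj: "q ` carrier G = carrier H"
    and fI: "finite (I1 \<union> I2)" and disj: "I1 \<inter> I2 = {}"
    and rep: "\<And>i. i \<in> I1 \<union> I2 \<Longrightarrow> is_rep G (\<kappa> i) (\<rho> i)"
    and entries: "\<And>i g a b. i \<in> I1 \<union> I2 \<Longrightarrow> a < \<kappa> i \<Longrightarrow> b < \<kappa> i \<Longrightarrow> \<rho> i g $$ (a, b) \<in> cyclo_field (d i)"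
    and onto: "\<And>i A. i \<in> I1 \<union> I2 \<Longrightarrow> A \<in> qcarrier (mat_alg (\<kappa> i) (d i)) \<Longrightarrow>
      \<exists>f. (\<forall>x. x \<notin> carrier G \<longrightarrow> f x = 0) \<and> rlift G (\<kappa> i) (\<rho> i) f = A"
    and sep: "\<And>i. i \<in> I1 \<union> I2 \<Longrightarrow> \<exists>e. (\<forall>Q. push G q e Q = 0) \<and> rlift G (\<kappa> i) (\<rho> i) e = 1\<^sub>m (\<kappa> i) \<and>
      (\<forall>j\<in>I1 \<union> I2. j \<noteq> i \<longrightarrow> rlift G (\<kappa> j) (\<rho> j) e = 0\<^sub>m (\<kappa> j) (\<kappa> j))"
    and inj: "\<And>f x. (\<And>x. x \<notin> carrier G \<Longrightarrow> f x = 0) \<Longrightarrow> (\<And>Q. push G q f Q = 0) \<Longrightarrow>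
      (\<And>i. i \<in> I1 \<union> I2 \<Longrightarrow> rlift G (\<kappa> i) (\<rho> i) f = 0\<^sub>m (\<kappa> i) (\<kappa> i)) \<Longrightarrow> f x = 0"
  shows "qalg_isomorphic (group_alg G) (qalg_sum (group_alg H)
    (qalg_sum (qalg_dsum I1 (\<lambda>i. mat_alg (\<kappa> i) (d i))) (qalg_dsum I2 (\<lambda>i. mat_alg (\<kappa> i) (d i)))))"
proof -
  interpret q: group_hom G H q by (rule hom)
  let ?I = "I1 \<union> I2"
  let ?L = "\<lambda>f i. rlift G (\<kappa> i) (\<rho> i) f"
  let ?B = "qalg_sum (group_alg H) (qalg_sum (qalg_dsum I1 (\<lambda>i. mat_alg (\<kappa> i) (d i))) (qalg_dsum I2 (\<lambda>i. mat_alg (\<kappa> i) (d i))))"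
  define \<phi> where "\<phi> f = (push G q f, (\<lambda>i. if i \<in> I1 then ?L f i else undefined), (\<lambda>i. if i \<in> I2 then ?L f i else undefined))" for f
  have push_off: "push G q f Q = 0" if "Q \<notin> carrier H" for f Q
  proof -
    have "{x. x \<in> carrier G \<and> q x = Q} = {}" using that by auto
    then show ?thesis by (simp only: push_def sum.empty)
  qed
  have Lc: "?L f i \<in> qcarrier (mat_alg (\<kappa> i) (d i))" if "i \<in> ?I" for f i
    using entries[OF that]
    by (auto simp: mat_alg_def rlift_index intro!: cyclo_field_sum cyclo_field_closed cyclo_field_of_rat)
  have carr: "\<phi> f \<in> qcarrier ?B" for f
    using Lc by (auto simp: \<phi>_def qalg_sum_def qalg_dsum_def group_alg_def push_off)
  have inj': "inj_on \<phi> (qcarrier (group_alg G))"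
  proof (rule inj_onI)
    fix f h assume fh: "f \<in> qcarrier (group_alg G)" "h \<in> qcarrier (group_alg G)" and eq: "\<phi> f = \<phi> h"
    let ?u = "\<lambda>x. f x + (- 1) * h x"
    have p: "push G q f Q = push G q h Q" for Q using eq by (simp add: \<phi>_def)
    have l: "?L f i = ?L h i" if "i \<in> ?I" for i
    proof (cases "i \<in> I1")
      case True
      have "fst (snd (\<phi> f)) i = fst (snd (\<phi> h)) i" by (simp only: eq)
      then show ?thesis using True by (simp add: \<phi>_def)
    next
      case False
      have "snd (snd (\<phi> f)) i = snd (snd (\<phi> h)) i" by (simp only: eq)
      then show ?thesis using False that by (simp add: \<phi>_def)
    qed
    have "?u x = 0" for x
    proof (rule inj)
      show "?u x = 0" if "x \<notin> carrier G" for x using fh that by (simp add: group_alg_def)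
      show "push G q ?u Q = 0" for Q unfolding push_add push_smult using p by simp
      show "?L ?u i = 0\<^sub>m (\<kappa> i) (\<kappa> i)" if "i \<in> ?I" for i
        unfolding rlift_add rlift_smult l[OF that] by (rule eq_matI) simp_all
    qed
    then show "f = h" by (simp add: fun_eq_iff)
  qed
  have surj': "B \<in> \<phi> ` qcarrier (group_alg G)" if B: "B \<in> qcarrier ?B" for B
  proof -
    obtain F B1 B2 where Beq: "B = (F, B1, B2)" by (metis prod.exhaust)
    have F: "F Q = 0" if "Q \<notin> carrier H" for Q using B that unfolding Beq by (simp add: qalg_sum_def group_alg_def)
    have Bu: "B1 i = undefined" if "i \<notin> I1" for i using B that unfolding Beq by (simp add: qalg_sum_def qalg_dsum_def)
    have Bu': "B2 i = undefined" if "i \<notin> I2" for i using B that unfolding Beq by (simp add: qalg_sum_def qalg_dsum_def)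
    define A where "A i = (if i \<in> I1 then B1 i else B2 i)" for i
    have A: "A i \<in> qcarrier (mat_alg (\<kappa> i) (d i))" if "i \<in> ?I" for i
      using B that unfolding Beq by (auto simp: qalg_sum_def qalg_dsum_def A_def)
    obtain f0 where f0: "\<And>x. x \<notin> carrier G \<Longrightarrow> f0 x = 0" "push G q f0 = F"
      using push_surj[OF surj, of F] F by blast
    have "\<forall>i. \<exists>f. i \<in> ?I \<longrightarrow> ?L f i = A i" using onto A by blast
    then obtain f where f: "\<And>i. i \<in> ?I \<Longrightarrow> ?L (f i) i = A i" by metis
    have "\<forall>i. \<exists>e. i \<in> ?I \<longrightarrow> (\<forall>Q. push G q e Q = 0) \<and> ?L e i = 1\<^sub>m (\<kappa> i) \<and> (\<forall>j\<in>?I. j \<noteq> i \<longrightarrow> ?L e j = 0\<^sub>m (\<kappa> j) (\<kappa> j))"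
      using sep by blast
    then obtain e where e: "\<And>i. i \<in> ?I \<Longrightarrow> (\<forall>Q. push G q (e i) Q = 0) \<and> ?L (e i) i = 1\<^sub>m (\<kappa> i) \<and>
      (\<forall>j\<in>?I. j \<noteq> i \<longrightarrow> ?L (e i) j = 0\<^sub>m (\<kappa> j) (\<kappa> j))" by metis
    \<comment> \<open>The element u starts from a preimage f0 of F and adds e_i (f_i - f0) for each
      i. This corrects block i and changes neither the other blocks nor the image in the group
      algebra of H.\<close>
    define h where "h i x = f i x + (- 1) * f0 x" for i x
    define u where "u x = f0 x + (\<Sum>i\<in>?I. conv G (e i) (h i) x)" for x
    have off: "u x = 0" if "x \<notin> carrier G" for x using that f0(1) by (simp add: u_def conv_def)
    have "push G q (conv G (e i) (h i)) Q = 0" if "i \<in> ?I" for i Q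
      using e[OF that] push_conv[OF hom _ surj] push_off by (cases "Q \<in> carrier H") simp_all
    then have pu: "push G q u = F"
      unfolding u_def by (simp add: fun_eq_iff push_add push_sum f0(2))
    have Lu: "?L u j = A j" if j: "j \<in> ?I" for j
    proof (rule eq_matI)
      fix a b assume "a < dim_row (A j)" "b < dim_col (A j)"
      then have ab: "a < \<kappa> j" "b < \<kappa> j" using A[OF j] by (auto simp: mat_alg_def)
      have c: "?L (conv G (e i) (h i)) j $$ (a, b) = (if i = j then ?L (h j) j $$ (a, b) else 0)" if i: "i \<in> ?I" for i
      proof (cases "i = j")
        case True
        then show ?thesis unfolding rlift_conv[OF rep[OF j]] using e[OF j] by simp
      next
        case False
        then have "?L (conv G (e i) (h i)) j = 0\<^sub>m (\<kappa> j) (\<kappa> j)"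
          unfolding rlift_conv[OF rep[OF j]] using e[OF i] j by (simp add: left_mult_zero_mat[OF rlift_carrier])
        then show ?thesis using False ab by simp
      qed
      have "?L u j $$ (a, b) = ?L f0 j $$ (a, b) + (\<Sum>g\<in>carrier G. \<Sum>i\<in>?I. of_rat (conv G (e i) (h i) g) * \<rho> j g $$ (a, b))"
        unfolding u_def rlift_add using ab by (simp add: rlift_index of_rat_sum sum_distrib_right)
      also have "(\<Sum>g\<in>carrier G. \<Sum>i\<in>?I. of_rat (conv G (e i) (h i) g) * \<rho> j g $$ (a, b))
          = (\<Sum>i\<in>?I. ?L (conv G (e i) (h i)) j $$ (a, b))"
        unfolding rlift_index[OF ab] by (rule sum.swap)
      also have "\<dots> = (\<Sum>i\<in>?I. if i = j then ?L (h j) j $$ (a, b) else 0)"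
        by (rule sum.cong[OF refl c])
      also have "\<dots> = ?L (h j) j $$ (a, b)" using fI j by (simp add: sum.delta)
      also have "\<dots> = A j $$ (a, b) - ?L f0 j $$ (a, b)"
        unfolding h_def rlift_add rlift_smult f[OF j] using ab A[OF j] by (simp add: mat_alg_def)
      finally show "?L u j $$ (a, b) = A j $$ (a, b)" by simp
    qed (use A[OF j] in \<open>auto simp: mat_alg_def\<close>)
    have d: "i \<notin> I1" if "i \<in> I2" for i using that disj by blast
    have "\<phi> u = B" unfolding \<phi>_def Beq pu
      using Lu d by (auto simp: fun_eq_iff A_def Bu Bu')
    moreover have "u \<in> qcarrier (group_alg G)" using off by (simp add: group_alg_def)
    ultimately show ?thesis by blast
  qed
  have pm: "push G q (conv G x y) = (\<lambda>Q. if Q \<in> carrier H then \<Sum>Y\<in>carrier H. push G q x Y * push G q y (inv\<^bsub>H\<^esub> Y \<otimes>\<^bsub>H\<^esub> Q) else 0)" for x y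
    using push_conv[OF hom _ surj] push_off by (simp add: fun_eq_iff)
  have po: "push G q (\<lambda>x. if x = \<one> then 1 else 0) = (\<lambda>Q. if Q = \<one>\<^bsub>H\<^esub> then 1 else 0)"
  proof
    fix Q
    show "push G q (\<lambda>x. if x = \<one> then 1 else 0) Q = (if Q = \<one>\<^bsub>H\<^esub> then 1 else 0)"
      unfolding push_def using fin by (subst sum.delta) auto
  qed
  have "qalg_iso (group_alg G) ?B \<phi>"
    unfolding qalg_iso_def
  proof (intro conjI ballI allI)
    show "bij_betw \<phi> (qcarrier (group_alg G)) (qcarrier ?B)"
      unfolding bij_betw_def using inj' carr surj' by blast
    fix x y c assume "x \<in> qcarrier (group_alg G)"
    have qm: "qmul (group_alg G) x y = conv G x y" by (simp add: group_alg_def conv_def)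
    have qa: "qadd (group_alg G) x y = (\<lambda>g. x g + y g)" "qsmul (group_alg G) c x = (\<lambda>g. c * x g)" by (simp_all add: group_alg_def)
    show "\<phi> (qadd (group_alg G) x y) = qadd ?B (\<phi> x) (\<phi> y)"
      unfolding qa \<phi>_def rlift_add
      by (simp add: fun_eq_iff qalg_sum_def qalg_dsum_def mat_alg_def group_alg_def push_add)
    show "\<phi> (qmul (group_alg G) x y) = qmul ?B (\<phi> x) (\<phi> y)"
      unfolding qm \<phi>_def using rep
      by (auto simp: fun_eq_iff qalg_sum_def qalg_dsum_def mat_alg_def group_alg_def pm rlift_conv)
    show "\<phi> (qsmul (group_alg G) c x) = qsmul ?B c (\<phi> x)"
      unfolding qa \<phi>_def rlift_smult
      by (simp add: fun_eq_iff qalg_sum_def qalg_dsum_def mat_alg_def group_alg_def push_smult)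
  next
    have qo: "qone (group_alg G) = (\<lambda>x. if x = \<one> then 1 else 0)" by (simp add: group_alg_def)
    show "\<phi> (qone (group_alg G)) = qone ?B"
      unfolding qo \<phi>_def po using rep
      by (auto simp: fun_eq_iff qalg_sum_def qalg_dsum_def mat_alg_def group_alg_def rlift_one)
  qed
  then show ?thesis unfolding qalg_isomorphic_def by blast
qed

end

subsection \<open>Separating elements\<close>

text \<open>For a finite subgroup N this is the idempotent of its trivial character; it acts as
  projection onto the N-fixed vectors.\<close>

definition avg :: "'a set \<Rightarrow> 'a \<Rightarrow> rat" where
  "avg N x = (if x \<in> N then 1 / of_nat (card N) else 0)"

text \<open>For \<open>k\<close> of order \<open>p\<close> modulo \<open>N\<close>, this is the difference of the averages over \<open>N\<close> and \<open>\<langle>N, k\<rangle>\<close>.\<close>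

definition separator :: "'a monoid \<Rightarrow> nat \<Rightarrow> 'a set \<Rightarrow> 'a \<Rightarrow> 'a \<Rightarrow> rat" where
  "separator G p N k x = avg N x + (- 1 / of_nat p) * (\<Sum>i<p. avg N (inv\<^bsub>G\<^esub> (k [^]\<^bsub>G\<^esub> i) \<otimes>\<^bsub>G\<^esub> x))"

context fin_group
begin

lemma rlift_avg_index:
  assumes "subgroup N G" "i < n" "j < n"
  shows "rlift G n \<rho> (avg N) $$ (i, j) = (\<Sum>x\<in>N. \<rho> x $$ (i, j)) / of_nat (card N)"
proof -
  have N: "N \<subseteq> carrier G" by (rule subgroup.subset[OF assms(1)])
  have "rlift G n \<rho> (avg N) $$ (i, j) = (\<Sum>x\<in>N. of_rat (avg N x) * \<rho> x $$ (i, j))"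
    unfolding rlift_index[OF assms(2,3)] using N fin by (intro sum.mono_neutral_right) (auto simp: avg_def)
  also have "\<dots> = (\<Sum>x\<in>N. \<rho> x $$ (i, j) / of_nat (card N))"
    by (rule sum.cong[OF refl]) (simp add: avg_def of_rat_divide)
  finally show ?thesis by (simp add: sum_divide_distrib)
qed

lemma rlift_avg_trivial:
  assumes N: "subgroup N G" and "\<And>x. x \<in> N \<Longrightarrow> \<rho> x = 1\<^sub>m n"
  shows "rlift G n \<rho> (avg N) = 1\<^sub>m n"
  using assms(2) card_subgroup_pos[OF N] by (intro eq_matI) (simp_all add: rlift_avg_index[OF N])

lemma rlift_avg_nontrivial:
  assumes rep: "is_rep G n \<rho>" and N: "subgroup N G" and w: "w \<in> N" "\<rho> w = c \<cdot>\<^sub>m 1\<^sub>m n" "c \<noteq> 1"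
  shows "rlift G n \<rho> (avg N) = 0\<^sub>m n n"
proof (rule eq_matI)
  fix i j assume "i < dim_row (0\<^sub>m n n)" "j < dim_col (0\<^sub>m n n)"
  then have ij: "i < n" "j < n" by simp_all
  have "(\<Sum>x\<in>N. \<rho> x $$ (i, j)) = (\<Sum>x\<in>N. \<rho> (w \<otimes> x) $$ (i, j))"
  proof (rule sum.reindex_bij_witness[of _ "\<lambda>x. w \<otimes> x" "\<lambda>x. inv w \<otimes> x"])
    fix x assume x: "x \<in> N"
    show "inv w \<otimes> x \<in> N" "w \<otimes> x \<in> N"
      using subgroup.m_closed[OF N] subgroup.m_inv_closed[OF N] w(1) x by simp_all
  qed (use w(1) subgroup.mem_carrier[OF N] in \<open>simp_all add: m_assoc[symmetric]\<close>)
  also have "\<dots> = (\<Sum>x\<in>N. c * \<rho> x $$ (i, j))"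
  proof (rule sum.cong[OF refl])
    fix x assume "x \<in> N"
    then have x: "x \<in> carrier G" "w \<in> carrier G" using w(1) subgroup.mem_carrier[OF N] by simp_all
    have "\<rho> (w \<otimes> x) = c \<cdot>\<^sub>m \<rho> x"
      unfolding is_repD(3)[OF rep x(2,1)] w(2) using is_repD(1)[OF rep x(1)] by (intro scalar_mult_mat) simp
    then show "\<rho> (w \<otimes> x) $$ (i, j) = c * \<rho> x $$ (i, j)" using is_repD(1)[OF rep x(1)] ij by simp
  qed
  also have "\<dots> = c * (\<Sum>x\<in>N. \<rho> x $$ (i, j))" by (simp add: sum_distrib_left)
  finally have "(\<Sum>x\<in>N. \<rho> x $$ (i, j)) = 0" using w(3) by simp
  then show "rlift G n \<rho> (avg N) $$ (i, j) = 0\<^sub>m n n $$ (i, j)" using ij by (simp add: rlift_avg_index[OF N])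
qed simp_all

lemma rlift_translate:
  assumes "is_rep G n \<rho>" "g \<in> carrier G"
  shows "rlift G n \<rho> (\<lambda>x. f (inv g \<otimes> x)) = \<rho> g * rlift G n \<rho> f"
proof -
  have "rlift G n \<rho> (\<lambda>x. f (inv g \<otimes> x)) = lift G n \<rho> (conv G (\<lambda>h. if h = g then 1 else 0) (\<lambda>x. of_rat (f x)))"
    unfolding rlift_def by (rule lift_cong) (simp add: conv_delta_left[OF assms(2)])
  then show ?thesis unfolding lift_conv[OF assms(1)] lift_delta[OF assms] rlift_def .
qed

lemma rlift_translate_right:
  assumes "is_rep G n \<rho>" "g \<in> carrier G"
  shows "rlift G n \<rho> (\<lambda>x. f (x \<otimes> inv g)) = rlift G n \<rho> f * \<rho> g"
proof -
  have "rlift G n \<rho> (\<lambda>x. f (x \<otimes> inv g)) = lift G n \<rho> (conv G (\<lambda>x. of_rat (f x)) (\<lambda>h. if h = g then 1 else 0))"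
    unfolding rlift_def by (rule lift_cong) (simp add: conv_delta_right[OF assms(2)])
  then show ?thesis unfolding lift_conv[OF assms(1)] lift_delta[OF assms] rlift_def .
qed

lemma rlift_separator_index:
  assumes "is_rep G n \<rho>" "k \<in> carrier G" and ij: "i < n" "j < n"
  shows "rlift G n \<rho> (separator G p N k) $$ (i, j) =
    rlift G n \<rho> (avg N) $$ (i, j) - (\<Sum>l<p. (\<rho> (k [^] l) * rlift G n \<rho> (avg N)) $$ (i, j)) / of_nat p"
proof -
  have "rlift G n \<rho> (separator G p N k) $$ (i, j) = rlift G n \<rho> (avg N) $$ (i, j)
      - (\<Sum>g\<in>carrier G. \<Sum>l<p. of_rat (avg N (inv (k [^] l) \<otimes> g)) * \<rho> g $$ (i, j)) / of_nat p"
    unfolding separator_def rlift_add rlift_smult using ij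
    by (simp add: rlift_index of_rat_sum sum_distrib_right of_rat_minus of_rat_divide)
  also have "(\<Sum>g\<in>carrier G. \<Sum>l<p. of_rat (avg N (inv (k [^] l) \<otimes> g)) * \<rho> g $$ (i, j))
      = (\<Sum>l<p. rlift G n \<rho> (\<lambda>x. avg N (inv (k [^] l) \<otimes> x)) $$ (i, j))"
    unfolding rlift_index[OF ij] by (rule sum.swap)
  also have "\<dots> = (\<Sum>l<p. (\<rho> (k [^] l) * rlift G n \<rho> (avg N)) $$ (i, j))"
    using assms(2) by (intro sum.cong refl) (simp only: rlift_translate[OF assms(1)] nat_pow_closed)
  finally show ?thesis .
qed

lemma rlift_separator_zero:
  assumes "is_rep G n \<rho>" "k \<in> carrier G" "rlift G n \<rho> (avg N) = 0\<^sub>m n n"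
  shows "rlift G n \<rho> (separator G p N k) = 0\<^sub>m n n"
proof (rule eq_matI)
  fix i j assume "i < dim_row (0\<^sub>m n n)" "j < dim_col (0\<^sub>m n n)"
  then have ij: "i < n" "j < n" by simp_all
  have "\<rho> (k [^] l) * 0\<^sub>m n n = 0\<^sub>m n n" for l :: nat
    by (rule right_mult_zero_mat[OF is_repD(1)[OF assms(1)]]) (use assms(2) in simp)
  then show "rlift G n \<rho> (separator G p N k) $$ (i, j) = 0\<^sub>m n n $$ (i, j)"
    unfolding rlift_separator_index[OF assms(1,2) ij] assms(3) using ij by simp
qed simp_all

lemma rlift_separator:
  assumes rep: "is_rep G n \<rho>" and k: "k \<in> carrier G" "\<rho> k = c \<cdot>\<^sub>m 1\<^sub>m n"
    and N: "rlift G n \<rho> (avg N) = 1\<^sub>m n"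
  shows "rlift G n \<rho> (separator G p N k) = (1 - (\<Sum>l<p. c ^ l) / of_nat p) \<cdot>\<^sub>m 1\<^sub>m n"
proof (rule eq_matI)
  fix i j
  assume "i < dim_row ((1 - (\<Sum>l<p. c ^ l) / of_nat p) \<cdot>\<^sub>m 1\<^sub>m n)" "j < dim_col ((1 - (\<Sum>l<p. c ^ l) / of_nat p) \<cdot>\<^sub>m 1\<^sub>m n)"
  then have ij: "i < n" "j < n" by simp_all
  have pow: "\<rho> (k [^] l) = c ^ l \<cdot>\<^sub>m 1\<^sub>m n" for l :: nat
  proof (induction l)
    case 0
    have "\<rho> (k [^] (0::nat)) = 1\<^sub>m n" using is_repD(2)[OF rep] by simp
    also have "\<dots> = c ^ 0 \<cdot>\<^sub>m 1\<^sub>m n" by (intro eq_matI) simp_all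
    finally show ?case .
  next
    case (Suc l)
    have "\<rho> (k [^] Suc l) = (c ^ l \<cdot>\<^sub>m 1\<^sub>m n) * (c \<cdot>\<^sub>m 1\<^sub>m n)"
      using is_repD(3)[OF rep, of "k [^] l" k] k Suc by simp
    also have "\<dots> = c ^ l \<cdot>\<^sub>m (c \<cdot>\<^sub>m 1\<^sub>m n)" by (rule scalar_mult_mat) simp
    also have "\<dots> = c ^ Suc l \<cdot>\<^sub>m 1\<^sub>m n" by (intro eq_matI) simp_all
    finally show ?case .
  qed
  have "(\<rho> (k [^] l) * 1\<^sub>m n) $$ (i, j) = c ^ l * (if i = j then 1 else 0)" for l :: nat
    unfolding right_mult_one_mat[OF is_repD(1)[OF rep nat_pow_closed[OF k(1)]]] unfolding pow using ij by simp
  then show "rlift G n \<rho> (separator G p N k) $$ (i, j) = ((1 - (\<Sum>l<p. c ^ l) / of_nat p) \<cdot>\<^sub>m 1\<^sub>m n) $$ (i, j)"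
    unfolding rlift_separator_index[OF rep k(1) ij] N using ij by (simp add: sum_distrib_right[symmetric])
qed simp_all

text \<open>The powers of k become trivial under q, so the p translated averages have the same image
  as the average over N and cancel it.\<close>

lemma push_separator:
  assumes hom: "group_hom G H q" and k: "k \<in> carrier G" "q k = \<one>\<^bsub>H\<^esub>" and p: "0 < p"
  shows "push G q (separator G p N k) Q = 0"
proof -
  interpret q: group_hom G H q by (rule hom)
  have t: "push G q (\<lambda>x. f (inv g \<otimes> x)) Q = push G q f Q" if g: "g \<in> carrier G" "q g = \<one>\<^bsub>H\<^esub>" for f g
    unfolding push_def
    by (rule sum.reindex_bij_witness[of _ "\<lambda>x. g \<otimes> x" "\<lambda>x. inv g \<otimes> x"])
       (use g in \<open>auto simp: m_assoc[symmetric]\<close>)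
  have "q (k [^] l) = \<one>\<^bsub>H\<^esub>" for l :: nat using k by (induction l) simp_all
  then have "push G q (\<lambda>x. avg N (inv (k [^] l) \<otimes> x)) Q = push G q (avg N) Q" for l :: nat
    using k(1) by (intro t) simp_all
  then show ?thesis unfolding separator_def push_add push_smult push_sum using p by simp
qed

text \<open>The image of \<theta> is cyclic, generated by its value at z0, and \<psi> is trivial on
  the kernel of \<theta>; so \<psi> = \<theta>^l with l read off at z0. If p divides l, then
  \<psi>(k) is a power of \<theta>(k)^p = 1; otherwise \<psi> is a conjugate of \<theta>.\<close>

lemma character_dichotomy:
  fixes p m :: nat
  assumes p: "Factorial_Ring.prime p" and Z: "subgroup Z G" and th: "lchar G Z \<theta>" "lchar G Z \<psi>"
    and root: "\<And>z. z \<in> Z \<Longrightarrow> \<theta> z ^ p ^ Suc m = 1" and z0: "z0 \<in> Z" "\<theta> z0 = zeta (p ^ Suc m)"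
    and ker: "\<And>z. z \<in> Z \<Longrightarrow> \<theta> z = 1 \<Longrightarrow> \<psi> z = 1" and k: "k \<in> Z" "\<theta> k ^ p = 1"
  shows "\<psi> k = 1 \<or> (\<exists>i. \<not> p dvd i \<and> (\<forall>z\<in>Z. \<psi> z = \<theta> z ^ i))"
proof -
  interpret Z: subgroup Z G by (rule Z)
  let ?w = "zeta (p ^ Suc m)"
  have p1: "1 < p" by (rule prime_gt_1_nat[OF p])
  then have w: "?w ^ p ^ Suc m = 1" by (intro zeta_root) simp
  have dvd: "p ^ Suc m dvd i" if "?w ^ i = 1" for i by (rule zeta_primitive[OF _ that]) (use p1 in simp)
  have "?w ^ p ^ m \<noteq> 1"
  proof
    assume "?w ^ p ^ m = 1"
    then have "p ^ Suc m dvd p ^ m" by (rule dvd)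
    then have "p ^ Suc m \<le> p ^ m" using p1 by (intro dvd_imp_le) simp_all
    then show False using p1 by simp
  qed
  note w = w this
  have pow: "\<theta> (z [^] i) = \<theta> z ^ i \<and> \<psi> (z [^] i) = \<psi> z ^ i" if "z \<in> Z" for z and i :: nat
    using th that subgroup_pow_closed[OF Z that] by (induction i) (simp_all add: lchar_def mult.commute)
  have expo: "\<exists>i. \<theta> z = ?w ^ i" if "z \<in> Z" for z
    by (rule primitive_prime_power_root[OF p w root[OF that]]) (rule exI)
  have psi: "\<psi> z = \<psi> z0 ^ i" if z: "z \<in> Z" "\<theta> z = ?w ^ i" for z i
  proof -
    have zi: "z0 [^] i \<in> Z" "inv (z0 [^] i) \<in> Z"
      using subgroup_pow_closed[OF Z z0(1)] by simp_all
    have "\<theta> (z \<otimes> inv (z0 [^] i)) = \<theta> z * inverse (\<theta> (z0 [^] i))"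
      using th(1) z(1) zi lchar_inv(3)[OF Z th(1) zi(1)] by (simp add: lchar_def)
    also have "\<dots> = 1" using pow[OF z0(1)] z(2) z0(2) lchar_inv(2)[OF Z th(1) zi(1)] by simp
    finally have "\<psi> (z \<otimes> inv (z0 [^] i)) = 1" by (intro ker Z.m_closed z(1) zi(2))
    moreover have "\<psi> (z \<otimes> inv (z0 [^] i)) = \<psi> z * inverse (\<psi> (z0 [^] i))"
      using th(2) z(1) zi lchar_inv(3)[OF Z th(2) zi(1)] by (simp add: lchar_def)
    ultimately have "\<psi> z = \<psi> (z0 [^] i)" using lchar_inv(2)[OF Z th(2) zi(1)] by (simp add: field_simps)
    then show ?thesis using pow[OF z0(1)] by simp
  qed
  have "\<psi> \<one> = \<psi> z0 ^ p ^ Suc m" by (rule psi) (use th(1) w(1) in \<open>simp_all add: lchar_def\<close>)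
  then have "\<psi> z0 ^ p ^ Suc m = 1" using th(2) by (simp add: lchar_def)
  then obtain l where l: "\<psi> z0 = ?w ^ l" by (rule primitive_prime_power_root[OF p w])
  show ?thesis
  proof (cases "p dvd l")
    case True
    then obtain b where b: "l = p * b" by (rule dvdE)
    obtain i where i: "\<theta> k = ?w ^ i" using expo[OF k(1)] by blast
    have "\<psi> k = (?w ^ l) ^ i" using psi[OF k(1) i] l by simp
    also have "\<dots> = ((?w ^ i) ^ p) ^ b" unfolding b power_mult[symmetric] by (simp add: mult_ac)
    also have "\<dots> = 1" using k(2) i by simp
    finally show ?thesis ..
  next
    case False
    have "\<psi> z = \<theta> z ^ l" if z: "z \<in> Z" for z
    proof -
      obtain i where i: "\<theta> z = ?w ^ i" using expo[OF z] by blast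
      show ?thesis unfolding psi[OF z i] l i power_mult[symmetric] by (simp add: mult.commute)
    qed
    then show ?thesis using False by blast
  qed
qed

end

subsection \<open>The blocks of a nested GVZ group\<close>

locale nested_gvz_odd = nested_gvz +
  assumes odd_p: "odd p"
begin

lemma p_gt_1: "1 < p" by (rule prime_gt_1_nat[OF prime_p])

lemma section_KK:
  assumes r: "1 \<le> r" "r \<le> n"
  shows "abelian_section G (ZZ r) (KK r)"
proof -
  have "KK r \<subseteq> ZZ r" using KK_mono[of "r - 1" r] KK_le_ZZ[OF r] r by simp
  then show ?thesis
    using ZZ_subgroup[OF r(2)] KK_subgroup[OF r(2)] ZZ_carrier[OF r(2)] cmt_in_commG fin_group_axioms
    by (simp add: abelian_section_def abelian_section_axioms_def subset_iff)
qed

lemma section_KK':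
  assumes r: "1 \<le> r" "r \<le> n"
  shows "abelian_section G (ZZ r) (KK (r - 1))"
  by (rule abelian_section_mono[OF section_KK[OF r] KK_mono KK_subgroup KK_le_ZZ[OF r]]) (use r in simp_all)

definition ramified_chars :: "nat \<Rightarrow> nat \<Rightarrow> ('a \<Rightarrow> complex) set" where
  "ramified_chars r m = {\<theta> \<in> abelian_section.chars_of_order G (ZZ r) (KK r) p m. \<exists>k\<in>KK (r - 1). \<theta> k \<noteq> 1}"

text \<open>A relation rather than a chosen representation, so that a separating element can be
  shown to work for every representation belonging to a character.\<close>

definition block :: "nat \<Rightarrow> nat \<Rightarrow> ('a \<Rightarrow> complex) \<Rightarrow> ('a \<Rightarrow> complex mat) \<Rightarrow> bool" where
  "block r m \<theta> \<rho> \<longleftrightarrow> is_rep G (p ^ \<delta> r) \<rho> \<and> (\<forall>z\<in>ZZ r. \<rho> z = \<theta> z \<cdot>\<^sub>m 1\<^sub>m (p ^ \<delta> r)) \<and>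
    (\<forall>g\<in>carrier G. g \<notin> ZZ r \<longrightarrow> mtrace (\<rho> g) = 0) \<and>
    (\<forall>g i j. i < p ^ \<delta> r \<longrightarrow> j < p ^ \<delta> r \<longrightarrow> \<rho> g $$ (i, j) \<in> cyclo_field (p ^ Suc m)) \<and>
    (\<forall>A\<in>qcarrier (mat_alg (p ^ \<delta> r) (p ^ Suc m)). \<exists>f. (\<forall>x. x \<notin> carrier G \<longrightarrow> f x = 0) \<and> rlift G (p ^ \<delta> r) \<rho> f = A)"

lemma ramified_charsD:
  assumes r: "1 \<le> r" "r \<le> n" and \<theta>: "\<theta> \<in> ramified_chars r m"
  shows "lchar G (ZZ r) \<theta>" "\<And>g. g \<notin> ZZ r \<Longrightarrow> \<theta> g = 0" "\<And>k. k \<in> KK r \<Longrightarrow> \<theta> k = 1"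
    "\<And>z. z \<in> ZZ r \<Longrightarrow> \<theta> z ^ p ^ Suc m = 1" "\<exists>z\<in>ZZ r. \<theta> z ^ p ^ m \<noteq> 1" "\<exists>k\<in>KK (r - 1). \<theta> k \<noteq> 1"
proof -
  interpret S: abelian_section G "ZZ r" "KK r" by (rule section_KK[OF r])
  have \<theta>': "\<theta> \<in> S.chars" "\<forall>z\<in>ZZ r. \<theta> z ^ p ^ Suc m = 1" "\<exists>z\<in>ZZ r. \<theta> z ^ p ^ m \<noteq> 1" "\<exists>k\<in>KK (r - 1). \<theta> k \<noteq> 1"
    using \<theta> unfolding ramified_chars_def S.chars_of_order_def by blast+
  show "lchar G (ZZ r) \<theta>" by (rule S.charsD(2)[OF \<theta>'(1)])
  show "\<theta> g = 0" if "g \<notin> ZZ r" for g by (rule S.charsD(1)[OF \<theta>'(1) that])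
  show "\<theta> k = 1" if "k \<in> KK r" for k by (rule S.charsD(3)[OF \<theta>'(1) that])
  show "\<theta> z ^ p ^ Suc m = 1" if "z \<in> ZZ r" for z using \<theta>'(2) that by (rule bspec)
qed (use \<theta> in \<open>simp_all only: ramified_chars_def abelian_section.chars_of_order_def[OF section_KK[OF r]] mem_Collect_eq\<close>)

lemma ramified_chars_root:
  assumes r: "1 \<le> r" "r \<le> n" and \<theta>: "\<theta> \<in> ramified_chars r m"
  obtains z0 where "z0 \<in> ZZ r" "\<theta> z0 = zeta (p ^ Suc m)"
proof -
  note D = ramified_charsD[OF r \<theta>]
  have sg: "subgroup (ZZ r) G" by (rule ZZ_subgroup[OF r(2)])
  obtain z where z: "z \<in> ZZ r" "\<theta> z ^ p ^ m \<noteq> 1" using D(5) by (rule bexE)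
  have "zeta (p ^ Suc m) ^ p ^ Suc m = 1" using p_gt_1 by (intro zeta_root) simp
  then obtain j where j: "zeta (p ^ Suc m) = \<theta> z ^ j"
    by (rule primitive_prime_power_root[OF prime_p D(4)[OF z(1)] z(2)])
  have "\<theta> (z [^] i) = \<theta> z ^ i" for i :: nat
    using D(1) subgroup_pow_closed[OF sg z(1)] z(1) by (induction i) (simp_all add: lchar_def mult.commute)
  then show thesis using that[OF subgroup_pow_closed[OF sg z(1)]] j by simp
qed

lemma ramified_chars_block:
  assumes r: "1 \<le> r" "r \<le> n" and \<theta>: "\<theta> \<in> ramified_chars r m"
  shows "\<exists>\<rho>. block r m \<theta> \<rho>"
proof -
  note D = ramified_charsD[OF r \<theta>]
  have sg: "subgroup (ZZ r) G" by (rule ZZ_subgroup[OF r(2)])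
  obtain a where a: "card (carrier G) = p ^ a" using p_group by (rule exE)
  obtain z0 where z0: "z0 \<in> ZZ r" "\<theta> z0 = zeta (p ^ Suc m)" by (rule ramified_chars_root[OF r \<theta>])
  obtain k where k: "k \<in> KK (r - 1)" "\<theta> k \<noteq> 1" using D(6) by (rule bexE)
  \<comment> \<open>Invariance of \<theta> under conjugation is its triviality on [Z_r, G].\<close>
  have ci: "conj_inv G (carrier G) (ZZ r) \<theta>"
    unfolding conj_inv_def
  proof (intro ballI conjI)
    fix z t assume zt: "z \<in> ZZ r" "t \<in> carrier G"
    then have zc: "z \<in> carrier G" using ZZ_carrier[OF r(2)] by (rule_tac subsetD)
    show cz: "inv t \<otimes> z \<otimes> t \<in> ZZ r" by (rule ZZ_conj[OF r(2) zt])
    have cm: "cmt G z t \<in> KK r" by (rule cmt_in_commG[OF zt])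
    have cmZ: "cmt G z t \<in> ZZ r" using cm abelian_section.KZ[OF section_KK[OF r]] by (rule_tac subsetD)
    have "inv t \<otimes> z \<otimes> t = z \<otimes> cmt G z t" using zc zt by (simp add: cmt_def m_assoc inv_cancel)
    then show "\<theta> (inv t \<otimes> z \<otimes> t) = \<theta> z" using D(1) D(3)[OF cm] zt(1) cmZ by (simp add: lchar_def)
  qed
  have rm: "ramified G (carrier G) (ZZ r) \<theta>"
    unfolding ramified_def ramified_axioms_def inv_char_def inv_char_axioms_def
    using fin_group_axioms subgroup_self sg ZZ_carrier[OF r(2)] D(1) ci ZZ_ramified[OF r D(1) ci k]
    by (intro conjI allI impI) simp_all
  have k0: "0 < p ^ \<delta> r" using p_gt_1 by simp
  show ?thesis
  proof (rule split_representation[OF a prime_p odd_p rm D(4) z0 k0 ZZ_card[OF r(2), symmetric]])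
    fix \<rho> assume \<rho>: "is_rep G (p ^ \<delta> r) \<rho>" "\<And>z. z \<in> ZZ r \<Longrightarrow> \<rho> z = \<theta> z \<cdot>\<^sub>m 1\<^sub>m (p ^ \<delta> r)"
    "\<And>g. g \<in> carrier G \<Longrightarrow> g \<notin> ZZ r \<Longrightarrow> mtrace (\<rho> g) = 0"
    "\<And>g i j. i < p ^ \<delta> r \<Longrightarrow> j < p ^ \<delta> r \<Longrightarrow> \<rho> g $$ (i, j) \<in> cyclo_field (p ^ Suc m)"
    "\<And>A. A \<in> qcarrier (mat_alg (p ^ \<delta> r) (p ^ Suc m)) \<Longrightarrow>
      \<exists>f. (\<forall>x. x \<notin> carrier G \<longrightarrow> f x = 0) \<and> lift G (p ^ \<delta> r) \<rho> (\<lambda>g. of_rat (f g)) = A"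
    have "block r m \<theta> \<rho>"
      unfolding block_def rlift_def by (intro conjI ballI allI impI; (rule \<rho>; assumption)?)
    then show ?thesis by blast
  qed
qed

text \<open>The separator is built from N = ker \<theta> and an element k of [Z_(r-1), G] with
  \<theta>(k) of order p. On the block of \<theta> the first average is 1 and the second 0. On
  another block either \<psi> is nontrivial at an element of N in Z_s, so the average over N
  vanishes, or the dichotomy gives \<psi>(k) = 1 and the two averages agree. In the abelian quotient
  k is trivial.\<close>

lemma ramified_chars_separator:
  assumes r: "1 \<le> r" "r \<le> n" and \<theta>: "\<theta> \<in> ramified_chars r m" and hom: "group_hom G H q" and qK: "\<And>k. k \<in> KK 0 \<Longrightarrow> q k = \<one>\<^bsub>H\<^esub>"
  obtains e where "\<forall>Q. push G q e Q = 0" "\<forall>\<rho>. block r m \<theta> \<rho> \<longrightarrow> rlift G (p ^ \<delta> r) \<rho> e = 1\<^sub>m (p ^ \<delta> r)"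
    "\<forall>s m' \<psi> \<rho>. 1 \<le> s \<longrightarrow> s \<le> n \<longrightarrow> \<psi> \<in> ramified_chars s m' \<longrightarrow> block s m' \<psi> \<rho> \<longrightarrow>
      \<not> (s = r \<and> m' = m \<and> (\<exists>i. \<forall>z\<in>ZZ r. \<psi> z = \<theta> z ^ i)) \<longrightarrow> rlift G (p ^ \<delta> s) \<rho> e = 0\<^sub>m (p ^ \<delta> s) (p ^ \<delta> s)"
proof -
  note D = ramified_charsD[OF r \<theta>]
  have sg: "subgroup (ZZ r) G" by (rule ZZ_subgroup[OF r(2)])
  interpret Z: subgroup "ZZ r" G by (rule sg)
  have KZ: "KK (r - 1) \<subseteq> ZZ r" by (rule KK_le_ZZ[OF r])
  have pow: "\<theta> (z [^] i) = \<theta> z ^ i" if "z \<in> ZZ r" for z and i :: nat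
    using D(1) subgroup_pow_closed[OF sg that] that by (induction i) (simp_all add: lchar_def mult.commute)
  obtain z0 where z0: "z0 \<in> ZZ r" "\<theta> z0 = zeta (p ^ Suc m)" by (rule ramified_chars_root[OF r \<theta>])
  obtain k0 where k0: "k0 \<in> KK (r - 1)" "\<theta> k0 \<noteq> 1" using D(6) by (rule bexE)
  have k0Z: "k0 \<in> ZZ r" by (rule subsetD[OF KZ k0(1)])
  \<comment> \<open>\<theta>(k0) has order p^e with e > 0, so for \<open>e'\<close> = e - 1 the
    power of k0 with exponent p^\<open>e'\<close> has a \<theta>-value of order exactly p.\<close>
  define e where "e = (LEAST e. \<theta> k0 ^ p ^ e = 1)"
  have e: "\<theta> k0 ^ p ^ e = 1" unfolding e_def by (rule LeastI[where P = "\<lambda>e. \<theta> k0 ^ p ^ e = 1", OF D(4)[OF k0Z]])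
  then obtain e' where e': "e = Suc e'" using k0(2) by (cases e) simp_all
  have "\<theta> k0 ^ p ^ e' \<noteq> 1"
    using not_less_Least[of e' "\<lambda>e. \<theta> k0 ^ p ^ e = 1"] e' unfolding e_def by simp
  define k where "k = k0 [^] (p ^ e')"
  have kK: "k \<in> KK (r - 1)" unfolding k_def by (rule subgroup_pow_closed[OF KK_subgroup k0(1)]) (use r in simp)
  have kZ: "k \<in> ZZ r" by (rule subsetD[OF KZ kK])
  then have kc: "k \<in> carrier G" by (rule Z.mem_carrier)
  have \<theta>k: "\<theta> k \<noteq> 1" using \<open>\<theta> k0 ^ p ^ e' \<noteq> 1\<close> pow[OF k0Z] by (simp add: k_def)
  have \<theta>kp: "\<theta> k ^ p = 1" using e unfolding e' by (simp add: k_def pow[OF k0Z] power_mult[symmetric] mult.commute)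
  define N where "N = {z \<in> ZZ r. \<theta> z = 1}"
  have N: "subgroup N G"
  proof (rule subgroupI)
    show "N \<subseteq> carrier G" unfolding N_def by auto
    have "\<one> \<in> N" using D(1) by (simp add: N_def lchar_def)
    then show "N \<noteq> {}" by blast
    fix a assume a: "a \<in> N"
    show "inv a \<in> N" using a lchar_inv(3)[OF sg D(1)] by (simp add: N_def)
    fix b assume "b \<in> N"
    then show "a \<otimes> b \<in> N" using a D(1) by (simp add: N_def lchar_def)
  qed
  let ?s = "separator G p N k"
  have own: "rlift G (p ^ \<delta> r) \<rho> ?s = 1\<^sub>m (p ^ \<delta> r)" if b: "block r m \<theta> \<rho>" for \<rho>
  proof -
    have rep: "is_rep G (p ^ \<delta> r) \<rho>" and \<rho>: "\<rho> z = \<theta> z \<cdot>\<^sub>m 1\<^sub>m (p ^ \<delta> r)" if "z \<in> ZZ r" for z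
      using b that by (simp_all add: block_def)
    have "rlift G (p ^ \<delta> r) \<rho> (avg N) = 1\<^sub>m (p ^ \<delta> r)"
    proof (rule rlift_avg_trivial[OF N])
      fix x assume "x \<in> N"
      then have "\<rho> x = 1 \<cdot>\<^sub>m 1\<^sub>m (p ^ \<delta> r)" using \<rho>[of x] by (simp add: N_def)
      also have "\<dots> = 1\<^sub>m (p ^ \<delta> r)" by (intro eq_matI) simp_all
      finally show "\<rho> x = 1\<^sub>m (p ^ \<delta> r)" .
    qed
    then have "rlift G (p ^ \<delta> r) \<rho> ?s = (1 - (\<Sum>l<p. \<theta> k ^ l) / of_nat p) \<cdot>\<^sub>m 1\<^sub>m (p ^ \<delta> r)"
      by (rule rlift_separator[OF rep[OF kZ] kc \<rho>[OF kZ]])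
    also have "(\<Sum>l<p. \<theta> k ^ l) = 0" using \<theta>k \<theta>kp by (simp add: geometric_sum)
    also have "(1 - 0 / of_nat p) \<cdot>\<^sub>m 1\<^sub>m (p ^ \<delta> r) = (1\<^sub>m (p ^ \<delta> r) :: complex mat)" by (intro eq_matI) simp_all
    finally show ?thesis .
  qed
  have other: "rlift G (p ^ \<delta> s) \<rho> ?s = 0\<^sub>m (p ^ \<delta> s) (p ^ \<delta> s)"
    if s: "1 \<le> s" "s \<le> n" and \<psi>: "\<psi> \<in> ramified_chars s m'" and b: "block s m' \<psi> \<rho>"
      and ne: "\<not> (s = r \<and> m' = m \<and> (\<exists>i. \<forall>z\<in>ZZ r. \<psi> z = \<theta> z ^ i))" for s m' \<psi> \<rho>
  proof -
    note E = ramified_charsD[OF s \<psi>]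
    have rep: "is_rep G (p ^ \<delta> s) \<rho>" using b by (simp add: block_def)
    have \<rho>: "\<rho> z = \<psi> z \<cdot>\<^sub>m 1\<^sub>m (p ^ \<delta> s)" if "z \<in> ZZ s" for z using b that by (simp add: block_def)
    have kill: ?thesis if w: "w \<in> N" "w \<in> ZZ s" "\<psi> w \<noteq> 1" for w
      by (rule rlift_separator_zero[OF rep kc rlift_avg_nontrivial[OF rep N w(1) \<rho>[OF w(2)] w(3)]])
    show ?thesis
    proof (cases "r < s")
      case True
      \<comment> \<open>\<psi> is nontrivial on [Z_(s-1), G], which for r < s lies in [Z_r, G] and
        hence in the kernel of \<theta>.\<close>
      obtain w where w: "w \<in> KK (s - 1)" "\<psi> w \<noteq> 1" using E(6) by (rule bexE)
      have "w \<in> KK r" by (rule subsetD[OF KK_mono w(1)]) (use True s in simp_all)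
      then have "w \<in> N" using D(3)[of w] abelian_section.K_Z[OF section_KK[OF r], of w] by (simp add: N_def)
      moreover have "w \<in> ZZ s" by (rule subsetD[OF KK_le_ZZ[OF s] w(1)])
      ultimately show ?thesis using w(2) by (rule kill)
    next
      case False
      then have Zs: "z \<in> ZZ s" if "z \<in> ZZ r" for z using subsetD[OF ZZ_antimono[of s r] that] r by simp
      show ?thesis
      proof (cases "\<forall>w\<in>N. \<psi> w = 1")
        case False
        then obtain w where w: "w \<in> N" "\<psi> w \<noteq> 1" by blast
        then have "w \<in> ZZ s" by (intro Zs) (simp add: N_def)
        then show ?thesis using w by (intro kill)
      next
        case triv: True
        have lc: "lchar G (ZZ r) \<psi>" using E(1) Zs by (simp add: lchar_def)
        have "\<psi> k = 1 \<or> (\<exists>i. \<not> p dvd i \<and> (\<forall>z\<in>ZZ r. \<psi> z = \<theta> z ^ i))"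
          by (rule character_dichotomy[OF prime_p sg D(1) lc D(4) z0 _ kZ \<theta>kp]) (use triv in \<open>simp_all add: N_def\<close>)
        \<comment> \<open>An exponent prime to p lets \<theta> and \<psi> have the same trivial
          values on Z_r, and even the same orders. If s = r this gives m' = m, the excluded case. If
          s < r, then k0 lies in [Z_s, G], so \<psi>(k0) = 1 while \<theta>(k0) \<noteq> 1.\<close>
        moreover have False if i: "\<not> p dvd i" "\<forall>z\<in>ZZ r. \<psi> z = \<theta> z ^ i" for i
        proof -
          have cop: "coprime i p" using prime_imp_coprime[OF prime_p i(1)] by (simp add: coprime_commute)
          have gcd1: "\<theta> z ^ j = 1" if z: "z \<in> ZZ r" "\<psi> z ^ j = 1" for z j
          proof -
            have "\<theta> z ^ (i * j) = 1" using i(2) z by (simp add: power_mult)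
            moreover have "(\<theta> z ^ j) ^ p ^ Suc m = 1"
              using D(4)[OF z(1)] by (metis power_mult mult.commute power_one)
            moreover have "(\<theta> z ^ j) ^ i = 1" using calculation(1) by (simp add: power_mult[symmetric] mult.commute)
            ultimately have "(\<theta> z ^ j) ^ gcd i (p ^ Suc m) = 1" by (intro power_gcd_eq_1)
            moreover have "gcd i (p ^ Suc m) = 1"
              using cop coprime_power_right_iff[of i p "Suc m"] coprime_imp_gcd_eq_1 by blast
            ultimately show ?thesis by simp
          qed
          show False
          proof (cases "s = r")
            case True
            have a1: "\<theta> z ^ p ^ Suc m' = 1" if "z \<in> ZZ r" for z using gcd1[OF that] E(4) that True by blast
            have a2: "\<psi> z ^ p ^ Suc m = 1" if "z \<in> ZZ r" for z
              using i(2) that D(4)[OF that] by (metis power_mult mult.commute power_one)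
            have "m' = m"
            proof (rule ccontr)
              assume "m' \<noteq> m"
              then consider "Suc m \<le> m'" | "Suc m' \<le> m" by linarith
              then show False
              proof cases
                case 1
                obtain z where z: "z \<in> ZZ r" "\<psi> z ^ p ^ m' \<noteq> 1" using E(5) True by blast
                obtain c where "p ^ m' = p ^ Suc m * c" using le_imp_power_dvd[OF 1] by (rule dvdE)
                then show False using z a2[OF z(1)] by (simp only: power_mult power_one)
              next
                case 2
                obtain z where z: "z \<in> ZZ r" "\<theta> z ^ p ^ m \<noteq> 1" using D(5) by blast
                obtain c where "p ^ m = p ^ Suc m' * c" using le_imp_power_dvd[OF 2] by (rule dvdE)
                then show False using z a1[OF z(1)] by (simp only: power_mult power_one)
              qed
            qed
            then show False using ne True i(2) by blast
          next
            case ns: False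
            have "k0 \<in> KK s" by (rule subsetD[OF KK_mono k0(1)]) (use ns False r in simp_all)
            then have "\<psi> k0 ^ 1 = 1" using E(3)[of k0] by simp
            then have "\<theta> k0 ^ 1 = 1" by (rule gcd1[OF k0Z])
            then show False using k0(2) by simp
          qed
        qed
        ultimately have \<psi>k: "\<psi> k = 1" by blast
        have "rlift G (p ^ \<delta> s) \<rho> (avg N) = 1\<^sub>m (p ^ \<delta> s)"
        proof (rule rlift_avg_trivial[OF N])
          fix x assume x: "x \<in> N"
          then have "\<rho> x = 1 \<cdot>\<^sub>m 1\<^sub>m (p ^ \<delta> s)" using \<rho>[OF Zs, of x] triv by (simp add: N_def)
          also have "\<dots> = 1\<^sub>m (p ^ \<delta> s)" by (intro eq_matI) simp_all
          finally show "\<rho> x = 1\<^sub>m (p ^ \<delta> s)" .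
        qed
        then have "rlift G (p ^ \<delta> s) \<rho> ?s = (1 - (\<Sum>l<p. \<psi> k ^ l) / of_nat p) \<cdot>\<^sub>m 1\<^sub>m (p ^ \<delta> s)"
          by (rule rlift_separator[OF rep kc \<rho>[OF Zs[OF kZ]]])
        also have "\<dots> = 0\<^sub>m (p ^ \<delta> s) (p ^ \<delta> s)" using \<psi>k p_gt_1 by (intro eq_matI) simp_all
        finally show ?thesis .
      qed
    qed
  qed
  have "k \<in> KK 0" by (rule subsetD[OF KK_mono kK]) (use r in simp_all)
  then have "push G q ?s Q = 0" for Q by (intro push_separator[OF hom kc qK]) (use p_gt_1 in simp_all)
  then show thesis using own other by (intro that[of ?s]) blast+
qed

end

section \<open>Vanishing arguments and the final isomorphism\<close>

context nested_gvz_odd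
begin

abbreviation nblocks :: "nat \<Rightarrow> nat \<Rightarrow> nat" where
  "nblocks r d \<equiv> acyc G p \<delta> r d - acyc' G p \<delta> r d"

lemma ramified_chars_classes:
  assumes r: "1 \<le> r" "r \<le> n"
  shows "\<exists>rep. (\<forall>j<nblocks r (p ^ Suc m). rep j \<in> ramified_chars r m) \<and>
    (\<forall>\<theta>\<in>ramified_chars r m. \<exists>j<nblocks r (p ^ Suc m). \<exists>i. \<not> p dvd i \<and> (\<forall>z\<in>ZZ r. \<theta> z = rep j z ^ i)) \<and>
    (\<forall>j l i. j < nblocks r (p ^ Suc m) \<longrightarrow> l < nblocks r (p ^ Suc m) \<longrightarrow> (\<forall>z\<in>ZZ r. rep l z = rep j z ^ i) \<longrightarrow> j = l)"
proof -
  have sub: "KK r \<subseteq> KK (r - 1)" by (rule KK_mono) (use r in simp_all)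
  let ?V = "{\<theta> \<in> abelian_section.chars_of_order G (ZZ r) (KK r) p m. \<exists>k\<in>KK (r - 1). \<theta> k \<noteq> 1}"
  let ?N = "num_cyclic (subquot G (ZZ r) (KK r)) (p ^ Suc m) - num_cyclic (subquot G (ZZ r) (KK (r - 1))) (p ^ Suc m)"
  show ?thesis
    unfolding ramified_chars_def acyc_def acyc'_def
  proof (rule abelian_section.class_representatives[OF section_KK[OF r] section_KK'[OF r] sub prime_p, where m = m])
    fix rep
    assume rep: "\<And>j. j < ?N \<Longrightarrow> rep j \<in> ?V"
      "\<And>\<theta>. \<theta> \<in> ?V \<Longrightarrow> \<exists>j<?N. \<exists>i. \<not> p dvd i \<and> (\<forall>z\<in>ZZ r. \<theta> z = rep j z ^ i)"
      "\<And>j l i. j < ?N \<Longrightarrow> l < ?N \<Longrightarrow> (\<forall>z\<in>ZZ r. rep l z = rep j z ^ i) \<Longrightarrow> j = l"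
    show "\<exists>rep. (\<forall>j<?N. rep j \<in> ?V) \<and> (\<forall>\<theta>\<in>?V. \<exists>j<?N. \<exists>i. \<not> p dvd i \<and> (\<forall>z\<in>ZZ r. \<theta> z = rep j z ^ i)) \<and>
      (\<forall>j l i. j < ?N \<longrightarrow> l < ?N \<longrightarrow> (\<forall>z\<in>ZZ r. rep l z = rep j z ^ i) \<longrightarrow> j = l)"
    proof (intro exI[of _ rep] conjI)
      show "\<forall>j<?N. rep j \<in> ?V" using rep(1) by blast
      show "\<forall>\<theta>\<in>?V. \<exists>j<?N. \<exists>i. \<not> p dvd i \<and> (\<forall>z\<in>ZZ r. \<theta> z = rep j z ^ i)" by (rule ballI) (rule rep(2))
      show "\<forall>j l i. j < ?N \<longrightarrow> l < ?N \<longrightarrow> (\<forall>z\<in>ZZ r. rep l z = rep j z ^ i) \<longrightarrow> j = l"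
        by (intro allI impI) (rule rep(3))
    qed
  qed
qed

text \<open>Take the trace of the image of f times \<rho>(g^-1): the character vanishes off Z_r and
  is p^\<delta>(r) \<theta> on Z_r.\<close>

lemma block_vanishing:
  assumes r: "1 \<le> r" "r \<le> n" and \<theta>: "\<theta> \<in> ramified_chars r m" and b: "block r m \<theta> \<rho>"
    and f: "rlift G (p ^ \<delta> r) \<rho> f = 0\<^sub>m (p ^ \<delta> r) (p ^ \<delta> r)" and g: "g \<in> carrier G"
  shows "(\<Sum>z\<in>ZZ r. of_rat (f (z \<otimes> g)) * \<theta> z) = 0"
proof -
  let ?k = "p ^ \<delta> r"
  have rep: "is_rep G ?k \<rho>" using b by (simp add: block_def)
  let ?h = "\<lambda>x. f (x \<otimes> inv (inv g))"
  have ig: "inv g \<in> carrier G" using g by simp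
  have h0: "rlift G ?k \<rho> ?h = 0\<^sub>m ?k ?k"
    unfolding rlift_translate_right[OF rep ig] f by (rule left_mult_zero_mat[OF is_repD(1)[OF rep ig]])
  have "(0::complex) = mtrace (rlift G ?k \<rho> ?h)" unfolding h0 by (simp add: mtrace_def)
  also have "\<dots> = (\<Sum>i<?k. \<Sum>x\<in>carrier G. of_rat (?h x) * \<rho> x $$ (i, i))"
    unfolding mtrace_def rlift_dim by (intro sum.cong refl) (simp only: rlift_index lessThan_iff)
  also have "\<dots> = (\<Sum>x\<in>carrier G. of_rat (?h x) * mtrace (\<rho> x))"
  proof (subst sum.swap, rule sum.cong[OF refl])
    fix x assume "x \<in> carrier G"
    then have "dim_row (\<rho> x) = ?k" using is_repD(1)[OF rep] by (metis carrier_matD(1))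
    then show "(\<Sum>i<?k. of_rat (?h x) * \<rho> x $$ (i, i)) = of_rat (?h x) * mtrace (\<rho> x)"
      by (simp add: mtrace_def sum_distrib_left)
  qed
  also have "\<dots> = (\<Sum>z\<in>ZZ r. of_rat (?h z) * mtrace (\<rho> z))"
    using b ZZ_carrier[OF r(2)] fin by (intro sum.mono_neutral_right) (simp_all add: block_def)
  also have "\<dots> = (\<Sum>z\<in>ZZ r. of_nat ?k * (of_rat (f (z \<otimes> g)) * \<theta> z))"
  proof (rule sum.cong[OF refl])
    fix z assume "z \<in> ZZ r"
    then have "mtrace (\<rho> z) = of_nat ?k * \<theta> z" using b mtrace_scalar by (simp add: block_def)
    then show "of_rat (?h z) * mtrace (\<rho> z) = of_nat ?k * (of_rat (f (z \<otimes> g)) * \<theta> z)"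
      using inv_inv[OF g] by (simp add: mult_ac)
  qed
  also have "\<dots> = of_nat ?k * (\<Sum>z\<in>ZZ r. of_rat (f (z \<otimes> g)) * \<theta> z)" by (rule sum_distrib_left[symmetric])
  finally show ?thesis using p_gt_1 by simp
qed

text \<open>Because F is rational, the relation survives \<zeta> -> \<zeta>^i; so one block for each
  conjugacy class of characters controls the whole class.\<close>

lemma conjugate_vanishing:
  assumes r: "1 \<le> r" "r \<le> n" and \<theta>: "\<theta> \<in> ramified_chars r m" and i: "\<not> p dvd i" "\<And>z. z \<in> ZZ r \<Longrightarrow> \<psi> z = \<theta> z ^ i"
    and 0: "(\<Sum>z\<in>ZZ r. of_rat (F z) * \<theta> z) = 0"
  shows "(\<Sum>z\<in>ZZ r. of_rat (F z) * \<psi> z) = 0"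
proof -
  have w: "zeta (p ^ Suc m) ^ p ^ Suc m = 1" using p_gt_1 by (intro zeta_root) simp
  obtain z0 where z0: "z0 \<in> ZZ r" "\<theta> z0 = zeta (p ^ Suc m)" by (rule ramified_chars_root[OF r \<theta>])
  have w': "zeta (p ^ Suc m) ^ p ^ m \<noteq> 1"
  proof
    assume "zeta (p ^ Suc m) ^ p ^ m = 1"
    then have "p ^ Suc m dvd p ^ m" using p_gt_1 by (intro zeta_primitive) simp_all
    then have "p ^ Suc m \<le> p ^ m" using p_gt_1 by (intro dvd_imp_le) simp_all
    then show False using p_gt_1 by simp
  qed
  have "\<forall>z. \<exists>a. z \<in> ZZ r \<longrightarrow> \<theta> z = zeta (p ^ Suc m) ^ a"
    using primitive_prime_power_root[OF prime_p w w' ramified_charsD(4)[OF r \<theta>]] by blast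
  then obtain a where a: "\<And>z. z \<in> ZZ r \<Longrightarrow> \<theta> z = zeta (p ^ Suc m) ^ a z" by metis
  have fZ: "finite (ZZ r)" using ZZ_carrier[OF r(2)] fin finite_subset by blast
  have "(\<Sum>z\<in>ZZ r. of_rat (F z) * zeta (p ^ Suc m) ^ a z) = 0"
    using 0 a by (simp cong: sum.cong)
  then have "(\<Sum>z\<in>ZZ r. of_rat (F z) * zeta (p ^ Suc m) ^ (i * a z)) = 0"
    by (rule zeta_relation_conjugate[OF prime_p fZ i(1)])
  moreover have "\<psi> z = zeta (p ^ Suc m) ^ (i * a z)" if "z \<in> ZZ r" for z
    using a[OF that] i(2)[OF that] by (simp add: power_mult[symmetric] mult.commute)
  ultimately show ?thesis by (simp cong: sum.cong)
qed

lemma ramified_chars_exhaust: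
  assumes r: "1 \<le> r" "r \<le> n" and \<theta>: "\<theta> \<in> abelian_section.chars G (ZZ r) (KK r)" and k: "k \<in> KK (r - 1)" "\<theta> k \<noteq> 1"
  obtains m where "\<theta> \<in> ramified_chars r m"
proof -
  interpret S: abelian_section G "ZZ r" "KK r" by (rule section_KK[OF r])
  obtain a where a: "card (carrier G) = p ^ a" using p_group by (rule exE)
  let ?P = "\<lambda>e. \<forall>z\<in>ZZ r. \<theta> z ^ p ^ e = 1"
  have "?P a" using S.chars_order[OF \<theta>] a by simp
  define E where "E = (LEAST e. ?P e)"
  have L: "?P E" unfolding E_def by (rule LeastI[where P = ?P]) (rule \<open>?P a\<close>)
  have P0: "\<not> ?P 0"
  proof
    assume "?P 0"
    then have "\<theta> k ^ p ^ 0 = 1" using subsetD[OF KK_le_ZZ[OF r] k(1)] by (rule bspec)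
    then show False using k(2) by simp
  qed
  then have "E \<noteq> 0" using L by (rule_tac notI) (simp only:)
  then obtain m where m: "E = Suc m" by (cases E) simp_all
  have nm: "\<not> ?P m" unfolding m[symmetric] by (rule not_less_Least[where P = ?P]) (simp only: E_def[symmetric] m lessI)
  then have "\<theta> \<in> S.chars_of_order p m"
    using L nm \<theta> unfolding m S.chars_of_order_def by blast
  then show thesis using k by (intro that[of m]) (auto simp: ramified_chars_def)
qed

lemma average_vanishing:
  assumes f: "\<And>g. g \<in> carrier G \<Longrightarrow> (\<Sum>k\<in>KK 0. f (k \<otimes> g)) = (0::rat)"
    and b: "\<And>r m \<theta>. 1 \<le> r \<Longrightarrow> r \<le> n \<Longrightarrow> \<theta> \<in> ramified_chars r m \<Longrightarrow>
      \<exists>\<theta>0 i \<rho>. \<theta>0 \<in> ramified_chars r m \<and> \<not> p dvd i \<and> (\<forall>z\<in>ZZ r. \<theta> z = \<theta>0 z ^ i) \<and> block r m \<theta>0 \<rho> \<and>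
        rlift G (p ^ \<delta> r) \<rho> f = 0\<^sub>m (p ^ \<delta> r) (p ^ \<delta> r)"
    and g: "g \<in> carrier G"
  shows "r \<le> n \<Longrightarrow> (\<Sum>k\<in>KK r. f (k \<otimes> g)) = 0"
proof (induction r)
  case 0
  show ?case by (rule f[OF g])
next
  case (Suc s)
  define r where "r = Suc s"
  have r: "1 \<le> r" "r \<le> n" using Suc(2) by (simp_all add: r_def)
  have IH: "(\<Sum>k\<in>KK (r - 1). f (k \<otimes> g)) = 0" using Suc by (simp add: r_def)
  interpret S: abelian_section G "ZZ r" "KK r" by (rule section_KK[OF r])
  interpret S': abelian_section G "ZZ r" "KK (r - 1)" by (rule section_KK'[OF r])
  let ?F = "\<lambda>z. of_rat (f (z \<otimes> g)) :: complex"
  have fZ: "finite (ZZ r)" by (rule S.finite_Z)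
  have col: "(\<Sum>\<theta>\<in>C. \<Sum>z\<in>ZZ r. ?F z * \<theta> z) = of_nat (card C) * (\<Sum>z\<in>K. ?F z)"
    if K: "K \<subseteq> ZZ r" and C: "\<And>z. z \<in> ZZ r \<Longrightarrow> (\<Sum>\<theta>\<in>C. \<theta> z) = (if z \<in> K then of_nat (card C) else 0)" for C :: "('a \<Rightarrow> complex) set" and K
  proof -
    have "(\<Sum>\<theta>\<in>C. \<Sum>z\<in>ZZ r. ?F z * \<theta> z) = (\<Sum>z\<in>ZZ r. \<Sum>\<theta>\<in>C. ?F z * \<theta> z)" by (rule sum.swap)
    also have "\<dots> = (\<Sum>z\<in>ZZ r. if z \<in> K then of_nat (card C) * ?F z else 0)"
      by (intro sum.cong refl) (simp add: sum_distrib_left[symmetric] C)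
    also have "\<dots> = (\<Sum>z\<in>K. of_nat (card C) * ?F z)"
      using K fZ by (simp add: sum.If_cases Int_absorb1)
    finally show ?thesis by (simp add: sum_distrib_left)
  qed
  have sub: "S'.chars \<subseteq> S.chars"
    using KK_mono[of "r - 1" r] r unfolding S.chars_def S'.chars_def by (simp add: subset_iff)
  have van: "(\<Sum>z\<in>ZZ r. ?F z * \<theta> z) = 0" if th: "\<theta> \<in> S.chars - S'.chars" for \<theta>
  proof -
    have "\<not> (\<forall>k\<in>KK (r - 1). \<theta> k = 1)" using th unfolding S.chars_def S'.chars_def by blast
    then obtain k where k: "k \<in> KK (r - 1)" "\<theta> k \<noteq> 1" by blast
    have "\<theta> \<in> S.chars" using th by blast
    then obtain m where m: "\<theta> \<in> ramified_chars r m" using k by (rule ramified_chars_exhaust[OF r])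
    obtain \<theta>0 i \<rho> where t: "\<theta>0 \<in> ramified_chars r m" "\<not> p dvd i" "\<forall>z\<in>ZZ r. \<theta> z = \<theta>0 z ^ i" "block r m \<theta>0 \<rho>"
      "rlift G (p ^ \<delta> r) \<rho> f = 0\<^sub>m (p ^ \<delta> r) (p ^ \<delta> r)" using b[OF r m] by blast
    show ?thesis
      by (rule conjugate_vanishing[OF r t(1,2) bspec[OF t(3)] block_vanishing[OF r t(1,4,5) g]])
  qed
  \<comment> \<open>The characters in the difference are the relevant ones, so the sums over both
    character groups agree. Column orthogonality turns them into multiples of the sums over [Z_r, G]
    and [Z_(r-1), G], the latter being 0 by induction.\<close>
  have "(\<Sum>\<theta>\<in>S.chars - S'.chars. \<Sum>z\<in>ZZ r. ?F z * \<theta> z) = 0"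
    by (rule sum.neutral) (intro ballI van)
  then have "(\<Sum>\<theta>\<in>S.chars. \<Sum>z\<in>ZZ r. ?F z * \<theta> z) = (\<Sum>\<theta>\<in>S'.chars. \<Sum>z\<in>ZZ r. ?F z * \<theta> z)"
    using sum.subset_diff[OF sub S.finite_chars, of "\<lambda>\<theta>. \<Sum>z\<in>ZZ r. ?F z * \<theta> z"] by simp
  also have "\<dots> = of_nat (card S'.chars) * (\<Sum>z\<in>KK (r - 1). ?F z)"
    by (rule col[OF S'.KZ S'.column_orthogonality])
  also have "(\<Sum>z\<in>KK (r - 1). ?F z) = of_rat (\<Sum>z\<in>KK (r - 1). f (z \<otimes> g))" by (rule of_rat_sum[symmetric])
  also have "\<dots> = 0" unfolding IH by simp
  finally have "of_nat (card S.chars) * (\<Sum>z\<in>KK r. ?F z) = 0"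
    using col[OF S.KZ S.column_orthogonality] by simp
  moreover have "card S.chars \<noteq> 0"
    using S.card_chars card_subgroup_pos[OF S.Z] by (metis mult_0 less_irrefl)
  ultimately have "of_rat (\<Sum>z\<in>KK r. f (z \<otimes> g)) = (0::complex)" by (simp add: of_rat_sum)
  then show ?case by (simp add: r_def)
qed

text \<open>The library generates the derived subgroup by x y x^-1 y^-1; replacing x and y by their
  inverses matches the convention of \<open>commG\<close>.\<close>

lemma derived_KK: "derived G (carrier G) = KK 0"
proof -
  have "(\<Union>x\<in>carrier G. \<Union>y\<in>carrier G. {x \<otimes> y \<otimes> inv x \<otimes> inv y})
      = {inv x \<otimes> inv y \<otimes> x \<otimes> y | x y. x \<in> carrier G \<and> y \<in> carrier G}" (is "?A = ?B")
  proof (intro equalityI subsetI)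
    fix u assume "u \<in> ?A"
    then obtain x y where "x \<in> carrier G" "y \<in> carrier G" "u = x \<otimes> y \<otimes> inv x \<otimes> inv y" by blast
    then have "u = inv (inv x) \<otimes> inv (inv y) \<otimes> inv x \<otimes> inv y \<and> inv x \<in> carrier G \<and> inv y \<in> carrier G" by simp
    then show "u \<in> ?B" by blast
  next
    fix u assume "u \<in> ?B"
    then obtain x y where "x \<in> carrier G" "y \<in> carrier G" "u = inv x \<otimes> inv y \<otimes> x \<otimes> y" by blast
    then have "u \<in> {inv x \<otimes> inv y \<otimes> inv (inv x) \<otimes> inv (inv y)} \<and> inv x \<in> carrier G \<and> inv y \<in> carrier G" by simp
    then show "u \<in> ?A" by blast
  qed
  then show ?thesis unfolding derived_def commG_def ZZ_0 by simp
qed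

text \<open>The exponent divides a power of p, and d = 1 is excluded since both quotients have
  exactly one cyclic subgroup of order 1, which makes \<open>nblocks r 1\<close> zero.\<close>

lemma index_prime_power:
  assumes r: "1 \<le> r" "r \<le> n" and d: "d dvd mexp G p \<delta> r" and j: "j < nblocks r d"
  obtains m where "d = p ^ Suc m"
proof -
  interpret S: abelian_section G "ZZ r" "KK r" by (rule section_KK[OF r])
  interpret S': abelian_section G "ZZ r" "KK (r - 1)" by (rule section_KK'[OF r])
  obtain a where a: "card (carrier G) = p ^ a" using p_group by (rule exE)
  let ?H = "subquot G (ZZ r) (KK r)"
  have "d dvd Coset.order ?H"
    using d group.grp_exponent(3)[OF S.subquot_group S.subquot_finite] unfolding mexp_def by (rule dvd_trans)
  also have "Coset.order ?H dvd card (ZZ r)"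
  proof -
    have "{z \<in> ZZ r. KK r #> z \<in> carrier ?H} = ZZ r" unfolding S.subquot_carrier by blast
    then have "card (ZZ r) = card (KK r) * card (carrier ?H)" using S.card_coset_preimage[OF subset_refl] by simp
    then show ?thesis by (simp add: Coset.order_def)
  qed
  also have "card (ZZ r) dvd p ^ a" using ZZ_card[OF r(2)] a by (metis dvd_triv_right)
  finally obtain b where b: "d = p ^ b" using divides_primepow_nat[OF prime_p] by blast
  have "b \<noteq> 0"
  proof
    assume "b = 0"
    then show False
      using j b group.num_cyclic_1[OF S.subquot_group] group.num_cyclic_1[OF S'.subquot_group]
      by (simp add: acyc_def acyc'_def)
  qed
  then obtain m where "b = Suc m" by (cases b) simp_all
  then show thesis using b by (intro that[of m]) simp
qed

lemma acyc_dvd: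
  assumes r: "1 \<le> r" "r \<le> n"
  shows "acyc G p \<delta> r d \<noteq> 0 \<Longrightarrow> d dvd mexp G p \<delta> r" "acyc' G p \<delta> r d \<noteq> 0 \<Longrightarrow> d dvd mexp' G p \<delta> r" "0 < mexp G p \<delta> r"
proof -
  interpret S: abelian_section G "ZZ r" "KK r" by (rule section_KK[OF r])
  interpret S': abelian_section G "ZZ r" "KK (r - 1)" by (rule section_KK'[OF r])
  show "acyc G p \<delta> r d \<noteq> 0 \<Longrightarrow> d dvd mexp G p \<delta> r" unfolding acyc_def mexp_def
    by (rule group.grp_exponent(4)[OF S.subquot_group S.subquot_finite])
  show "acyc' G p \<delta> r d \<noteq> 0 \<Longrightarrow> d dvd mexp' G p \<delta> r" unfolding acyc'_def mexp'_def
    by (rule group.grp_exponent(4)[OF S'.subquot_group S'.subquot_finite])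
  show "0 < mexp G p \<delta> r" unfolding mexp_def
    by (rule group.grp_exponent(1)[OF S.subquot_group S.subquot_finite])
qed

theorem rational_group_algebra:
  "qalg_isomorphic (group_alg G)
     (qalg_sum (group_alg (G Mod derived G (carrier G)))
       (qalg_sum
         (qalg_dsum {(r, d, j). 1 \<le> r \<and> r \<le> n \<and> 0 < d \<and>
                        d dvd mexp G p \<delta> r \<and> \<not> d dvd mexp' G p \<delta> r \<and>
                        j < acyc G p \<delta> r d}
            (\<lambda>(r, d, j). mat_alg (p ^ \<delta> r) d))
         (qalg_dsum {(r, d, j). 1 \<le> r \<and> r \<le> n \<and> 0 < d \<and>
                        d dvd mexp G p \<delta> r \<and> d dvd mexp' G p \<delta> r \<and>
                        j < acyc G p \<delta> r d - acyc' G p \<delta> r d}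
            (\<lambda>(r, d, j). mat_alg (p ^ \<delta> r) d))))"
    (is "qalg_isomorphic _ (qalg_sum (group_alg ?H) (qalg_sum (qalg_dsum ?I1 ?M) (qalg_dsum ?I2 ?M)))")
proof -
  let ?I = "?I1 \<union> ?I2"
  have "\<forall>r m. \<exists>rep. 1 \<le> r \<and> r \<le> n \<longrightarrow> (\<forall>j<nblocks r (p ^ Suc m). rep j \<in> ramified_chars r m) \<and>
    (\<forall>\<theta>\<in>ramified_chars r m. \<exists>j<nblocks r (p ^ Suc m). \<exists>i. \<not> p dvd i \<and> (\<forall>z\<in>ZZ r. \<theta> z = rep j z ^ i)) \<and>
    (\<forall>j l i. j < nblocks r (p ^ Suc m) \<longrightarrow> l < nblocks r (p ^ Suc m) \<longrightarrow> (\<forall>z\<in>ZZ r. rep l z = rep j z ^ i) \<longrightarrow> j = l)"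
    using ramified_chars_classes by simp
  then obtain \<theta> where "\<forall>r m. 1 \<le> r \<and> r \<le> n \<longrightarrow> (\<forall>j<nblocks r (p ^ Suc m). \<theta> r m j \<in> ramified_chars r m) \<and>
    (\<forall>\<psi>\<in>ramified_chars r m. \<exists>j<nblocks r (p ^ Suc m). \<exists>i. \<not> p dvd i \<and> (\<forall>z\<in>ZZ r. \<psi> z = \<theta> r m j z ^ i)) \<and>
    (\<forall>j l i. j < nblocks r (p ^ Suc m) \<longrightarrow> l < nblocks r (p ^ Suc m) \<longrightarrow> (\<forall>z\<in>ZZ r. \<theta> r m l z = \<theta> r m j z ^ i) \<longrightarrow> j = l)"
    unfolding choice_iff by blast
  then have \<theta>: "\<And>r m j. 1 \<le> r \<Longrightarrow> r \<le> n \<Longrightarrow> j < nblocks r (p ^ Suc m) \<Longrightarrow> \<theta> r m j \<in> ramified_chars r m"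
    "\<And>r m \<psi>. 1 \<le> r \<Longrightarrow> r \<le> n \<Longrightarrow> \<psi> \<in> ramified_chars r m \<Longrightarrow>
      \<exists>j<nblocks r (p ^ Suc m). \<exists>i. \<not> p dvd i \<and> (\<forall>z\<in>ZZ r. \<psi> z = \<theta> r m j z ^ i)"
    "\<And>r m j l i. 1 \<le> r \<Longrightarrow> r \<le> n \<Longrightarrow> j < nblocks r (p ^ Suc m) \<Longrightarrow> l < nblocks r (p ^ Suc m) \<Longrightarrow>
      \<forall>z\<in>ZZ r. \<theta> r m l z = \<theta> r m j z ^ i \<Longrightarrow> j = l"
    by blast+
  have "\<forall>r m j. \<exists>\<rho>. 1 \<le> r \<and> r \<le> n \<and> j < nblocks r (p ^ Suc m) \<longrightarrow> block r m (\<theta> r m j) \<rho>"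
    using ramified_chars_block \<theta>(1) by blast
  then obtain R where R: "\<And>r m j. 1 \<le> r \<Longrightarrow> r \<le> n \<Longrightarrow> j < nblocks r (p ^ Suc m) \<Longrightarrow> block r m (\<theta> r m j) (R r m j)"
    unfolding choice_iff by blast
  \<comment> \<open>The summands are indexed by d, whereas characters and blocks are indexed by m
    with d = p^(m+1).\<close>
  define M where "M d = (SOME m. d = p ^ Suc m)" for d
  have M: "M (p ^ Suc m) = m" for m
  proof -
    have "p ^ Suc m = p ^ Suc (M (p ^ Suc m))" unfolding M_def by (rule someI) (rule refl)
    then show ?thesis using p_gt_1 by (simp only: power_inject_exp nat.inject)
  qed
  define \<kappa> where "\<kappa> i = p ^ \<delta> (fst i)" for i :: "nat \<times> nat \<times> nat"
  define d where "d i = fst (snd i)" for i :: "nat \<times> nat \<times> nat"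
  define \<rho> where "\<rho> i = R (fst i) (M (d i)) (snd (snd i))" for i
  have mem: "\<exists>r m j. i = (r, p ^ Suc m, j) \<and> 1 \<le> r \<and> r \<le> n \<and> j < nblocks r (p ^ Suc m)" if i: "i \<in> ?I" for i
  proof -
    obtain r e j where e: "i = (r, e, j)" by (metis prod.exhaust)
    have r: "1 \<le> r" "r \<le> n" and dv: "e dvd mexp G p \<delta> r" using i unfolding e by auto
    \<comment> \<open>In the first index set j is bounded by \<open>acyc\<close> alone;
      \<open>acyc'\<close> is 0 there, so both sets satisfy j < \<open>nblocks r e\<close>.\<close>
    have "acyc' G p \<delta> r e = 0 \<or> e dvd mexp' G p \<delta> r" using acyc_dvd(2)[OF r] by blast
    then have "j < nblocks r e" using i unfolding e by auto
    moreover from this obtain m where "e = p ^ Suc m" by (rule index_prime_power[OF r dv])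
    ultimately show ?thesis using e r by blast
  qed
  have mem': "(r, p ^ Suc m, j) \<in> ?I" if "1 \<le> r" "r \<le> n" "j < nblocks r (p ^ Suc m)" for r m j
    using that acyc_dvd(1)[OF that(1,2), of "p ^ Suc m"] p_gt_1 by auto
  have B: "block r m (\<theta> r m j) (\<rho> (r, p ^ Suc m, j))" if "1 \<le> r" "r \<le> n" "j < nblocks r (p ^ Suc m)" for r m j
    unfolding \<rho>_def d_def fst_conv snd_conv M using R[OF that] .
  have N: "KK 0 \<lhd> G" unfolding derived_KK[symmetric] by (rule derived_self_is_normal)
  interpret N: normal "KK 0" G by (rule N)
  let ?q = "(#>) (KK 0)"
  have hom: "group_hom G ?H ?q"
    unfolding derived_KK by (intro group_hom.intro group_hom_axioms.intro N.r_coset_hom_Mod N.factorgroup_is_group group_axioms)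
  have surj: "?q ` carrier G = carrier ?H"
    unfolding derived_KK by (auto simp: FactGroup_def RCOSETS_def)
  have q1: "?q k = \<one>\<^bsub>?H\<^esub>" if "k \<in> KK 0" for k
    unfolding derived_KK using coset_join2[OF N.mem_carrier[OF that] N.subgroup_axioms that] by (simp add: FactGroup_def)
  have Mat: "?M = (\<lambda>i. mat_alg (\<kappa> i) (d i))" by (simp add: fun_eq_iff \<kappa>_def d_def)
  show ?thesis
    unfolding Mat
  proof (rule block_decomposition[OF hom surj, where \<rho> = \<rho>])
    have "?I \<subseteq> (SIGMA r:{1..n}. SIGMA e:{e. e dvd mexp G p \<delta> r}. {..<acyc G p \<delta> r e})" by auto
    moreover have "finite (SIGMA r:{1..n}. SIGMA e:{e. e dvd mexp G p \<delta> r}. {..<acyc G p \<delta> r e})"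
      using acyc_dvd(3) by (intro finite_SigmaI) simp_all
    ultimately show "finite ?I" by (rule finite_subset)
    show "?I1 \<inter> ?I2 = {}" by auto
  next
    fix i assume iI: "i \<in> ?I"
    obtain r m j where i: "i = (r, p ^ Suc m, j)" and rj: "1 \<le> r" "r \<le> n" "j < nblocks r (p ^ Suc m)"
      using mem[OF iI] by blast
    have k: "\<kappa> i = p ^ \<delta> r" "d i = p ^ Suc m" unfolding i \<kappa>_def d_def by simp_all
    have b: "block r m (\<theta> r m j) (\<rho> i)" unfolding i by (rule B[OF rj])
    show "is_rep G (\<kappa> i) (\<rho> i)" using b unfolding block_def k by blast
    show "\<rho> i g $$ (a, c) \<in> cyclo_field (d i)" if "a < \<kappa> i" "c < \<kappa> i" for g a c
      using b that unfolding block_def k by blast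
    show "\<exists>f. (\<forall>x. x \<notin> carrier G \<longrightarrow> f x = 0) \<and> rlift G (\<kappa> i) (\<rho> i) f = A"
      if "A \<in> qcarrier (mat_alg (\<kappa> i) (d i))" for A
      using b that unfolding block_def k by blast
    obtain e where e: "\<forall>Q. push G ?q e Q = 0" "\<forall>\<rho>. block r m (\<theta> r m j) \<rho> \<longrightarrow> rlift G (p ^ \<delta> r) \<rho> e = 1\<^sub>m (p ^ \<delta> r)"
      "\<forall>s m' \<psi> \<rho>. 1 \<le> s \<longrightarrow> s \<le> n \<longrightarrow> \<psi> \<in> ramified_chars s m' \<longrightarrow> block s m' \<psi> \<rho> \<longrightarrow>
        \<not> (s = r \<and> m' = m \<and> (\<exists>i. \<forall>z\<in>ZZ r. \<psi> z = \<theta> r m j z ^ i)) \<longrightarrow> rlift G (p ^ \<delta> s) \<rho> e = 0\<^sub>m (p ^ \<delta> s) (p ^ \<delta> s)"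
      by (rule ramified_chars_separator[OF rj(1,2) \<theta>(1)[OF rj] hom q1])
    have "rlift G (\<kappa> i') (\<rho> i') e = 0\<^sub>m (\<kappa> i') (\<kappa> i')" if i': "i' \<in> ?I" "i' \<noteq> i" for i'
    proof -
      obtain s m' l where s: "i' = (s, p ^ Suc m', l)" and sl: "1 \<le> s" "s \<le> n" "l < nblocks s (p ^ Suc m')"
        using mem[OF i'(1)] by blast
      have k': "\<kappa> i' = p ^ \<delta> s" unfolding s \<kappa>_def by simp
      have "\<not> (s = r \<and> m' = m \<and> (\<exists>t. \<forall>z\<in>ZZ r. \<theta> s m' l z = \<theta> r m j z ^ t))"
      proof
        assume a: "s = r \<and> m' = m \<and> (\<exists>t. \<forall>z\<in>ZZ r. \<theta> s m' l z = \<theta> r m j z ^ t)"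
        then have "j = l" using \<theta>(3)[OF rj(1,2,3), of l] sl(3) by blast
        then show False using a i'(2) unfolding i s by blast
      qed
      then show ?thesis unfolding k' using e(3) sl(1,2) \<theta>(1)[OF sl] B[OF sl] unfolding s by blast
    qed
    then show "\<exists>e. (\<forall>Q. push G ?q e Q = 0) \<and> rlift G (\<kappa> i) (\<rho> i) e = 1\<^sub>m (\<kappa> i) \<and>
      (\<forall>j\<in>?I. j \<noteq> i \<longrightarrow> rlift G (\<kappa> j) (\<rho> j) e = 0\<^sub>m (\<kappa> j) (\<kappa> j))"
      using e(1,2) b unfolding k by (intro exI[of _ e] conjI ballI impI; simp)
  next
    fix f x
    assume off: "\<And>x. x \<notin> carrier G \<Longrightarrow> f x = (0::rat)" and push0: "\<And>Q. push G ?q f Q = 0"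
      and blk: "\<And>i. i \<in> ?I \<Longrightarrow> rlift G (\<kappa> i) (\<rho> i) f = 0\<^sub>m (\<kappa> i) (\<kappa> i)"
    have "f g = 0" if g: "g \<in> carrier G" for g
    proof -
      \<comment> \<open>The coset sum is the coefficient of f at that coset in the group algebra of
        G/G', which starts the induction on r.\<close>
      have 1: "(\<Sum>k\<in>KK 0. f (k \<otimes> h)) = 0" if h: "h \<in> carrier G" for h
      proof -
        have "(\<Sum>k\<in>KK 0. f (k \<otimes> h)) = push G ?q f (KK 0 #> h)"
          unfolding push_def
        proof (rule sum.reindex_bij_witness[of _ "\<lambda>x. x \<otimes> inv h" "\<lambda>k. k \<otimes> h"])
          fix y assume y: "y \<in> {x \<in> carrier G. KK 0 #> x = KK 0 #> h}"
          then have "y \<in> KK 0 #> h" using rcos_self[OF _ N.subgroup_axioms, of y] by simp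
          then obtain k where "k \<in> KK 0" "y = k \<otimes> h" by (auto simp: r_coset_def)
          then show "y \<otimes> inv h \<in> KK 0" using h N.mem_carrier by (simp add: m_assoc)
        next
          fix k assume k: "k \<in> KK 0"
          have "KK 0 #> (k \<otimes> h) = KK 0 #> h"
            using coset_mult_assoc[OF N.subset N.mem_carrier[OF k] h] coset_join2[OF N.mem_carrier[OF k] N.subgroup_axioms k] by simp
          then show "k \<otimes> h \<in> {x \<in> carrier G. KK 0 #> x = KK 0 #> h}" using k h N.mem_carrier by simp
        qed (use h N.mem_carrier in \<open>simp_all add: m_assoc\<close>)
        then show ?thesis using push0 by simp
      qed
      have 2: "\<exists>\<theta>0 i \<rho>. \<theta>0 \<in> ramified_chars r m \<and> \<not> p dvd i \<and> (\<forall>z\<in>ZZ r. \<psi> z = \<theta>0 z ^ i) \<and> block r m \<theta>0 \<rho> \<and>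
        rlift G (p ^ \<delta> r) \<rho> f = 0\<^sub>m (p ^ \<delta> r) (p ^ \<delta> r)" if r: "1 \<le> r" "r \<le> n" and \<psi>: "\<psi> \<in> ramified_chars r m" for r m \<psi>
      proof -
        obtain j i where j: "j < nblocks r (p ^ Suc m)" and i: "\<not> p dvd i" "\<forall>z\<in>ZZ r. \<psi> z = \<theta> r m j z ^ i"
          using \<theta>(2)[OF r \<psi>] by blast
        have "rlift G (p ^ \<delta> r) (\<rho> (r, p ^ Suc m, j)) f = 0\<^sub>m (p ^ \<delta> r) (p ^ \<delta> r)"
          using blk[OF mem'[OF r j]] by (simp only: \<kappa>_def fst_conv)
        then show ?thesis using \<theta>(1)[OF r j] i B[OF r j] by blast
      qed
      have "(\<Sum>k\<in>KK n. f (k \<otimes> g)) = 0" by (rule average_vanishing[OF 1 2 g order_refl])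
      then show ?thesis using g unfolding KK_n by simp
    qed
    then show "f x = 0" using off by blast
  qed
qed

end

theorem theorem1p3:
  fixes G :: "'a monoid" and p :: nat and n :: nat and \<delta> :: "nat \<Rightarrow> nat"
  assumes "group G" and "finite (carrier G)"
    and "Factorial_Ring.prime p" and "odd p" and "\<exists>k. card (carrier G) = p ^ k"
    and "nested_GVZ G"
    and "\<delta> 0 = 0" and "\<forall>i<n. \<delta> i < \<delta> (Suc i)"
    and "cd G = {p ^ \<delta> i | i. i \<le> n}"
  shows "qalg_isomorphic (group_alg G)
           (qalg_sum (group_alg (G Mod derived G (carrier G)))
             (qalg_sum
               (qalg_dsum {(r, d, j). 1 \<le> r \<and> r \<le> n \<and> 0 < d \<and>
                              d dvd mexp G p \<delta> r \<and> \<not> d dvd mexp' G p \<delta> r \<and>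
                              j < acyc G p \<delta> r d}
                  (\<lambda>(r, d, j). mat_alg (p ^ \<delta> r) d))
               (qalg_dsum {(r, d, j). 1 \<le> r \<and> r \<le> n \<and> 0 < d \<and>
                              d dvd mexp G p \<delta> r \<and> d dvd mexp' G p \<delta> r \<and>
                              j < acyc G p \<delta> r d - acyc' G p \<delta> r d}
                  (\<lambda>(r, d, j). mat_alg (p ^ \<delta> r) d))))"
proof -
  interpret group G by (rule assms(1))
  interpret nested_gvz_odd G p n \<delta> by unfold_locales (rule assms)+
  show ?thesis by (rule rational_group_algebra)
qed

end
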